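(* The form $\omega^{(2)}$ is a unique obstruction to the linearizability of the ODEs $$y''=u^0(x,y)+u^1(x,y)y'+u^2(x,y)(y')^2+u^3(x,y)(y')^3\qquad(\ast)$$ by point transformations. That is: an equation $\mathcal E$ of the form $(\ast)$, with corresponding section $S_{\mathcal E}$ of $\pi$, can be reduced locally (near every point of the domain of $S_{\mathcal E}$) to a linear second-order ODE $y''=a(x)y'+b(x)y+c(x)$ by a point transformation if and only if $(j_2S_{\mathcal E})^*(\omega^{(2)})\equiv0$.
   Context: All manifolds and maps are smooth. $[h]^k_p$ denotes the $k$-jet of $h$ at $p$. **Bundle and lifts.** $\pi:E=\mathbb{R}^2\times\mathbb{R}^4\to\mathbb{R}^2$ is the product bundle, with base coordinates $(x^1,x^2)=(x,y)$ and fibre coordinates $u^0,u^1,u^2,u^3$. An equation $\mathcal E$ of the form $(\ast)$ is identified with the section $S_{\mathcal E}:(x^1,x^2)\mapsto(x^1,x^2,u^0,\dots,u^3)$ of $\pi$. A point transformation is a diffeomorphism $f$ between open subsets of the base $\mathbb{R}^2$; $\Gamma$ is the pseudogroup of all of them. A point transformation $f$ takes each such ODE to an ODE of the same form, and this defines the lift $f^{(0)}$ of $f$ to $\pi$: with $g=(g^1,g^2)=f^{-1}$, $f^{(0)}$ sends $(p,u^0,\dots,u^3)$ to $(f(p),\tilde u^0,\dots,\tilde u^3)$, where $\tilde u^\alpha$ is the coefficient of $q^\alpha$ in the polynomial $J^{-1}\bigl(u^0a^3+u^1a^2b+u^2ab^2+u^3b^3-aB+bA\bigr)$, with $a=g^1_1+g^1_2q$,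 $b=g^2_1+g^2_2q$, $A=g^1_{11}+2g^1_{12}q+g^1_{22}q^2$, $B=g^2_{11}+2g^2_{12}q+g^2_{22}q^2$, $J=g^1_1g^2_2-g^1_2g^2_1$ (lower indices are partial derivatives of $g^i$ at $f(p)$). $f$ takes $\mathcal E$ to $\tilde{\mathcal E}$ iff $S_{\tilde{\mathcal E}}=f^{(0)}\circ S_{\mathcal E}\circ f^{-1}$. $J^k\pi$ is the bundle of $k$-jets of sections of $\pi$, $\pi_k:J^k\pi\to\mathbb{R}^2$ and $\pi_{k,r}:J^k\pi\to J^r\pi$ are the projections, and $j_kS:q\mapsto[S]^k_q$. The lift $f^{(k)}$ to $J^k\pi$ is $f^{(k)}([S]^k_p)=[f^{(0)}\circ S\circ f^{-1}]^k_{f(p)}$. A vector field $X$ on the base with flow $f_t$ has lift $X^{(k)}$, the vector field on $J^k\pi$ with flow $f_t^{(k)}$; $X^{(k)}_{\theta_k}$ depends only on $[X]^{k+2}_p$. **Formal vector fields.** $W_p$ is the Lie algebra of $\infty$-jets at $p$ of vector fields on the base, $L^k_p=\{[X]^\infty_p: [X]^k_p=0\}$ for $k\ge0$, $V_p=W_p/L^0_p\cong T_p\mathbb{R}^2$. $W_p/L^k_p$ is identified with $k$-jets $[X]^k_p$. For $i>j\ge 0$, $\rho_{i,j}:W_p/L^i_p\to W_p/L^j_p$, $[X]^i_p\mapsto[X]^j_p$, and $\rho_i=\rho_{i,0}$. The bracket induces $[\cdot,\cdot]:W_p/L^k_p\times W_p/L^k_p\to W_p/L^{k-1}_p$. A 2-dimensional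 subspace $H\subset W_p/L^k_p$ is horizontal if $\rho_k(H)=V_p$. **The space $g$.** $g=g_p\subset L^1_p/L^2_p$ is the 2-dimensional space of 2-jets (with zero 1-jet) whose second derivatives $X^i_{jk}$ at $p$ satisfy $X^2_{11}=0$, $X^1_{11}-2X^2_{12}=0$, $2X^1_{12}-X^2_{22}=0$, $X^1_{22}=0$. **Isotropy spaces.** For $\theta_{k+1}=[S]^{k+1}_p$ and $\theta_k=\pi_{k+1,k}(\theta_{k+1})$, $\mathcal H_{\theta_{k+1}}\subset T_{\theta_k}J^k\pi$ is the tangent space at $\theta_k$ to the image of $j_kS$. Put $\mathcal A_{\theta_{k+1}}=\{[X]^{2+k}_p\in W_p/L^{2+k}_p : X^{(k)}_{\theta_k}\in\mathcal H_{\theta_{k+1}}\}$. If $[X]^{k+2}_p,[Y]^{k+2}_p\in\mathcal A_{\theta_{k+1}}$ ($k\ge1$), their bracket lies in $\mathcal A_{\theta_k}$. **The form $\omega^{(2)}$.** Let $H_p\subset W_p/L^1_p$ be the horizontal subspace of 1-jets of constant vector fields. Let $\theta_2\in J^2\pi$, $p=\pi_2(\theta_2)$, $\theta_1=\pi_{2,1}(\theta_2)$. There is a unique horizontal subspace $H_{\theta_1}\subset\mathcal A_{\theta_1}$ with $\rho_{2,1}(H_{\theta_1})=H_p$ and $[(\rho_2|_{H_{\theta_1}})^{-1}(v),(\rho_2|_{H_{\theta_1}})^{-1}(w)]=0$ in $W_p/L^1_p$ for all $v,w\in V_p$. There is a unique horizontal subspace $H_{\theta_2}\subset\mathcal A_{\theta_2}$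 with $\rho_{3,2}(H_{\theta_2})=H_{\theta_1}$. Define $\omega_{\theta_2}(v,w)=[(\rho_3|_{H_{\theta_2}})^{-1}(v),(\rho_3|_{H_{\theta_2}})^{-1}(w)]\in W_p/L^2_p$; it takes values in $g_p$, so $\omega_{\theta_2}\in g_p\otimes\wedge^2V_p^*$. The horizontal $g$-valued 2-form $\omega^{(2)}$ on $J^2\pi$ is $\omega^{(2)}|_{\theta_2}=\pi_2^*(\omega_{\theta_2})$; thus $(j_2S)^*(\omega^{(2)})$ has value $\omega_{[S]^2_p}$ at $p$. *)

theory Defs
  imports
    "HOL-Analysis.Analysis"
    "HOL-Analysis.Finite_Function_Topology"
    "HOL-Computational_Algebra.Polynomial"
begin

section \<open>Smooth maps and point transformations\<close>

type_synonym base = "real \<times> real"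
type_synonym fibre = "real \<times> real \<times> real \<times> real"

primrec cdiff_on ::
  "nat \<Rightarrow> 'a::euclidean_space set \<Rightarrow> ('a \<Rightarrow> 'b::real_normed_vector) \<Rightarrow> bool" where
  "cdiff_on 0 U h \<longleftrightarrow> continuous_on U h"
| "cdiff_on (Suc k) U h \<longleftrightarrow> (\<forall>x\<in>U. h differentiable (at x)) \<and>
     (\<forall>b\<in>Basis. cdiff_on k U (\<lambda>x. frechet_derivative h (at x) b))"

text \<open>The derivatives are full derivatives, not derivatives within \<open>U\<close>; the notion is only
  used for open \<open>U\<close>.\<close>

definition smooth_on ::
  "'a::euclidean_space set \<Rightarrow> ('a \<Rightarrow> 'b::real_normed_vector) \<Rightarrow> bool" where
  "smooth_on U h \<longleftrightarrow> (\<forall>k. cdiff_on k U h)"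

definition point_transformation :: "base set \<Rightarrow> (base \<Rightarrow> base) \<Rightarrow> bool" where
  "point_transformation U f \<longleftrightarrow> open U \<and> open (f ` U) \<and> inj_on f U \<and>
     smooth_on U f \<and> smooth_on (f ` U) (the_inv_into U f)"

definition d1 :: "(base \<Rightarrow> 'b::real_normed_vector) \<Rightarrow> base \<Rightarrow> 'b" where
  "d1 h p = frechet_derivative h (at p) (1, 0)"

definition d2 :: "(base \<Rightarrow> 'b::real_normed_vector) \<Rightarrow> base \<Rightarrow> 'b" where
  "d2 h p = frechet_derivative h (at p) (0, 1)"


section \<open>Jets\<close>

text \<open>The \<open>k\<close>-jet of \<open>h\<close> at \<open>p\<close> is represented by the family of the partial derivatives of \<open>h\<close>
  at \<open>p\<close> of order at most \<open>k\<close>; the multi-index \<open>(m, n)\<close> stands for \<open>m\<close> derivatives in \<open>x\<close> and \<open>n\<close>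
  derivatives in \<open>y\<close>. All orders share one type of finitely supported families, which is a
  real normed space.\<close>

type_synonym 'b coeffs = "(nat \<times> nat) \<Rightarrow>\<^sub>0 'b"

definition jet :: "nat \<Rightarrow> (base \<Rightarrow> 'b::real_normed_vector) \<Rightarrow> base \<Rightarrow> 'b coeffs" where
  "jet k h p = (\<Sum>(m, n) \<in> {(m, n). m + n \<le> k}.
     Poly_Mapping.single (m, n) ((d1 ^^ m) ((d2 ^^ n) h) p))"

definition trunc :: "nat \<Rightarrow> 'b::real_normed_vector coeffs \<Rightarrow> 'b coeffs" where
  "trunc r j = (\<Sum>(m, n) \<in> {(m, n). m + n \<le> r}.
     Poly_Mapping.single (m, n) (Poly_Mapping.lookup j (m, n)))"

definition local_section :: "base set \<Rightarrow> (base \<Rightarrow> base \<times> fibre) \<Rightarrow> bool" where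
  "local_section U S \<longleftrightarrow> open U \<and> smooth_on U S \<and> (\<forall>q\<in>U. fst (S q) = q)"

text \<open>Points of \<open>J\<^sup>k\<pi>\<close>, and also tangent vectors of \<open>J\<^sup>k\<pi>\<close>, are given by their coordinates: a
  base part, and the fibre coordinates \<open>u\<^sup>\<alpha>\<^sub>\<sigma>\<close> with \<open>\<bar>\<sigma>\<bar> \<le> k\<close>. Thus \<open>\<pi>\<^sub>k\<close> is \<open>fst\<close>.\<close>

type_synonym jpoint = "base \<times> fibre coeffs"

definition sjet :: "nat \<Rightarrow> (base \<Rightarrow> base \<times> fibre) \<Rightarrow> base \<Rightarrow> jpoint" where
  "sjet k S p = (p, jet k (snd \<circ> S) p)"

definition jproj :: "nat \<Rightarrow> jpoint \<Rightarrow> jpoint" where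
  "jproj r \<theta> = (fst \<theta>, trunc r (snd \<theta>))"


section \<open>Lifts of point transformations and of vector fields\<close>

text \<open>\<open>lift0 U f\<close> is \<open>f\<^sup>(\<^sup>0\<^sup>)\<close>, where \<open>U\<close> is the domain of \<open>f\<close>.\<close>

definition lift0 :: "base set \<Rightarrow> (base \<Rightarrow> base) \<Rightarrow> base \<times> fibre \<Rightarrow> base \<times> fibre" where
  "lift0 U f = (\<lambda>(p, (u0, u1, u2, u3)).
     let q = f p;
         g1 = fst \<circ> the_inv_into U f;
         g2 = snd \<circ> the_inv_into U f;
         a = [: d1 g1 q, d2 g1 q :];
         b = [: d1 g2 q, d2 g2 q :];
         A = [: d1 (d1 g1) q, 2 * d1 (d2 g1) q, d2 (d2 g1) q :];
         B = [: d1 (d1 g2) q, 2 * d1 (d2 g2) q, d2 (d2 g2) q :];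
         J = d1 g1 q * d2 g2 q - d2 g1 q * d1 g2 q;
         P = smult (1 / J) (smult u0 (a ^ 3) + smult u1 (a ^ 2 * b) + smult u2 (a * b ^ 2)
               + smult u3 (b ^ 3) - a * B + b * A)
     in (q, (coeff P 0, coeff P 1, coeff P 2, coeff P 3)))"

definition push_section ::
  "base set \<Rightarrow> (base \<Rightarrow> base) \<Rightarrow> (base \<Rightarrow> base \<times> fibre) \<Rightarrow> base \<Rightarrow> base \<times> fibre" where
  "push_section U f S = lift0 U f \<circ> S \<circ> the_inv_into U f"

definition lift_jet :: "base set \<Rightarrow> (base \<Rightarrow> base) \<Rightarrow> nat \<Rightarrow> jpoint \<Rightarrow> jpoint" where
  "lift_jet U f k \<theta> = (THE \<theta>'. \<exists>N S. fst \<theta> \<in> N \<and> local_section N S \<and> sjet k S (fst \<theta>) = \<theta> \<and>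
     \<theta>' = sjet k (push_section U f S) (f (fst \<theta>)))"

text \<open>\<open>\<Phi>\<close> is the flow, on \<open>U\<close> and for times in \<open>]-e, e[\<close>, of the vector field \<open>X\<close> with domain \<open>D\<close>.\<close>

definition local_flow ::
  "(base \<Rightarrow> base) \<Rightarrow> base set \<Rightarrow> base set \<Rightarrow> real \<Rightarrow> (real \<Rightarrow> base \<Rightarrow> base) \<Rightarrow> bool" where
  "local_flow X D U e \<Phi> \<longleftrightarrow>
     open D \<and> smooth_on D X \<and> open U \<and> U \<subseteq> D \<and> 0 < e \<and>
     smooth_on ({-e<..<e} \<times> U) (\<lambda>(t, q). \<Phi> t q) \<and>
     (\<forall>q\<in>U. \<Phi> 0 q = q) \<and>
     (\<forall>t\<in>{-e<..<e}. point_transformation U (\<Phi> t)) \<and>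
     (\<forall>t\<in>{-e<..<e}. \<forall>q\<in>U. \<Phi> t q \<in> D \<and>
        ((\<lambda>s. \<Phi> s q) has_vector_derivative X (\<Phi> t q)) (at t))"

text \<open>\<open>has_lift k X \<theta> \<xi>\<close> says that \<open>X\<^sup>(\<^sup>k\<^sup>)\<close> has the value \<open>\<xi>\<close> at \<open>\<theta> \<in> J\<^sup>k\<pi>\<close>.\<close>

definition has_lift :: "nat \<Rightarrow> (base \<Rightarrow> base) \<Rightarrow> jpoint \<Rightarrow> jpoint \<Rightarrow> bool" where
  "has_lift k X \<theta> \<xi> \<longleftrightarrow> (\<exists>D U e \<Phi>. local_flow X D U e \<Phi> \<and> fst \<theta> \<in> U \<and>
     ((\<lambda>t. lift_jet U (\<Phi> t) k \<theta>) has_vector_derivative \<xi>) (at 0))"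


section \<open>Jets of vector fields\<close>

text \<open>\<open>vjets k p\<close> is \<open>W\<^sub>p / L\<^sup>k\<^sub>p\<close>, identified with the space of \<open>k\<close>-jets at \<open>p\<close> of vector fields.\<close>

definition vjets :: "nat \<Rightarrow> base \<Rightarrow> base coeffs set" where
  "vjets k p = {jet k X p | X D. open D \<and> p \<in> D \<and> smooth_on D X}"

text \<open>\<open>\<rho>\<^sub>k\<close>, with \<open>V\<^sub>p\<close> identified with the tangent space of the plane at \<open>p\<close>. The map \<open>\<rho>\<^sub>i\<^sub>,\<^sub>j\<close> is
  \<open>trunc j\<close>.\<close>

definition rho :: "base coeffs \<Rightarrow> base" where
  "rho j = Poly_Mapping.lookup j (0, 0)"

definition lie_bracket :: "(base \<Rightarrow> base) \<Rightarrow> (base \<Rightarrow> base) \<Rightarrow> base \<Rightarrow> base" where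
  "lie_bracket X Y q = frechet_derivative Y (at q) (X q) - frechet_derivative X (at q) (Y q)"

text \<open>The induced bracket from pairs of \<open>k\<close>-jets at \<open>p\<close> to \<open>(k - 1)\<close>-jets at \<open>p\<close>.\<close>

definition jet_bracket :: "nat \<Rightarrow> base \<Rightarrow> base coeffs \<Rightarrow> base coeffs \<Rightarrow> base coeffs" where
  "jet_bracket k p \<alpha> \<beta> = (THE \<gamma>. \<exists>X Y D. open D \<and> p \<in> D \<and> smooth_on D X \<and> smooth_on D Y \<and>
     jet k X p = \<alpha> \<and> jet k Y p = \<beta> \<and> \<gamma> = jet (k - 1) (lie_bracket X Y) p)"

definition horizontal :: "nat \<Rightarrow> base \<Rightarrow> base coeffs set \<Rightarrow> bool" where
  "horizontal k p H \<longleftrightarrow> H \<subseteq> vjets k p \<and> subspace H \<and> dim H = 2 \<and> rho ` H = UNIV"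

definition horizontal_bracket ::
  "nat \<Rightarrow> base \<Rightarrow> base coeffs set \<Rightarrow> base \<Rightarrow> base \<Rightarrow> base coeffs" where
  "horizontal_bracket k p H v w =
     jet_bracket k p (the_inv_into H rho v) (the_inv_into H rho w)"


section \<open>Isotropy spaces and the obstruction form\<close>

text \<open>For \<open>\<theta> \<in> J\<^sup>k\<^sup>+\<^sup>1\<pi>\<close>, \<open>jet_plane k \<theta>\<close> is the subspace \<open>\<H>\<^sub>\<theta>\<close> of the tangent space of \<open>J\<^sup>k\<pi>\<close>, and
  \<open>isotropy k \<theta>\<close> is \<open>\<A>\<^sub>\<theta>\<close>.\<close>

definition jet_plane :: "nat \<Rightarrow> jpoint \<Rightarrow> jpoint set" where
  "jet_plane k \<theta> = {frechet_derivative (sjet k S) (at (fst \<theta>)) v | S N v.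
     fst \<theta> \<in> N \<and> local_section N S \<and> sjet (Suc k) S (fst \<theta>) = \<theta>}"

definition isotropy :: "nat \<Rightarrow> jpoint \<Rightarrow> base coeffs set" where
  "isotropy k \<theta> = {jet (k + 2) X (fst \<theta>) | X \<xi>.
     has_lift k X (jproj k \<theta>) \<xi> \<and> \<xi> \<in> jet_plane k \<theta>}"

definition H_const :: "base \<Rightarrow> base coeffs set" where
  "H_const p = {jet 1 (\<lambda>_. v) p | v. True}"

definition H_theta1 :: "jpoint \<Rightarrow> base coeffs set" where
  "H_theta1 \<theta> = (THE H. horizontal 2 (fst \<theta>) H \<and> H \<subseteq> isotropy 0 \<theta> \<and>
     trunc 1 ` H = H_const (fst \<theta>) \<and> (\<forall>v w. horizontal_bracket 2 (fst \<theta>) H v w = 0))"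

definition H_theta2 :: "jpoint \<Rightarrow> base coeffs set" where
  "H_theta2 \<theta> = (THE H. horizontal 3 (fst \<theta>) H \<and> H \<subseteq> isotropy 1 \<theta> \<and>
     trunc 2 ` H = H_theta1 (jproj 1 \<theta>))"

definition omega_at :: "jpoint \<Rightarrow> base \<Rightarrow> base \<Rightarrow> base coeffs" where
  "omega_at \<theta> = horizontal_bracket 3 (fst \<theta>) (H_theta2 \<theta>)"

text \<open>The form \<open>\<omega>\<^sup>(\<^sup>2\<^sup>)\<close>; the differential of the projection \<open>\<pi>\<^sub>2\<close> is again \<open>fst\<close>.\<close>

definition omega2 :: "jpoint \<Rightarrow> jpoint \<Rightarrow> jpoint \<Rightarrow> base coeffs" where
  "omega2 \<theta> \<xi> \<eta> = omega_at \<theta> (fst \<xi>) (fst \<eta>)"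

definition pullback_form ::
  "(base \<Rightarrow> jpoint) \<Rightarrow> (jpoint \<Rightarrow> jpoint \<Rightarrow> jpoint \<Rightarrow> 'c) \<Rightarrow> base \<Rightarrow> base \<Rightarrow> base \<Rightarrow> 'c" where
  "pullback_form s w p v v' =
     w (s p) (frechet_derivative s (at p) v) (frechet_derivative s (at p) v')"


section \<open>Equations and linearizability\<close>

text \<open>The section of the equation \<open>y'' = u\<^sup>0 + u\<^sup>1 y' + u\<^sup>2 y'\<^sup>2 + u\<^sup>3 y'\<^sup>3\<close>.\<close>

definition ode_section ::
  "(base \<Rightarrow> real) \<Rightarrow> (base \<Rightarrow> real) \<Rightarrow> (base \<Rightarrow> real) \<Rightarrow> (base \<Rightarrow> real) \<Rightarrow> base \<Rightarrow> base \<times> fibre" where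
  "ode_section u0 u1 u2 u3 q = (q, (u0 q, u1 q, u2 q, u3 q))"

text \<open>The section of the linear equation \<open>y'' = a(x) y' + b(x) y + c(x)\<close>.\<close>

definition linear_ode_section ::
  "(real \<Rightarrow> real) \<Rightarrow> (real \<Rightarrow> real) \<Rightarrow> (real \<Rightarrow> real) \<Rightarrow> base \<Rightarrow> base \<times> fibre" where
  "linear_ode_section a b c =
     ode_section (\<lambda>(x, y). b x * y + c x) (\<lambda>(x, y). a x) (\<lambda>_. 0) (\<lambda>_. 0)"

definition linearizable_near :: "base set \<Rightarrow> (base \<Rightarrow> base \<times> fibre) \<Rightarrow> base \<Rightarrow> bool" where
  "linearizable_near U S p \<longleftrightarrow>
     (\<exists>N f a b c. p \<in> N \<and> N \<subseteq> U \<and> point_transformation N f \<and>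
        smooth_on (fst ` f ` N) a \<and> smooth_on (fst ` f ` N) b \<and> smooth_on (fst ` f ` N) c \<and>
        (\<forall>q \<in> f ` N. linear_ode_section a b c q = push_section N f S q))"

end

theory Submission
  imports Defs
begin

text \<open>
  An equation \<open>y'' = u\<^sup>0 + u\<^sup>1 y' + u\<^sup>2 y'\<^sup>2 + u\<^sup>3 y'\<^sup>3\<close> has two relative invariants, the expressions
  \<open>liouville1\<close> and \<open>liouville2\<close> of Liouville in the second jets of the coefficients. Both sides of the
  theorem are equivalent to the vanishing of these two functions.

  The obstruction form. Differentiating the lifts along a flow turns the condition that a vector field
  lies in an isotropy space into linear equations for its jet (\<open>flow_lift_derivative\<close>,
  \<open>isotropy_iff\<close>). For fields with vanishing first derivatives these equations involve the four
  combinations \<open>X\<^sup>2\<^sub>1\<^sub>1\<close>, \<open>2X\<^sup>2\<^sub>1\<^sub>2 - X\<^sup>1\<^sub>1\<^sub>1\<close>, \<open>X\<^sup>2\<^sub>2\<^sub>2 - 2X\<^sup>1\<^sub>1\<^sub>2\<close>, \<open>-X\<^sup>1\<^sub>2\<^sub>2\<close> of second derivatives and,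
  one order higher, the derivatives of these combinations. Together with the bracket condition they
  determine the second derivatives, and then the third ones, as explicit linear functions of the value
  of the field. Every jet found in this way with nonzero value belongs to a field that has a flow,
  because the field can be straightened up to any finite order (\<open>flow_box_jet\<close>). Hence the horizontal
  spaces are known, and their brackets have the Liouville expressions as components
  (\<open>omega_vanishes_iff\<close>).

  Vanishing invariants imply linearizability. If the solutions of the equation are the zero sets of
  functions \<open>z\<close>, then \<open>z\<close> may be normalised to satisfy a linear system that expresses the second
  derivatives of \<open>z\<close> by its first derivatives and its value. This system is a linear connection on a
  bundle of rank three, and it is flat exactly if the Liouville expressions vanish. A flat connection
  has parallel sections (\<open>flat_connection_parallel_section\<close>), and three independent solutions
  \<open>z\<^sub>0, z\<^sub>1, z\<^sub>2\<close> give the transformation \<open>(z\<^sub>1/z\<^sub>0, z\<^sub>2/z\<^sub>0)\<close>, under which the solutions become straight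
  lines, so that the new equation is \<open>y'' = 0\<close> (\<open>flattening\<close>).

  Linearizability implies vanishing invariants. A linear equation has vanishing Liouville expressions
  (\<open>linear_ode_liouville\<close>), so by the preceding part it is locally equivalent to \<open>y'' = 0\<close>, and
  therefore so is every linearizable equation. But the coefficients of an equation that some map \<open>F\<close>
  takes to \<open>y'' = 0\<close> are combinations of the Christoffel symbols of the flat connection with flat
  coordinates \<open>F\<close>, and the Liouville expressions are a differential consequence of the vanishing of
  its curvature (\<open>relates_zero_imp_liouville\<close>).
\<close>

section \<open>Partial derivatives and smooth functions\<close>

text \<open>The derivative in the direction \<open>b\<close> as a function of the point, so that it can be iterated; \<open>d1\<close> and
  \<open>d2\<close> are the cases of the two basis vectors of the plane.\<close>

definition pd :: "'a::euclidean_space \<Rightarrow> ('a \<Rightarrow> 'b::real_normed_vector) \<Rightarrow> 'a \<Rightarrow> 'b" where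
  "pd b h x = frechet_derivative h (at x) b"

lemma pd_unique: "(h has_derivative h') (at x) \<Longrightarrow> pd b h x = h' b"
  unfolding pd_def using frechet_derivative_at by metis

lemma has_pd: "h differentiable (at x) \<Longrightarrow> (h has_derivative (\<lambda>b. pd b h x)) (at x)"
  unfolding pd_def by (simp add: frechet_derivative_works)

lemma has_derivative_cong_open:
  assumes "open U" "x \<in> U" "\<And>y. y \<in> U \<Longrightarrow> f y = g y"
  shows "(f has_derivative D) (at x) \<longleftrightarrow> (g has_derivative D) (at x)"
  using has_derivative_transform_within_open[of f D x UNIV U g]
    has_derivative_transform_within_open[of g D x UNIV U f] assms by auto

lemma pd_cong:
  assumes "open U" "x \<in> U" "\<And>y. y \<in> U \<Longrightarrow> f y = g y"
  shows "pd b f x = pd b g x"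
  unfolding pd_def frechet_derivative_def using has_derivative_cong_open[OF assms] by simp

lemma differentiable_cong_open:
  assumes "open U" "x \<in> U" "\<And>y. y \<in> U \<Longrightarrow> f y = g y"
  shows "f differentiable (at x) \<longleftrightarrow> g differentiable (at x)"
  unfolding differentiable_def using has_derivative_cong_open[OF assms] by simp

lemma linear_pd: "h differentiable (at x) \<Longrightarrow> linear (\<lambda>b. pd b h x)"
  using has_pd has_derivative_linear by blast

lemma pd_expand:
  assumes "h differentiable (at x)"
  shows "pd v h x = (\<Sum>b\<in>Basis. (v \<bullet> b) *\<^sub>R pd b h x)"
proof -
  have "pd v h x = pd (\<Sum>b\<in>Basis. (v \<bullet> b) *\<^sub>R b) h x"
    by (simp add: euclidean_representation)
  also have "\<dots> = (\<Sum>b\<in>Basis. pd ((v \<bullet> b) *\<^sub>R b) h x)"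
    by (rule linear_sum[OF linear_pd[OF assms]])
  also have "\<dots> = (\<Sum>b\<in>Basis. (v \<bullet> b) *\<^sub>R pd b h x)"
    using linear_scale[OF linear_pd[OF assms]] by simp
  finally show ?thesis .
qed

lemma cdiff_on_Suc_pd:
  "cdiff_on (Suc k) U h \<longleftrightarrow> (\<forall>x\<in>U. h differentiable (at x)) \<and> (\<forall>b\<in>Basis. cdiff_on k U (pd b h))"
  by (simp add: pd_def[abs_def])

declare cdiff_on.simps(2)[simp del]

lemma cdiff_on_cong:
  assumes "open U" "\<And>y. y \<in> U \<Longrightarrow> f y = g y"
  shows "cdiff_on k U f \<longleftrightarrow> cdiff_on k U g"
  using assms(2)
proof (induction k arbitrary: f g)
  case 0
  then show ?case using continuous_on_cong[OF refl, of U f g] by simp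
next
  case (Suc k)
  show ?case
  proof -
    have "f differentiable (at x) \<longleftrightarrow> g differentiable (at x)" if "x \<in> U" for x
      by (rule differentiable_cong_open[OF assms(1) that Suc.prems])
    moreover have "cdiff_on k U (pd b f) \<longleftrightarrow> cdiff_on k U (pd b g)" for b
      by (rule Suc.IH) (rule pd_cong[OF assms(1) _ Suc.prems])
    ultimately show ?thesis unfolding cdiff_on_Suc_pd by blast
  qed
qed

lemma cdiff_on_subset: "cdiff_on k U h \<Longrightarrow> V \<subseteq> U \<Longrightarrow> cdiff_on k V h"
  by (induction k arbitrary: h)
    (auto simp: cdiff_on_Suc_pd intro: continuous_on_subset)

lemma cdiff_on_continuous: "cdiff_on k U h \<Longrightarrow> continuous_on U h"
  by (cases k) (auto simp: cdiff_on_Suc_pd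
      intro!: continuous_at_imp_continuous_on differentiable_imp_continuous_within)

lemma cdiff_on_Suc_imp: "cdiff_on (Suc k) U h \<Longrightarrow> cdiff_on k U h"
proof (induction k arbitrary: h)
  case 0
  then show ?case using cdiff_on_continuous by (metis cdiff_on.simps(1))
next
  case (Suc k)
  then show ?case using cdiff_on_Suc_pd by metis
qed

lemma pd_const [simp]: "pd b (\<lambda>x. c) = (\<lambda>x. 0)"
  by (rule ext) (rule pd_unique[OF has_derivative_const, THEN trans], simp)

lemma cdiff_on_const: "cdiff_on k U (\<lambda>x. c)"
  by (induction k arbitrary: c) (auto simp: cdiff_on_Suc_pd)

lemma pd_add:
  "f differentiable (at x) \<Longrightarrow> g differentiable (at x) \<Longrightarrow>
    pd b (\<lambda>x. f x + g x) x = pd b f x + pd b g x"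
  by (rule pd_unique[OF has_derivative_add[OF has_pd has_pd], THEN trans]) auto

lemma cdiff_on_add:
  "open U \<Longrightarrow> cdiff_on k U f \<Longrightarrow> cdiff_on k U g \<Longrightarrow> cdiff_on k U (\<lambda>x. f x + g x)"
proof (induction k arbitrary: f g)
  case 0
  then show ?case by (auto intro: continuous_intros)
next
  case (Suc k)
  have "cdiff_on k U (pd b (\<lambda>x. f x + g x))" if "b \<in> Basis" for b
    using Suc cdiff_on_cong[OF Suc.prems(1), of "pd b (\<lambda>x. f x + g x)" "\<lambda>x. pd b f x + pd b g x"]
    by (auto simp: cdiff_on_Suc_pd pd_add that)
  then show ?case using Suc.prems by (auto simp: cdiff_on_Suc_pd)
qed

lemma pd_bounded_linear:
  assumes "bounded_linear L" "f differentiable (at x)"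
  shows "pd b (\<lambda>x. L (f x)) x = L (pd b f x)"
  by (rule pd_unique[OF bounded_linear.has_derivative[OF assms(1) has_pd[OF assms(2)]]])

lemma differentiable_bounded_linear:
  fixes f :: "'a::euclidean_space \<Rightarrow> 'b::real_normed_vector"
  assumes "bounded_linear L" "f differentiable (at x)"
  shows "(\<lambda>x. L (f x)) differentiable (at x)"
  using bounded_linear.has_derivative[OF assms(1) has_pd[OF assms(2)]] differentiable_def by blast

lemma cdiff_on_bounded_linear:
  assumes "bounded_linear L"
  shows "open U \<Longrightarrow> cdiff_on k U f \<Longrightarrow> cdiff_on k U (\<lambda>x. L (f x))"
proof (induction k arbitrary: f)
  case 0
  then show ?case using bounded_linear.continuous_on[OF assms] by simp
next
  case (Suc k)
  have "cdiff_on k U (pd b (\<lambda>x. L (f x)))" if "b \<in> Basis" for b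
    using Suc cdiff_on_cong[OF Suc.prems(1), of "pd b (\<lambda>x. L (f x))" "\<lambda>x. L (pd b f x)"]
    by (auto simp: cdiff_on_Suc_pd pd_bounded_linear[OF assms] that)
  then show ?case using Suc.prems
    by (auto simp: cdiff_on_Suc_pd differentiable_bounded_linear[OF assms])
qed

lemma pd_bilinear:
  assumes "bounded_bilinear B" "f differentiable (at x)" "g differentiable (at x)"
  shows "pd b (\<lambda>x. B (f x) (g x)) x = B (f x) (pd b g x) + B (pd b f x) (g x)"
  by (rule pd_unique[OF bounded_bilinear.FDERIV[OF assms(1) has_pd[OF assms(2)] has_pd[OF assms(3)]]])

lemma differentiable_bilinear:
  fixes f :: "'a::euclidean_space \<Rightarrow> 'b::real_normed_vector"
  assumes "bounded_bilinear B" "f differentiable (at x)" "g differentiable (at x)"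
  shows "(\<lambda>x. B (f x) (g x)) differentiable (at x)"
  using bounded_bilinear.FDERIV[OF assms(1) has_pd[OF assms(2)] has_pd[OF assms(3)]]
    differentiable_def by blast

lemma cdiff_on_bilinear:
  assumes B: "bounded_bilinear B"
  shows "open U \<Longrightarrow> cdiff_on k U f \<Longrightarrow> cdiff_on k U g \<Longrightarrow> cdiff_on k U (\<lambda>x. B (f x) (g x))"
proof (induction k arbitrary: f g)
  case 0
  then show ?case using bounded_bilinear.continuous_on[OF B] by simp
next
  case (Suc k)
  have "cdiff_on k U (pd b (\<lambda>x. B (f x) (g x)))" if b: "b \<in> Basis" for b
  proof -
    have "cdiff_on k U (\<lambda>x. B (f x) (pd b g x) + B (pd b f x) (g x))"
      using Suc.prems b cdiff_on_Suc_imp[OF Suc.prems(2)] cdiff_on_Suc_imp[OF Suc.prems(3)]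
      by (intro cdiff_on_add Suc.IH) (simp_all add: cdiff_on_Suc_pd)
    then show ?thesis
      using cdiff_on_cong[OF Suc.prems(1), of "pd b (\<lambda>x. B (f x) (g x))"
          "\<lambda>x. B (f x) (pd b g x) + B (pd b f x) (g x)"] Suc.prems
      by (auto simp: cdiff_on_Suc_pd pd_bilinear[OF B])
  qed
  then show ?case using Suc.prems
    by (auto simp: cdiff_on_Suc_pd differentiable_bilinear[OF B])
qed

lemma cdiff_on_sum:
  assumes "open U" "finite I"
  shows "(\<And>i. i \<in> I \<Longrightarrow> cdiff_on k U (f i)) \<Longrightarrow> cdiff_on k U (\<lambda>x. \<Sum>i\<in>I. f i x)"
  using assms(2)
  by (induction I rule: finite_induct) (auto simp: cdiff_on_const intro: cdiff_on_add[OF assms(1)])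

lemma pd_compose:
  assumes "h differentiable (at x)" "g differentiable (at (h x))"
  shows "pd b (\<lambda>x. g (h x)) x = pd (pd b h x) g (h x)"
  by (rule pd_unique[OF has_derivative_compose[OF has_pd[OF assms(1)] has_pd[OF assms(2)]]])

lemma differentiable_compose_at:
  fixes h :: "'a::euclidean_space \<Rightarrow> 'c::euclidean_space" and g :: "'c \<Rightarrow> 'b::real_normed_vector"
  assumes "h differentiable (at x)" "g differentiable (at (h x))"
  shows "(\<lambda>x. g (h x)) differentiable (at x)"
  using has_derivative_compose[OF has_pd[OF assms(1)] has_pd[OF assms(2)]] differentiable_def by blast

text \<open>By the chain rule and an expansion in a basis, a derivative of the composition is a sum of products
  of a derivative of \<open>h\<close> with the composition of \<open>h\<close> and a derivative of \<open>g\<close>. So the induction is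
  over all outer functions at once, while the inner function stays fixed.\<close>

lemma cdiff_on_compose:
  fixes h :: "'a::euclidean_space \<Rightarrow> 'c::euclidean_space" and g :: "'c \<Rightarrow> 'b::real_normed_vector"
  assumes "open U" "open V" "h ` U \<subseteq> V"
  shows "cdiff_on k U h \<Longrightarrow> cdiff_on k V g \<Longrightarrow> cdiff_on k U (\<lambda>x. g (h x))"
proof (induction k arbitrary: g)
  case 0
  then show ?case using continuous_on_compose2[of V g U h] assms(3) by simp
next
  case (Suc k)
  have "cdiff_on k U (pd b (\<lambda>x. g (h x)))" if b: "b \<in> Basis" for b
  proof -
    have *: "pd b (\<lambda>x. g (h x)) x = (\<Sum>c\<in>Basis. (pd b h x \<bullet> c) *\<^sub>R pd c g (h x))" if "x \<in> U" for x
    proof -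
      have 1: "h differentiable (at x)" "g differentiable (at (h x))"
        using Suc.prems assms(3) that by (auto simp: cdiff_on_Suc_pd)
      show ?thesis unfolding pd_compose[OF 1] by (rule pd_expand[OF 1(2)])
    qed
    have "cdiff_on k U (\<lambda>x. \<Sum>c\<in>Basis. (pd b h x \<bullet> c) *\<^sub>R pd c g (h x))"
    proof (intro cdiff_on_sum cdiff_on_bilinear[OF bounded_bilinear_scaleR] assms finite_Basis)
      fix c :: 'c assume c: "c \<in> Basis"
      show "cdiff_on k U (\<lambda>x. pd b h x \<bullet> c)"
        using Suc.prems b
        by (intro cdiff_on_bounded_linear[OF bounded_linear_inner_left] assms) (auto simp: cdiff_on_Suc_pd)
      show "cdiff_on k U (\<lambda>x. pd c g (h x))"
        using Suc.IH[OF cdiff_on_Suc_imp[OF Suc.prems(1)]] Suc.prems(2) c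
        by (simp add: cdiff_on_Suc_pd)
    qed
    then show ?thesis using cdiff_on_cong[OF assms(1), of "pd b (\<lambda>x. g (h x))", OF *] by simp
  qed
  moreover have "(\<lambda>x. g (h x)) differentiable (at x)" if "x \<in> U" for x
  proof (rule differentiable_compose_at)
    show "h differentiable (at x)" using Suc.prems(1) that by (simp add: cdiff_on_Suc_pd)
    show "g differentiable (at (h x))"
      using Suc.prems(2) assms(3) that by (simp add: cdiff_on_Suc_pd image_subset_iff)
  qed
  ultimately show ?case by (auto simp: cdiff_on_Suc_pd)
qed

named_theorems smooth_intros

lemma smooth_on_cdiff: "smooth_on U h \<Longrightarrow> cdiff_on k U h" by (simp add: smooth_on_def)

lemma smooth_on_subset: "smooth_on U h \<Longrightarrow> V \<subseteq> U \<Longrightarrow> smooth_on V h"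
  unfolding smooth_on_def using cdiff_on_subset by blast

lemma smooth_on_cong:
  "open U \<Longrightarrow> (\<And>y. y \<in> U \<Longrightarrow> f y = g y) \<Longrightarrow> smooth_on U f \<longleftrightarrow> smooth_on U g"
  unfolding smooth_on_def using cdiff_on_cong by blast

lemma smooth_on_differentiable: "smooth_on U h \<Longrightarrow> x \<in> U \<Longrightarrow> h differentiable (at x)"
  unfolding smooth_on_def using cdiff_on_Suc_pd by blast

lemma smooth_on_continuous: "smooth_on U h \<Longrightarrow> continuous_on U h"
  unfolding smooth_on_def using cdiff_on_continuous by blast

lemma smooth_on_const [smooth_intros]: "smooth_on U (\<lambda>x. c)"
  by (simp add: smooth_on_def cdiff_on_const)

lemma smooth_on_add [smooth_intros]:
  "open U \<Longrightarrow> smooth_on U f \<Longrightarrow> smooth_on U g \<Longrightarrow> smooth_on U (\<lambda>x. f x + g x)"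
  unfolding smooth_on_def using cdiff_on_add by blast

lemma smooth_on_bounded_linear:
  "bounded_linear L \<Longrightarrow> open U \<Longrightarrow> smooth_on U f \<Longrightarrow> smooth_on U (\<lambda>x. L (f x))"
  unfolding smooth_on_def using cdiff_on_bounded_linear by blast

lemma smooth_on_bilinear:
  "bounded_bilinear B \<Longrightarrow> open U \<Longrightarrow> smooth_on U f \<Longrightarrow> smooth_on U g \<Longrightarrow>
    smooth_on U (\<lambda>x. B (f x) (g x))"
  unfolding smooth_on_def using cdiff_on_bilinear by blast

lemma smooth_on_sum:
  "open U \<Longrightarrow> finite I \<Longrightarrow> (\<And>i. i \<in> I \<Longrightarrow> smooth_on U (f i)) \<Longrightarrow> smooth_on U (\<lambda>x. \<Sum>i\<in>I. f i x)"
  unfolding smooth_on_def by (intro allI cdiff_on_sum) auto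

lemma smooth_on_compose:
  fixes h :: "'a::euclidean_space \<Rightarrow> 'c::euclidean_space" and g :: "'c \<Rightarrow> 'b::real_normed_vector"
  assumes "open U" "open V" "smooth_on U h" "smooth_on V g" "h ` U \<subseteq> V"
  shows "smooth_on U (\<lambda>x. g (h x))"
  using cdiff_on_compose[OF assms(1,2,5)] assms(3,4) unfolding smooth_on_def by blast

lemma cdiff_on_id: "cdiff_on k U (\<lambda>x. x)"
proof (cases k)
  case (Suc n)
  have "pd b (\<lambda>x. x) = (\<lambda>x::'a. b)" for b :: 'a
    by (rule ext) (rule pd_unique[OF has_derivative_ident])
  then show ?thesis by (auto simp: Suc cdiff_on_Suc_pd cdiff_on_const)
qed (auto intro: continuous_on_id)

lemma smooth_on_id [smooth_intros]: "smooth_on U (\<lambda>x. x)"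
  by (simp add: smooth_on_def cdiff_on_id)

lemma smooth_on_pd [smooth_intros]:
  assumes "open U" "smooth_on U h"
  shows "smooth_on U (pd b h)"
proof -
  have "smooth_on U (\<lambda>x. \<Sum>c\<in>Basis. (b \<bullet> c) *\<^sub>R pd c h x)"
    using assms(2)
    by (intro smooth_on_sum smooth_on_bounded_linear[OF bounded_linear_scaleR_right] assms finite_Basis)
      (metis smooth_on_def cdiff_on_Suc_pd)
  moreover have "pd b h x = (\<Sum>c\<in>Basis. (b \<bullet> c) *\<^sub>R pd c h x)" if "x \<in> U" for x
    using assms that by (intro pd_expand smooth_on_differentiable)
  ultimately show ?thesis using smooth_on_cong[OF assms(1)] by (metis (no_types, lifting))
qed

lemma smooth_on_minus [smooth_intros]:
  "open U \<Longrightarrow> smooth_on U f \<Longrightarrow> smooth_on U (\<lambda>x. - f x)"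
  by (rule smooth_on_bounded_linear[OF bounded_linear_minus[OF bounded_linear_ident]])

lemma smooth_on_diff [smooth_intros]:
  "open U \<Longrightarrow> smooth_on U f \<Longrightarrow> smooth_on U g \<Longrightarrow> smooth_on U (\<lambda>x. f x - g x)"
  using smooth_on_add[of U f "\<lambda>x. - g x"] smooth_on_minus[of U g] by simp

lemma smooth_on_mult [smooth_intros]:
  fixes f g :: "'a::euclidean_space \<Rightarrow> real"
  shows "open U \<Longrightarrow> smooth_on U f \<Longrightarrow> smooth_on U g \<Longrightarrow> smooth_on U (\<lambda>x. f x * g x)"
  by (rule smooth_on_bilinear[OF bounded_bilinear_mult])

lemma smooth_on_scaleR [smooth_intros]:
  "open U \<Longrightarrow> smooth_on U f \<Longrightarrow> smooth_on U g \<Longrightarrow> smooth_on U (\<lambda>x. f x *\<^sub>R g x)"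
  by (rule smooth_on_bilinear[OF bounded_bilinear_scaleR])

lemma smooth_on_power [smooth_intros]:
  fixes f :: "'a::euclidean_space \<Rightarrow> real"
  shows "open U \<Longrightarrow> smooth_on U f \<Longrightarrow> smooth_on U (\<lambda>x. f x ^ n)"
  by (induction n) (simp_all add: smooth_on_const smooth_on_mult)

lemma smooth_on_fst [smooth_intros]: "open U \<Longrightarrow> smooth_on U f \<Longrightarrow> smooth_on U (\<lambda>x. fst (f x))"
  by (rule smooth_on_bounded_linear[OF bounded_linear_fst])

lemma smooth_on_snd [smooth_intros]: "open U \<Longrightarrow> smooth_on U f \<Longrightarrow> smooth_on U (\<lambda>x. snd (f x))"
  by (rule smooth_on_bounded_linear[OF bounded_linear_snd])

lemma smooth_on_Pair [smooth_intros]: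
  assumes "open U" "smooth_on U f" "smooth_on U g"
  shows "smooth_on U (\<lambda>x. (f x, g x))"
proof -
  have "bounded_linear (\<lambda>x::'b. (x, 0::'c))" "bounded_linear (\<lambda>x::'c. (0::'b, x))"
    by (intro bounded_linear_Pair bounded_linear_ident bounded_linear_zero)+
  then have "smooth_on U (\<lambda>x. (f x, 0) + (0, g x))"
    using assms by (intro smooth_on_add smooth_on_bounded_linear[of "\<lambda>x. (x,0)" U f] smooth_on_bounded_linear[of "\<lambda>x. (0,x)" U g])
  then show ?thesis by simp
qed

lemma pd_inverse:
  fixes f :: "'a::euclidean_space \<Rightarrow> real"
  assumes "f differentiable (at x)" "f x \<noteq> 0"
  shows "pd b (\<lambda>x. inverse (f x)) x = - (pd b f x * (inverse (f x))\<^sup>2)"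
  by (rule pd_unique[OF Deriv.has_derivative_inverse[OF assms(2) has_pd[OF assms(1)]], THEN trans])
    (simp add: power2_eq_square)

lemma differentiable_inverse_at:
  fixes f :: "'a::euclidean_space \<Rightarrow> real"
  assumes "f differentiable (at x)" "f x \<noteq> 0"
  shows "(\<lambda>x. inverse (f x)) differentiable (at x)"
  using Deriv.has_derivative_inverse[OF assms(2) has_pd[OF assms(1)]] differentiable_def by blast

lemma smooth_on_inverse [smooth_intros]:
  fixes f :: "'a::euclidean_space \<Rightarrow> real"
  assumes "open U" "smooth_on U f" "\<And>x. x \<in> U \<Longrightarrow> f x \<noteq> 0"
  shows "smooth_on U (\<lambda>x. inverse (f x))"
  unfolding smooth_on_def
proof
  fix k show "cdiff_on k U (\<lambda>x. inverse (f x))"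
  proof (induction k)
    case 0
    show ?case using assms smooth_on_continuous by (auto intro!: continuous_intros)
  next
    case (Suc k)
    have "cdiff_on k U (pd b (\<lambda>x. inverse (f x)))" for b
    proof -
      have "cdiff_on k U (\<lambda>x. - (pd b f x * (inverse (f x) * inverse (f x))))"
        using assms smooth_on_pd[OF assms(1,2)]
        by (intro cdiff_on_bilinear[OF bounded_bilinear_mult] Suc smooth_on_cdiff
            cdiff_on_bounded_linear[OF bounded_linear_minus[OF bounded_linear_ident]])
      then show ?thesis
        using cdiff_on_cong[OF assms(1), of "pd b (\<lambda>x. inverse (f x))" "\<lambda>x. - (pd b f x * (inverse (f x) * inverse (f x)))"]
          pd_inverse smooth_on_differentiable assms by (fastforce simp: power2_eq_square)
    qed
    then show ?case
      using assms by (auto simp: cdiff_on_Suc_pd intro!: differentiable_inverse_at smooth_on_differentiable[of U f])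
  qed
qed

lemma smooth_on_divide [smooth_intros]:
  fixes f :: "'a::euclidean_space \<Rightarrow> real"
  assumes "open U" "smooth_on U f" "smooth_on U g" "\<And>x. x \<in> U \<Longrightarrow> g x \<noteq> 0"
  shows "smooth_on U (\<lambda>x. f x / g x)"
  using smooth_on_mult[OF assms(1,2) smooth_on_inverse[OF assms(1,3,4)]] by (simp add: divide_inverse)

lemma pd_line:
  fixes h :: "'a::euclidean_space \<Rightarrow> real"
  assumes "h differentiable (at (x + t *\<^sub>R b))"
  shows "((\<lambda>t. h (x + t *\<^sub>R b)) has_real_derivative pd b h (x + t *\<^sub>R b)) (at t)"
proof -
  have "((\<lambda>t. x + t *\<^sub>R b) has_derivative (\<lambda>s. s *\<^sub>R b)) (at t)"
    by (auto intro!: derivative_eq_intros)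
  from has_derivative_compose[OF this has_pd[OF assms]]
  have "((\<lambda>t. h (x + t *\<^sub>R b)) has_derivative (\<lambda>s. pd (s *\<^sub>R b) h (x + t *\<^sub>R b))) (at t)" .
  then show ?thesis
    using linear_scale[OF linear_pd[OF assms]]
    by (simp add: has_field_derivative_def mult.commute[of "pd _ _ _"] mult_commute_abs)
qed

text \<open>Two applications of the mean value theorem. The left-hand side is symmetric in \<open>b\<close> and \<open>c\<close>, which
  yields the symmetry of second derivatives when \<open>s\<close> tends to \<open>0\<close>.\<close>

lemma second_difference:
  fixes h :: "'a::euclidean_space \<Rightarrow> real"
  assumes U: "open U" "ball x r \<subseteq> U" "smooth_on U h" and s: "0 < s" "s * (norm b + norm c) < r"
  shows "\<exists>y\<in>ball x (r::real). norm (y - x) \<le> s * (norm b + norm c) \<and>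
    h (x + s *\<^sub>R b + s *\<^sub>R c) - h (x + s *\<^sub>R b) - h (x + s *\<^sub>R c) + h x = s * s * pd c (pd b h) y"
proof -
  have bnd: "norm (\<xi> *\<^sub>R b + \<eta> *\<^sub>R c) \<le> s * (norm b + norm c)" if "0 \<le> \<xi>" "\<xi> \<le> s" "0 \<le> \<eta>" "\<eta> \<le> s" for \<xi> \<eta>
  proof -
    have "norm (\<xi> *\<^sub>R b + \<eta> *\<^sub>R c) \<le> \<xi> * norm b + \<eta> * norm c"
      using norm_triangle_ineq[of "\<xi> *\<^sub>R b" "\<eta> *\<^sub>R c"] that by simp
    also have "\<dots> \<le> s * norm b + s * norm c"
      using that by (intro add_mono mult_right_mono) auto
    finally show ?thesis by (simp add: algebra_simps)
  qed
  have inU: "x + \<xi> *\<^sub>R b + \<eta> *\<^sub>R c \<in> U" "x + \<eta> *\<^sub>R c + \<xi> *\<^sub>R b \<in> U" if "0 \<le> \<xi>" "\<xi> \<le> s" "0 \<le> \<eta>" "\<eta> \<le> s" for \<xi> \<eta>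
  proof -
    have "x + (\<xi> *\<^sub>R b + \<eta> *\<^sub>R c) \<in> ball x r"
      using bnd[OF that] s norm_minus_cancel[of "\<xi> *\<^sub>R b + \<eta> *\<^sub>R c"] by (simp add: dist_norm)
    then show "x + \<xi> *\<^sub>R b + \<eta> *\<^sub>R c \<in> U" "x + \<eta> *\<^sub>R c + \<xi> *\<^sub>R b \<in> U" using U by (auto simp: algebra_simps)
  qed
  define \<phi> where "\<phi> = (\<lambda>\<tau>. h (x + s *\<^sub>R c + \<tau> *\<^sub>R b) - h (x + \<tau> *\<^sub>R b))"
  have d\<phi>: "(\<phi> has_real_derivative (pd b h (x + s *\<^sub>R c + \<tau> *\<^sub>R b) - pd b h (x + \<tau> *\<^sub>R b))) (at \<tau>)"
    if "0 \<le> \<tau>" "\<tau> \<le> s" for \<tau>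
    unfolding \<phi>_def using inU(2)[of \<tau> s] inU(2)[of \<tau> 0] that s U(3)
    by (intro DERIV_diff pd_line smooth_on_differentiable[of U]) auto
  obtain \<xi> where \<xi>: "0 < \<xi>" "\<xi> < s"
    and e1: "\<phi> s - \<phi> 0 = (s - 0) * (pd b h (x + s *\<^sub>R c + \<xi> *\<^sub>R b) - pd b h (x + \<xi> *\<^sub>R b))"
    using MVT2[OF s(1) d\<phi>] by auto
  have d2: "((\<lambda>t. pd b h (x + \<xi> *\<^sub>R b + t *\<^sub>R c)) has_real_derivative pd c (pd b h) (x + \<xi> *\<^sub>R b + t *\<^sub>R c)) (at t)"
    if "0 \<le> t" "t \<le> s" for t
    using inU(1)[of \<xi> t] that less_imp_le[OF \<xi>(1)] less_imp_le[OF \<xi>(2)] by (auto intro!: pd_line smooth_on_differentiable[of U] smooth_on_pd U)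
  obtain \<eta> where \<eta>: "0 < \<eta>" "\<eta> < s"
    and e2: "pd b h (x + \<xi> *\<^sub>R b + s *\<^sub>R c) - pd b h (x + \<xi> *\<^sub>R b + 0 *\<^sub>R c) = (s - 0) * pd c (pd b h) (x + \<xi> *\<^sub>R b + \<eta> *\<^sub>R c)"
    using MVT2[OF s(1) d2] by auto
  let ?y = "x + \<xi> *\<^sub>R b + \<eta> *\<^sub>R c"
  have n: "norm (?y - x) \<le> s * (norm b + norm c)" using bnd[of \<xi> \<eta>] \<xi> \<eta> by (simp add: algebra_simps)
  moreover have "?y \<in> ball x r" using order_le_less_trans[OF n s(2)] by (simp add: dist_norm norm_minus_commute add.commute)
  moreover have "h (x + s *\<^sub>R b + s *\<^sub>R c) - h (x + s *\<^sub>R b) - h (x + s *\<^sub>R c) + h x = s * s * pd c (pd b h) ?y"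
    using e1 e2 by (simp add: \<phi>_def algebra_simps)
  ultimately show ?thesis by blast
qed

lemma pd_commute_real:
  fixes h :: "'a::euclidean_space \<Rightarrow> real"
  assumes "open U" "x \<in> U" "smooth_on U h"
  shows "pd b (pd c h) x = pd c (pd b h) x"
proof (rule ccontr)
  assume ne: "pd b (pd c h) x \<noteq> pd c (pd b h) x"
  define e where "e = \<bar>pd b (pd c h) x - pd c (pd b h) x\<bar> / 2"
  have e: "e > 0" using ne by (simp add: e_def)
  have ct: "isCont (pd b (pd c h)) x" "isCont (pd c (pd b h)) x"
    using assms by (meson smooth_on_continuous smooth_on_pd continuous_on_eq_continuous_at)+
  obtain r1 where r1: "r1 > 0" "\<And>y. dist y x < r1 \<Longrightarrow> dist (pd b (pd c h) y) (pd b (pd c h) x) < e"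
    using ct(1) e unfolding continuous_at_eps_delta by blast
  obtain r2 where r2: "r2 > 0" "\<And>y. dist y x < r2 \<Longrightarrow> dist (pd c (pd b h) y) (pd c (pd b h) x) < e"
    using ct(2) e unfolding continuous_at_eps_delta by blast
  obtain r0 where r0: "r0 > 0" "ball x r0 \<subseteq> U" using assms openE by blast
  define r where "r = min r0 (min r1 r2)"
  have r: "r > 0" "ball x r \<subseteq> U" using r0 r1 r2 by (auto simp: r_def)
  define s where "s = r / (2 * (norm b + norm c + 1))"
  have pos: "2 * (norm b + norm c + 1) > 0" by (smt (verit) norm_ge_zero)
  then have s: "s > 0" using r by (simp add: s_def)
  have "s * (2 * (norm b + norm c + 1)) = r" unfolding s_def using pos by simp
  moreover have "s * (2 * (norm b + norm c + 1)) = s * (norm b + norm c) + s * (norm b + norm c + 2)"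
    by (simp add: algebra_simps)
  moreover have "s * (norm b + norm c + 2) > 0" using s by (intro mult_pos_pos) (auto simp: add_nonneg_pos)
  ultimately have s2: "s * (norm b + norm c) < r" "s * (norm c + norm b) < r" by (auto simp: add.commute)
  obtain y where y: "y \<in> ball x r"
    "h (x + s *\<^sub>R b + s *\<^sub>R c) - h (x + s *\<^sub>R b) - h (x + s *\<^sub>R c) + h x = s * s * pd c (pd b h) y"
    using second_difference[OF assms(1) r(2) assms(3) s s2(1)] by blast
  obtain z where z: "z \<in> ball x r"
    "h (x + s *\<^sub>R c + s *\<^sub>R b) - h (x + s *\<^sub>R c) - h (x + s *\<^sub>R b) + h x = s * s * pd b (pd c h) z"
    using second_difference[OF assms(1) r(2) assms(3) s s2(2)] by blast
  have "pd c (pd b h) y = pd b (pd c h) z"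
    using y(2) z(2) s by (simp add: algebra_simps)
  moreover have "dist (pd c (pd b h) y) (pd c (pd b h) x) < e" using y(1) by (intro r2) (auto simp: r_def dist_commute)
  moreover have "dist (pd b (pd c h) z) (pd b (pd c h) x) < e" using z(1) by (intro r1) (auto simp: r_def dist_commute)
  ultimately show False unfolding e_def dist_real_def by argo
qed

lemma pd_commute:
  fixes h :: "'a::euclidean_space \<Rightarrow> 'b::euclidean_space"
  assumes "open U" "x \<in> U" "smooth_on U h"
  shows "pd b (pd c h) x = pd c (pd b h) x"
proof (rule euclidean_eqI)
  fix i :: 'b assume "i \<in> Basis"
  have bl: "bounded_linear (\<lambda>y::'b. y \<bullet> i)" by (rule bounded_linear_inner_left)
  have *: "pd b (pd c h) x \<bullet> i = pd b (pd c (\<lambda>x. h x \<bullet> i)) x" for b c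
  proof -
    have "pd b (pd c h) x \<bullet> i = pd b (\<lambda>x. pd c h x \<bullet> i) x"
      using assms by (intro pd_bounded_linear[OF bl, symmetric] smooth_on_differentiable[of U] smooth_on_pd)
    also have "\<dots> = pd b (pd c (\<lambda>x. h x \<bullet> i)) x"
      using assms by (intro pd_cong[OF assms(1,2)] pd_bounded_linear[OF bl, symmetric] smooth_on_differentiable[of U]) auto
    finally show ?thesis .
  qed
  show "pd b (pd c h) x \<bullet> i = pd c (pd b h) x \<bullet> i"
    unfolding * by (rule pd_commute_real[OF assms(1,2)])
      (rule smooth_on_bounded_linear[OF bl assms(1,3)])
qed


section \<open>Calculus in the plane and local diffeomorphisms\<close>

lemma d1_eq: "d1 h = pd (1, 0) h" by (rule ext) (simp add: d1_def pd_def)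
lemma d2_eq: "d2 h = pd (0, 1) h" by (rule ext) (simp add: d2_def pd_def)

lemma smooth_on_d1 [smooth_intros]: "open U \<Longrightarrow> smooth_on U h \<Longrightarrow> smooth_on U (d1 h)"
  unfolding d1_eq by (rule smooth_on_pd)

lemma smooth_on_d2 [smooth_intros]: "open U \<Longrightarrow> smooth_on U h \<Longrightarrow> smooth_on U (d2 h)"
  unfolding d2_eq by (rule smooth_on_pd)

lemma pd_base:
  fixes h :: "base \<Rightarrow> 'b::real_normed_vector"
  assumes "h differentiable (at p)"
  shows "pd v h p = fst v *\<^sub>R d1 h p + snd v *\<^sub>R d2 h p"
  using pd_expand[OF assms, of v]
  by (simp add: d1_eq d2_eq Basis_prod_def sum.union_disjoint inner_prod_def)

lemma d1_cong: "open U \<Longrightarrow> x \<in> U \<Longrightarrow> (\<And>y. y \<in> U \<Longrightarrow> f y = g y) \<Longrightarrow> d1 f x = d1 g x"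
  unfolding d1_eq by (rule pd_cong)
lemma d2_cong: "open U \<Longrightarrow> x \<in> U \<Longrightarrow> (\<And>y. y \<in> U \<Longrightarrow> f y = g y) \<Longrightarrow> d2 f x = d2 g x"
  unfolding d2_eq by (rule pd_cong)

lemma d_commute:
  fixes h :: "base \<Rightarrow> 'b::euclidean_space"
  shows "open U \<Longrightarrow> x \<in> U \<Longrightarrow> smooth_on U h \<Longrightarrow> d2 (d1 h) x = d1 (d2 h) x"
  unfolding d1_eq d2_eq by (rule pd_commute)

named_theorems pds
named_theorems dfs

context
  fixes f g :: "'a::euclidean_space \<Rightarrow> real" and x :: 'a
  assumes df: "f differentiable (at x)" and dg: "g differentiable (at x)"
begin
lemma pd_diff_real: "pd b (\<lambda>x. f x - g x) x = pd b f x - pd b g x"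
  by (rule pd_unique[OF has_derivative_diff[OF has_pd[OF df] has_pd[OF dg]]])
lemma pd_mult_real: "pd b (\<lambda>x. f x * g x) x = f x * pd b g x + pd b f x * g x"
  by (rule pd_bilinear[OF bounded_bilinear_mult df dg])
lemma pd_divide_real:
  assumes "g x \<noteq> 0"
  shows "pd b (\<lambda>x. f x / g x) x = (pd b f x * g x - f x * pd b g x) / (g x * g x)"
proof -
  have "pd b (\<lambda>x. f x * inverse (g x)) x = f x * pd b (\<lambda>x. inverse (g x)) x + pd b f x * inverse (g x)"
    by (rule pd_bilinear[OF bounded_bilinear_mult df differentiable_inverse_at[OF dg assms]])
  then have "pd b (\<lambda>x. f x / g x) x = f x * - (pd b g x * (inverse (g x))\<^sup>2) + pd b f x * inverse (g x)"
    unfolding pd_inverse[OF dg assms] by (simp add: divide_inverse)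
  then show ?thesis using assms by (simp add: field_simps power2_eq_square)
qed
end

lemma pd_minus: "f differentiable (at x) \<Longrightarrow> pd b (\<lambda>x. - f x) x = - pd b f x"
  by (rule pd_unique[OF has_derivative_minus[OF has_pd]])

lemma pd_power_real:
  fixes f :: "'a::euclidean_space \<Rightarrow> real"
  assumes "f differentiable (at x)"
  shows "pd b (\<lambda>x. f x ^ n) x = of_nat n * pd b f x * f x ^ (n - 1)"
  by (rule pd_unique[OF has_derivative_power[OF has_pd[OF assms]], THEN trans]) simp

lemma pd_fst: "f differentiable (at x) \<Longrightarrow> pd b (\<lambda>x. fst (f x)) x = fst (pd b f x)"
  by (rule pd_bounded_linear[OF bounded_linear_fst])
lemma pd_snd: "f differentiable (at x) \<Longrightarrow> pd b (\<lambda>x. snd (f x)) x = snd (pd b f x)"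
  by (rule pd_bounded_linear[OF bounded_linear_snd])
lemma pd_Pair: "f differentiable (at x) \<Longrightarrow> g differentiable (at x) \<Longrightarrow>
   pd b (\<lambda>x. (f x, g x)) x = (pd b f x, pd b g x)"
  by (rule pd_unique[OF has_derivative_Pair[OF has_pd has_pd]])
lemma pd_scaleR: "f differentiable (at x) \<Longrightarrow> g differentiable (at x) \<Longrightarrow>
   pd b (\<lambda>x. f x *\<^sub>R g x) x = f x *\<^sub>R pd b g x + pd b f x *\<^sub>R g x"
  by (rule pd_bilinear[OF bounded_bilinear_scaleR])
lemma pd_diff: "f differentiable (at x) \<Longrightarrow> g differentiable (at x) \<Longrightarrow>
   pd b (\<lambda>x. f x - g x) x = pd b f x - pd b g x"
  by (rule pd_unique[OF has_derivative_diff[OF has_pd has_pd]])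

lemmas [pds] = pd_const pd_add pd_diff_real pd_mult_real pd_divide_real pd_minus
  pd_power_real pd_fst pd_snd pd_Pair pd_scaleR pd_diff

lemma differentiable_fst: "f differentiable (at x) \<Longrightarrow> (\<lambda>x. fst (f x)) differentiable (at x)"
  unfolding differentiable_def using has_derivative_fst by blast
lemma differentiable_snd: "f differentiable (at x) \<Longrightarrow> (\<lambda>x. snd (f x)) differentiable (at x)"
  unfolding differentiable_def using has_derivative_snd by blast
lemma differentiable_Pair: "f differentiable (at x) \<Longrightarrow> g differentiable (at x) \<Longrightarrow>
   (\<lambda>x. (f x, g x)) differentiable (at x)"
  unfolding differentiable_def using has_derivative_Pair by blast
lemma differentiable_divide_real:
  fixes f g :: "'a::euclidean_space \<Rightarrow> real"
  shows "f differentiable (at x) \<Longrightarrow> g differentiable (at x) \<Longrightarrow> g x \<noteq> 0 \<Longrightarrow>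
   (\<lambda>x. f x / g x) differentiable (at x)"
  by (rule differentiable_divide)

lemmas [dfs] = differentiable_const differentiable_add differentiable_diff differentiable_mult
  differentiable_minus differentiable_power differentiable_fst differentiable_snd
  differentiable_Pair differentiable_divide_real differentiable_scaleR

definition jac :: "(base \<Rightarrow> base) \<Rightarrow> base \<Rightarrow> real" where
  "jac f p = fst (d1 f p) * snd (d2 f p) - fst (d2 f p) * snd (d1 f p)"

text \<open>Cramer's rule for the inverse of the differential of \<open>f\<close> at \<open>p\<close>, applied to \<open>v\<close>.\<close>

definition dinv :: "(base \<Rightarrow> base) \<Rightarrow> base \<Rightarrow> base \<Rightarrow> base" where
  "dinv f v p = ((snd (d2 f p) * fst v - fst (d2 f p) * snd v) / jac f p,
                 (fst (d1 f p) * snd v - snd (d1 f p) * fst v) / jac f p)"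

lemma dinv_solve:
  assumes "jac f p \<noteq> 0" "fst w *\<^sub>R d1 f p + snd w *\<^sub>R d2 f p = v"
  shows "w = dinv f v p"
proof -
  have v: "fst v = fst w * fst (d1 f p) + snd w * fst (d2 f p)"
    "snd v = fst w * snd (d1 f p) + snd w * snd (d2 f p)" using assms(2) by auto
  have "fst w * jac f p = snd (d2 f p) * fst v - fst (d2 f p) * snd v"
    "snd w * jac f p = fst (d1 f p) * snd v - snd (d1 f p) * fst v"
    unfolding v jac_def by algebra+
  then show ?thesis using assms(1) by (simp add: dinv_def prod_eq_iff eq_divide_eq)
qed

lemma dinv_right:
  assumes "jac f p \<noteq> 0"
  shows "fst (dinv f v p) *\<^sub>R d1 f p + snd (dinv f v p) *\<^sub>R d2 f p = v"
proof -
  have "(snd (d2 f p) * fst v - fst (d2 f p) * snd v) * fst (d1 f p) + (fst (d1 f p) * snd v - snd (d1 f p) * fst v) * fst (d2 f p) = fst v * jac f p"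
    "(snd (d2 f p) * fst v - fst (d2 f p) * snd v) * snd (d1 f p) + (fst (d1 f p) * snd v - snd (d1 f p) * fst v) * snd (d2 f p) = snd v * jac f p"
    unfolding jac_def by algebra+
  then show ?thesis using assms by (simp add: dinv_def prod_eq_iff add_divide_distrib[symmetric])
qed

lemma smooth_on_jac [smooth_intros]: "open U \<Longrightarrow> smooth_on U f \<Longrightarrow> smooth_on U (jac f)"
  unfolding jac_def[abs_def] by (intro smooth_intros)

lemma smooth_on_dinv:
  "open U \<Longrightarrow> smooth_on U f \<Longrightarrow> (\<And>p. p \<in> U \<Longrightarrow> jac f p \<noteq> 0) \<Longrightarrow> smooth_on U (dinv f v)"
  unfolding dinv_def[abs_def] by (intro smooth_intros)

lemma pd_inverse_map:
  assumes "open V" "y \<in> V" "\<And>z. z \<in> V \<Longrightarrow> f (g z) = z"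
    and "g differentiable (at y)" "f differentiable (at (g y))"
  shows "pd (pd b g y) f (g y) = b"
proof -
  have "pd b (\<lambda>z. f (g z)) y = pd b (\<lambda>z. z) y"
    by (rule pd_cong[OF assms(1,2)]) (rule assms(3))
  also have "\<dots> = b" by (rule pd_unique[OF has_derivative_ident])
  finally show ?thesis using pd_compose[OF assms(4,5), of b] by simp
qed

text \<open>Bootstrapping: the derivatives of \<open>g\<close> are smooth functions of \<open>f\<close>'s derivatives composed with \<open>g\<close>,
  so they are as often differentiable as \<open>g\<close> itself.\<close>

lemma smooth_on_inverse_map:
  fixes f g :: "base \<Rightarrow> base"
  assumes "open U" "open V" "smooth_on U f" "\<And>p. p \<in> U \<Longrightarrow> jac f p \<noteq> 0"
    and "g ` V \<subseteq> U" "\<And>z. z \<in> V \<Longrightarrow> f (g z) = z" "\<And>z. z \<in> V \<Longrightarrow> g differentiable (at z)"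
  shows "smooth_on V g"
proof -
  have *: "pd b g z = dinv f b (g z)" if "z \<in> V" for b z
  proof -
    have gz: "g z \<in> U" using assms(5) that by auto
    have df: "f differentiable (at (g z))" by (rule smooth_on_differentiable[OF assms(3) gz])
    have "pd (pd b g z) f (g z) = b"
      by (rule pd_inverse_map[OF assms(2) that assms(6,7) df]) (use that in auto)
    then show ?thesis
      by (intro dinv_solve[OF assms(4)[OF gz]]) (simp add: pd_base[OF df])
  qed
  show ?thesis unfolding smooth_on_def
  proof
    fix k show "cdiff_on k V g"
    proof (induction k)
      case 0
      show ?case using assms(7)
        by (auto intro!: continuous_at_imp_continuous_on differentiable_imp_continuous_within)
    next
      case (Suc k)
      have "cdiff_on k V (pd b g)" for b
      proof -
        have "cdiff_on k V (\<lambda>z. dinv f b (g z))"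
          by (rule cdiff_on_compose[OF assms(2,1,5) Suc])
            (rule smooth_on_cdiff[OF smooth_on_dinv[OF assms(1,3,4)]])
        then show ?thesis using cdiff_on_cong[OF assms(2), of "pd b g", OF *] by simp
      qed
      then show ?case using assms(7) by (simp add: cdiff_on_Suc_pd)
    qed
  qed
qed

lemma the_inv_intoE:
  assumes "inj_on f U" "q \<in> f ` U"
  shows "f (the_inv_into U f q) = q" "the_inv_into U f q \<in> U"
  using assms by (auto intro: f_the_inv_into_f the_inv_into_into)

text \<open>A vector in the kernel of the differential is also killed by the differential of the identity, that
  is of the composition with the inverse map.\<close>

lemma point_transformation_jac:
  assumes "point_transformation U f" "p \<in> U"
  shows "jac f p \<noteq> 0"
proof
  assume j: "jac f p = 0"
  have inv: "\<And>z. z \<in> U \<Longrightarrow> the_inv_into U f (f z) = z"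
    using assms by (simp add: point_transformation_def the_inv_into_f_f)
  have df: "f differentiable (at p)" using assms smooth_on_differentiable unfolding point_transformation_def by blast
  have dg: "the_inv_into U f differentiable (at (f p))"
    using assms smooth_on_differentiable unfolding point_transformation_def by blast
  have id: "pd (pd b f p) (the_inv_into U f) (f p) = b" for b
    using pd_inverse_map[OF _ assms(2) inv df dg] assms(1) unfolding point_transformation_def by blast
  have inj: "pd b f p = 0 \<Longrightarrow> b = 0" for b
    using id[of b] linear_0[OF linear_pd[OF dg]] by simp
  have "pd (snd (d2 f p), - snd (d1 f p)) f p = 0" "pd (- fst (d2 f p), fst (d1 f p)) f p = 0"
    using j unfolding pd_base[OF df] jac_def by (auto simp: prod_eq_iff algebra_simps)
  then have "(snd (d2 f p), - snd (d1 f p)) = 0" "(- fst (d2 f p), fst (d1 f p)) = 0"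
    using inj by blast+
  then have "d1 f p = 0" by (simp add: prod_eq_iff zero_prod_def)
  then have "pd (1, 0) f p = 0" by (simp add: d1_eq)
  then show False using inj by (fastforce simp: zero_prod_def)
qed

lemma local_diffeo:
  fixes f :: "base \<Rightarrow> base"
  assumes "open U" "p \<in> U" "smooth_on U f" "jac f p \<noteq> 0"
  obtains N where "p \<in> N" "N \<subseteq> U" "point_transformation N f"
proof -
  have df: "f differentiable (at x)" if "x \<in> U" for x by (rule smooth_on_differentiable[OF assms(3) that])
  have "isCont (jac f) p"
    using smooth_on_continuous[OF smooth_on_jac[OF assms(1,3)]] assms(1,2) continuous_on_eq_continuous_at by blast
  then have op: "open {x \<in> U. jac f x \<noteq> 0}"
    using continuous_open_preimage[OF smooth_on_continuous[OF smooth_on_jac[OF assms(1,3)]] assms(1), of "- {0}"]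
    by (simp add: vimage_def Int_def open_Compl conj_commute)
  define W where "W = {x \<in> U. jac f x \<noteq> 0}"
  define f' where "f' x = Blinfun (\<lambda>v. pd v f x)" for x
  have f': "blinfun_apply (f' x) = (\<lambda>v. pd v f x)" if "x \<in> U" for x
    unfolding f'_def using has_pd[OF df[OF that]] has_derivative_bounded_linear
    by (intro bounded_linear_Blinfun_apply) blast
  have bl: "bounded_linear (\<lambda>v. dinv f v p)"
    unfolding dinv_def diff_divide_distrib times_divide_eq_left[symmetric]
    by (intro bounded_linear_Pair bounded_linear_sub bounded_linear_const_mult bounded_linear_fst bounded_linear_snd)
  have pW: "p \<in> W" using assms by (simp add: W_def)
  obtain U' V g g' where U': "open U'" "U' \<subseteq> W" "p \<in> U'" and V: "open V" "f p \<in> V"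
    and h: "homeomorphism U' V f g" and dg: "\<And>y. y \<in> V \<Longrightarrow> (g has_derivative (g' y)) (at y)"
  proof (rule inverse_function_theorem[of W f f' p "Blinfun (\<lambda>v. dinv f v p)"])
    show "open W" using op by (simp add: W_def)
    show "(f has_derivative blinfun_apply (f' x)) (at x)" if "x \<in> W" for x
      using that has_pd[OF df] f' by (simp add: W_def)
    show "continuous_on W f'"
    proof (rule continuous_on_blinfun_componentwise)
      fix i :: base
      have "continuous_on W (pd i f)"
        using smooth_on_continuous[OF smooth_on_pd[OF assms(1,3)]] continuous_on_subset by (metis (no_types, lifting) W_def mem_Collect_eq subsetI)
      then show "continuous_on W (\<lambda>x. blinfun_apply (f' x) i)"
        by (rule continuous_on_eq) (simp add: f' W_def)
    qed
    show "p \<in> W" by (rule pW)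
    show "Blinfun (\<lambda>v. dinv f v p) o\<^sub>L f' p = id_blinfun"
    proof (rule blinfun_eqI)
      fix w
      have "w = dinv f (pd w f p) p"
        using dinv_solve[OF assms(4)] pd_base[OF df[OF assms(2)], of w] by simp
      then show "blinfun_apply (Blinfun (\<lambda>v. dinv f v p) o\<^sub>L f' p) w = blinfun_apply id_blinfun w"
        by (simp add: bounded_linear_Blinfun_apply[OF bl] f' assms(2))
    qed
  qed blast
  have img: "f ` U' = V" and gf: "\<And>x. x \<in> U' \<Longrightarrow> g (f x) = x" and fg: "\<And>y. y \<in> V \<Longrightarrow> f (g y) = y" and gV: "g ` V = U'"
    using h by (auto simp: homeomorphism_def)
  have inj: "inj_on f U'" using gf by (metis inj_onI)
  have sf: "smooth_on U' f" using assms(3) U'(2) smooth_on_subset unfolding W_def by blast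
  have "smooth_on V g"
    by (rule smooth_on_inverse_map[OF U'(1) V(1) sf])
      (use U' gV fg in \<open>auto simp: W_def\<close>, use dg differentiable_def in blast)
  moreover have "the_inv_into U' f y = g y" if "y \<in> V" for y
    using gf gV fg that inj by (metis image_eqI the_inv_into_f_f)
  ultimately have "smooth_on V (the_inv_into U' f)"
    using smooth_on_cong[OF V(1), of "the_inv_into U' f" g] by blast
  then have "point_transformation U' f"
    unfolding point_transformation_def using U' V img inj sf by simp
  moreover have "U' \<subseteq> U" using U' by (auto simp: W_def)
  ultimately show ?thesis using that U' by blast
qed


section \<open>Jets and order of vanishing\<close>

text \<open>The order of the derivatives is the one used for jets.\<close>

definition dd :: "nat \<Rightarrow> nat \<Rightarrow> (base \<Rightarrow> 'b::real_normed_vector) \<Rightarrow> base \<Rightarrow> 'b" where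
  "dd m n h = (d1 ^^ m) ((d2 ^^ n) h)"

text \<open>The jet with given coefficients. Calculations with jets become calculations with coefficient
  functions, of which only the values of order at most \<open>k\<close> matter.\<close>

definition jet_of :: "nat \<Rightarrow> (nat \<Rightarrow> nat \<Rightarrow> 'b::real_normed_vector) \<Rightarrow> 'b coeffs" where
  "jet_of k c = (\<Sum>(m, n) \<in> {(m, n). m + n \<le> k}. Poly_Mapping.single (m, n) (c m n))"

lemma finite_multiindices [simp]: "finite {(m, n). m + n \<le> (k::nat)}"
  by (rule finite_subset[of _ "{..k} \<times> {..k}"]) auto

lemma lookup_jet_of: "Poly_Mapping.lookup (jet_of k c) (m, n) = (if m + n \<le> k then c m n else 0)"
proof -
  have "Poly_Mapping.lookup (jet_of k c) (m, n) = (\<Sum>i\<in>{(m, n). m + n \<le> k}. if i = (m, n) then c (fst i) (snd i) else 0)"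
    unfolding jet_of_def lookup_sum by (intro sum.cong) (auto simp: lookup_single when_def split: if_splits)
  then show ?thesis by (simp add: sum.delta)
qed

lemma jet_eq_jet_of: "jet k h p = jet_of k (\<lambda>m n. dd m n h p)"
  by (simp add: jet_def jet_of_def dd_def)

lemma jet_of_eq_iff: "jet_of k c = jet_of k c' \<longleftrightarrow> (\<forall>m n. m + n \<le> k \<longrightarrow> c m n = c' m n)"
proof
  assume "jet_of k c = jet_of k c'"
  then show "\<forall>m n. m + n \<le> k \<longrightarrow> c m n = c' m n"
    using lookup_jet_of[of k c] lookup_jet_of[of k c'] by metis
next
  assume *: "\<forall>m n. m + n \<le> k \<longrightarrow> c m n = c' m n"
  show "jet_of k c = jet_of k c'"
  proof (rule poly_mapping_eqI)
    fix i show "Poly_Mapping.lookup (jet_of k c) i = Poly_Mapping.lookup (jet_of k c') i"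
      using * by (cases i) (simp add: lookup_jet_of)
  qed
qed

lemma lookup_scaleR: "Poly_Mapping.lookup (r *\<^sub>R x) i = r *\<^sub>R Poly_Mapping.lookup x i"
proof -
  have "{i. r *\<^sub>R Poly_Mapping.lookup x i \<noteq> 0} \<subseteq> {i. Poly_Mapping.lookup x i \<noteq> 0}" by auto
  then have "finite {i. r *\<^sub>R Poly_Mapping.lookup x i \<noteq> 0}"
    using finite_lookup finite_subset by blast
  then show ?thesis unfolding scaleR_poly_mapping_def by (simp add: Abs_poly_mapping_inverse)
qed

lemma jet_of_add: "jet_of k c + jet_of k c' = jet_of k (\<lambda>m n. c m n + c' m n)"
proof (rule poly_mapping_eqI)
  fix i show "Poly_Mapping.lookup (jet_of k c + jet_of k c') i = Poly_Mapping.lookup (jet_of k (\<lambda>m n. c m n + c' m n)) i"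
    by (cases i) (simp add: lookup_jet_of lookup_add)
qed

lemma jet_of_scaleR: "r *\<^sub>R jet_of k c = jet_of k (\<lambda>m n. r *\<^sub>R c m n)"
proof (rule poly_mapping_eqI)
  fix i show "Poly_Mapping.lookup (r *\<^sub>R jet_of k c) i = Poly_Mapping.lookup (jet_of k (\<lambda>m n. r *\<^sub>R c m n)) i"
    by (cases i) (simp add: lookup_jet_of lookup_scaleR)
qed

lemma jet_of_zero: "jet_of k (\<lambda>m n. 0) = 0"
  by (simp add: jet_of_def)

lemma trunc_jet_of: "r \<le> k \<Longrightarrow> trunc r (jet_of k c) = jet_of r c"
proof -
  assume "r \<le> k"
  have "trunc r (jet_of k c) = jet_of r (\<lambda>m n. Poly_Mapping.lookup (jet_of k c) (m, n))"
    by (simp add: trunc_def jet_of_def)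
  then show ?thesis using \<open>r \<le> k\<close> by (simp add: jet_of_eq_iff lookup_jet_of)
qed

lemma rho_jet_of [simp]: "rho (jet_of k c) = c 0 0"
  by (simp add: rho_def lookup_jet_of)

lemma bounded_linear_single: "bounded_linear (\<lambda>v::'b::real_normed_vector. Poly_Mapping.single i v)"
proof (rule bounded_linear_intro[of _ 1])
  show "Poly_Mapping.single i (x + y) = Poly_Mapping.single i x + Poly_Mapping.single i y" for x y :: 'b
    by (rule single_add)
  show "Poly_Mapping.single i (r *\<^sub>R x) = r *\<^sub>R Poly_Mapping.single i x" for r and x :: 'b
    by (rule poly_mapping_eqI) (simp add: lookup_scaleR lookup_single when_def)
  show "norm (Poly_Mapping.single i x) \<le> norm x * 1" for x :: 'b
    by (cases "x = 0") (simp_all add: norm_poly_mapping_def dist_poly_mapping_def)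
qed

lemma has_derivative_jet_of:
  assumes "\<And>m n. m + n \<le> k \<Longrightarrow> ((\<lambda>t. c t m n) has_derivative (\<lambda>v. c' v m n)) F"
  shows "((\<lambda>t. jet_of k (c t)) has_derivative (\<lambda>v. jet_of k (c' v))) F"
  unfolding jet_of_def
  by (intro has_derivative_sum) (auto intro!: bounded_linear.has_derivative[OF bounded_linear_single] assms)

lemma smooth_on_d1_funpow: "open U \<Longrightarrow> smooth_on U h \<Longrightarrow> smooth_on U ((d1 ^^ m) h)"
  by (induction m) (auto intro: smooth_on_d1)
lemma smooth_on_d2_funpow: "open U \<Longrightarrow> smooth_on U h \<Longrightarrow> smooth_on U ((d2 ^^ m) h)"
  by (induction m) (auto intro: smooth_on_d2)
lemma smooth_on_dd: "open U \<Longrightarrow> smooth_on U h \<Longrightarrow> smooth_on U (dd m n h)"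
  unfolding dd_def by (intro smooth_on_d1_funpow smooth_on_d2_funpow)

lemma d1_funpow_cong:
  assumes "open U" "\<And>y. y \<in> U \<Longrightarrow> f y = g y" "x \<in> U"
  shows "(d1 ^^ m) f x = (d1 ^^ m) g x"
  using assms(3) by (induction m arbitrary: x) (auto simp: assms(2) intro: d1_cong[OF assms(1)])

context
  fixes U and h :: "base \<Rightarrow> 'b::euclidean_space"
  assumes U: "open U" and h: "smooth_on U h"
begin

lemma d2_funpow_d1: "x \<in> U \<Longrightarrow> (d2 ^^ n) (d1 h) x = d1 ((d2 ^^ n) h) x"
proof (induction n arbitrary: x)
  case (Suc n)
  have "d2 ((d2 ^^ n) (d1 h)) x = d2 (d1 ((d2 ^^ n) h)) x"
    by (rule d2_cong[OF U Suc.prems]) (rule Suc.IH)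
  also have "\<dots> = d1 (d2 ((d2 ^^ n) h)) x"
    by (rule d_commute[OF U Suc.prems smooth_on_d2_funpow[OF U h]])
  finally show ?case by simp
qed simp

lemma d2_d1_funpow:
  assumes g: "smooth_on U (g :: base \<Rightarrow> 'b)"
  shows "x \<in> U \<Longrightarrow> d2 ((d1 ^^ m) g) x = (d1 ^^ m) (d2 g) x"
proof (induction m arbitrary: x)
  case (Suc m)
  have "d2 (d1 ((d1 ^^ m) g)) x = d1 (d2 ((d1 ^^ m) g)) x"
    by (rule d_commute[OF U Suc.prems smooth_on_d1_funpow[OF U g]])
  also have "\<dots> = d1 ((d1 ^^ m) (d2 g)) x"
    by (rule d1_cong[OF U Suc.prems]) (rule Suc.IH)
  finally show ?case by simp
qed simp

lemma dd_d1: "x \<in> U \<Longrightarrow> dd m n (d1 h) x = dd (Suc m) n h x"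
  unfolding dd_def funpow_Suc_right comp_def
  by (rule d1_funpow_cong[OF U]) (rule d2_funpow_d1)

lemma dd_d2: "dd m n (d2 h) x = dd m (Suc n) h x"
  unfolding dd_def funpow_Suc_right comp_def ..

lemma d1_dd: "d1 (dd m n h) x = dd (Suc m) n h x"
  by (simp add: dd_def)

lemma d2_dd: "x \<in> U \<Longrightarrow> d2 (dd m n h) x = dd m (Suc n) h x"
  unfolding dd_def using d2_d1_funpow[OF smooth_on_d2_funpow[OF U h]] by simp

end

lemma dd_add_scaleR:
  assumes U: "open U" "p \<in> U" "smooth_on U f" "smooth_on U g"
  shows "dd m n (\<lambda>q. a *\<^sub>R f q + b *\<^sub>R g q) p = a *\<^sub>R dd m n f p + b *\<^sub>R dd m n g p"
proof -
  have 2: "(d2 ^^ n) (\<lambda>q. a *\<^sub>R f q + b *\<^sub>R g q) q = a *\<^sub>R (d2 ^^ n) f q + b *\<^sub>R (d2 ^^ n) g q"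
    if "q \<in> U" "smooth_on U f" "smooth_on U g" for n f g q
    using that(1)
  proof (induction n arbitrary: q)
    case (Suc n)
    have "d2 ((d2 ^^ n) (\<lambda>q. a *\<^sub>R f q + b *\<^sub>R g q)) q = d2 (\<lambda>q. a *\<^sub>R (d2 ^^ n) f q + b *\<^sub>R (d2 ^^ n) g q) q"
      by (rule d2_cong[OF U(1) Suc.prems]) (rule Suc.IH)
    moreover have "(d2 ^^ n) f differentiable (at q)" "(d2 ^^ n) g differentiable (at q)"
      using Suc.prems that by (auto intro!: smooth_on_differentiable[of U] smooth_on_d2_funpow U)
    ultimately show ?case by (simp add: d2_eq[of "\<lambda>q. a *\<^sub>R _ q + _ q"] d2_eq[of "(d2 ^^ n) _"] pds dfs)
  qed simp
  have 1: "(d1 ^^ n) (\<lambda>q. a *\<^sub>R f q + b *\<^sub>R g q) q = a *\<^sub>R (d1 ^^ n) f q + b *\<^sub>R (d1 ^^ n) g q"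
    if "q \<in> U" "smooth_on U f" "smooth_on U g" for n f g q
    using that(1)
  proof (induction n arbitrary: q)
    case (Suc n)
    have "d1 ((d1 ^^ n) (\<lambda>q. a *\<^sub>R f q + b *\<^sub>R g q)) q = d1 (\<lambda>q. a *\<^sub>R (d1 ^^ n) f q + b *\<^sub>R (d1 ^^ n) g q) q"
      by (rule d1_cong[OF U(1) Suc.prems]) (rule Suc.IH)
    moreover have "(d1 ^^ n) f differentiable (at q)" "(d1 ^^ n) g differentiable (at q)"
      using Suc.prems that by (auto intro!: smooth_on_differentiable[of U] smooth_on_d1_funpow U)
    ultimately show ?case by (simp add: d1_eq[of "\<lambda>q. a *\<^sub>R _ q + _ q"] d1_eq[of "(d1 ^^ n) _"] pds dfs)
  qed simp
  have "dd m n (\<lambda>q. a *\<^sub>R f q + b *\<^sub>R g q) p = (d1 ^^ m) (\<lambda>q. a *\<^sub>R (d2 ^^ n) f q + b *\<^sub>R (d2 ^^ n) g q) p"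
    unfolding dd_def by (rule d1_funpow_cong[OF U(1) _ U(2)]) (rule 2[OF _ U(3,4)])
  also have "\<dots> = a *\<^sub>R dd m n f p + b *\<^sub>R dd m n g p"
    unfolding dd_def by (rule 1[OF U(2)]) (intro smooth_on_d2_funpow U)+
  finally show ?thesis .
qed

text \<open>All derivatives of order less than \<open>k\<close> vanish at \<open>p\<close>. In this recursive form the Leibniz rule
  shows at once that orders of vanishing add up in products, and equality of jets becomes the vanishing
  of a difference.\<close>

primrec vanish :: "nat \<Rightarrow> (base \<Rightarrow> 'b::real_normed_vector) \<Rightarrow> base \<Rightarrow> bool" where
  "vanish 0 f p \<longleftrightarrow> True"
| "vanish (Suc k) f p \<longleftrightarrow> f p = 0 \<and> vanish k (d1 f) p \<and> vanish k (d2 f) p"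

context
  fixes U :: "base set" and p :: base
  assumes U: "open U" and p: "p \<in> U"
begin

lemma vanish_cong: "(\<And>y. y \<in> U \<Longrightarrow> f y = g y) \<Longrightarrow> vanish k f p \<longleftrightarrow> vanish k g p"
proof (induction k arbitrary: f g)
  case (Suc k)
  have "vanish k (d1 f) p \<longleftrightarrow> vanish k (d1 g) p" "vanish k (d2 f) p \<longleftrightarrow> vanish k (d2 g) p"
    by (rule Suc.IH, rule d1_cong[OF U] d2_cong[OF U], assumption, rule Suc.prems, assumption)+
  then show ?case using Suc.prems[OF p] by simp
qed simp

lemma vanish_transfer: "vanish k f p \<Longrightarrow> (\<And>y. y \<in> U \<Longrightarrow> g y = f y) \<Longrightarrow> vanish k g p"
  using vanish_cong[of g f] by simp

lemma vanish_dd: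
  fixes f :: "base \<Rightarrow> 'b::euclidean_space"
  shows "smooth_on U f \<Longrightarrow> vanish k f p \<longleftrightarrow> (\<forall>m n. m + n < k \<longrightarrow> dd m n f p = 0)"
proof (induction k arbitrary: f)
  case (Suc k)
  have IH: "vanish k (d1 f) p \<longleftrightarrow> (\<forall>m n. m + n < k \<longrightarrow> dd (Suc m) n f p = 0)"
    "vanish k (d2 f) p \<longleftrightarrow> (\<forall>m n. m + n < k \<longrightarrow> dd m (Suc n) f p = 0)"
    using Suc.IH[OF smooth_on_d1[OF U Suc.prems]] Suc.IH[OF smooth_on_d2[OF U Suc.prems]]
      dd_d1[OF U Suc.prems p] dd_d2[OF U Suc.prems] by auto
  have "(\<forall>m n. m + n < Suc k \<longrightarrow> dd m n f p = 0) \<longleftrightarrow> f p = 0 \<and>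
    (\<forall>m n. m + n < k \<longrightarrow> dd (Suc m) n f p = 0) \<and> (\<forall>m n. m + n < k \<longrightarrow> dd m (Suc n) f p = 0)"
    (is "?L \<longleftrightarrow> ?R")
  proof
    assume L: ?L
    have "dd 0 0 f p = 0" using L by simp
    then show ?R using L by (auto simp: dd_def[of 0 0])
  next
    assume R: ?R
    show ?L
    proof (intro allI impI)
      fix m n assume "m + n < Suc k"
      then show "dd m n f p = 0"
        using R by (cases m; cases n) (auto simp: dd_def[of 0 0])
    qed
  qed
  then show ?case using IH by simp
qed simp

lemma vanish_mono: "vanish k f p \<Longrightarrow> j \<le> k \<Longrightarrow> vanish j f p"
proof (induction j arbitrary: k f)
  case (Suc j)
  then obtain k' where "k = Suc k'" "j \<le> k'" by (cases k) auto
  then show ?case using Suc by auto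
qed simp

lemma vanish_add:
  "smooth_on U f \<Longrightarrow> smooth_on U g \<Longrightarrow> vanish k f p \<Longrightarrow> vanish k g p \<Longrightarrow> vanish k (\<lambda>q. f q + g q) p"
proof (induction k arbitrary: f g)
  case (Suc k)
  have v: "vanish k (\<lambda>q. d1 f q + d1 g q) p" "vanish k (\<lambda>q. d2 f q + d2 g q) p"
    by (intro Suc.IH smooth_on_d1[OF U] smooth_on_d2[OF U] Suc.prems(1,2); use Suc.prems(3,4) in simp)+
  have e: "d1 (\<lambda>q. f q + g q) q = d1 f q + d1 g q" "d2 (\<lambda>q. f q + g q) q = d2 f q + d2 g q" if "q \<in> U" for q
    unfolding d1_eq d2_eq
    by (rule pd_add; rule smooth_on_differentiable[OF _ that], rule Suc.prems)+
  have "vanish k (d1 (\<lambda>q. f q + g q)) p" "vanish k (d2 (\<lambda>q. f q + g q)) p"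
    by (rule vanish_transfer[OF v(1)] vanish_transfer[OF v(2)], erule e)+
  then show ?case using Suc.prems by simp
qed simp

lemma vanish_bounded_linear:
  fixes f :: "base \<Rightarrow> 'b::real_normed_vector"
  assumes L: "bounded_linear L"
  shows "smooth_on U f \<Longrightarrow> vanish k f p \<Longrightarrow> vanish k (\<lambda>q. L (f q)) p"
proof (induction k arbitrary: f)
  case (Suc k)
  have v: "vanish k (\<lambda>q. L (d1 f q)) p" "vanish k (\<lambda>q. L (d2 f q)) p"
    by (intro Suc.IH smooth_on_d1[OF U] smooth_on_d2[OF U] Suc.prems(1); use Suc.prems(2) in simp)+
  have e: "d1 (\<lambda>q. L (f q)) q = L (d1 f q)" "d2 (\<lambda>q. L (f q)) q = L (d2 f q)" if "q \<in> U" for q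
    unfolding d1_eq d2_eq
    by (rule pd_bounded_linear[OF L]; rule smooth_on_differentiable[OF _ that], rule Suc.prems)+
  have "vanish k (d1 (\<lambda>q. L (f q))) p" "vanish k (d2 (\<lambda>q. L (f q))) p"
    by (rule vanish_transfer[OF v(1)] vanish_transfer[OF v(2)], erule e)+
  then show ?case using Suc.prems by (simp add: linear_0[OF bounded_linear.linear[OF L]])
qed simp

text \<open>The order \<open>k\<close> is separated from the sum \<open>i + j\<close> so that the induction on \<open>k\<close> can differentiate
  either factor and lower its order by one, even if that order is already zero.\<close>

lemma vanish_scaleR:
  fixes f :: "base \<Rightarrow> real" and g :: "base \<Rightarrow> 'b::real_normed_vector"
  shows "smooth_on U f \<Longrightarrow> smooth_on U g \<Longrightarrow> vanish i f p \<Longrightarrow> vanish j g p \<Longrightarrow> k \<le> i + j \<Longrightarrow>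
    vanish k (\<lambda>q. f q *\<^sub>R g q) p"
proof (induction k arbitrary: i j f g)
  case (Suc k)
  note sm = smooth_on_d1[OF U] smooth_on_d2[OF U]
  have pre: "vanish (i - 1) (d1 f) p" "vanish (i - 1) (d2 f) p" "vanish (j - 1) (d1 g) p" "vanish (j - 1) (d2 g) p"
    using Suc.prems by (cases i; cases j; simp)+
  have le: "k \<le> i - 1 + j" "k \<le> i + (j - 1)" using Suc.prems by auto
  have v1: "vanish k (\<lambda>q. f q *\<^sub>R d1 g q + d1 f q *\<^sub>R g q) p"
    by (intro vanish_add smooth_on_scaleR[OF U] sm Suc.prems(1,2) Suc.IH[OF _ _ _ _ le(1)] Suc.IH[OF _ _ _ _ le(2)] pre Suc.prems(3,4))
  have v2: "vanish k (\<lambda>q. f q *\<^sub>R d2 g q + d2 f q *\<^sub>R g q) p"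
    by (intro vanish_add smooth_on_scaleR[OF U] sm Suc.prems(1,2) Suc.IH[OF _ _ _ _ le(1)] Suc.IH[OF _ _ _ _ le(2)] pre Suc.prems(3,4))
  have e: "d1 (\<lambda>q. f q *\<^sub>R g q) q = f q *\<^sub>R d1 g q + d1 f q *\<^sub>R g q"
    "d2 (\<lambda>q. f q *\<^sub>R g q) q = f q *\<^sub>R d2 g q + d2 f q *\<^sub>R g q" if "q \<in> U" for q
    unfolding d1_eq d2_eq
    by (rule pd_scaleR; rule smooth_on_differentiable[OF _ that], rule Suc.prems)+
  have "vanish k (d1 (\<lambda>q. f q *\<^sub>R g q)) p" "vanish k (d2 (\<lambda>q. f q *\<^sub>R g q)) p"
    by (rule vanish_transfer[OF v1] vanish_transfer[OF v2], erule e)+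
  moreover have "f p *\<^sub>R g p = 0" using Suc.prems by (cases i; cases j) auto
  ultimately show ?case by simp
qed simp

lemma vanish_diff:
  assumes "smooth_on U f" "smooth_on U g" "vanish k f p" "vanish k g p"
  shows "vanish k (\<lambda>q. f q - g q) p"
  using vanish_add[OF assms(1) smooth_on_minus[OF U assms(2)] assms(3)
      vanish_bounded_linear[OF bounded_linear_minus[OF bounded_linear_ident] assms(2,4)]] by simp

lemma dd_diff:
  assumes "smooth_on U f" "smooth_on U g" "q \<in> U"
  shows "dd m n (\<lambda>q. f q - g q) q = dd m n f q - dd m n g q"
  using dd_add_scaleR[OF U assms(3,1,2), of m n 1 "-1"] by simp

lemma jet_eq_iff_vanish:
  fixes f g :: "base \<Rightarrow> 'b::euclidean_space"
  assumes "smooth_on U f" "smooth_on U g"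
  shows "jet k f p = jet k g p \<longleftrightarrow> vanish (Suc k) (\<lambda>q. f q - g q) p"
  unfolding vanish_dd[OF smooth_on_diff[OF U assms]] jet_eq_jet_of jet_of_eq_iff dd_diff[OF assms p]
  by (auto simp: less_Suc_eq_le)

lemma lie_bracket_eq:
  assumes "smooth_on U X" "smooth_on U Y" "q \<in> U"
  shows "lie_bracket X Y q = fst (X q) *\<^sub>R d1 Y q + snd (X q) *\<^sub>R d2 Y q
    - (fst (Y q) *\<^sub>R d1 X q + snd (Y q) *\<^sub>R d2 X q)"
  using pd_base[OF smooth_on_differentiable[OF assms(1,3)], of "Y q"]
    pd_base[OF smooth_on_differentiable[OF assms(2,3)], of "X q"]
  by (simp add: lie_bracket_def pd_def)

lemma smooth_on_lie_bracket:
  assumes "smooth_on U X" "smooth_on U Y"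
  shows "smooth_on U (lie_bracket X Y)"
proof -
  have "smooth_on U (\<lambda>q. fst (X q) *\<^sub>R d1 Y q + snd (X q) *\<^sub>R d2 Y q
    - (fst (Y q) *\<^sub>R d1 X q + snd (Y q) *\<^sub>R d2 X q))"
    by (intro smooth_intros U assms)
  then show ?thesis using smooth_on_cong[OF U lie_bracket_eq[OF assms]] by simp
qed

text \<open>The difference of the brackets is a sum of products of a field or its derivative with a difference
  of the fields or its derivative; one order is lost by differentiating.\<close>

lemma vanish_lie_bracket:
  assumes "smooth_on U X" "smooth_on U X'" "smooth_on U Y" "smooth_on U Y'"
    and "vanish (Suc (Suc k)) (\<lambda>q. X q - X' q) p" "vanish (Suc (Suc k)) (\<lambda>q. Y q - Y' q) p"
  shows "vanish (Suc k) (\<lambda>q. lie_bracket X Y q - lie_bracket X' Y' q) p"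
proof -
  note sm = smooth_intros U assms(1-4)
  have A: "vanish (Suc k) (\<lambda>q. (fst (X q - X' q) *\<^sub>R d1 Y q + snd (X q - X' q) *\<^sub>R d2 Y q) +
     (fst (X' q) *\<^sub>R d1 (\<lambda>q. Y q - Y' q) q + snd (X' q) *\<^sub>R d2 (\<lambda>q. Y q - Y' q) q)) p"
    if s: "smooth_on U X" "smooth_on U X'" "smooth_on U Y" "smooth_on U Y'"
      "vanish (Suc (Suc k)) (\<lambda>q. X q - X' q) p" "vanish (Suc (Suc k)) (\<lambda>q. Y q - Y' q) p" for X X' Y Y' :: "base \<Rightarrow> base"
  proof -
    note sm = smooth_intros U s(1-4)
    have v1: "vanish (Suc k) (\<lambda>q. fst (X q - X' q)) p" "vanish (Suc k) (\<lambda>q. snd (X q - X' q)) p"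
      by (rule vanish_bounded_linear[OF bounded_linear_fst] vanish_bounded_linear[OF bounded_linear_snd],
          intro sm, rule vanish_mono[OF s(5)], simp)+
    have v2: "vanish (Suc k) (d1 (\<lambda>q. Y q - Y' q)) p" "vanish (Suc k) (d2 (\<lambda>q. Y q - Y' q)) p"
      using s(6) unfolding vanish.simps(2)[of "Suc k"] by blast+
    have le: "Suc k \<le> Suc k + 0" "Suc k \<le> 0 + Suc k" by simp_all
    show ?thesis
      by (intro vanish_add vanish_scaleR[OF _ _ v1(1) _ le(1)] vanish_scaleR[OF _ _ v1(2) _ le(1)]
          vanish_scaleR[OF _ _ _ v2(1) le(2)] vanish_scaleR[OF _ _ _ v2(2) le(2)] sm) simp_all
  qed
  have v: "vanish (Suc k) (\<lambda>q. ((fst (X q - X' q) *\<^sub>R d1 Y q + snd (X q - X' q) *\<^sub>R d2 Y q) +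
     (fst (X' q) *\<^sub>R d1 (\<lambda>q. Y q - Y' q) q + snd (X' q) *\<^sub>R d2 (\<lambda>q. Y q - Y' q) q)) -
     ((fst (Y q - Y' q) *\<^sub>R d1 X q + snd (Y q - Y' q) *\<^sub>R d2 X q) +
     (fst (Y' q) *\<^sub>R d1 (\<lambda>q. X q - X' q) q + snd (Y' q) *\<^sub>R d2 (\<lambda>q. X q - X' q) q))) p"
    by (rule vanish_diff[OF _ _ A[OF assms] A[OF assms(3,4,1,2,6,5)]]) (intro sm)+
  have "lie_bracket X Y q - lie_bracket X' Y' q = ((fst (X q - X' q) *\<^sub>R d1 Y q + snd (X q - X' q) *\<^sub>R d2 Y q) +
     (fst (X' q) *\<^sub>R d1 (\<lambda>q. Y q - Y' q) q + snd (X' q) *\<^sub>R d2 (\<lambda>q. Y q - Y' q) q)) -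
     ((fst (Y q - Y' q) *\<^sub>R d1 X q + snd (Y q - Y' q) *\<^sub>R d2 X q) +
     (fst (Y' q) *\<^sub>R d1 (\<lambda>q. X q - X' q) q + snd (Y' q) *\<^sub>R d2 (\<lambda>q. X q - X' q) q))" if q: "q \<in> U" for q
  proof -
    note d = smooth_on_differentiable[OF _ q]
    have e: "d1 (\<lambda>q. X q - X' q) q = d1 X q - d1 X' q" "d2 (\<lambda>q. X q - X' q) q = d2 X q - d2 X' q"
      "d1 (\<lambda>q. Y q - Y' q) q = d1 Y q - d1 Y' q" "d2 (\<lambda>q. Y q - Y' q) q = d2 Y q - d2 Y' q"
      unfolding d1_eq d2_eq by (intro pd_diff d assms)+
    show ?thesis unfolding e lie_bracket_eq[OF assms(1,3) q] lie_bracket_eq[OF assms(2,4) q]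
      by (simp add: algebra_simps)
  qed
  then show ?thesis by (rule vanish_transfer[OF v])
qed

end

text \<open>The induced bracket does not depend on the choice of the representing fields.\<close>

lemma jet_bracket_eq:
  assumes "open U" "p \<in> U" "smooth_on U X" "smooth_on U Y"
  shows "jet_bracket (Suc k) p (jet (Suc k) X p) (jet (Suc k) Y p) = jet k (lie_bracket X Y) p"
  unfolding jet_bracket_def
proof (rule the_equality)
  show "\<exists>Xa Ya D. open D \<and> p \<in> D \<and> smooth_on D Xa \<and> smooth_on D Ya \<and>
       jet (Suc k) Xa p = jet (Suc k) X p \<and> jet (Suc k) Ya p = jet (Suc k) Y p \<and>
       jet k (lie_bracket X Y) p = jet (Suc k - 1) (lie_bracket Xa Ya) p"
    using assms by auto
next
  fix \<gamma>
  assume "\<exists>Xa Ya D. open D \<and> p \<in> D \<and> smooth_on D Xa \<and> smooth_on D Ya \<and>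
       jet (Suc k) Xa p = jet (Suc k) X p \<and> jet (Suc k) Ya p = jet (Suc k) Y p \<and>
       \<gamma> = jet (Suc k - 1) (lie_bracket Xa Ya) p"
  then obtain X' Y' D where D: "open D" "p \<in> D" "smooth_on D X'" "smooth_on D Y'"
    "jet (Suc k) X' p = jet (Suc k) X p" "jet (Suc k) Y' p = jet (Suc k) Y p"
    "\<gamma> = jet k (lie_bracket X' Y') p" by auto
  define V where "V = D \<inter> U"
  have V: "open V" "p \<in> V" using D assms by (auto simp: V_def)
  have sm: "smooth_on V X" "smooth_on V Y" "smooth_on V X'" "smooth_on V Y'"
    using D assms by (auto intro: smooth_on_subset simp: V_def)
  have "vanish (Suc k) (\<lambda>q. lie_bracket X' Y' q - lie_bracket X Y q) p"
    using D(5,6) by (intro vanish_lie_bracket[OF V] sm)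
      (simp_all add: jet_eq_iff_vanish[OF V sm(3,1)] jet_eq_iff_vanish[OF V sm(4,2)])
  then show "\<gamma> = jet k (lie_bracket X Y) p"
    unfolding D(7) using jet_eq_iff_vanish[OF V smooth_on_lie_bracket[OF V sm(3,4)] smooth_on_lie_bracket[OF V sm(1,2)]]
    by simp
qed


section \<open>Vector fields with a prescribed jet and a flow\<close>

text \<open>A monomial centred at \<open>a\<close> with divided powers: a partial derivative just lowers an exponent, without
  a numerical factor.\<close>

definition dmon :: "base \<Rightarrow> nat \<Rightarrow> nat \<Rightarrow> base \<Rightarrow> real" where
  "dmon a m n q = (fst q - fst a) ^ m / fact m * ((snd q - snd a) ^ n / fact n)"

lemma smooth_on_dmon: "smooth_on UNIV (dmon a m n)"
  unfolding dmon_def[abs_def] divide_inverse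
  by (intro smooth_intros open_UNIV)

lemma pd_dmon:
  "pd b (dmon a m n) q = fst b * (if m = 0 then 0 else dmon a (m - 1) n q)
     + snd b * (if n = 0 then 0 else dmon a m (n - 1) q)"
proof -
  have P: "((\<lambda>q. (g q - z) ^ k / fact k) has_derivative
      (\<lambda>b. g b * (if k = 0 then 0 else (g q - z) ^ (k - 1) / fact (k - 1)))) (at q)"
    if g: "bounded_linear g" for g :: "base \<Rightarrow> real" and z k
  proof (cases k)
    case 0
    then show ?thesis by simp
  next
    case (Suc j)
    have "fact (Suc j) = of_nat (Suc j) * (fact j :: real)" by simp
    then have e: "of_nat (Suc j) * x * y / fact (Suc j) = x * (y / fact j)" for x y :: real
      by (simp only: mult.assoc mult_divide_mult_cancel_left_if) (simp del: of_nat_Suc)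
    have "((\<lambda>q. (g q - z)) has_derivative g) (at q)"
      using has_derivative_diff[OF bounded_linear_imp_has_derivative[OF g] has_derivative_const] by simp
    from has_derivative_power[OF this, of "Suc j"]
    have "((\<lambda>q. (g q - z) ^ Suc j) has_derivative (\<lambda>b. of_nat (Suc j) * g b * (g q - z) ^ j)) (at q)" by simp
    from bounded_linear.has_derivative[OF bounded_linear_divide[of "fact (Suc j)"] this]
    show ?thesis unfolding Suc e by simp
  qed
  show ?thesis unfolding dmon_def[abs_def]
    by (rule pd_unique[OF has_derivative_mult[OF P[OF bounded_linear_fst] P[OF bounded_linear_snd]], THEN trans])
       (auto simp: dmon_def mult_ac)
qed

lemma d1_dmon: "d1 (dmon a m n) = (if m = 0 then (\<lambda>_. 0) else dmon a (m - 1) n)"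
  by (rule ext) (simp add: d1_eq pd_dmon)
lemma d2_dmon: "d2 (dmon a m n) = (if n = 0 then (\<lambda>_. 0) else dmon a m (n - 1))"
  by (rule ext) (simp add: d2_eq pd_dmon)

lemma dmon_at: "dmon a m n a = (if m = 0 \<and> n = 0 then 1 else 0)"
  by (auto simp: dmon_def)

lemma d1_zero: "d1 (\<lambda>_. 0) = (\<lambda>_. 0)" and d2_zero: "d2 (\<lambda>_. 0) = (\<lambda>_. 0)"
  by (auto simp: d1_eq d2_eq)

lemma dd_dmon_at: "dd i j (dmon a m n) a = (if i = m \<and> j = n then 1 else 0)"
proof -
  have z: "(d1 ^^ i) (\<lambda>_. 0) = (\<lambda>_. 0::real)" for i by (induction i) (auto simp: d1_zero)
  have 2: "(d2 ^^ j) (dmon a m n) = (if j \<le> n then dmon a m (n - j) else (\<lambda>_. 0))"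
  proof (induction j)
    case (Suc j) then show ?case by (auto simp: d2_dmon d2_zero)
  qed simp
  have 1: "(d1 ^^ i) (dmon a m n) = (if i \<le> m then dmon a (m - i) n else (\<lambda>_. 0))" for n
  proof (induction i)
    case (Suc i) then show ?case by (auto simp: d1_dmon d1_zero)
  qed simp
  show ?thesis unfolding dd_def 2 by (cases "j \<le> n") (simp_all add: 1 z dmon_at)
qed

lemma vanish_dmon_poly: "k \<le> m + n \<Longrightarrow> vanish k (dmon a m n) a"
proof -
  assume "k \<le> m + n"
  then show ?thesis
    by (subst vanish_dd[OF open_UNIV UNIV_I smooth_on_dmon]) (auto simp: dd_dmon_at)
qed

lemma pd_scale: "f differentiable (at x) \<Longrightarrow> pd b (\<lambda>q. r * f q) x = r * pd b f x" for r :: real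
  by (rule pd_bounded_linear[OF bounded_linear_mult_right])

text \<open>If the first component of \<open>v\<close> is nonzero, then raising the first exponent gives a primitive up to a
  multiple of a monomial whose second exponent is smaller; this is an induction on that exponent.\<close>

lemma dmon_primitive:
  assumes "v \<noteq> 0"
  shows "\<exists>F. smooth_on UNIV F \<and> (\<forall>q. pd v F q = dmon a m n q) \<and> vanish (m + n + 1) F a"
proof (cases "fst v = 0")
  case True
  then have v2: "snd v \<noteq> 0" using assms by (auto simp: prod_eq_iff)
  let ?F = "\<lambda>q. inverse (snd v) * dmon a m (Suc n) q"
  have "pd v ?F q = dmon a m n q" for q
    using v2 True smooth_on_differentiable[OF smooth_on_dmon, of q a m "Suc n"]
    by (simp add: pd_scale pd_dmon)
  moreover have "smooth_on UNIV ?F" by (intro smooth_intros open_UNIV smooth_on_dmon)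
  moreover have "vanish (m + n + 1) ?F a"
    by (rule vanish_bounded_linear[OF open_UNIV UNIV_I bounded_linear_mult_right smooth_on_dmon])
       (rule vanish_dmon_poly, simp)
  ultimately show ?thesis by blast
next
  case v1: False
  show ?thesis
  proof (induction n arbitrary: m)
    case 0
    let ?F = "\<lambda>q. inverse (fst v) * dmon a (Suc m) 0 q"
    have "pd v ?F q = dmon a m 0 q" for q
      using v1 smooth_on_differentiable[OF smooth_on_dmon, of q a "Suc m" 0]
      by (simp add: pd_scale pd_dmon)
    moreover have "smooth_on UNIV ?F" by (intro smooth_intros open_UNIV smooth_on_dmon)
    moreover have "vanish (m + 0 + 1) ?F a"
      by (rule vanish_bounded_linear[OF open_UNIV UNIV_I bounded_linear_mult_right smooth_on_dmon])
         (rule vanish_dmon_poly, simp)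
    ultimately show ?case by blast
  next
    case (Suc n)
    obtain F where F: "smooth_on UNIV F" "\<And>q. pd v F q = dmon a (Suc m) n q" "vanish (Suc m + n + 1) F a"
      using Suc.IH[of "Suc m"] by blast
    let ?F = "\<lambda>q. inverse (fst v) * (dmon a (Suc m) (Suc n) q - snd v * F q)"
    have dF: "F differentiable (at q)" and dm: "dmon a (Suc m) (Suc n) differentiable (at q)" for q
      using smooth_on_differentiable F(1) smooth_on_dmon by blast+
    have ds: "(\<lambda>q. snd v * F q) differentiable (at q)" for q by (intro dfs dF)
    have "pd v ?F q = dmon a m (Suc n) q" for q
    proof -
      have "pd v (\<lambda>q. dmon a (Suc m) (Suc n) q - snd v * F q) q = fst v * dmon a m (Suc n) q"
        using pd_diff_real[OF dm ds, of v q] by (simp add: pd_scale dF F(2) pd_dmon)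
      moreover have "(\<lambda>q. dmon a (Suc m) (Suc n) q - snd v * F q) differentiable (at q)"
        by (intro dfs dm ds)
      ultimately show ?thesis using v1 by (simp add: pd_scale)
    qed
    moreover have "smooth_on UNIV ?F" by (intro smooth_intros open_UNIV smooth_on_dmon F)
    moreover have "vanish (m + Suc n + 1) ?F a"
      by (intro vanish_bounded_linear[OF open_UNIV UNIV_I bounded_linear_mult_right]
          vanish_diff[OF open_UNIV UNIV_I] smooth_intros open_UNIV smooth_on_dmon F vanish_dmon_poly)
         (use F(3) in simp_all)
    ultimately show ?case by blast
  qed
qed

lemma point_transformationI:
  assumes "open U" "open V" "smooth_on U f" "smooth_on V g" "f ` U = V" "\<And>x. x \<in> U \<Longrightarrow> g (f x) = x"
  shows "point_transformation U f"
proof -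
  have inj: "inj_on f U" using assms(6) by (metis inj_onI)
  have "the_inv_into U f y = g y" if "y \<in> V" for y
    using that assms(5,6) inj by (metis imageE the_inv_into_f_f)
  then have "smooth_on V (the_inv_into U f)"
    using smooth_on_cong[OF assms(2), of "the_inv_into U f" g] assms(4) by blast
  then show ?thesis using assms inj by (simp add: point_transformation_def)
qed

lemma pd_the_inv_into:
  assumes "point_transformation N f" "z \<in> f ` N"
  shows "pd b (the_inv_into N f) z = dinv f b (the_inv_into N f z)"
proof -
  let ?g = "the_inv_into N f"
  have N: "open (f ` N)" "smooth_on (f ` N) ?g" "smooth_on N f" "inj_on f N"
    using assms(1) by (auto simp: point_transformation_def)
  have gz: "?g z \<in> N" using the_inv_intoE[OF N(4) assms(2)] by simp
  have df: "f differentiable (at (?g z))" by (rule smooth_on_differentiable[OF N(3) gz])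
  have "pd (pd b ?g z) f (?g z) = b"
    by (rule pd_inverse_map[OF N(1) assms(2) _ smooth_on_differentiable[OF N(2) assms(2)] df])
       (rule the_inv_intoE[OF N(4)])
  then show ?thesis
    by (intro dinv_solve[OF point_transformation_jac[OF assms(1) gz]]) (simp add: pd_base[OF df])
qed

text \<open>The vector field is the constant field \<open>v\<close> in the chart \<open>\<phi>\<close>. Its flow is the translation by
  \<open>t v\<close> in this chart, which stays in the chart for small times.\<close>

lemma translation_flow:
  assumes pt: "point_transformation N \<phi>" and a: "a \<in> N"
  obtains U e \<Phi> where "local_flow (dinv \<phi> v) N U e \<Phi>" "a \<in> U"
proof -
  define \<psi> where "\<psi> = the_inv_into N \<phi>"
  have N: "open N" "open (\<phi> ` N)" "smooth_on (\<phi> ` N) \<psi>" "smooth_on N \<phi>" "inj_on \<phi> N"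
    using pt by (auto simp: point_transformation_def \<psi>_def)
  have \<phi>\<psi>: "\<phi> (\<psi> z) = z" "\<psi> z \<in> N" if "z \<in> \<phi> ` N" for z
    using the_inv_intoE[OF N(5) that] by (auto simp: \<psi>_def)
  have \<psi>\<phi>: "\<psi> (\<phi> q) = q" if "q \<in> N" for q
    using the_inv_into_f_f[OF N(5) that] by (simp add: \<psi>_def)
  obtain r0 where r0: "r0 > 0" "ball (\<phi> a) r0 \<subseteq> \<phi> ` N"
    using N(2) a openE by blast
  define r where "r = r0 / 2"
  have r: "r > 0" and sub: "ball (\<phi> a) (2 * r) \<subseteq> \<phi> ` N" using r0 by (auto simp: r_def)
  define V where "V t = {q \<in> N. \<phi> q - t *\<^sub>R v \<in> ball (\<phi> a) r}" for t
  define U where "U = V 0"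
  have cont: "continuous_on N \<phi>" by (rule smooth_on_continuous[OF N(4)])
  have oV: "open (V t)" for t
  proof -
    have "open (N \<inter> (\<lambda>q. \<phi> q - t *\<^sub>R v) -` ball (\<phi> a) r)"
      by (rule continuous_open_preimage[OF _ N(1) open_ball]) (intro continuous_intros cont)
    then show ?thesis by (simp add: V_def vimage_def Int_def)
  qed
  define e where "e = r / (norm v + 1)"
  have e: "e > 0" using r by (simp add: e_def add_nonneg_pos)
  have tv: "norm (t *\<^sub>R v) < r" if "t \<in> {-e<..<e}" for t
  proof -
    have "norm (t *\<^sub>R v) \<le> e * norm v" using that by (auto intro!: mult_right_mono)
    also have "\<dots> < e * (norm v + 1)" using e by simp
    also have "\<dots> = r" by (simp add: e_def add_nonneg_eq_0_iff)
    finally show ?thesis .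
  qed
  have inN: "\<phi> q + t *\<^sub>R v \<in> \<phi> ` N" if "q \<in> U" "t \<in> {-e<..<e}" for q t
  proof -
    have "norm (\<phi> q - \<phi> a) < r" using that by (simp add: U_def V_def dist_norm norm_minus_commute)
    then have "norm ((\<phi> q - \<phi> a) + t *\<^sub>R v) < 2 * r"
      using norm_triangle_ineq[of "\<phi> q - \<phi> a" "t *\<^sub>R v"] tv[OF that(2)] by linarith
    then have "\<phi> q + t *\<^sub>R v \<in> ball (\<phi> a) (2 * r)"
      by (simp add: dist_norm norm_minus_commute algebra_simps)
    then show ?thesis using sub by blast
  qed
  have UN: "U \<subseteq> N" by (auto simp: U_def V_def)
  define \<Phi> where "\<Phi> t q = \<psi> (\<phi> q + t *\<^sub>R v)" for t q
  have oU: "open U" by (simp add: U_def oV)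
  have smU: "smooth_on U (\<lambda>q. \<psi> (\<phi> q + t *\<^sub>R v))" if "t \<in> {-e<..<e}" for t
    by (rule smooth_on_compose[OF oU N(2) _ N(3)])
       (use inN that in \<open>auto intro!: smooth_intros oU smooth_on_subset[OF N(4) UN]\<close>)
  have "local_flow (dinv \<phi> v) N U e \<Phi>"
    unfolding local_flow_def
  proof (intro conjI ballI)
    show "smooth_on N (dinv \<phi> v)"
      by (rule smooth_on_dinv[OF N(1,4) point_transformation_jac[OF pt]])
    have o: "open ({-e<..<e} \<times> U)" by (intro open_Times oU) simp
    have "smooth_on ({-e<..<e} \<times> U) (\<lambda>x. \<phi> (snd x))"
      by (rule smooth_on_compose[OF o N(1) _ N(4)]) (use UN in \<open>auto intro!: smooth_on_snd o smooth_on_id\<close>)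
    then have "smooth_on ({-e<..<e} \<times> U) (\<lambda>x. \<phi> (snd x) + fst x *\<^sub>R v)"
      by (intro smooth_intros o)
    then have "smooth_on ({-e<..<e} \<times> U) (\<lambda>x. \<psi> (\<phi> (snd x) + fst x *\<^sub>R v))"
      by (rule smooth_on_compose[OF o N(2) _ N(3)]) (use inN in auto)
    then show "smooth_on ({-e<..<e} \<times> U) (\<lambda>(t, q). \<Phi> t q)"
      by (simp add: \<Phi>_def case_prod_beta')
    show "\<Phi> 0 q = q" if "q \<in> U" for q using \<psi>\<phi>[OF subsetD[OF UN that]] by (simp add: \<Phi>_def)
    show "point_transformation U (\<Phi> t)" if t: "t \<in> {-e<..<e}" for t
    proof (rule point_transformationI[OF oU oV])
      show "smooth_on U (\<Phi> t)" using smU[OF t] by (simp add: \<Phi>_def[abs_def])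
      have inN': "\<phi> q + (- t) *\<^sub>R v \<in> \<phi> ` N" if "q \<in> V t" for q
      proof -
        have "\<phi> q - t *\<^sub>R v \<in> ball (\<phi> a) (2 * r)" using that r by (auto simp: V_def)
        then show ?thesis using sub by auto
      qed
      show "smooth_on (V t) (\<lambda>q. \<psi> (\<phi> q + (- t) *\<^sub>R v))"
      proof (rule smooth_on_compose[OF oV N(2) _ N(3)])
        have "V t \<subseteq> N" by (auto simp: V_def)
        then show "smooth_on (V t) (\<lambda>q. \<phi> q + (- t) *\<^sub>R v)"
          by (intro smooth_intros oV smooth_on_subset[OF N(4)])
      qed (use inN' in auto)
      show "\<psi> (\<phi> (\<Phi> t q) + (- t) *\<^sub>R v) = q" if "q \<in> U" for q
        using \<phi>\<psi>(1)[OF inN[OF that t]] \<psi>\<phi>[OF subsetD[OF UN that]] by (simp add: \<Phi>_def)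
      show "\<Phi> t ` U = V t"
      proof (intro equalityI subsetI)
        fix z assume "z \<in> \<Phi> t ` U"
        then obtain q where q: "q \<in> U" "z = \<Phi> t q" by auto
        then show "z \<in> V t" using \<phi>\<psi>[OF inN[OF q(1) t]] by (auto simp: V_def \<Phi>_def U_def)
      next
        fix z assume z: "z \<in> V t"
        let ?q = "\<psi> (\<phi> z + (- t) *\<^sub>R v)"
        have "?q \<in> U" using \<phi>\<psi>[OF inN'[OF z]] z by (simp add: U_def V_def)
        moreover have "\<Phi> t ?q = z" using \<phi>\<psi>[OF inN'[OF z]] z \<psi>\<phi> by (simp add: \<Phi>_def V_def)
        ultimately show "z \<in> \<Phi> t ` U" by (metis image_eqI)
      qed
    qed
    fix t q assume t: "t \<in> {-e<..<e}" and q: "q \<in> U"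
    show "\<Phi> t q \<in> N" using \<phi>\<psi>(2)[OF inN[OF q t]] by (simp add: \<Phi>_def)
    let ?z = "\<phi> q + t *\<^sub>R v"
    have d\<psi>: "\<psi> differentiable (at ?z)" by (rule smooth_on_differentiable[OF N(3) inN[OF q t]])
    have "((\<lambda>s. \<phi> q + s *\<^sub>R v) has_derivative (\<lambda>s. s *\<^sub>R v)) (at t)"
      by (auto intro!: derivative_eq_intros)
    from has_derivative_compose[OF this has_pd[OF d\<psi>]]
    have "((\<lambda>s. \<psi> (\<phi> q + s *\<^sub>R v)) has_derivative (\<lambda>s. s *\<^sub>R pd v \<psi> ?z)) (at t)"
      using linear_scale[OF linear_pd[OF d\<psi>]] by simp
    moreover have "pd v \<psi> ?z = dinv \<phi> v (\<psi> ?z)"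
      unfolding \<psi>_def by (rule pd_the_inv_into[OF pt inN[OF q t]])
    ultimately show "((\<lambda>s. \<Phi> s q) has_vector_derivative dinv \<phi> v (\<Phi> t q)) (at t)"
      by (simp add: \<Phi>_def has_vector_derivative_def)
  qed (use N oU UN e in auto)
  moreover have "a \<in> U" using a r by (simp add: U_def V_def)
  ultimately show ?thesis using that by blast
qed

lemma vanish_sum:
  assumes "finite I" "\<And>i. i \<in> I \<Longrightarrow> smooth_on UNIV (f i) \<and> vanish k (f i) a"
  shows "vanish k (\<lambda>q. \<Sum>i\<in>I. f i q) a"
  using assms
proof (induction I rule: finite_induct)
  case empty
  have "vanish k (\<lambda>q. 0 :: 'b) a" by (induction k) (auto simp: d1_zero d2_zero d1_eq d2_eq)
  then show ?case by simp
next
  case (insert i I)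
  then show ?case
    by (auto intro!: vanish_add[OF open_UNIV UNIV_I] smooth_on_sum)
qed

lemma d_sum_scale:
  assumes "\<And>i. i \<in> I \<Longrightarrow> smooth_on UNIV (f i)"
  shows "pd b (\<lambda>q. \<Sum>i\<in>I. (f i q :: real) *\<^sub>R w i) = (\<lambda>q. \<Sum>i\<in>I. pd b (f i) q *\<^sub>R w i)"
proof
  fix q
  have "f i differentiable (at q)" if "i \<in> I" for i
    using smooth_on_differentiable[OF assms[OF that]] by simp
  then show "pd b (\<lambda>q. \<Sum>i\<in>I. (f i q :: real) *\<^sub>R w i) q = (\<Sum>i\<in>I. pd b (f i) q *\<^sub>R w i)"
    by (intro pd_unique[where h' = "\<lambda>b. \<Sum>i\<in>I. pd b (f i) q *\<^sub>R w i"] has_derivative_sum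
        bounded_linear.has_derivative[OF bounded_linear_scaleR_left] has_pd)
qed

lemma dd_sum_scale:
  assumes "\<And>i. i \<in> I \<Longrightarrow> smooth_on UNIV (f i)"
  shows "dd m n (\<lambda>q. \<Sum>i\<in>I. (f i q :: real) *\<^sub>R w i) = (\<lambda>q. \<Sum>i\<in>I. dd m n (f i) q *\<^sub>R w i)"
proof -
  have 2: "(d2 ^^ n) (\<lambda>q. \<Sum>i\<in>I. (f i q :: real) *\<^sub>R w i) = (\<lambda>q. \<Sum>i\<in>I. (d2 ^^ n) (f i) q *\<^sub>R w i)" for n
    using assms
    by (induction n) (simp_all add: d2_eq d_sum_scale smooth_on_d2_funpow[OF open_UNIV])
  have 1: "(d1 ^^ m) (\<lambda>q. \<Sum>i\<in>I. (g i q :: real) *\<^sub>R w i) = (\<lambda>q. \<Sum>i\<in>I. (d1 ^^ m) (g i) q *\<^sub>R w i)"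
    if "\<And>i. i \<in> I \<Longrightarrow> smooth_on UNIV (g i)" for g
    using that
    by (induction m) (simp_all add: d1_eq d_sum_scale smooth_on_d1_funpow[OF open_UNIV])
  show ?thesis unfolding dd_def 2 by (rule 1) (rule smooth_on_d2_funpow[OF open_UNIV assms])
qed

text \<open>Let \<open>X\<^sub>0 = v + G\<close> be the Taylor polynomial that is asked for, with \<open>G\<close> of order two, and choose \<open>F\<close>
  of order three with \<open>D\<^sub>v F = G\<close>. In the chart \<open>q - F q\<close> the field \<open>X\<^sub>0\<close> is \<open>v - D\<^sub>G F\<close>, and the error
  is of order four because \<open>G\<close> and the differential of \<open>F\<close> both have order two. So the field that is
  exactly \<open>v\<close> in this chart has the same third jet, and it has a flow.\<close>

lemma flow_box_jet:
  fixes v a :: base and c :: "nat \<Rightarrow> nat \<Rightarrow> base"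
  assumes v: "v \<noteq> 0" and c: "c 0 0 = v" "c 1 0 = 0" "c 0 1 = 0"
  obtains X D U e \<Phi> where "local_flow X D U e \<Phi>" "a \<in> U" "jet 3 X a = jet_of 3 c"
proof -
  define I where "I = {(m, n). 2 \<le> m + n \<and> m + n \<le> (3::nat)}"
  define J where "J = {(m, n). m + n \<le> (3::nat)}"
  have fJ: "finite J" unfolding J_def by (rule finite_multiindices)
  have fI: "finite I" by (rule finite_subset[OF _ fJ]) (auto simp: I_def J_def)
  have "\<forall>i. \<exists>F. smooth_on UNIV F \<and> (\<forall>q. pd v F q = dmon a (fst i) (snd i) q)
      \<and> vanish (fst i + snd i + 1) F a"
    by (intro allI dmon_primitive[OF v])
  from choice[OF this] obtain Fc where Fc: "\<And>i. smooth_on UNIV (Fc i)"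
    "\<And>i q. pd v (Fc i) q = dmon a (fst i) (snd i) q" "\<And>i. vanish (fst i + snd i + 1) (Fc i) a"
    by blast
  define C where "C i = c (fst i) (snd i)" for i
  define G where "G q = (\<Sum>i\<in>I. dmon a (fst i) (snd i) q *\<^sub>R C i)" for q
  define F where "F q = (\<Sum>i\<in>I. Fc i q *\<^sub>R C i)" for q
  define X0 where "X0 q = v + G q" for q
  note sU = smooth_intros open_UNIV smooth_on_dmon
  have sG: "smooth_on UNIV G" unfolding G_def[abs_def] by (intro smooth_on_sum fI sU)
  have sF: "smooth_on UNIV F" unfolding F_def[abs_def] by (intro smooth_on_sum fI sU Fc)
  have sX0: "smooth_on UNIV X0" unfolding X0_def[abs_def] by (intro sU sG)
  \<comment> \<open>the terms of order one that are added here have the coefficient zero\<close>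
  have X0J: "X0 q = (\<Sum>i\<in>J. dmon a (fst i) (snd i) q *\<^sub>R C i)" for q
  proof -
    have J: "J = insert (0,0) (insert (1,0) (insert (0,1) I))"
      by (auto simp: I_def J_def)
    have ni: "(0,0) \<notin> insert (1,0) (insert (0,1) I)" "(1,0) \<notin> insert (0,1) I" "(0,1) \<notin> I"
      by (auto simp: I_def)
    show ?thesis unfolding J X0_def G_def using fI ni c
      by (simp add: C_def dmon_def)
  qed
  have jX0: "dd m n X0 a = c m n" if "m + n \<le> 3" for m n
  proof -
    have "dd m n X0 a = (\<Sum>i\<in>J. dd m n (dmon a (fst i) (snd i)) a *\<^sub>R C i)"
      unfolding X0J[abs_def] by (subst dd_sum_scale) (auto intro: smooth_on_dmon)
    also have "\<dots> = (\<Sum>i\<in>J. if i = (m, n) then C i else 0)"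
      by (intro sum.cong) (auto simp: dd_dmon_at)
    also have "\<dots> = c m n" using that fJ by (simp add: J_def C_def)
    finally show ?thesis .
  qed
  have pdF: "pd v F q = G q" for q
    unfolding F_def[abs_def] G_def by (subst d_sum_scale) (auto simp: Fc)
  have bl: "bounded_linear (\<lambda>r. r *\<^sub>R C i)" for i by (rule bounded_linear_scaleR_left)
  have vG: "vanish 2 G a" unfolding G_def[abs_def]
    by (intro vanish_sum fI conjI vanish_bounded_linear[OF open_UNIV UNIV_I bl] vanish_dmon_poly sU)
       (auto simp: I_def)
  have vF: "vanish 3 F a" unfolding F_def[abs_def]
  proof (intro vanish_sum fI conjI vanish_bounded_linear[OF open_UNIV UNIV_I bl] sU Fc)
    fix i assume "i \<in> I"
    then show "vanish 3 (Fc i) a" by (intro vanish_mono[OF open_UNIV UNIV_I Fc(3)[of i]]) (auto simp: I_def)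
  qed
  have vF': "vanish 2 (d1 F) a" "vanish 2 (d2 F) a" and F0: "d1 F a = 0" "d2 F a = 0"
    using vF by (auto simp: eval_nat_numeral)
  \<comment> \<open>the chart in which the field is to be constant\<close>
  define \<phi> where "\<phi> q = q - F q" for q
  have s\<phi>: "smooth_on UNIV \<phi>" unfolding \<phi>_def[abs_def] by (intro sU sF)
  have dF: "F differentiable (at q)" for q using smooth_on_differentiable[OF sF] by blast
  have d\<phi>: "\<phi> differentiable (at q)" for q using smooth_on_differentiable[OF s\<phi>] by blast
  have pd\<phi>: "pd b \<phi> q = b - pd b F q" for b q
    unfolding \<phi>_def[abs_def] by (rule pd_unique[OF has_derivative_diff[OF has_derivative_ident has_pd[OF dF]]])
  have "d1 \<phi> a = (1, 0)" "d2 \<phi> a = (0, 1)" using F0 by (auto simp: d1_eq d2_eq pd\<phi>)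
  then have "jac \<phi> a \<noteq> 0" by (simp add: jac_def)
  then obtain N where N: "a \<in> N" and pt: "point_transformation N \<phi>"
    using local_diffeo[OF open_UNIV UNIV_I s\<phi>] by metis
  define X where "X = dinv \<phi> v"
  obtain U e \<Phi> where fl: "local_flow X N U e \<Phi>" "a \<in> U"
    using translation_flow[OF pt N] unfolding X_def by blast
  have oN: "open N" using pt by (simp add: point_transformation_def)
  have sN: "smooth_on UNIV f \<Longrightarrow> smooth_on N f" for f :: "base \<Rightarrow> 'z::real_normed_vector"
    by (rule smooth_on_subset) auto
  have jN: "jac \<phi> q \<noteq> 0" if "q \<in> N" for q by (rule point_transformation_jac[OF pt that])
  have sX: "smooth_on N X" unfolding X_def by (rule smooth_on_dinv[OF oN sN[OF s\<phi>] jN])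
  define E where "E q = fst (G q) *\<^sub>R d1 F q + snd (G q) *\<^sub>R d2 F q" for q
  have sE: "smooth_on N E" unfolding E_def[abs_def] by (intro smooth_intros oN sN sF sG)
  have le: "4 \<le> (2::nat) + 2" "4 \<le> 4 + (0::nat)" by simp_all
  have vE: "vanish 4 E a" unfolding E_def[abs_def]
    by (intro vanish_add[OF oN N] vanish_scaleR[OF oN N _ _ _ _ le(1)] smooth_intros oN sN sF sG vF'
        vanish_bounded_linear[OF oN N bounded_linear_fst] vanish_bounded_linear[OF oN N bounded_linear_snd] vG)
  define W where "W q = fst (E q) *\<^sub>R dinv \<phi> (1, 0) q + snd (E q) *\<^sub>R dinv \<phi> (0, 1) q" for q
  have "vanish 4 W a" unfolding W_def[abs_def]
    by (intro vanish_add[OF oN N] vanish_scaleR[OF oN N _ _ _ _ le(2)] smooth_intros oN sE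
        smooth_on_dinv sN s\<phi> jN
        vanish_bounded_linear[OF oN N bounded_linear_fst] vanish_bounded_linear[OF oN N bounded_linear_snd] vE) simp_all
  moreover have "X q - X0 q = W q" if q: "q \<in> N" for q
  proof -
    have "pd (X q) \<phi> q = v" unfolding X_def pd_base[OF d\<phi>] by (rule dinv_right[OF jN[OF q]])
    moreover have "pd (X0 q) \<phi> q = v - E q"
    proof -
      have "pd (X0 q) F q = pd v F q + pd (G q) F q"
        unfolding X0_def by (rule linear_add[OF linear_pd[OF dF]])
      then have "pd (X0 q) F q = G q + E q" by (simp add: pdF pd_base[OF dF, of "G q"] E_def)
      then show ?thesis by (simp add: pd\<phi> X0_def)
    qed
    ultimately have "pd (X q - X0 q) \<phi> q = E q"
      using linear_diff[OF linear_pd[OF d\<phi>], of "X q" "X0 q" q] by simp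
    then have "X q - X0 q = dinv \<phi> (E q) q"
      unfolding pd_base[OF d\<phi>] by (rule dinv_solve[OF jN[OF q]])
    also have "\<dots> = W q" by (simp add: W_def dinv_def prod_eq_iff diff_divide_distrib mult.commute)
    finally show ?thesis .
  qed
  ultimately have "vanish (Suc 3) (\<lambda>q. X q - X0 q) a"
    using vanish_transfer[OF oN N, of 4 W "\<lambda>q. X q - X0 q"] by simp
  then have "jet 3 X a = jet 3 X0 a"
    using jet_eq_iff_vanish[OF oN N sX sN[OF sX0]] by blast
  also have "\<dots> = jet_of 3 c" unfolding jet_eq_jet_of jet_of_eq_iff using jX0 by blast
  finally show ?thesis using that fl by blast
qed


section \<open>The lift in terms of the jets of the transformation\<close>

text \<open>The coefficients of the transformed equation at \<open>f p\<close>, expressed by the derivatives of \<open>f\<close> itself at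
  \<open>p\<close>; the arguments are the two first derivatives, the second derivatives and the old coefficients.
  In this form it can be differentiated along a flow, where the inverse maps have varying domains.\<close>

definition lift_fun :: "base \<times> base \<times> base \<times> base \<times> base \<times> fibre \<Rightarrow> fibre" where
  "lift_fun x = (let fx = fst (fst x); gx = snd (fst x); fy = fst (fst (snd x)); gy = snd (fst (snd x));
     A11 = fst (fst (snd (snd x))); B11 = snd (fst (snd (snd x)));
     A12 = fst (fst (snd (snd (snd x)))); B12 = snd (fst (snd (snd (snd x))));
     A22 = fst (fst (snd (snd (snd (snd x))))); B22 = snd (fst (snd (snd (snd (snd x)))));
     u = snd (snd (snd (snd (snd x))));
     u0 = fst u; u1 = fst (snd u); u2 = fst (snd (snd u)); u3 = snd (snd (snd u));
     J = fx * gy - fy * gx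
   in ((u0 * gy^3 - u1 * gx * gy^2 + u2 * gy * gx^2 - u3 * gx^3
          + (B11 * gy^2 - 2 * B12 * gx * gy + B22 * gx^2)) / J^2,
       (- 3 * u0 * gy^2 * fy + u1 * (fx * gy^2 + 2 * gx * gy * fy) - u2 * (2 * gx * fx * gy + fy * gx^2)
          + 3 * u3 * gx^2 * fx
          + (2 * B12 * (fx * gy + gx * fy) - 2 * B11 * gy * fy - 2 * B22 * gx * fx)
          - (A11 * gy^2 - 2 * A12 * gx * gy + A22 * gx^2)) / J^2,
       (3 * u0 * gy * fy^2 - u1 * (2 * fx * gy * fy + gx * fy^2) + u2 * (gy * fx^2 + 2 * fy * gx * fx)
          - 3 * u3 * gx * fx^2
          + (B11 * fy^2 - 2 * B12 * fx * fy + B22 * fx^2)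
          - (2 * A12 * (fx * gy + gx * fy) - 2 * A11 * gy * fy - 2 * A22 * gx * fx)) / J^2,
       (- u0 * fy^3 + u1 * fx * fy^2 - u2 * fy * fx^2 + u3 * fx^3
          - (A11 * fy^2 - 2 * A12 * fx * fy + A22 * fx^2)) / J^2))"

definition jet2 :: "(base \<Rightarrow> base) \<Rightarrow> base \<Rightarrow> fibre \<Rightarrow> base \<times> base \<times> base \<times> base \<times> base \<times> fibre" where
  "jet2 f p u = (d1 f p, d2 f p, d1 (d1 f) p, d1 (d2 f) p, d2 (d2 f) p, u)"

text \<open>The derivative of the identity \<open>Df(Dg b) = b\<close> in the direction \<open>c\<close>.\<close>

lemma inverse_second_derivative:
  fixes f :: "base \<Rightarrow> base" and b c :: base
  assumes pt: "point_transformation U f" and p: "p \<in> U"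
  defines "g \<equiv> the_inv_into U f"
  defines "H \<equiv> pd c (pd b g) (f p)"
  defines "B \<equiv> pd b g (f p)" and "C \<equiv> pd c g (f p)"
  shows "fst H *\<^sub>R d1 f p + snd H *\<^sub>R d2 f p = - (fst B *\<^sub>R (fst C *\<^sub>R d1 (d1 f) p + snd C *\<^sub>R d1 (d2 f) p)
    + snd B *\<^sub>R (fst C *\<^sub>R d1 (d2 f) p + snd C *\<^sub>R d2 (d2 f) p))"
proof -
  have N: "open U" "open (f ` U)" "smooth_on (f ` U) g" "smooth_on U f" "inj_on f U"
    using pt by (auto simp: point_transformation_def g_def)
  have fp: "f p \<in> f ` U" using p by simp
  have gfp: "g (f p) = p" using the_inv_into_f_f[OF N(5) p] by (simp add: g_def)
  have sg: "smooth_on (f ` U) (\<lambda>z. h (g z))" if "smooth_on U h" for h :: "base \<Rightarrow> base"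
    by (rule smooth_on_compose[OF N(2,1,3) that], rule image_subsetI)
      (unfold g_def, rule the_inv_intoE(2)[OF N(5)])
  have id: "fst (pd b g z) *\<^sub>R d1 f (g z) + snd (pd b g z) *\<^sub>R d2 f (g z) = b" if z: "z \<in> f ` U" for z
    unfolding g_def pd_the_inv_into[OF pt z]
    by (rule dinv_right[OF point_transformation_jac[OF pt the_inv_intoE(2)[OF N(5) z]]])
  have "pd c (\<lambda>z. fst (pd b g z) *\<^sub>R d1 f (g z) + snd (pd b g z) *\<^sub>R d2 f (g z)) (f p) = pd c (\<lambda>z. b) (f p)"
    by (rule pd_cong[OF N(2) fp id])
  then have z: "pd c (\<lambda>z. fst (pd b g z) *\<^sub>R d1 f (g z) + snd (pd b g z) *\<^sub>R d2 f (g z)) (f p) = 0" by simp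
  have db: "pd b g differentiable (at (f p))"
    by (rule smooth_on_differentiable[OF smooth_on_pd[OF N(2,3)] fp])
  have d1: "(\<lambda>z. d1 f (g z)) differentiable (at (f p))" "(\<lambda>z. d2 f (g z)) differentiable (at (f p))"
    by (rule smooth_on_differentiable[OF sg fp], intro smooth_intros N)+
  have c1: "pd c (\<lambda>z. d1 f (g z)) (f p) = pd C (d1 f) p" "pd c (\<lambda>z. d2 f (g z)) (f p) = pd C (d2 f) p"
    unfolding C_def
    by (subst pd_compose; (simp add: gfp)?; (rule smooth_on_differentiable[OF N(3) fp] smooth_on_differentiable[OF _ p]); intro smooth_intros N)+
  have c2: "pd C (d1 f) p = fst C *\<^sub>R d1 (d1 f) p + snd C *\<^sub>R d1 (d2 f) p"
    "pd C (d2 f) p = fst C *\<^sub>R d1 (d2 f) p + snd C *\<^sub>R d2 (d2 f) p"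
    using pd_base[OF smooth_on_differentiable[OF smooth_on_d1[OF N(1,4)] p], of C]
      pd_base[OF smooth_on_differentiable[OF smooth_on_d2[OF N(1,4)] p], of C] d_commute[OF N(1) p N(4)] by auto
  have df: "(\<lambda>z. fst (pd b g z)) differentiable (at (f p))" "(\<lambda>z. snd (pd b g z)) differentiable (at (f p))"
    by (intro dfs db)+
  have "(fst B *\<^sub>R pd C (d1 f) p + fst H *\<^sub>R d1 f p) + (snd B *\<^sub>R pd C (d2 f) p + snd H *\<^sub>R d2 f p) = 0"
    using z unfolding pd_add[OF differentiable_scaleR[OF df(1) d1(1)] differentiable_scaleR[OF df(2) d1(2)]]
      pd_scaleR[OF df(1) d1(1)] pd_scaleR[OF df(2) d1(2)] pd_fst[OF db] pd_snd[OF db] c1 gfp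
    by (simp add: B_def H_def)
  then show ?thesis unfolding c2[symmetric] eq_neg_iff_add_eq_0 by (simp only: add_ac)
qed

lemma coeff_cubic:
  fixes a0 a1 b0 b1 :: real
  shows "[:a0, a1:] ^ 3 = [:a0^3, 3*a0^2*a1, 3*a0*a1^2, a1^3:]"
    "[:a0, a1:] ^ 2 * [:b0, b1:] = [:a0^2*b0, a0^2*b1 + 2*a0*a1*b0, 2*a0*a1*b1 + a1^2*b0, a1^2*b1:]"
    "[:a0, a1:] * [:b0, b1:] ^ 2 = [:a0*b0^2, 2*a0*b0*b1 + a1*b0^2, a0*b1^2 + 2*a1*b0*b1, a1*b1^2:]"
    "[:a0, a1:] * [:c0, c1, c2:] = [:a0*c0, a0*c1 + a1*c0, a0*c2 + a1*c1, a1*c2:]"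
  by (simp_all add: power2_eq_square power3_eq_cube algebra_simps)

text \<open>By the preceding lemma, applying \<open>Df\<close> to the second derivatives of the inverse map gives minus the
  second derivatives of \<open>f\<close>. Since \<open>Df\<close> multiplies the determinant \<open>aB - bA\<close> by the Jacobian, this
  eliminates the second derivatives of the inverse map.\<close>

lemma lift0_eq:
  assumes pt: "point_transformation U f" and p: "p \<in> U"
  shows "lift0 U f (p, u) = (f p, lift_fun (jet2 f p u))"
proof -
  obtain u0 u1 u2 u3 where u: "u = (u0, u1, u2, u3)" by (cases u) auto
  define g where "g = the_inv_into U f"
  have N: "open U" "open (f ` U)" "smooth_on (f ` U) g" "smooth_on U f" "inj_on f U"
    using pt by (auto simp: point_transformation_def g_def)
  have fp: "f p \<in> f ` U" using p by simp
  have gfp: "g (f p) = p" using the_inv_into_f_f[OF N(5) p] by (simp add: g_def)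
  define fx fy gx gy where "fx = fst (d1 f p)" "fy = fst (d2 f p)" "gx = snd (d1 f p)" "gy = snd (d2 f p)"
  define J where "J = fx * gy - fy * gx"
  have J: "J \<noteq> 0" using point_transformation_jac[OF pt p] by (simp add: J_def jac_def fx_fy_gx_gy_def)
  define r where "r = inverse J"
  have rJ: "r * J = 1" using J by (simp add: r_def)
  have dg: "pd b g (f p) = ((gy * fst b - fy * snd b) * r, (fx * snd b - gx * fst b) * r)" for b
    using pd_the_inv_into[OF pt fp, of b] gfp
    by (simp add: g_def[symmetric] dinv_def fx_fy_gx_gy_def jac_def J_def r_def divide_inverse)
  note d = smooth_on_differentiable[OF _ fp]
  have comp: "d1 (fst \<circ> g) (f p) = gy * r" "d2 (fst \<circ> g) (f p) = - fy * r"
    "d1 (snd \<circ> g) (f p) = - gx * r" "d2 (snd \<circ> g) (f p) = fx * r"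
    unfolding d1_eq d2_eq comp_def
    by (simp_all add: pd_fst pd_snd d[OF N(3)] dg)
  have c1: "pd b (\<lambda>z. fst (g z)) z = fst (pd b g z)" "pd b (\<lambda>z. snd (g z)) z = snd (pd b g z)" if "z \<in> f ` U" for b z
    using smooth_on_differentiable[OF N(3) that] by (simp_all add: pd_fst pd_snd)
  have c2: "pd c (pd b (\<lambda>z. fst (g z))) (f p) = fst (pd c (pd b g) (f p))"
    "pd c (pd b (\<lambda>z. snd (g z))) (f p) = snd (pd c (pd b g) (f p))" for b c
  proof -
    have "pd c (pd b (\<lambda>z. fst (g z))) (f p) = pd c (\<lambda>z. fst (pd b g z)) (f p)"
      "pd c (pd b (\<lambda>z. snd (g z))) (f p) = pd c (\<lambda>z. snd (pd b g z)) (f p)"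
      by (rule pd_cong[OF N(2) fp], rule c1, assumption)+
    then show "pd c (pd b (\<lambda>z. fst (g z))) (f p) = fst (pd c (pd b g) (f p))"
      "pd c (pd b (\<lambda>z. snd (g z))) (f p) = snd (pd c (pd b g) (f p))"
      using d[OF smooth_on_pd[OF N(2,3)]] by (simp_all add: pd_fst pd_snd)
  qed
  define A where "A b c = fst (pd c (pd b g) (f p))" for b c
  define B where "B b c = snd (pd c (pd b g) (f p))" for b c
  define A11 A12 A22 where "A11 = fst (d1 (d1 f) p)" "A12 = fst (d1 (d2 f) p)" "A22 = fst (d2 (d2 f) p)"
  define B11 B12 B22 where "B11 = snd (d1 (d1 f) p)" "B12 = snd (d1 (d2 f) p)" "B22 = snd (d2 (d2 f) p)"
  define Q where "Q b c h11 h12 h22 = fst (pd b g (f p)) * (fst (pd c g (f p)) * h11 + snd (pd c g (f p)) * h12)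
    + snd (pd b g (f p)) * (fst (pd c g (f p)) * h12 + snd (pd c g (f p)) * h22)" for b c and h11 h12 h22 :: real
  have E: "fx * A b c + fy * B b c = - Q b c A11 A12 A22" "gx * A b c + gy * B b c = - Q b c B11 B12 B22" for b c
    using arg_cong[OF inverse_second_derivative[OF pt p, where b = b and c = c], of fst]
      arg_cong[OF inverse_second_derivative[OF pt p, where b = b and c = c], of snd]
    by (simp_all add: A_def B_def Q_def g_def[symmetric] A11_A12_A22_def B11_B12_B22_def fx_fy_gx_gy_def algebra_simps)
  have Q: "Q (1,0) (1,0) h k l = (gy^2 * h - 2*gx*gy*k + gx^2*l) * r^2"
    "Q (0,1) (1,0) h k l = (- gy*fy * h + (fx*gy + gx*fy) * k - gx*fx*l) * r^2"
    "Q (0,1) (0,1) h k l = (fy^2 * h - 2*fx*fy*k + fx^2*l) * r^2" for h k l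
    by (simp_all add: Q_def dg power2_eq_square algebra_simps)
  define c0 c1 c2 c3 where
    "c0 = - (gy * r * B (1,0) (1,0)) + (- gx * r) * A (1,0) (1,0)"
    "c1 = - (gy * r * (2 * B (0,1) (1,0)) + (- fy * r) * B (1,0) (1,0)) + (- gx * r * (2 * A (0,1) (1,0)) + fx * r * A (1,0) (1,0))"
    "c2 = - (gy * r * B (0,1) (0,1) + (- fy * r) * (2 * B (0,1) (1,0))) + (- gx * r * A (0,1) (0,1) + fx * r * (2 * A (0,1) (1,0)))"
    "c3 = - ((- fy * r) * B (0,1) (0,1)) + fx * r * A (0,1) (0,1)"
  have c: "c0 = r * Q (1,0) (1,0) B11 B12 B22"
    "c1 = r * (2 * Q (0,1) (1,0) B11 B12 B22 - Q (1,0) (1,0) A11 A12 A22)"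
    "c2 = r * (Q (0,1) (0,1) B11 B12 B22 - 2 * Q (0,1) (1,0) A11 A12 A22)"
    "c3 = - r * Q (0,1) (0,1) A11 A12 A22"
    unfolding c0_c1_c2_c3_def
    using E[of "(1,0)" "(1,0)"] E[of "(0,1)" "(1,0)"] E[of "(0,1)" "(0,1)"] by algebra+
  have Jg: "(gy * r) * (fx * r) - (- fy * r) * (- gx * r) = r"
    using rJ unfolding J_def by algebra
  have key: "lift0 U f (p, u) = (f p, ((u0 * (gy*r)^3 + u1 * ((gy*r)^2 * (- gx*r)) + u2 * (gy*r*(- gx*r)^2) + u3 * (- gx*r)^3 + c0) / r,
     (u0 * (3*(gy*r)^2*(- fy*r)) + u1 * ((gy*r)^2*(fx*r) + 2*(gy*r)*(- fy*r)*(- gx*r)) + u2 * (2*(gy*r)*(- gx*r)*(fx*r) + (- fy*r)*(- gx*r)^2) + u3 * (3*(- gx*r)^2*(fx*r)) + c1) / r,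
     (u0 * (3*(gy*r)*(- fy*r)^2) + u1 * (2*(gy*r)*(- fy*r)*(fx*r) + (- fy*r)^2*(- gx*r)) + u2 * ((gy*r)*(fx*r)^2 + 2*(- fy*r)*(- gx*r)*(fx*r)) + u3 * (3*(- gx*r)*(fx*r)^2) + c2) / r,
     (u0 * (- fy*r)^3 + u1 * ((- fy*r)^2*(fx*r)) + u2 * ((- fy*r)*(fx*r)^2) + u3 * (fx*r)^3 + c3) / r))"
    unfolding lift0_def u prod.case Let_def g_def[symmetric] comp Jg coeff_cubic
    unfolding d1_eq d2_eq comp_def c2 A_def[symmetric] B_def[symmetric]
    by (simp add: c0_c1_c2_c3_def eval_nat_numeral divide_inverse algebra_simps)
  have R: "x / r = x * J" for x using rJ J by (simp add: r_def divide_inverse)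
  have R2: "x / J^2 = x * r^2" for x by (simp add: r_def divide_inverse power_inverse)
  show ?thesis
    unfolding key unfolding lift_fun_def jet2_def u Let_def fst_conv snd_conv
      fx_fy_gx_gy_def[symmetric] A11_A12_A22_def[symmetric] B11_B12_B22_def[symmetric] J_def[symmetric] R R2 c Q prod.inject
    using rJ by (intro conjI) algebra+
qed


section \<open>The lift of a vector field\<close>

lemma smooth_on_lift_fun:
  "smooth_on {x. fst (fst x) * snd (fst (snd x)) - fst (fst (snd x)) * snd (fst x) \<noteq> 0} lift_fun" (is "smooth_on ?D _")
proof -
  have o: "open ?D"
    by (intro open_Collect_neq continuous_intros)
  have c: "smooth_on ?D (\<lambda>x. - 3 :: real)" by (rule smooth_on_const)
  show ?thesis unfolding lift_fun_def[abs_def] Let_def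
    by (intro smooth_intros o c) auto
qed

lemma smooth_on_jet2:
  assumes "open U" "smooth_on U f" "smooth_on U s"
  shows "smooth_on U (\<lambda>q. jet2 f q (s q))"
  unfolding jet2_def by (intro smooth_intros assms)

lemma smooth_on_lifted_section:
  assumes "point_transformation U f" "open M" "M \<subseteq> U" "smooth_on M s"
  shows "smooth_on M (\<lambda>q. lift_fun (jet2 f q (s q)))"
proof -
  have "smooth_on M f" using assms(1,3) smooth_on_subset unfolding point_transformation_def by blast
  moreover have "open {x::base \<times> base \<times> base \<times> base \<times> base \<times> fibre. fst (fst x) * snd (fst (snd x)) - fst (fst (snd x)) * snd (fst x) \<noteq> 0}"
    by (intro open_Collect_neq continuous_intros)
  ultimately show ?thesis
    using point_transformation_jac[OF assms(1)] assms(3)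
    by (intro smooth_on_compose[OF assms(2) _ _ smooth_on_lift_fun] smooth_on_jet2 assms)
       (auto simp: jet2_def jac_def)
qed

lemma pd_lifted_section:
  assumes "point_transformation U f" "p \<in> U" "s differentiable (at p)"
  shows "pd b (\<lambda>q. lift_fun (jet2 f q (s q))) p =
    pd (pd b (d1 f) p, pd b (d2 f) p, pd b (d1 (d1 f)) p, pd b (d1 (d2 f)) p, pd b (d2 (d2 f)) p, pd b s p)
      lift_fun (jet2 f p (s p))"
proof -
  have U: "open U" "smooth_on U f" using assms(1) by (auto simp: point_transformation_def)
  have d: "h differentiable (at p)" if "smooth_on U h" for h :: "base \<Rightarrow> base"
    by (rule smooth_on_differentiable[OF that assms(2)])
  have dj: "d1 f differentiable (at p)" "d2 f differentiable (at p)" "d1 (d1 f) differentiable (at p)"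
    "d1 (d2 f) differentiable (at p)" "d2 (d2 f) differentiable (at p)"
    by (intro d smooth_intros U)+
  have "lift_fun differentiable (at (jet2 f p (s p)))"
    using point_transformation_jac[OF assms(1,2)]
    by (intro smooth_on_differentiable[OF smooth_on_lift_fun]) (auto simp: jet2_def jac_def)
  moreover have "(\<lambda>q. jet2 f q (s q)) differentiable (at p)"
    unfolding jet2_def by (intro dfs dj assms(3))
  ultimately show ?thesis
    using pd_compose[of "\<lambda>q. jet2 f q (s q)" p lift_fun b] 
    by (simp add: jet2_def[abs_def] pds dfs dj assms(3))
qed

lemma dd_simps: "dd 0 0 h = h" "dd (Suc m) n h = d1 (dd m n h)" "dd 0 (Suc n) h = d2 (dd 0 n h)"
  by (simp_all add: dd_def)

lemma jet_of1_eqI: "c 0 0 = c' 0 0 \<Longrightarrow> c 1 0 = c' 1 0 \<Longrightarrow> c 0 1 = c' 0 1 \<Longrightarrow> jet_of 1 c = jet_of 1 c'"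
proof -
  assume a: "c 0 0 = c' 0 0" "c 1 0 = c' 1 0" "c 0 1 = c' 0 1"
  have "c m n = c' m n" if "m + n \<le> 1" for m n
    using a that by (cases m; cases n) auto
  then show ?thesis by (simp add: jet_of_eq_iff)
qed

definition jet1c :: "'b \<Rightarrow> 'b \<Rightarrow> 'b \<Rightarrow> nat \<Rightarrow> nat \<Rightarrow> 'b" where
  "jet1c x y z m n = (if m = 0 \<and> n = 0 then x else if n = 0 then y else z)"

lemma jet1_eq: "jet 1 h p = jet_of 1 (jet1c (h p) (d1 h p) (d2 h p))"
  unfolding jet_eq_jet_of by (rule jet_of1_eqI) (simp_all add: jet1c_def dd_simps)

lemma jet0_eq: "jet 0 h p = jet_of 0 (\<lambda>_ _. h p)"
  by (simp add: jet_eq_jet_of jet_of_eq_iff dd_simps)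

lemma push_section_at:
  assumes "point_transformation U f" "local_section N S" "q \<in> U" "q \<in> N"
  shows "push_section U f S (f q) = (f q, lift_fun (jet2 f q (snd (S q))))"
proof -
  have "the_inv_into U f (f q) = q"
    using assms by (simp add: point_transformation_def the_inv_into_f_f)
  moreover have "S q = (q, snd (S q))" using assms by (simp add: local_section_def prod_eq_iff)
  ultimately show ?thesis using lift0_eq[OF assms(1,3), of "snd (S q)"]
    by (simp add: push_section_def)
qed

text \<open>The transformed section composed with \<open>f\<close> is a function of the jets of \<open>f\<close> and of the section at the
  same point, so its first derivatives follow from those by the inverse of the differential of \<open>f\<close>.\<close>

lemma push_section_jets:
  assumes pt: "point_transformation U f" and S: "local_section N S" and p: "p \<in> U" "p \<in> N"
  defines "W \<equiv> \<lambda>q. lift_fun (jet2 f q (snd (S q)))"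
  shows "sjet 0 (push_section U f S) (f p) = (f p, jet_of 0 (\<lambda>_ _. W p))"
    "sjet 1 (push_section U f S) (f p) =
       (f p, jet_of 1 (jet1c (W p) (pd (dinv f (1,0) p) W p) (pd (dinv f (0,1) p) W p)))"
proof -
  define g where "g = the_inv_into U f"
  define M where "M = U \<inter> N"
  define P where "P = snd \<circ> push_section U f S"
  have U: "open U" "open (f ` U)" "smooth_on (f ` U) g" "smooth_on U f" "inj_on f U"
    using pt by (auto simp: point_transformation_def g_def)
  have N: "open N" "smooth_on N S" using S by (auto simp: local_section_def)
  have M: "open M" "p \<in> M" "M \<subseteq> U" "M \<subseteq> N" using U N p by (auto simp: M_def)
  have sW: "smooth_on M W" unfolding W_def
    by (rule smooth_on_lifted_section[OF pt M(1,3)]) (intro smooth_intros M smooth_on_subset[OF N(2) M(4)])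
  have gf: "g (f q) = q" if "q \<in> U" for q
    using the_inv_into_f_f[OF U(5) that] by (simp add: g_def)
  have PW: "P (f q) = W q" if "q \<in> M" for q
    using push_section_at[OF pt S subsetD[OF M(3) that] subsetD[OF M(4) that]] by (simp add: P_def W_def)
  show "sjet 0 (push_section U f S) (f p) = (f p, jet_of 0 (\<lambda>_ _. W p))"
    using PW[OF M(2)] by (simp add: sjet_def jet0_eq P_def)
  have fM: "open (f ` M)"
  proof -
    have "f ` M = f ` U \<inter> g -` M"
    proof (intro equalityI subsetI)
      fix z assume "z \<in> f ` U \<inter> g -` M"
      then show "z \<in> f ` M" using the_inv_intoE(1)[OF U(5)] by (metis Int_iff g_def image_eqI vimageE)
    qed (use gf M in auto)
    then show ?thesis
      using continuous_open_preimage[OF smooth_on_continuous[OF U(3)] U(2) M(1)] by simp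
  qed
  have fp: "f p \<in> f ` M" using M by simp
  have "pd b P (f p) = pd (dinv f b p) W p" for b
  proof -
    have "pd b P (f p) = pd b (\<lambda>z. W (g z)) (f p)"
      by (rule pd_cong[OF fM fp]) (use PW gf M in auto)
    also have "\<dots> = pd (pd b g (f p)) W (g (f p))"
    proof (rule pd_compose)
      show "g differentiable at (f p)" using smooth_on_differentiable[OF U(3)] p by auto
      show "W differentiable at (g (f p))" using smooth_on_differentiable[OF sW] M gf p by auto
    qed
    also have "\<dots> = pd (dinv f b p) W p"
      using pd_the_inv_into[OF pt, of "f p" b] p gf by (simp add: g_def)
    finally show ?thesis .
  qed
  then show "sjet 1 (push_section U f S) (f p) =
       (f p, jet_of 1 (jet1c (W p) (pd (dinv f (1,0) p) W p) (pd (dinv f (0,1) p) W p)))"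
    using PW[OF M(2)] unfolding sjet_def jet1_eq d1_eq d2_eq P_def[symmetric] by (simp add: P_def)
qed

text \<open>The lifted jet does not depend on the choice of the section: in the derivative of the transformed
  section, the section enters through its first jet.\<close>

lemma lift_jet_eq:
  assumes pt: "point_transformation U f" and S: "local_section N S" and p: "p \<in> U" "p \<in> N"
    and k: "k = 0 \<or> k = 1"
  shows "lift_jet U f k (sjet k S p) = sjet k (push_section U f S) (f p)"
  unfolding lift_jet_def
proof (rule the_equality)
  show "\<exists>N' S'. fst (sjet k S p) \<in> N' \<and> local_section N' S' \<and> sjet k S' (fst (sjet k S p)) = sjet k S p \<and>
    sjet k (push_section U f S) (f p) = sjet k (push_section U f S') (f (fst (sjet k S p)))"
    using S p by (auto simp: sjet_def)
next
  fix \<theta>'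
  assume "\<exists>N' S'. fst (sjet k S p) \<in> N' \<and> local_section N' S' \<and> sjet k S' (fst (sjet k S p)) = sjet k S p \<and>
    \<theta>' = sjet k (push_section U f S') (f (fst (sjet k S p)))"
  then obtain N' S' where S': "p \<in> N'" "local_section N' S'" "sjet k S' p = sjet k S p"
    "\<theta>' = sjet k (push_section U f S') (f p)" by (auto simp: sjet_def)
  have j: "jet k (snd \<circ> S') p = jet k (snd \<circ> S) p" using S'(3) by (simp add: sjet_def)
  have d: "(\<lambda>q. snd (S q)) differentiable (at p)" "(\<lambda>q. snd (S' q)) differentiable (at p)"
    using S S'(1,2) p smooth_on_differentiable by (auto simp: local_section_def intro!: dfs)
  from k show "\<theta>' = sjet k (push_section U f S) (f p)"
  proof
    assume k: "k = 0"
    show ?thesis using j unfolding k S'(4) push_section_jets(1)[OF pt S p] push_section_jets(1)[OF pt S'(2) p(1) S'(1)]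
      by (simp add: jet0_eq jet_of_eq_iff)
  next
    assume k: "k = 1"
    have e: "snd (S' p) = snd (S p)" "d1 (snd \<circ> S') p = d1 (snd \<circ> S) p" "d2 (snd \<circ> S') p = d2 (snd \<circ> S) p"
      using j[unfolded k jet1_eq jet_of_eq_iff, rule_format, of 0 0] j[unfolded k jet1_eq jet_of_eq_iff, rule_format, of 1 0]
        j[unfolded k jet1_eq jet_of_eq_iff, rule_format, of 0 1] by (simp_all add: jet1c_def)
    have "pd b (\<lambda>q. snd (S' q)) p = pd b (\<lambda>q. snd (S q)) p" for b
      using e unfolding pd_base[OF d(1)] pd_base[OF d(2)] by (simp add: comp_def)
    then show ?thesis
      unfolding k S'(4) push_section_jets(2)[OF pt S p] push_section_jets(2)[OF pt S'(2) p(1) S'(1)]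
        pd_lifted_section[OF pt p(1) d(1)] pd_lifted_section[OF pt p(1) d(2)] by (simp add: e)
  qed
qed

text \<open>The fibre component of the lift of \<open>X\<close> at \<open>s q\<close>.\<close>

definition delta :: "(base \<Rightarrow> base) \<Rightarrow> (base \<Rightarrow> fibre) \<Rightarrow> base \<Rightarrow> fibre" where
  "delta X s q = (let Xx = d1 X q; Xy = d2 X q; Xxx = d1 (d1 X) q; Xxy = d1 (d2 X) q; Xyy = d2 (d2 X) q;
      u0 = fst (s q); u1 = fst (snd (s q)); u2 = fst (snd (snd (s q))); u3 = snd (snd (snd (s q)))
    in (u0 * (snd Xy - 2 * fst Xx) - u1 * snd Xx + snd Xxx,
        - u1 * fst Xx - 3 * u0 * fst Xy - 2 * u2 * snd Xx + 2 * snd Xxy - fst Xxx,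
        - u2 * snd Xy - 2 * u1 * fst Xy - 3 * u3 * snd Xx + snd Xyy - 2 * fst Xxy,
        u3 * (fst Xx - 2 * snd Xy) - u2 * fst Xy - fst Xyy))"

text \<open>The linearisation of the transformation formula at the jet of the identity map.\<close>

lemma lift_fun_variation:
  fixes a b A B C :: "'a::euclidean_space \<Rightarrow> base" and u :: "'a \<Rightarrow> fibre"
  assumes d: "a differentiable (at z)" "b differentiable (at z)" "A differentiable (at z)" "B differentiable (at z)"
    "C differentiable (at z)" "u differentiable (at z)"
    and v: "a z = (1, 0)" "b z = (0, 1)" "A z = 0" "B z = 0" "C z = 0" "pd w u z = 0"
  shows "pd w (\<lambda>z. lift_fun (a z, b z, A z, B z, C z, u z)) z =
    (fst (u z) * (snd (pd w b z) - 2 * fst (pd w a z)) - fst (snd (u z)) * snd (pd w a z) + snd (pd w A z),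
     - fst (snd (u z)) * fst (pd w a z) - 3 * fst (u z) * fst (pd w b z) - 2 * fst (snd (snd (u z))) * snd (pd w a z)
       + 2 * snd (pd w B z) - fst (pd w A z),
     - fst (snd (snd (u z))) * snd (pd w b z) - 2 * fst (snd (u z)) * fst (pd w b z)
       - 3 * snd (snd (snd (u z))) * snd (pd w a z) + snd (pd w C z) - 2 * fst (pd w B z),
     snd (snd (snd (u z))) * (fst (pd w a z) - 2 * snd (pd w b z)) - fst (snd (snd (u z))) * fst (pd w b z) - fst (pd w C z))"
  unfolding lift_fun_def Let_def fst_conv snd_conv
  by (simp add: pds dfs d v)  (simp add: algebra_simps)?


lemma pd_slice:
  fixes h :: "real \<times> 'a::euclidean_space \<Rightarrow> 'b::real_normed_vector"
  assumes "h differentiable (at (t, q))"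
  shows "pd b (\<lambda>q. h (t, q)) q = pd (0, b) h (t, q)"
    and "((\<lambda>t. h (t, q)) has_vector_derivative pd (1, 0) h (t, q)) (at t)"
proof -
  have "((\<lambda>q. (t, q)) has_derivative (\<lambda>b. (0, b))) (at q)"
    by (auto intro!: derivative_eq_intros)
  from has_derivative_compose[OF this has_pd[OF assms]]
  show "pd b (\<lambda>q. h (t, q)) q = pd (0, b) h (t, q)" by (rule pd_unique)
  have "((\<lambda>t. (t, q)) has_derivative (\<lambda>s. s *\<^sub>R (1, 0))) (at t)"
    by (auto intro!: derivative_eq_intros simp: zero_prod_def)
  from has_derivative_compose[OF this has_pd[OF assms]]
  show "((\<lambda>t. h (t, q)) has_vector_derivative pd (1, 0) h (t, q)) (at t)"
    unfolding has_vector_derivative_def linear_scale[OF linear_pd[OF assms]] .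
qed

lemma has_vector_derivative_jet_of:
  assumes "\<And>m n. m + n \<le> k \<Longrightarrow> ((\<lambda>t. c t m n) has_vector_derivative c' m n) F"
  shows "((\<lambda>t. jet_of k (c t)) has_vector_derivative jet_of k c') F"
  unfolding has_vector_derivative_def jet_of_scaleR
  by (rule has_derivative_jet_of) (use assms in \<open>simp add: has_vector_derivative_def\<close>)

lemma has_vector_derivative_jet1c:
  assumes "(x has_vector_derivative x') F" "(y has_vector_derivative y') F" "(z has_vector_derivative z') F"
  shows "((\<lambda>t. jet_of 1 (jet1c (x t) (y t) (z t))) has_vector_derivative jet_of 1 (jet1c x' y' z')) F"
  by (rule has_vector_derivative_jet_of) (use assms in \<open>auto simp: jet1c_def\<close>)

text \<open>All maps of the flow are seen as one smooth function of time and place. At time zero its spatial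
  derivatives are those of the identity, and the time derivative of a spatial derivative is the same
  spatial derivative of \<open>X\<close>, since partial derivatives commute. The first jet of the transformed section
  contributes a further term because the inverse of the differential of the flow varies too.\<close>

lemma flow_lift_derivative:
  assumes fl: "local_flow X D U e \<Phi>" and S: "local_section N S" and p: "p \<in> U" "p \<in> N"
  defines "s \<equiv> \<lambda>q. snd (S q)"
  shows "((\<lambda>t. lift_jet U (\<Phi> t) 0 (sjet 0 S p)) has_vector_derivative (X p, jet_of 0 (\<lambda>_ _. delta X s p))) (at 0)"
    and "((\<lambda>t. lift_jet U (\<Phi> t) 1 (sjet 1 S p)) has_vector_derivative
      (X p, jet_of 1 (jet1c (delta X s p)
         (d1 (delta X s) p - (fst (d1 X p) *\<^sub>R d1 s p + snd (d1 X p) *\<^sub>R d2 s p))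
         (d2 (delta X s) p - (fst (d2 X p) *\<^sub>R d1 s p + snd (d2 X p) *\<^sub>R d2 s p))))) (at 0)"
proof -
  define T where "T = {-e<..<e}"
  define M where "M = U \<inter> N"
  define \<Psi> where "\<Psi> z = \<Phi> (fst z) (snd z)" for z
  have fl': "open D" "smooth_on D X" "open U" "U \<subseteq> D" "0 < e" "smooth_on (T \<times> U) \<Psi>"
    "\<And>q. q \<in> U \<Longrightarrow> \<Phi> 0 q = q" "\<And>t. t \<in> T \<Longrightarrow> point_transformation U (\<Phi> t)"
    "\<And>t q. t \<in> T \<Longrightarrow> q \<in> U \<Longrightarrow> ((\<lambda>s. \<Phi> s q) has_vector_derivative X (\<Phi> t q)) (at t)"
    using fl unfolding local_flow_def T_def \<Psi>_def[abs_def] by (auto simp: case_prod_beta')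
  have N: "open N" "smooth_on N S" using S by (auto simp: local_section_def)
  have T: "open T" "0 \<in> T" using fl'(5) by (auto simp: T_def)
  have M: "open M" "M \<subseteq> U" "M \<subseteq> N" "p \<in> M" using fl'(3) N p by (auto simp: M_def)
  have o: "open (T \<times> U)" "open (T \<times> M)" using T fl'(3) M by (auto intro: open_Times)
  have sX: "smooth_on U X" by (rule smooth_on_subset[OF fl'(2,4)])
  have ss: "smooth_on M s" unfolding s_def by (intro smooth_intros M smooth_on_subset[OF N(2) M(3)])
  define Dx Dy :: "(real \<times> base \<Rightarrow> base) \<Rightarrow> real \<times> base \<Rightarrow> base" where
    "Dx = pd (0, (1, 0))" and "Dy = pd (0, (0, 1))"
  define E :: "real \<times> base" where "E = (1, 0)"
  have sm: "smooth_on (T \<times> U) (Dx h)" "smooth_on (T \<times> U) (Dy h)" if "smooth_on (T \<times> U) h" for h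
    unfolding Dx_def Dy_def by (intro smooth_on_pd o that)+
  have sl: "pd (0, b) h (t, q) = pd b (\<lambda>q. h (t, q)) q" if "smooth_on (T \<times> U) h" "t \<in> T" "q \<in> U"
    for b t q and h :: "real \<times> base \<Rightarrow> base"
    using pd_slice(1)[OF smooth_on_differentiable[OF that(1)], of t q b] that by simp
  have Dx1: "Dx \<Psi> (t, q) = d1 (\<Phi> t) q" and Dy1: "Dy \<Psi> (t, q) = d2 (\<Phi> t) q" if "t \<in> T" "q \<in> U" for t q
    unfolding Dx_def Dy_def d1_eq d2_eq sl[OF fl'(6) that] by (simp_all add: \<Psi>_def)
  have Dx2: "Dx (Dx \<Psi>) (t, q) = d1 (d1 (\<Phi> t)) q" "Dx (Dy \<Psi>) (t, q) = d1 (d2 (\<Phi> t)) q"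
    "Dy (Dy \<Psi>) (t, q) = d2 (d2 (\<Phi> t)) q" if tq: "t \<in> T" "q \<in> U" for t q
  proof -
    have "Dx (Dx \<Psi>) (t, q) = pd (1, 0) (\<lambda>q. Dx \<Psi> (t, q)) q" "Dx (Dy \<Psi>) (t, q) = pd (1, 0) (\<lambda>q. Dy \<Psi> (t, q)) q"
      "Dy (Dy \<Psi>) (t, q) = pd (0, 1) (\<lambda>q. Dy \<Psi> (t, q)) q"
      unfolding Dx_def[THEN fun_cong, of "Dx \<Psi>"] Dx_def[THEN fun_cong, of "Dy \<Psi>"] Dy_def[THEN fun_cong, of "Dy \<Psi>"]
      by (rule sl[OF _ tq], intro sm fl'(6))+
    moreover have "pd b (\<lambda>q. Dx \<Psi> (t, q)) q = pd b (d1 (\<Phi> t)) q" "pd b (\<lambda>q. Dy \<Psi> (t, q)) q = pd b (d2 (\<Phi> t)) q" for b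
      by (rule pd_cong[OF fl'(3) tq(2)], simp add: Dx1 Dy1 tq(1))+
    ultimately show "Dx (Dx \<Psi>) (t, q) = d1 (d1 (\<Phi> t)) q" "Dx (Dy \<Psi>) (t, q) = d1 (d2 (\<Phi> t)) q"
      "Dy (Dy \<Psi>) (t, q) = d2 (d2 (\<Phi> t)) q" by (simp_all add: d1_eq[of "d1 _"] d1_eq[of "d2 _"] d2_eq[of "d2 _"])
  qed
  have z1: "d1 (\<Phi> 0) q = (1, 0)" "d2 (\<Phi> 0) q = (0, 1)" if "q \<in> U" for q
  proof -
    have "pd b (\<Phi> 0) q = b" for b
      using pd_cong[OF fl'(3) that, of "\<Phi> 0" "\<lambda>q. q" b] fl'(7) pd_unique[OF has_derivative_ident, where x = q and b = b] by simp
    then show "d1 (\<Phi> 0) q = (1, 0)" "d2 (\<Phi> 0) q = (0, 1)" by (auto simp: d1_eq d2_eq)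
  qed
  have z2: "d1 (d1 (\<Phi> 0)) q = 0" "d1 (d2 (\<Phi> 0)) q = 0" "d2 (d2 (\<Phi> 0)) q = 0" if "q \<in> U" for q
    using d1_cong[OF fl'(3) that, of "d1 (\<Phi> 0)" "\<lambda>_. (1,0)"] d1_cong[OF fl'(3) that, of "d2 (\<Phi> 0)" "\<lambda>_. (0,1)"]
      d2_cong[OF fl'(3) that, of "d2 (\<Phi> 0)" "\<lambda>_. (0,1)"] z1 by (auto simp: d1_eq d2_eq)
  have t0: "pd E \<Psi> (0, q) = X q" if "q \<in> U" for q
    using vector_derivative_unique_at[OF pd_slice(2)[OF smooth_on_differentiable[OF fl'(6)]], of 0 q "X q"]
      fl'(9)[OF T(2) that] T that by (simp add: \<Psi>_def E_def fl'(7))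
  have tt: "pd E (Dx h) (0, q) = d1 Y q" "pd E (Dy h) (0, q) = d2 Y q"
    if h: "smooth_on (T \<times> U) h" and q: "q \<in> U" and Y: "\<And>q. q \<in> U \<Longrightarrow> pd E h (0, q) = Y q"
    for h Y q
  proof -
    have zq: "(0, q) \<in> T \<times> U" using T q by simp
    have "pd E (pd (0, b) h) (0, q) = pd b Y q" for b
    proof -
      have "pd E (pd (0, b) h) (0, q) = pd (0, b) (pd E h) (0, q)"
        by (rule pd_commute[OF o(1) zq h])
      also have "\<dots> = pd b (\<lambda>q. pd E h (0, q)) q" by (rule sl[OF smooth_on_pd[OF o(1) h] T(2) q])
      also have "\<dots> = pd b Y q" by (rule pd_cong[OF fl'(3) q Y])
      finally show ?thesis .
    qed
    then show "pd E (Dx h) (0, q) = d1 Y q" "pd E (Dy h) (0, q) = d2 Y q"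
      by (simp_all add: Dx_def Dy_def d1_eq d2_eq)
  qed
  note t1 = tt[OF fl'(6) _ t0]
  have t2: "pd E (Dx (Dx \<Psi>)) (0, q) = d1 (d1 X) q" "pd E (Dx (Dy \<Psi>)) (0, q) = d1 (d2 X) q"
    "pd E (Dy (Dy \<Psi>)) (0, q) = d2 (d2 X) q" if "q \<in> U" for q
    by (rule tt(1)[OF sm(1)[OF fl'(6)] that t1(1)] tt(1)[OF sm(2)[OF fl'(6)] that t1(2)] tt(2)[OF sm(2)[OF fl'(6)] that t1(2)]; simp)+
  define w where "w z = lift_fun (Dx \<Psi> z, Dy \<Psi> z, Dx (Dx \<Psi>) z, Dx (Dy \<Psi>) z, Dy (Dy \<Psi>) z, s (snd z))" for z
  have w: "w (t, q) = lift_fun (jet2 (\<Phi> t) q (s q))" if "t \<in> T" "q \<in> U" for t q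
    by (simp add: w_def jet2_def Dx1 Dy1 Dx2 that)
  have smM: "smooth_on (T \<times> M) h" if "smooth_on (T \<times> U) h" for h :: "real \<times> base \<Rightarrow> base"
    by (rule smooth_on_subset[OF that]) (intro Sigma_mono M(2) order_refl)
  have ssnd: "smooth_on (T \<times> M) (\<lambda>z. s (snd z))"
    by (rule smooth_on_compose[OF o(2) M(1) _ ss]) (auto intro!: smooth_on_snd o smooth_on_id)
  have sw: "smooth_on (T \<times> M) w" unfolding w_def[abs_def]
  proof (rule smooth_on_compose[OF o(2) _ _ smooth_on_lift_fun])
    show "open {x::base \<times> base \<times> base \<times> base \<times> base \<times> fibre. fst (fst x) * snd (fst (snd x)) - fst (fst (snd x)) * snd (fst x) \<noteq> 0}"
      by (intro open_Collect_neq continuous_intros)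
    show "smooth_on (T \<times> M) (\<lambda>z. (Dx \<Psi> z, Dy \<Psi> z, Dx (Dx \<Psi>) z, Dx (Dy \<Psi>) z, Dy (Dy \<Psi>) z, s (snd z)))"
      by (intro smooth_on_Pair o ssnd smM sm fl'(6))
    show "(\<lambda>z. (Dx \<Psi> z, Dy \<Psi> z, Dx (Dx \<Psi>) z, Dx (Dy \<Psi>) z, Dy (Dy \<Psi>) z, s (snd z))) ` (T \<times> M)
      \<subseteq> {x. fst (fst x) * snd (fst (snd x)) - fst (fst (snd x)) * snd (fst x) \<noteq> 0}"
    proof (rule image_subsetI)
      fix z assume "z \<in> T \<times> M"
      then obtain t q where z: "z = (t, q)" and tq: "t \<in> T" "q \<in> U" using M(2) by blast
      show "(Dx \<Psi> z, Dy \<Psi> z, Dx (Dx \<Psi>) z, Dx (Dy \<Psi>) z, Dy (Dy \<Psi>) z, s (snd z))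
        \<in> {x. fst (fst x) * snd (fst (snd x)) - fst (fst (snd x)) * snd (fst x) \<noteq> 0}"
        using point_transformation_jac[OF fl'(8)[OF tq(1)] tq(2)] by (simp add: z Dx1 Dy1 tq jac_def)
    qed
  qed
  have w0: "w (0, q) = s q" if "q \<in> U" for q
    unfolding w[OF T(2) that] jet2_def z1[OF that] z2[OF that] lift_fun_def by (simp add: Let_def)
  have dt: "pd E w (0, q) = delta X s q" if q: "q \<in> M" for q
  proof -
    have zM: "(0, q) \<in> T \<times> M" and zU: "(0, q) \<in> T \<times> U" and qU: "q \<in> U" using T q M by auto
    note df = smooth_on_differentiable[OF _ zU]
    have "pd E (\<lambda>z. s (snd z)) (0, q) = pd (pd E snd (0, q)) s q"
      by (subst pd_compose) (auto intro!: smooth_on_differentiable[OF ss q] bounded_linear_imp_differentiable bounded_linear_snd)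
    also have "pd E snd (0, q) = (0 :: base)"
      using pd_unique[OF bounded_linear_imp_has_derivative[OF bounded_linear_snd], of E "(0, q)"] by (simp add: E_def)
    also have "pd 0 s q = 0" using linear_0[OF linear_pd[OF smooth_on_differentiable[OF ss q]]] .
    finally have s0: "pd E (\<lambda>z. s (snd z)) (0, q) = 0" .
    show ?thesis unfolding w_def[abs_def] delta_def Let_def
      by (subst lift_fun_variation)
        (auto simp: df sm fl'(6) smooth_on_differentiable[OF ssnd zM] s0 Dx1 Dy1 Dx2 z1 z2 T qU t1 t2)
  qed
  have Tev: "((\<lambda>t. lift_jet U (\<Phi> t) k (sjet k S p)) has_vector_derivative v) (at 0)"
    if "((\<lambda>t. L t) has_vector_derivative v) (at 0)" "\<And>t. t \<in> T \<Longrightarrow> lift_jet U (\<Phi> t) k (sjet k S p) = L t" for k L v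
    by (rule has_vector_derivative_transform_within_open[OF that(1) T]) (simp add: that(2))
  have zM: "(0, p) \<in> T \<times> M" and zU: "(0, p) \<in> T \<times> U" using T p M by auto
  have dw: "w differentiable (at (t, p))" if "t \<in> T" for t
    by (rule smooth_on_differentiable[OF sw]) (use that M in auto)
  have W: "(\<lambda>q. lift_fun (jet2 (\<Phi> t) q (snd (S q)))) p = w (t, p)"
    "pd b (\<lambda>q. lift_fun (jet2 (\<Phi> t) q (snd (S q)))) p = fst b *\<^sub>R pd (0,(1,0)) w (t, p) + snd b *\<^sub>R pd (0,(0,1)) w (t, p)"
    if t: "t \<in> T" for t b
  proof -
    show "(\<lambda>q. lift_fun (jet2 (\<Phi> t) q (snd (S q)))) p = w (t, p)" using w[OF t p(1)] by (simp add: s_def)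
    have "pd b (\<lambda>q. lift_fun (jet2 (\<Phi> t) q (snd (S q)))) p = pd b (\<lambda>q. w (t, q)) p"
      by (rule pd_cong[OF fl'(3) p(1)]) (simp add: w t s_def)
    also have "\<dots> = pd (0, b) w (t, p)" by (rule pd_slice(1)[OF dw[OF t]])
    also have "(0, b) = fst b *\<^sub>R (0, (1, 0)) + snd b *\<^sub>R (0::real, (0::real, 1::real))" by (simp add: prod_eq_iff)
    also have "pd \<dots> w (t, p) = fst b *\<^sub>R pd (0,(1,0)) w (t, p) + snd b *\<^sub>R pd (0,(0,1)) w (t, p)"
      unfolding linear_add[OF linear_pd[OF dw[OF t]]] linear_scale[OF linear_pd[OF dw[OF t]]] ..
    finally show "pd b (\<lambda>q. lift_fun (jet2 (\<Phi> t) q (snd (S q)))) p = fst b *\<^sub>R pd (0,(1,0)) w (t, p) + snd b *\<^sub>R pd (0,(0,1)) w (t, p)" .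
  qed
  have vw: "((\<lambda>t. w (t, p)) has_vector_derivative delta X s p) (at 0)"
    using pd_slice(2)[OF dw[OF T(2)]] dt[OF M(4)] by (simp add: E_def)
  have v\<Phi>: "((\<lambda>t. \<Phi> t p) has_vector_derivative X p) (at 0)"
    using fl'(9)[OF T(2) p(1)] fl'(7)[OF p(1)] by simp
  show "((\<lambda>t. lift_jet U (\<Phi> t) 0 (sjet 0 S p)) has_vector_derivative (X p, jet_of 0 (\<lambda>_ _. delta X s p))) (at 0)"
  proof (rule Tev)
    show "((\<lambda>t. (\<Phi> t p, jet_of 0 (\<lambda>_ _. w (t, p)))) has_vector_derivative (X p, jet_of 0 (\<lambda>_ _. delta X s p))) (at 0)"
      by (intro has_vector_derivative_Pair v\<Phi> has_vector_derivative_jet_of vw)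
    show "lift_jet U (\<Phi> t) 0 (sjet 0 S p) = (\<Phi> t p, jet_of 0 (\<lambda>_ _. w (t, p)))" if t: "t \<in> T" for t
      using lift_jet_eq[OF fl'(8)[OF t] S p, of 0] push_section_jets(1)[OF fl'(8)[OF t] S p] W(1)[OF t] by simp
  qed
  define Y where "Y b z = ((snd (Dy \<Psi> z) * fst b - fst (Dy \<Psi> z) * snd b) / (fst (Dx \<Psi> z) * snd (Dy \<Psi> z) - fst (Dy \<Psi> z) * snd (Dx \<Psi> z))) *\<^sub>R pd (0,(1,0)) w z
     + ((fst (Dx \<Psi> z) * snd b - snd (Dx \<Psi> z) * fst b) / (fst (Dx \<Psi> z) * snd (Dy \<Psi> z) - fst (Dy \<Psi> z) * snd (Dx \<Psi> z))) *\<^sub>R pd (0,(0,1)) w z" for b z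
  have Y: "pd (dinv (\<Phi> t) b p) (\<lambda>q. lift_fun (jet2 (\<Phi> t) q (snd (S q)))) p = Y b (t, p)" if t: "t \<in> T" for t b
    unfolding W(2)[OF t] Y_def by (simp add: dinv_def jac_def Dx1 Dy1 t p)
  have vY: "((\<lambda>t. Y b (t, p)) has_vector_derivative (pd b (delta X s) p
      - (fst (pd b X p) *\<^sub>R d1 s p + snd (pd b X p) *\<^sub>R d2 s p))) (at 0)" for b
  proof -
    have dd: "Dx \<Psi> differentiable (at (0, p))" "Dy \<Psi> differentiable (at (0, p))"
      by (rule smooth_on_differentiable[OF _ zU], intro sm fl'(6))+
    have dpw: "pd c w differentiable (at (0, p))" for c
      by (rule smooth_on_differentiable[OF smooth_on_pd[OF o(2) sw] zM])
    have v0: "Dx \<Psi> (0, p) = (1, 0)" "Dy \<Psi> (0, p) = (0, 1)" using Dx1 Dy1 z1 T p by auto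
    have "Y b differentiable (at (0, p))"
      unfolding Y_def[abs_def] by (intro dfs dd dpw) (simp_all add: v0)
    from pd_slice(2)[OF this]
    have 1: "((\<lambda>t. Y b (t, p)) has_vector_derivative pd E (Y b) (0, p)) (at 0)" by (simp add: E_def)
    have pw: "pd (0, c) w (0, p) = pd c s p" for c
    proof -
      have "pd (0, c) w (0, p) = pd c (\<lambda>q. w (0, q)) p" by (rule pd_slice(1)[OF dw[OF T(2)], symmetric])
      also have "\<dots> = pd c s p" by (rule pd_cong[OF fl'(3) p(1)]) (rule w0)
      finally show ?thesis .
    qed
    have pEw: "pd E (pd (0, c) w) (0, p) = pd c (delta X s) p" for c
    proof -
      have "pd E (pd (0, c) w) (0, p) = pd (0, c) (pd E w) (0, p)" by (rule pd_commute[OF o(2) zM sw])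
      also have "\<dots> = pd c (\<lambda>q. pd E w (0, q)) p" by (rule pd_slice(1)[OF dpw, symmetric])
      also have "\<dots> = pd c (delta X s) p" by (rule pd_cong[OF M(1,4) dt])
      finally show ?thesis .
    qed
    have dX: "X differentiable (at p)" by (rule smooth_on_differentiable[OF sX p(1)])
    have "delta X s differentiable (at p)"
    proof -
      have "smooth_on M (\<lambda>q. pd E w (0, q))"
        by (rule smooth_on_compose[OF M(1) o(2) _ smooth_on_pd[OF o(2) sw]]) (intro smooth_on_Pair M smooth_on_const smooth_on_id, use T in auto)
      then have "(\<lambda>q. pd E w (0, q)) differentiable (at p)" by (rule smooth_on_differentiable[OF _ M(4)])
      then show ?thesis using differentiable_cong_open[OF M(1,4) dt] by simp
    qed
    note pb = pd_base[OF this, of b] pd_base[OF dX, of b]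
    have "pd E (Y b) (0, p) = pd b (delta X s) p - (fst (pd b X p) *\<^sub>R d1 s p + snd (pd b X p) *\<^sub>R d2 s p)"
      unfolding Y_def[abs_def] pb
      by (simp add: pds dfs dd dpw v0 pw pEw t1 p T d1_eq[symmetric] d2_eq[symmetric] algebra_simps)
    then show ?thesis using 1 by simp
  qed
  show "((\<lambda>t. lift_jet U (\<Phi> t) 1 (sjet 1 S p)) has_vector_derivative
      (X p, jet_of 1 (jet1c (delta X s p)
         (d1 (delta X s) p - (fst (d1 X p) *\<^sub>R d1 s p + snd (d1 X p) *\<^sub>R d2 s p))
         (d2 (delta X s) p - (fst (d2 X p) *\<^sub>R d1 s p + snd (d2 X p) *\<^sub>R d2 s p))))) (at 0)"
  proof (rule Tev)
    show "((\<lambda>t. (\<Phi> t p, jet_of 1 (jet1c (w (t, p)) (Y (1,0) (t, p)) (Y (0,1) (t, p))))) has_vector_derivative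
      (X p, jet_of 1 (jet1c (delta X s p)
         (d1 (delta X s) p - (fst (d1 X p) *\<^sub>R d1 s p + snd (d1 X p) *\<^sub>R d2 s p))
         (d2 (delta X s) p - (fst (d2 X p) *\<^sub>R d1 s p + snd (d2 X p) *\<^sub>R d2 s p))))) (at 0)"
      using vY[of "(1,0)"] vY[of "(0,1)"]
      by (intro has_vector_derivative_Pair v\<Phi> has_vector_derivative_jet1c vw) (simp_all add: d1_eq d2_eq)
    show "lift_jet U (\<Phi> t) 1 (sjet 1 S p) = (\<Phi> t p, jet_of 1 (jet1c (w (t, p)) (Y (1,0) (t, p)) (Y (0,1) (t, p))))" if t: "t \<in> T" for t
      using lift_jet_eq[OF fl'(8)[OF t] S p, of 1] push_section_jets(2)[OF fl'(8)[OF t] S p] W(1)[OF t] Y[OF t] by simp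
  qed
qed


section \<open>Isotropy equations and relative invariants\<close>

text \<open>Multi-indices are kept as numerals, so that the rules for derivatives of low order apply to them.\<close>

declare One_nat_def [simp del]

lemma dd_numeral:
  "dd 1 0 h = d1 h" "dd 0 1 h = d2 h" "dd 2 0 h = d1 (d1 h)" "dd 1 1 h = d1 (d2 h)" "dd 0 2 h = d2 (d2 h)"
  "dd 3 0 h = d1 (d1 (d1 h))" "dd 2 1 h = d1 (d1 (d2 h))" "dd 1 2 h = d1 (d2 (d2 h))" "dd 0 3 h = d2 (d2 (d2 h))"
  by (simp_all add: dd_def eval_nat_numeral One_nat_def)

lemma multiindex_le1: "(\<forall>m n. m + n \<le> 1 \<longrightarrow> P m n) \<longleftrightarrow> P 0 0 \<and> P 1 0 \<and> P 0 1" for P :: "nat \<Rightarrow> nat \<Rightarrow> bool"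
proof
  assume P: "P 0 0 \<and> P 1 0 \<and> P 0 1"
  show "\<forall>m n. m + n \<le> 1 \<longrightarrow> P m n"
  proof (intro allI impI)
    fix m n :: nat assume "m + n \<le> 1"
    then have "(m = 0 \<and> n = 0) \<or> (m = 1 \<and> n = 0) \<or> (m = 0 \<and> n = 1)" by linarith
    then show "P m n" using P by auto
  qed
qed simp

lemma delta_at:
  assumes "d1 X p = 0" "d2 X p = 0"
  shows "delta X s p = (snd (dd 2 0 X p), 2 * snd (dd 1 1 X p) - fst (dd 2 0 X p),
    snd (dd 0 2 X p) - 2 * fst (dd 1 1 X p), - fst (dd 0 2 X p))"
  by (simp add: delta_def assms dd_numeral Let_def)

text \<open>Terms in which a first derivative of \<open>X\<close> is left undifferentiated drop out at \<open>p\<close>.\<close>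

lemma pd_delta_at:
  assumes U: "open U" "p \<in> U" "smooth_on U X" "smooth_on U s" and z: "d1 X p = 0" "d2 X p = 0"
  shows "pd b (delta X s) p =
    (fst (s p) * (snd (pd b (d2 X) p) - 2 * fst (pd b (d1 X) p)) - fst (snd (s p)) * snd (pd b (d1 X) p) + snd (pd b (dd 2 0 X) p),
     - fst (snd (s p)) * fst (pd b (d1 X) p) - 3 * fst (s p) * fst (pd b (d2 X) p) - 2 * fst (snd (snd (s p))) * snd (pd b (d1 X) p)
       + 2 * snd (pd b (dd 1 1 X) p) - fst (pd b (dd 2 0 X) p),
     - fst (snd (snd (s p))) * snd (pd b (d2 X) p) - 2 * fst (snd (s p)) * fst (pd b (d2 X) p) - 3 * snd (snd (snd (s p))) * snd (pd b (d1 X) p)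
       + snd (pd b (dd 0 2 X) p) - 2 * fst (pd b (dd 1 1 X) p),
     snd (snd (snd (s p))) * (fst (pd b (d1 X) p) - 2 * snd (pd b (d2 X) p)) - fst (snd (snd (s p))) * fst (pd b (d2 X) p) - fst (pd b (dd 0 2 X) p))"
proof -
  have d: "d1 X differentiable (at p)" "d2 X differentiable (at p)" "d1 (d1 X) differentiable (at p)"
    "d1 (d2 X) differentiable (at p)" "d2 (d2 X) differentiable (at p)" "s differentiable (at p)"
    by (rule smooth_on_differentiable[OF _ U(2)], intro smooth_intros U)+
  show ?thesis unfolding delta_def[abs_def] Let_def dd_numeral
    by (simp add: pds dfs d z)
qed

lemma pd_third:
  fixes X :: "base \<Rightarrow> base"
  assumes U: "open U" "p \<in> U" "smooth_on U X"
  shows "d1 (dd 2 0 X) p = dd 3 0 X p" "d1 (dd 1 1 X) p = dd 2 1 X p" "d1 (dd 0 2 X) p = dd 1 2 X p"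
    "d2 (dd 2 0 X) p = dd 2 1 X p" "d2 (dd 1 1 X) p = dd 1 2 X p" "d2 (dd 0 2 X) p = dd 0 3 X p"
    "d1 (d1 X) p = dd 2 0 X p" "d1 (d2 X) p = dd 1 1 X p" "d2 (d1 X) p = dd 1 1 X p" "d2 (d2 X) p = dd 0 2 X p"
proof -
  show "d1 (dd 2 0 X) p = dd 3 0 X p" "d1 (dd 1 1 X) p = dd 2 1 X p" "d1 (dd 0 2 X) p = dd 1 2 X p"
    "d1 (d1 X) p = dd 2 0 X p" "d1 (d2 X) p = dd 1 1 X p" "d2 (d2 X) p = dd 0 2 X p"
    by (simp_all add: dd_numeral)
  show "d2 (d1 X) p = dd 1 1 X p" using d_commute[OF U] by (simp add: dd_numeral)
  show "d2 (dd 2 0 X) p = dd 2 1 X p" "d2 (dd 1 1 X) p = dd 1 2 X p" "d2 (dd 0 2 X) p = dd 0 3 X p"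
    using d2_dd[OF U(1,3,2), of 2 0] d2_dd[OF U(1,3,2), of 1 1] d2_dd[OF U(1,3,2), of 0 2]
    by (simp_all add: One_nat_def numeral_2_eq_2 numeral_3_eq_3)
qed

lemma jproj_sjet: "r \<le> k \<Longrightarrow> jproj r (sjet k S p) = sjet r S p"
  by (simp add: jproj_def sjet_def jet_eq_jet_of trunc_jet_of)

lemma has_derivative_sjet:
  assumes "local_section N S" "p \<in> N"
  defines "s \<equiv> \<lambda>q. snd (S q)"
  shows "(sjet k S has_derivative
    (\<lambda>v. (v, jet_of k (\<lambda>m n. fst v *\<^sub>R dd (Suc m) n s p + snd v *\<^sub>R dd m (Suc n) s p)))) (at p)"
proof -
  have N: "open N" "smooth_on N s" using assms(1) unfolding s_def
    by (auto simp: local_section_def intro!: smooth_on_snd)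
  have "(dd m n s has_derivative (\<lambda>v. fst v *\<^sub>R dd (Suc m) n s p + snd v *\<^sub>R dd m (Suc n) s p)) (at p)" for m n
  proof -
    have df: "dd m n s differentiable (at p)"
      by (rule smooth_on_differentiable[OF smooth_on_dd[OF N] assms(2)])
    have "pd v (dd m n s) p = fst v *\<^sub>R dd (Suc m) n s p + snd v *\<^sub>R dd m (Suc n) s p" for v
      using pd_base[OF df, of v] d1_dd[OF N, of m n p] d2_dd[OF N assms(2), of m n] by simp
    then show ?thesis using has_pd[OF df] by simp
  qed
  then show ?thesis
    unfolding sjet_def[abs_def] jet_eq_jet_of s_def comp_def
    by (intro has_derivative_Pair has_derivative_ident has_derivative_jet_of)
qed

lemma sjet_eqD:
  assumes "sjet k S' p = sjet k S p" "m + n \<le> k"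
  shows "dd m n (\<lambda>q. snd (S' q)) p = dd m n (\<lambda>q. snd (S q)) p"
  using assms by (simp add: sjet_def jet_eq_jet_of jet_of_eq_iff comp_def)

text \<open>The differential of a \<open>k\<close>-jet prolongation involves the derivatives of the section up to order
  \<open>k + 1\<close>, so the plane does not depend on the section that represents the jet.\<close>

lemma jet_plane_eq:
  assumes "local_section N S" "p \<in> N"
  defines "s \<equiv> \<lambda>q. snd (S q)"
  shows "jet_plane k (sjet (Suc k) S p) =
    {(v, jet_of k (\<lambda>m n. fst v *\<^sub>R dd (Suc m) n s p + snd v *\<^sub>R dd m (Suc n) s p)) | v. True}"
proof -
  have *: "frechet_derivative (sjet k S') (at p) v =
      (v, jet_of k (\<lambda>m n. fst v *\<^sub>R dd (Suc m) n s p + snd v *\<^sub>R dd m (Suc n) s p))"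
    if S': "p \<in> N'" "local_section N' S'" "sjet (Suc k) S' p = sjet (Suc k) S p" for S' N' v
    unfolding frechet_derivative_at[OF has_derivative_sjet[OF S'(2,1)], symmetric] prod.inject jet_of_eq_iff s_def
    using sjet_eqD[OF S'(3)] by simp
  have fp: "fst (sjet (Suc k) S p) = p" by (simp add: sjet_def)
  show ?thesis unfolding jet_plane_def fp
  proof (intro equalityI subsetI)
    fix \<xi> assume "\<xi> \<in> {frechet_derivative (sjet k Sa) (at p) v |Sa Na v.
        p \<in> Na \<and> local_section Na Sa \<and> sjet (Suc k) Sa p = sjet (Suc k) S p}"
    then show "\<xi> \<in> {(v, jet_of k (\<lambda>m n. fst v *\<^sub>R dd (Suc m) n s p + snd v *\<^sub>R dd m (Suc n) s p)) | v. True}"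
      using * by blast
  next
    fix \<xi> assume "\<xi> \<in> {(v, jet_of k (\<lambda>m n. fst v *\<^sub>R dd (Suc m) n s p + snd v *\<^sub>R dd m (Suc n) s p)) | v. True}"
    then obtain v where "\<xi> = frechet_derivative (sjet k S) (at p) v"
      using *[OF assms(2,1) refl] by auto
    then show "\<xi> \<in> {frechet_derivative (sjet k Sa) (at p) v |Sa Na v.
        p \<in> Na \<and> local_section Na Sa \<and> sjet (Suc k) Sa p = sjet (Suc k) S p}"
      using assms(1,2) by blast
  qed
qed

lemma has_lift_iff:
  assumes S: "local_section N S" "p \<in> N"
  defines "s \<equiv> \<lambda>q. snd (S q)"
  shows "has_lift 0 X (sjet 0 S p) \<xi> \<longleftrightarrow> (\<exists>D U e \<Phi>. local_flow X D U e \<Phi> \<and> p \<in> U) \<and>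
      \<xi> = (X p, jet_of 0 (\<lambda>_ _. delta X s p))" (is ?A)
    and "has_lift 1 X (sjet 1 S p) \<xi> \<longleftrightarrow> (\<exists>D U e \<Phi>. local_flow X D U e \<Phi> \<and> p \<in> U) \<and>
      \<xi> = (X p, jet_of 1 (jet1c (delta X s p)
         (d1 (delta X s) p - (fst (d1 X p) *\<^sub>R d1 s p + snd (d1 X p) *\<^sub>R d2 s p))
         (d2 (delta X s) p - (fst (d2 X p) *\<^sub>R d1 s p + snd (d2 X p) *\<^sub>R d2 s p))))" (is ?B)
proof -
  have fp: "fst (sjet k S p) = p" for k by (simp add: sjet_def)
  note d = flow_lift_derivative[OF _ S(1) _ S(2), folded s_def]
  show ?A ?B unfolding has_lift_def fp using d vector_derivative_unique_at by blast+
qed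

text \<open>The equation of the isotropy space over the zeroth jets for a field with Taylor coefficients \<open>c\<close> whose
  first derivatives vanish.\<close>

definition iso0 :: "(base \<Rightarrow> fibre) \<Rightarrow> base \<Rightarrow> (nat \<Rightarrow> nat \<Rightarrow> base) \<Rightarrow> bool" where
  "iso0 s p c \<longleftrightarrow>
    (snd (c 2 0), 2 * snd (c 1 1) - fst (c 2 0), snd (c 0 2) - 2 * fst (c 1 1), - fst (c 0 2))
      = fst (c 0 0) *\<^sub>R d1 s p + snd (c 0 0) *\<^sub>R d2 s p"

text \<open>The additional equations over the first jets: the two derivatives of the equation \<open>iso0\<close>, in which
  the second derivatives of the field are multiplied by the coefficients of the equation.\<close>

definition iso1 :: "(base \<Rightarrow> fibre) \<Rightarrow> base \<Rightarrow> (nat \<Rightarrow> nat \<Rightarrow> base) \<Rightarrow> bool" where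
  "iso1 s p c \<longleftrightarrow> (let u0 = fst (s p); u1 = fst (snd (s p)); u2 = fst (snd (snd (s p))); u3 = snd (snd (snd (s p))) in
    (u0 * (snd (c 1 1) - 2 * fst (c 2 0)) - u1 * snd (c 2 0) + snd (c 3 0),
     - u1 * fst (c 2 0) - 3 * u0 * fst (c 1 1) - 2 * u2 * snd (c 2 0) + 2 * snd (c 2 1) - fst (c 3 0),
     - u2 * snd (c 1 1) - 2 * u1 * fst (c 1 1) - 3 * u3 * snd (c 2 0) + snd (c 1 2) - 2 * fst (c 2 1),
     u3 * (fst (c 2 0) - 2 * snd (c 1 1)) - u2 * fst (c 1 1) - fst (c 1 2))
      = fst (c 0 0) *\<^sub>R d1 (d1 s) p + snd (c 0 0) *\<^sub>R d1 (d2 s) p \<and>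
    (u0 * (snd (c 0 2) - 2 * fst (c 1 1)) - u1 * snd (c 1 1) + snd (c 2 1),
     - u1 * fst (c 1 1) - 3 * u0 * fst (c 0 2) - 2 * u2 * snd (c 1 1) + 2 * snd (c 1 2) - fst (c 2 1),
     - u2 * snd (c 0 2) - 2 * u1 * fst (c 0 2) - 3 * u3 * snd (c 1 1) + snd (c 0 3) - 2 * fst (c 1 2),
     u3 * (fst (c 1 1) - 2 * snd (c 0 2)) - u2 * fst (c 0 2) - fst (c 0 3))
      = fst (c 0 0) *\<^sub>R d1 (d2 s) p + snd (c 0 0) *\<^sub>R d2 (d2 s) p)"

definition has_flow_at :: "(base \<Rightarrow> base) \<Rightarrow> base \<Rightarrow> bool" where
  "has_flow_at X p \<longleftrightarrow> (\<exists>D U e \<Phi>. local_flow X D U e \<Phi> \<and> p \<in> U)"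

lemma has_flow_at_smooth: "has_flow_at X p \<Longrightarrow> \<exists>U. open U \<and> p \<in> U \<and> smooth_on U X"
  unfolding has_flow_at_def local_flow_def using smooth_on_subset by blast

text \<open>Both the value of the lift and the tangent vectors of the plane \<open>\<H>\<close> are determined by their base
  component, so that membership is an equation between the fibre components. Over the first jets the
  terms with first derivatives of the field drop out.\<close>

lemma isotropy_iff:
  assumes S: "local_section N S" "p \<in> N"
  defines "s \<equiv> \<lambda>q. snd (S q)"
  assumes z: "dd 1 0 X p = 0" "dd 0 1 X p = 0"
  shows "has_lift 0 X (sjet 0 S p) \<xi> \<and> \<xi> \<in> jet_plane 0 (sjet 1 S p) \<longleftrightarrow> has_flow_at X p \<and>
      \<xi> = (X p, jet_of 0 (\<lambda>_ _. delta X s p)) \<and> iso0 s p (\<lambda>m n. dd m n X p)"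
    and "(\<exists>\<xi>. has_lift 1 X (sjet 1 S p) \<xi> \<and> \<xi> \<in> jet_plane 1 (sjet 2 S p)) \<longleftrightarrow> has_flow_at X p \<and>
      iso0 s p (\<lambda>m n. dd m n X p) \<and> iso1 s p (\<lambda>m n. dd m n X p)"
proof -
  have z': "d1 X p = 0" "d2 X p = 0" using z by (simp_all add: dd_numeral)
  have N: "open N" "smooth_on N s" using S(1) unfolding s_def
    by (auto simp: local_section_def intro!: smooth_on_snd)
  show "has_lift 0 X (sjet 0 S p) \<xi> \<and> \<xi> \<in> jet_plane 0 (sjet 1 S p) \<longleftrightarrow> has_flow_at X p \<and>
      \<xi> = (X p, jet_of 0 (\<lambda>_ _. delta X s p)) \<and> iso0 s p (\<lambda>m n. dd m n X p)"
  proof -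
    have g: "(x, w) \<in> {(v, F v) | v. True} \<longleftrightarrow> w = F x" for x :: base and w and F :: "base \<Rightarrow> fibre coeffs"
      by blast
    show ?thesis
      unfolding has_lift_iff(1)[OF S, folded s_def] One_nat_def jet_plane_eq[OF S, folded s_def] has_flow_at_def[symmetric]
      by (simp add: g iso0_def jet_of_eq_iff delta_at[OF z'] dd_simps cong: conj_cong del: split_paired_Ex)
  qed
  have "iso0 s p (\<lambda>m n. dd m n X p) \<and> iso1 s p (\<lambda>m n. dd m n X p) \<longleftrightarrow>
    (X p, jet_of 1 (jet1c (delta X s p)
         (d1 (delta X s) p - (fst (d1 X p) *\<^sub>R d1 s p + snd (d1 X p) *\<^sub>R d2 s p))
         (d2 (delta X s) p - (fst (d2 X p) *\<^sub>R d1 s p + snd (d2 X p) *\<^sub>R d2 s p)))) \<in> jet_plane 1 (sjet 2 S p)"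
    if flow: "has_flow_at X p"
  proof -
    obtain U where U: "open U" "p \<in> U" "smooth_on U X" using has_flow_at_smooth[OF flow] by blast
    define M where "M = U \<inter> N"
    have M: "open M" "p \<in> M" "smooth_on M X" "smooth_on M s" 
      using U N S by (auto simp: M_def intro: smooth_on_subset)
    have com: "d2 (d1 s) p = d1 (d2 s) p" by (rule d_commute[OF N(1) S(2) N(2)])
    have g: "(x, w) \<in> {(v, F v) | v. True} \<longleftrightarrow> w = F x" for x :: base and w and F :: "base \<Rightarrow> fibre coeffs"
      by blast
    have jp: "jet_plane 1 (sjet 2 S p) =
      {(v, jet_of 1 (\<lambda>m n. fst v *\<^sub>R dd (Suc m) n s p + snd v *\<^sub>R dd m (Suc n) s p)) | v. True}"
      using jet_plane_eq[OF S, of 1, folded s_def] by (simp add: numeral_2_eq_2 One_nat_def)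
    have ds: "dd (Suc 0) 0 s p = d1 s p" "dd (Suc 0) 1 s p = d1 (d2 s) p" "dd 0 (Suc 0) s p = d2 s p"
      "dd (Suc 1) 0 s p = d1 (d1 s) p" "dd 1 (Suc 0) s p = d1 (d2 s) p" "dd 0 (Suc 1) s p = d2 (d2 s) p"
      by (simp_all add: dd_def One_nat_def)
    show ?thesis
      unfolding jp g jet_of_eq_iff multiindex_le1 ds
      using pd_delta_at[OF M z', of "(1,0)"] pd_delta_at[OF M z', of "(0,1)"]
        delta_at[OF z', of s] pd_third[OF M(1-3)]
      by (simp add: iso0_def iso1_def Let_def jet1c_def z' dd_simps(1) d1_eq[symmetric] d2_eq[symmetric])
  qed
  then show "(\<exists>\<xi>. has_lift 1 X (sjet 1 S p) \<xi> \<and> \<xi> \<in> jet_plane 1 (sjet 2 S p)) \<longleftrightarrow> has_flow_at X p \<and>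
      iso0 s p (\<lambda>m n. dd m n X p) \<and> iso1 s p (\<lambda>m n. dd m n X p)"
    unfolding has_lift_iff(2)[OF S, folded s_def] has_flow_at_def[symmetric] by blast
qed

text \<open>The relative invariants of Liouville.\<close>

definition liouville1 :: "(base \<Rightarrow> fibre) \<Rightarrow> base \<Rightarrow> real" where
  "liouville1 s p = (let u0 = fst (s p); u1 = fst (snd (s p)); u2 = fst (snd (snd (s p))); u3 = snd (snd (snd (s p)));
     sx = d1 s p; sy = d2 s p
   in 3 * fst (d2 (d2 s) p) - 2 * fst (snd (d1 (d2 s) p)) + fst (snd (snd (d1 (d1 s) p)))
     - 3 * u0 * fst (snd (snd sy)) + 6 * u0 * snd (snd (snd sx)) + 2 * u1 * fst (snd sy) - u1 * fst (snd (snd sx))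
     - 3 * u2 * fst sy + 3 * u3 * fst sx)"

definition liouville2 :: "(base \<Rightarrow> fibre) \<Rightarrow> base \<Rightarrow> real" where
  "liouville2 s p = (let u0 = fst (s p); u1 = fst (snd (s p)); u2 = fst (snd (snd (s p))); u3 = snd (snd (snd (s p)));
     sx = d1 s p; sy = d2 s p
   in fst (snd (d2 (d2 s) p)) - 2 * fst (snd (snd (d1 (d2 s) p))) + 3 * snd (snd (snd (d1 (d1 s) p)))
     + 3 * u1 * snd (snd (snd sx)) - 3 * u0 * snd (snd (snd sy)) - 6 * u3 * fst sy + 3 * u3 * fst (snd sx)
     + u2 * fst (snd sy) - 2 * u2 * fst (snd (snd sx)))"

text \<open>The second-order part of the element with value \<open>v\<close> of the horizontal space. The bracket condition
  makes the second derivatives of the field a trilinear symmetric expression \<open>T\<close> in \<open>v\<close> and the two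
  directions of differentiation, and the isotropy equations determine \<open>T\<close>.\<close>

definition hjet2 :: "(base \<Rightarrow> fibre) \<Rightarrow> base \<Rightarrow> base \<Rightarrow> nat \<Rightarrow> nat \<Rightarrow> base" where
  "hjet2 s p v m n = (let sx = d1 s p; sy = d2 s p;
     T111 = (2 * fst sy - fst (snd sx), fst sx);
     T112 = ((fst (snd sy) - 2 * fst (snd (snd sx))) / 3, fst sy);
     T122 = (- snd (snd (snd sx)), (2 * fst (snd sy) - fst (snd (snd sx))) / 3);
     T222 = (- snd (snd (snd sy)), fst (snd (snd sy)) - 2 * snd (snd (snd sx)))
   in if m = 0 \<and> n = 0 then v
      else if m = 2 \<and> n = 0 then fst v *\<^sub>R T111 + snd v *\<^sub>R T112
      else if m = 1 \<and> n = 1 then fst v *\<^sub>R T112 + snd v *\<^sub>R T122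
      else if m = 0 \<and> n = 2 then fst v *\<^sub>R T122 + snd v *\<^sub>R T222
      else 0)"

text \<open>The element with value \<open>v\<close> of the horizontal space of third jets. The numbers \<open>R\<close> are the right-hand
  sides of the differentiated isotropy equations, in which the third derivatives are isolated.\<close>

definition hjet :: "(base \<Rightarrow> fibre) \<Rightarrow> base \<Rightarrow> base \<Rightarrow> nat \<Rightarrow> nat \<Rightarrow> base" where
  "hjet s p v m n = (let u0 = fst (s p); u1 = fst (snd (s p)); u2 = fst (snd (snd (s p))); u3 = snd (snd (snd (s p)));
     a = hjet2 s p v 2 0; b = hjet2 s p v 1 1; c = hjet2 s p v 0 2;
     D1 = fst v *\<^sub>R d1 (d1 s) p + snd v *\<^sub>R d1 (d2 s) p; D2 = fst v *\<^sub>R d1 (d2 s) p + snd v *\<^sub>R d2 (d2 s) p;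
     R01 = fst D1 - u0 * (snd b - 2 * fst a) + u1 * snd a;
     R02 = fst D2 - u0 * (snd c - 2 * fst b) + u1 * snd b;
     R11 = fst (snd D1) + u1 * fst a + 3 * u0 * fst b + 2 * u2 * snd a;
     R12 = fst (snd D2) + u1 * fst b + 3 * u0 * fst c + 2 * u2 * snd b;
     R21 = fst (snd (snd D1)) + u2 * snd b + 2 * u1 * fst b + 3 * u3 * snd a;
     R22 = fst (snd (snd D2)) + u2 * snd c + 2 * u1 * fst c + 3 * u3 * snd b;
     R31 = snd (snd (snd D1)) - u3 * (fst a - 2 * snd b) + u2 * fst b;
     R32 = snd (snd (snd D2)) - u3 * (fst b - 2 * snd c) + u2 * fst c
   in if m = 3 \<and> n = 0 then (2 * R02 - R11, R01)
      else if m = 2 \<and> n = 1 then ((R12 - 2 * R21) / 3, R02)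
      else if m = 1 \<and> n = 2 then (- R31, (2 * R12 - R21) / 3)
      else if m = 0 \<and> n = 3 then (- R32, R22 - 2 * R31)
      else hjet2 s p v m n)"

lemma hjet_vals:
  "hjet s p v 0 0 = v" "hjet s p v 1 0 = 0" "hjet s p v 0 1 = 0"
  "hjet s p v 2 0 = hjet2 s p v 2 0" "hjet s p v 1 1 = hjet2 s p v 1 1" "hjet s p v 0 2 = hjet2 s p v 0 2"
  by (simp_all add: hjet_def hjet2_def Let_def)

lemma hjet2_linear:
  "hjet2 s p (v + w) m n = hjet2 s p v m n + hjet2 s p w m n"
  "hjet2 s p (r *\<^sub>R v) m n = r *\<^sub>R hjet2 s p v m n"
  unfolding hjet2_def Let_def
  by (simp_all add: scaleR_add_left scaleR_add_right add_ac del: scaleR_Pair add_Pair)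

lemma hjet_linear:
  "hjet s p (v + w) m n = hjet s p v m n + hjet s p w m n"
  "hjet s p (r *\<^sub>R v) m n = r *\<^sub>R hjet s p v m n"
proof -
  show "hjet s p (v + w) m n = hjet s p v m n + hjet s p w m n"
    unfolding hjet_def Let_def hjet2_linear by (simp add: prod_eq_iff) (simp add: algebra_simps add_divide_distrib diff_divide_distrib)
  show "hjet s p (r *\<^sub>R v) m n = r *\<^sub>R hjet s p v m n"
    unfolding hjet_def Let_def hjet2_linear by (simp add: prod_eq_iff) (simp add: algebra_simps add_divide_distrib diff_divide_distrib)
qed

lemma iso0_hjet: "iso0 s p (hjet s p v)"
  by (simp add: iso0_def hjet_vals) (simp add: hjet2_def Let_def prod_eq_iff field_simps)

lemma iso1_hjet: "iso1 s p (hjet s p v)"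
proof -
  define a b d where "a = hjet2 s p v 2 0" and "b = hjet2 s p v 1 1" and "d = hjet2 s p v 0 2"
  show ?thesis
    unfolding iso1_def hjet_vals hjet_def[of s p v 3 0] hjet_def[of s p v 2 1] hjet_def[of s p v 1 2] hjet_def[of s p v 0 3]
      a_def[symmetric] b_def[symmetric] d_def[symmetric]
    by (simp add: Let_def prod_eq_iff) argo
qed

text \<open>Eight linear equations for the eight second derivatives that remain after the bracket condition.\<close>

lemma iso0_unique:
  assumes "iso0 s p c" "iso0 s p c'" "c 0 0 = (1, 0)" "c' 0 0 = (0, 1)" "c' 2 0 = c 1 1" "c' 1 1 = c 0 2"
  shows "c 2 0 = hjet s p (1, 0) 2 0 \<and> c 1 1 = hjet s p (1, 0) 1 1 \<and> c 0 2 = hjet s p (1, 0) 0 2 \<and>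
    c' 2 0 = hjet s p (0, 1) 2 0 \<and> c' 1 1 = hjet s p (0, 1) 1 1 \<and> c' 0 2 = hjet s p (0, 1) 0 2"
  using assms unfolding hjet_vals by (simp add: iso0_def hjet2_def Let_def prod_eq_iff)

lemma iso1_unique:
  assumes "iso1 s p c" "c 0 0 = v" "c 2 0 = hjet s p v 2 0" "c 1 1 = hjet s p v 1 1" "c 0 2 = hjet s p v 0 2"
  shows "c 3 0 = hjet s p v 3 0 \<and> c 2 1 = hjet s p v 2 1 \<and> c 1 2 = hjet s p v 1 2 \<and> c 0 3 = hjet s p v 0 3"
proof -
  define a b d where "a = hjet2 s p v 2 0" and "b = hjet2 s p v 1 1" and "d = hjet2 s p v 0 2"
  show ?thesis
    using assms(1) unfolding iso1_def assms(2-5) hjet_vals hjet_def[of s p v 3 0] hjet_def[of s p v 2 1] hjet_def[of s p v 1 2] hjet_def[of s p v 0 3]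
      a_def[symmetric] b_def[symmetric] d_def[symmetric]
    by (simp add: Let_def prod_eq_iff)
qed

text \<open>The components of the bracket of the elements with values \<open>v\<close> and \<open>w\<close>. The components of order two
  have the symmetries that define the space \<open>g\<close>.\<close>

lemma curvature_hjet:
  defines "D \<equiv> \<lambda>s p v w m n. fst v *\<^sub>R hjet s p w (Suc m) n + snd v *\<^sub>R hjet s p w m (Suc n)
    - (fst w *\<^sub>R hjet s p v (Suc m) n + snd w *\<^sub>R hjet s p v m (Suc n))"
  shows "D s p v w 0 0 = 0" "D s p v w 1 0 = 0" "D s p v w 0 1 = 0"
    "D s p v w 2 0 = ((fst v * snd w - snd v * fst w) / 3) *\<^sub>R (2 * liouville1 s p, 0)"
    "D s p v w 1 1 = ((fst v * snd w - snd v * fst w) / 3) *\<^sub>R (liouville2 s p, liouville1 s p)"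
    "D s p v w 0 2 = ((fst v * snd w - snd v * fst w) / 3) *\<^sub>R (0, 2 * liouville2 s p)"
  unfolding D_def by (simp_all add: hjet_def hjet2_def liouville1_def liouville2_def Let_def prod_eq_iff field_simps)


section \<open>The horizontal spaces and the obstruction form\<close>

lemma bounded_linear_rho: "bounded_linear (rho :: base coeffs \<Rightarrow> base)"
proof (rule bounded_linear_intro[of _ 1])
  show "rho (x + y) = rho x + rho y" for x y :: "base coeffs" by (simp add: rho_def lookup_add)
  show "rho (r *\<^sub>R x) = r *\<^sub>R rho x" for r and x :: "base coeffs" by (simp add: rho_def lookup_scaleR)
  show "norm (rho x) \<le> norm x * 1" for x :: "base coeffs"
  proof (cases "(0, 0) \<in> Poly_Mapping.keys x")
    case True
    have "norm (Poly_Mapping.lookup x (0, 0)) \<le> (\<Sum>n\<in>Poly_Mapping.keys x. norm (Poly_Mapping.lookup x n))"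
      by (rule member_le_sum[OF True]) auto
    then show ?thesis by (simp add: rho_def norm_poly_mapping_def dist_poly_mapping_def)
  qed (simp add: rho_def in_keys_iff)
qed

lemma linear_rho: "linear (rho :: base coeffs \<Rightarrow> base)"
  using bounded_linear_rho bounded_linear.linear by blast

text \<open>The space has dimension two and is mapped onto the plane.\<close>

lemma horizontal_inj:
  assumes "horizontal k p H"
  shows "inj_on rho H"
proof -
  have H: "subspace H" "dim H = 2" "rho ` H = UNIV" using assms by (auto simp: horizontal_def)
  obtain B where B: "B \<subseteq> H" "independent B" "H \<subseteq> span B" "card B = dim H"
    using basis_exists[of H] by blast
  obtain b1 b2 where b: "B = {b1, b2}" using B(4) H(2) card_2_iff by metis
  have lc: "\<exists>x y. h = x *\<^sub>R b1 + y *\<^sub>R b2" if "h \<in> H" for h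
    using B(3) that unfolding b span_insert span_singleton by (auto simp: algebra_simps eq_diff_eq)
  have r: "rho (x *\<^sub>R b1 + y *\<^sub>R b2) = x *\<^sub>R rho b1 + y *\<^sub>R rho b2" for x y
    by (simp add: linear_add[OF linear_rho] linear_scale[OF linear_rho])
  obtain h1 h2 where "h1 \<in> H" "rho h1 = (1, 0)" "h2 \<in> H" "rho h2 = (0, 1)" using H(3) by (metis UNIV_I imageE)
  then obtain a b c d where 1: "a *\<^sub>R rho b1 + b *\<^sub>R rho b2 = (1, 0)" and 2: "c *\<^sub>R rho b1 + d *\<^sub>R rho b2 = (0, 1)"
    using lc r by metis
  have zero: "h = 0" if h: "h \<in> H" "rho h = 0" for h
  proof -
    obtain x y where xy: "h = x *\<^sub>R b1 + y *\<^sub>R b2" using lc[OF h(1)] by blast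
    have e: "x * fst (rho b1) + y * fst (rho b2) = 0" "x * snd (rho b1) + y * snd (rho b2) = 0"
      using h(2) r[of x y] xy by (auto simp: prod_eq_iff)
    have f: "a * fst (rho b1) + b * fst (rho b2) = 1" "a * snd (rho b1) + b * snd (rho b2) = 0"
      "c * fst (rho b1) + d * fst (rho b2) = 0" "c * snd (rho b1) + d * snd (rho b2) = 1"
      using 1 2 by (auto simp: prod_eq_iff)
    have D: "(a * d - b * c) * (fst (rho b1) * snd (rho b2) - fst (rho b2) * snd (rho b1)) = 1"
      using f by algebra
    have "x * (fst (rho b1) * snd (rho b2) - fst (rho b2) * snd (rho b1)) = 0"
      "y * (fst (rho b1) * snd (rho b2) - fst (rho b2) * snd (rho b1)) = 0" using e by algebra+
    then have "x = 0" "y = 0" using D by auto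
    then show ?thesis using xy by simp
  qed
  show ?thesis
  proof (rule inj_onI)
    fix x y assume "x \<in> H" "y \<in> H" "rho x = rho y"
    then have "x - y \<in> H" "rho (x - y) = 0" using H(1) by (auto simp: subspace_diff linear_diff[OF linear_rho])
    then show "x = y" using zero by fastforce
  qed
qed

lemma horizontal_graph:
  fixes \<alpha> :: "base \<Rightarrow> base coeffs"
  assumes lin: "linear \<alpha>" and r: "\<And>v. rho (\<alpha> v) = v" and vj: "\<And>v. \<alpha> v \<in> vjets k p"
  shows "horizontal k p (range \<alpha>)"
proof -
  have sp: "range \<alpha> = span {\<alpha> (1, 0), \<alpha> (0, 1)}"
  proof (intro equalityI subsetI)
    fix x assume "x \<in> range \<alpha>"
    then obtain v where "x = \<alpha> v" by blast
    moreover have "v = fst v *\<^sub>R (1, 0) + snd v *\<^sub>R (0, 1)" by (simp add: prod_eq_iff)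
    ultimately have "x = fst v *\<^sub>R \<alpha> (1, 0) + snd v *\<^sub>R \<alpha> (0, 1)"
      by (metis linear_add[OF lin] linear_scale[OF lin])
    then show "x \<in> span {\<alpha> (1, 0), \<alpha> (0, 1)}"
      by (metis insertCI span_add span_base span_scale)
  next
    fix x assume "x \<in> span {\<alpha> (1, 0), \<alpha> (0, 1)}"
    moreover have "subspace (range \<alpha>)" by (rule linear_subspace_image[OF lin subspace_UNIV])
    ultimately show "x \<in> range \<alpha>"
      using span_minimal[of "{\<alpha> (1, 0), \<alpha> (0, 1)}" "range \<alpha>"] by auto
  qed
  have ne: "\<alpha> (1, 0) \<noteq> \<alpha> (0, 1)" using r by (metis prod.inject zero_neq_one)
  have "independent {\<alpha> (1, 0), \<alpha> (0, 1)}"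
  proof -
    have "\<alpha> (0, 1) \<noteq> 0" using r[of "(0,1)"] linear_0[OF linear_rho] by (auto simp: zero_prod_def)
    moreover have "\<alpha> (1, 0) \<notin> span {\<alpha> (0, 1)}"
    proof
      assume "\<alpha> (1, 0) \<in> span {\<alpha> (0, 1)}"
      then obtain c where "\<alpha> (1, 0) = c *\<^sub>R \<alpha> (0, 1)" by (auto simp: span_singleton)
      then have "rho (\<alpha> (1, 0)) = c *\<^sub>R rho (\<alpha> (0, 1))" by (simp add: linear_scale[OF linear_rho])
      then show False by (simp add: r)
    qed
    ultimately show ?thesis by (simp add: independent_insert ne)
  qed
  then have "dim (range \<alpha>) = 2" unfolding sp using ne by (simp add: dim_eq_card_independent)
  moreover have "subspace (range \<alpha>)" by (rule linear_subspace_image[OF lin subspace_UNIV])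
  moreover have "rho ` range \<alpha> = UNIV" using r by (metis surjI image_image range_composition surj_def)
  ultimately show ?thesis using vj unfolding horizontal_def by auto
qed

lemma the_inv_into_graph:
  assumes "\<And>v. rho (\<alpha> v) = v"
  shows "the_inv_into (range \<alpha>) rho v = \<alpha> v"
proof (rule the_inv_into_f_eq)
  show "inj_on rho (range \<alpha>)" by (rule inj_onI) (use assms in auto)
qed (use assms in auto)

text \<open>Replacing the coefficients of \<open>X\<close> and \<open>Y\<close> by their values at \<open>p\<close> changes the bracket by products of
  a function vanishing to second order with a derivative that vanishes to first order.\<close>

lemma dd_lie_bracket:
  fixes X Y :: "base \<Rightarrow> base"
  assumes U: "open U" "p \<in> U" "smooth_on U X" "smooth_on U Y"
    and z: "d1 X p = 0" "d2 X p = 0" "d1 Y p = 0" "d2 Y p = 0" and mn: "m + n \<le> 2"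
  shows "dd m n (lie_bracket X Y) p = fst (X p) *\<^sub>R dd (Suc m) n Y p + snd (X p) *\<^sub>R dd m (Suc n) Y p
    - (fst (Y p) *\<^sub>R dd (Suc m) n X p + snd (Y p) *\<^sub>R dd m (Suc n) X p)"
proof -
  define v w where "v = X p" and "w = Y p"
  define K where "K q = fst v *\<^sub>R d1 Y q + snd v *\<^sub>R d2 Y q - (fst w *\<^sub>R d1 X q + snd w *\<^sub>R d2 X q)" for q
  note sm = smooth_intros U
  have sK: "smooth_on U K" unfolding K_def[abs_def] by (intro sm)
  define R where "R q = (fst (X q - v) *\<^sub>R d1 Y q + snd (X q - v) *\<^sub>R d2 Y q)
    - (fst (Y q - w) *\<^sub>R d1 X q + snd (Y q - w) *\<^sub>R d2 X q)" for q
  have eq: "lie_bracket X Y q - K q = R q" if "q \<in> U" for q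
    unfolding lie_bracket_eq[OF U(1,2) U(3,4) that] K_def R_def by (simp add: algebra_simps)
  have v2: "vanish 2 (\<lambda>q. X q - v) p" "vanish 2 (\<lambda>q. Y q - w) p"
  proof -
    have "d1 (\<lambda>q. Z q - c) p = d1 Z p" "d2 (\<lambda>q. Z q - c) p = d2 Z p" if "smooth_on U Z" for Z :: "base \<Rightarrow> base" and c
      using smooth_on_differentiable[OF that U(2)] by (simp_all add: d1_eq d2_eq pds dfs)
    then show "vanish 2 (\<lambda>q. X q - v) p" "vanish 2 (\<lambda>q. Y q - w) p"
      using U z by (simp_all add: numeral_2_eq_2 v_def w_def)
  qed
  have v1: "vanish 1 (d1 X) p" "vanish 1 (d2 X) p" "vanish 1 (d1 Y) p" "vanish 1 (d2 Y) p"
    using z by (simp_all add: One_nat_def)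
  have le: "3 \<le> 2 + (1::nat)" by simp
  have "vanish 3 R p" unfolding R_def[abs_def]
    by (intro vanish_diff[OF U(1,2)] vanish_add[OF U(1,2)] vanish_scaleR[OF U(1,2) _ _ _ _ le] v1
        vanish_bounded_linear[OF U(1,2) bounded_linear_fst] vanish_bounded_linear[OF U(1,2) bounded_linear_snd] v2 sm)
  then have "vanish 3 (\<lambda>q. lie_bracket X Y q - K q) p"
    by (rule vanish_transfer[OF U(1,2)]) (rule eq)
  then have "dd m n (\<lambda>q. lie_bracket X Y q - K q) p = 0"
    using vanish_dd[OF U(1,2) smooth_on_diff[OF U(1) smooth_on_lie_bracket[OF U(1,2) U(3,4)] sK], of 3] mn by simp
  then have "dd m n (lie_bracket X Y) p = dd m n K p"
    using dd_diff[OF U(1,2) smooth_on_lie_bracket[OF U(1,2) U(3,4)] sK U(2), of m n] by simp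
  also have "\<dots> = dd m n (\<lambda>q. fst v *\<^sub>R d1 Y q + snd v *\<^sub>R d2 Y q) p - dd m n (\<lambda>q. fst w *\<^sub>R d1 X q + snd w *\<^sub>R d2 X q) p"
    unfolding K_def[abs_def] by (rule dd_diff[OF U(1,2) _ _ U(2)]) (intro sm)+
  also have "dd m n (\<lambda>q. fst v *\<^sub>R d1 Y q + snd v *\<^sub>R d2 Y q) p = fst v *\<^sub>R dd m n (d1 Y) p + snd v *\<^sub>R dd m n (d2 Y) p"
    by (rule dd_add_scaleR[OF U(1,2)]) (intro sm)+
  also have "dd m n (\<lambda>q. fst w *\<^sub>R d1 X q + snd w *\<^sub>R d2 X q) p = fst w *\<^sub>R dd m n (d1 X) p + snd w *\<^sub>R dd m n (d2 X) p"
    by (rule dd_add_scaleR[OF U(1,2)]) (intro sm)+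
  finally show ?thesis
    unfolding v_def w_def dd_d1[OF U(1,3,2)] dd_d2[OF U(1,3)] dd_d1[OF U(1,4,2)] dd_d2[OF U(1,4)] .
qed

lemma jet_bracket_jet_of:
  assumes X: "has_flow_at X p" "has_flow_at Y p" and z: "dd 1 0 X p = 0" "dd 0 1 X p = 0" "dd 1 0 Y p = 0" "dd 0 1 Y p = 0"
    and k: "k \<le> 2"
  shows "jet_bracket (Suc k) p (jet (Suc k) X p) (jet (Suc k) Y p) =
    jet_of k (\<lambda>m n. fst (X p) *\<^sub>R dd (Suc m) n Y p + snd (X p) *\<^sub>R dd m (Suc n) Y p
    - (fst (Y p) *\<^sub>R dd (Suc m) n X p + snd (Y p) *\<^sub>R dd m (Suc n) X p))"
proof -
  obtain U V where "open U" "p \<in> U" "smooth_on U X" "open V" "p \<in> V" "smooth_on V Y"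
    using has_flow_at_smooth X by metis
  then have M: "open (U \<inter> V)" "p \<in> U \<inter> V" "smooth_on (U \<inter> V) X" "smooth_on (U \<inter> V) Y"
    by (auto intro: smooth_on_subset)
  show ?thesis
    unfolding jet_bracket_eq[OF M] jet_eq_jet_of[of k "lie_bracket X Y"] jet_of_eq_iff
    using dd_lie_bracket[OF M] z k by (simp add: dd_numeral)
qed

text \<open>Isotropy spaces consist of jets of fields that have flows. For nonzero \<open>v\<close> the field can be
  straightened; for \<open>v = 0\<close> all coefficients vanish and the zero field can be taken.\<close>

lemma flow_with_hjet:
  obtains X where "has_flow_at X p" "\<And>m n. m + n \<le> 3 \<Longrightarrow> dd m n X p = hjet s p v m n"
proof (cases "v = 0")
  case False
  obtain X D U e \<Phi> where "local_flow X D U e \<Phi>" "p \<in> U" "jet 3 X p = jet_of 3 (hjet s p v)"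
    by (rule flow_box_jet[OF False, where c = "hjet s p v" and a = p]) (simp_all add: hjet_vals)
  then show ?thesis using that unfolding has_flow_at_def jet_eq_jet_of jet_of_eq_iff by blast
next
  case True
  have id: "smooth_on UNIV (\<lambda>q::base. q)" by (rule smooth_on_id)
  have "point_transformation UNIV (\<lambda>q. q)"
    by (rule point_transformationI[OF open_UNIV open_UNIV id id]) auto
  then have "local_flow (\<lambda>_. 0) UNIV UNIV 1 (\<lambda>t q. q)"
    unfolding local_flow_def
    by (auto intro!: smooth_on_const smooth_on_snd open_Times smooth_on_id simp: case_prod_beta')
  then have 1: "has_flow_at (\<lambda>_. 0) p" unfolding has_flow_at_def by blast
  have 2: "(d2 ^^ n) (\<lambda>_. 0::base) = (\<lambda>_. 0)" for n by (induction n) (auto simp: d2_zero)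
  have 3: "(d1 ^^ n) (\<lambda>_. 0::base) = (\<lambda>_. 0)" for n by (induction n) (auto simp: d1_zero)
  have "hjet s p v m n = 0" for m n using hjet_linear(2)[of s p 0 v m n] True by simp
  then show ?thesis using that[OF 1] by (simp add: dd_def 2 3)
qed

lemma linear_jet_of_hjet: "linear (\<lambda>v. jet_of k (hjet s p v))"
proof (rule linearI)
  show "jet_of k (hjet s p (v + w)) = jet_of k (hjet s p v) + jet_of k (hjet s p w)" for v w
    unfolding jet_of_add by (simp add: hjet_linear[abs_def])
  show "jet_of k (hjet s p (r *\<^sub>R v)) = r *\<^sub>R jet_of k (hjet s p v)" for r v
    unfolding jet_of_scaleR by (simp add: hjet_linear[abs_def])
qed

lemma has_flow_vjets: "has_flow_at X p \<Longrightarrow> jet k X p \<in> vjets k p"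
  using has_flow_at_smooth unfolding vjets_def by blast

lemma horizontal_hjet:
  assumes "k \<le> 3"
  shows "horizontal k p (range (\<lambda>v. jet_of k (hjet s p v)))"
proof (rule horizontal_graph[OF linear_jet_of_hjet])
  show "rho (jet_of k (hjet s p v)) = v" for v by (simp add: hjet_vals)
  show "jet_of k (hjet s p v) \<in> vjets k p" for v
  proof -
    obtain X where X: "has_flow_at X p" "\<And>m n. m + n \<le> 3 \<Longrightarrow> dd m n X p = hjet s p v m n" using flow_with_hjet by blast
    have "jet k X p = jet_of k (hjet s p v)" unfolding jet_eq_jet_of jet_of_eq_iff using X(2) assms by simp
    then show ?thesis using has_flow_vjets[OF X(1)] by metis
  qed
qed

lemma bracket_hjet:
  assumes k: "k \<le> 2"
  shows "horizontal_bracket (Suc k) p (range (\<lambda>v. jet_of (Suc k) (hjet s p v))) v w =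
    jet_of k (\<lambda>m n. fst v *\<^sub>R hjet s p w (Suc m) n + snd v *\<^sub>R hjet s p w m (Suc n)
    - (fst w *\<^sub>R hjet s p v (Suc m) n + snd w *\<^sub>R hjet s p v m (Suc n)))"
proof -
  obtain X where X: "has_flow_at X p" "\<And>m n. m + n \<le> 3 \<Longrightarrow> dd m n X p = hjet s p v m n" using flow_with_hjet by blast
  obtain Y where Y: "has_flow_at Y p" "\<And>m n. m + n \<le> 3 \<Longrightarrow> dd m n Y p = hjet s p w m n" using flow_with_hjet by blast
  have r: "rho (jet_of (Suc k) (hjet s p v)) = v" for v by (simp add: hjet_vals)
  have j: "jet_of (Suc k) (hjet s p v) = jet (Suc k) X p" "jet_of (Suc k) (hjet s p w) = jet (Suc k) Y p"
    unfolding jet_eq_jet_of jet_of_eq_iff using X(2) Y(2) k by simp_all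
  have v: "X p = v" "Y p = w" using X(2)[of 0 0] Y(2)[of 0 0] by (simp_all add: dd_simps hjet_vals)
  have z: "dd 1 0 X p = 0" "dd 0 1 X p = 0" "dd 1 0 Y p = 0" "dd 0 1 Y p = 0"
    using X(2)[of 1 0] X(2)[of 0 1] Y(2)[of 1 0] Y(2)[of 0 1] by (simp_all add: hjet_vals)
  show ?thesis
    unfolding horizontal_bracket_def the_inv_into_graph[OF r] j jet_bracket_jet_of[OF X(1) Y(1) z k] v jet_of_eq_iff
    using X(2) Y(2) k by simp
qed

lemma multiindex_le2: "(\<forall>m n. m + n \<le> 2 \<longrightarrow> P m n) \<longleftrightarrow> P 0 0 \<and> P 1 0 \<and> P 0 1 \<and> P 2 0 \<and> P 1 1 \<and> P 0 2" for P :: "nat \<Rightarrow> nat \<Rightarrow> bool"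
proof
  assume P: "P 0 0 \<and> P 1 0 \<and> P 0 1 \<and> P 2 0 \<and> P 1 1 \<and> P 0 2"
  show "\<forall>m n. m + n \<le> 2 \<longrightarrow> P m n"
  proof (intro allI impI)
    fix m n :: nat assume "m + n \<le> 2"
    then have "(m = 0 \<and> n = 0) \<or> (m = 1 \<and> n = 0) \<or> (m = 0 \<and> n = 1) \<or> (m = 2 \<and> n = 0) \<or> (m = 1 \<and> n = 1) \<or> (m = 0 \<and> n = 2)"
      by linarith
    then show "P m n" using P by auto
  qed
qed simp

lemma multiindex_le3: "(\<forall>m n. m + n \<le> 3 \<longrightarrow> P m n) \<longleftrightarrow> (\<forall>m n. m + n \<le> 2 \<longrightarrow> P m n) \<and> P 3 0 \<and> P 2 1 \<and> P 1 2 \<and> P 0 3"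
  for P :: "nat \<Rightarrow> nat \<Rightarrow> bool"
proof
  assume P: "(\<forall>m n. m + n \<le> 2 \<longrightarrow> P m n) \<and> P 3 0 \<and> P 2 1 \<and> P 1 2 \<and> P 0 3"
  show "\<forall>m n. m + n \<le> 3 \<longrightarrow> P m n"
  proof (intro allI impI)
    fix m n :: nat assume "m + n \<le> 3"
    then have "m + n \<le> 2 \<or> (m = 3 \<and> n = 0) \<or> (m = 2 \<and> n = 1) \<or> (m = 1 \<and> n = 2) \<or> (m = 0 \<and> n = 3)" by linarith
    then show "P m n" using P by auto
  qed
qed simp

lemma iso_cong:
  assumes "\<And>m n. m + n \<le> 3 \<Longrightarrow> c m n = c' m n"
  shows "iso0 s p c \<longleftrightarrow> iso0 s p c'" "iso1 s p c \<longleftrightarrow> iso1 s p c'"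
  by (simp_all add: iso0_def iso1_def assms)

lemma H_const_eq: "H_const p = range (\<lambda>v. jet_of 1 (hjet s p v))"
  unfolding H_const_def jet_eq_jet_of
proof -
  have "jet_of 1 (\<lambda>m n. dd m n (\<lambda>_. v) p) = jet_of 1 (hjet s p v)" for v
    unfolding jet_of_eq_iff multiindex_le1 by (simp add: hjet_vals dd_numeral d1_eq d2_eq dd_simps(1))
  then show "{jet_of 1 (\<lambda>m n. dd m n (\<lambda>_. v) p) |v. True} = range (\<lambda>v. jet_of 1 (hjet s p v))" by auto
qed

text \<open>Any space with the required properties contains elements with the two basis vectors as values. The
  isotropy equations and the bracket condition determine these two elements, and they span the space.\<close>

lemma H_theta1_eq:
  assumes S: "local_section N S" "p \<in> N"
  defines "s \<equiv> \<lambda>q. snd (S q)"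
  shows "H_theta1 (sjet 1 S p) = range (\<lambda>v. jet_of 2 (hjet s p v))"
proof -
  have fp: "fst (sjet 1 S p) = p" by (simp add: sjet_def)
  have jp: "jproj 0 (sjet 1 S p) = sjet 0 S p" by (simp add: jproj_sjet)
  have iso: "\<alpha> \<in> isotropy 0 (sjet 1 S p) \<longleftrightarrow> (\<exists>X \<xi>. \<alpha> = jet 2 X p \<and> has_lift 0 X (sjet 0 S p) \<xi> \<and> \<xi> \<in> jet_plane 0 (sjet 1 S p))" for \<alpha>
    unfolding isotropy_def jp fp by (auto simp: numeral_2_eq_2)
  show ?thesis unfolding H_theta1_def fp
  proof (rule the_equality, intro conjI)
    let ?H = "range (\<lambda>v. jet_of 2 (hjet s p v))"
    show "horizontal 2 p ?H" by (rule horizontal_hjet) simp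
    show "?H \<subseteq> isotropy 0 (sjet 1 S p)"
    proof
      fix \<alpha> assume "\<alpha> \<in> ?H"
      then obtain v where v: "\<alpha> = jet_of 2 (hjet s p v)" by blast
      obtain X where X: "has_flow_at X p" "\<And>m n. m + n \<le> 3 \<Longrightarrow> dd m n X p = hjet s p v m n" using flow_with_hjet by blast
      have z: "dd 1 0 X p = 0" "dd 0 1 X p = 0" using X(2) by (simp_all add: hjet_vals)
      have "iso0 s p (\<lambda>m n. dd m n X p)" using iso_cong(1)[of "\<lambda>m n. dd m n X p" "hjet s p v", OF X(2)] iso0_hjet by simp
      moreover have "\<alpha> = jet 2 X p" unfolding v jet_eq_jet_of jet_of_eq_iff using X(2) by simp
      ultimately show "\<alpha> \<in> isotropy 0 (sjet 1 S p)"
        unfolding iso using isotropy_iff(1)[OF S z, folded s_def] X(1) by blast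
    qed
    show "trunc 1 ` ?H = H_const p"
      unfolding H_const_eq[of p s] image_image by (simp add: trunc_jet_of)
    show "\<forall>v w. horizontal_bracket 2 p ?H v w = 0"
    proof (intro allI)
      fix v w
      have "jet_of 1 (\<lambda>m n. fst v *\<^sub>R hjet s p w (Suc m) n + snd v *\<^sub>R hjet s p w m (Suc n)
        - (fst w *\<^sub>R hjet s p v (Suc m) n + snd w *\<^sub>R hjet s p v m (Suc n))) = jet_of 1 (\<lambda>m n. 0)"
        unfolding jet_of_eq_iff multiindex_le1 using curvature_hjet(1-3) by simp
      then show "horizontal_bracket 2 p ?H v w = 0"
        using bracket_hjet[of 1 p s v w] by (simp add: jet_of_zero numeral_2_eq_2 One_nat_def)
    qed
  next
    fix H
    assume H: "horizontal 2 p H \<and> H \<subseteq> isotropy 0 (sjet 1 S p) \<and> trunc 1 ` H = H_const p \<and>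
      (\<forall>v w. horizontal_bracket 2 p H v w = 0)"
    have inj: "inj_on rho H" by (rule horizontal_inj) (use H in blast)
    have sub: "subspace H" and surj: "rho ` H = UNIV" using H by (auto simp: horizontal_def)
    have ex: "\<exists>h X. h \<in> H \<and> rho h = v \<and> h = jet 2 X p \<and> has_flow_at X p \<and> iso0 s p (\<lambda>m n. dd m n X p) \<and>
      dd 0 0 X p = v \<and> dd 1 0 X p = 0 \<and> dd 0 1 X p = 0" for v
    proof -
      obtain h where h: "h \<in> H" "rho h = v" using surj by (metis UNIV_I imageE)
      obtain X \<xi> where X: "h = jet 2 X p" "has_lift 0 X (sjet 0 S p) \<xi>" "\<xi> \<in> jet_plane 0 (sjet 1 S p)"
        using H h(1) iso by blast
      have "trunc 1 h \<in> H_const p" using H h(1) by blast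
      then obtain w where "jet_of 1 (\<lambda>m n. dd m n X p) = jet_of 1 (hjet s p w)"
        unfolding H_const_eq[of p s] X(1) jet_eq_jet_of by (auto simp: trunc_jet_of)
      then have z: "dd 1 0 X p = 0" "dd 0 1 X p = 0" unfolding jet_of_eq_iff multiindex_le1 by (simp_all add: hjet_vals)
      have "has_flow_at X p \<and> iso0 s p (\<lambda>m n. dd m n X p)"
        using isotropy_iff(1)[OF S z, folded s_def] X(2,3) by blast
      moreover have "dd 0 0 X p = v" using h(2) by (simp add: X(1) jet_eq_jet_of)
      ultimately show ?thesis using h X(1) z by blast
    qed
    obtain h1 X1 where 1: "h1 \<in> H" "rho h1 = (1, 0)" "h1 = jet 2 X1 p" "has_flow_at X1 p" "iso0 s p (\<lambda>m n. dd m n X1 p)"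
      "dd 0 0 X1 p = (1, 0)" "dd 1 0 X1 p = 0" "dd 0 1 X1 p = 0" using ex[of "(1, 0)"] by blast
    obtain h2 X2 where 2: "h2 \<in> H" "rho h2 = (0, 1)" "h2 = jet 2 X2 p" "has_flow_at X2 p" "iso0 s p (\<lambda>m n. dd m n X2 p)"
      "dd 0 0 X2 p = (0, 1)" "dd 1 0 X2 p = 0" "dd 0 1 X2 p = 0" using ex[of "(0, 1)"] by blast
    have inv: "the_inv_into H rho (1, 0) = h1" "the_inv_into H rho (0, 1) = h2"
      using the_inv_into_f_eq[OF inj] 1 2 by blast+
    have "jet_bracket (Suc 1) p (jet (Suc 1) X1 p) (jet (Suc 1) X2 p) = 0"
      using H inv 1(3) 2(3) unfolding horizontal_bracket_def by (metis Suc_1)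
    then have b0: "jet_of 1 (\<lambda>m n. fst (X1 p) *\<^sub>R dd (Suc m) n X2 p + snd (X1 p) *\<^sub>R dd m (Suc n) X2 p
    - (fst (X2 p) *\<^sub>R dd (Suc m) n X1 p + snd (X2 p) *\<^sub>R dd m (Suc n) X1 p)) = jet_of 1 (\<lambda>m n. 0)"
      using jet_bracket_jet_of[OF 1(4) 2(4) 1(7,8) 2(7,8), of 1] by (simp add: jet_of_zero)
    have xp: "X1 p = (1, 0)" "X2 p = (0, 1)" using 1(6) 2(6) by (simp_all add: dd_simps)
    have "dd 2 0 X2 p = dd 1 1 X1 p" "dd 1 1 X2 p = dd 0 2 X1 p"
      using b0 unfolding jet_of_eq_iff multiindex_le1 xp by (simp_all add: numeral_2_eq_2 One_nat_def)
    note u = iso0_unique[OF 1(5) 2(5) 1(6) 2(6) this]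
    have e1: "h1 = jet_of 2 (hjet s p (1, 0))"
      unfolding 1(3) jet_eq_jet_of jet_of_eq_iff multiindex_le2 using u 1 by (simp add: hjet_vals(1-3))
    have e2: "h2 = jet_of 2 (hjet s p (0, 1))"
      unfolding 2(3) jet_eq_jet_of jet_of_eq_iff multiindex_le2 using u 2 by (simp add: hjet_vals(1-3))
    have mem: "jet_of 2 (hjet s p v) \<in> H" for v
    proof -
      have "v = fst v *\<^sub>R (1, 0) + snd v *\<^sub>R (0, 1)" by (simp add: prod_eq_iff)
      then have "jet_of 2 (hjet s p v) = fst v *\<^sub>R h1 + snd v *\<^sub>R h2"
        unfolding e1 e2 by (metis linear_add[OF linear_jet_of_hjet] linear_scale[OF linear_jet_of_hjet])
      then show ?thesis using sub 1(1) 2(1) by (simp add: subspace_add subspace_scale)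
    qed
    show "H = range (\<lambda>v. jet_of 2 (hjet s p v))"
    proof (intro equalityI subsetI)
      fix h assume h: "h \<in> H"
      have "rho (jet_of 2 (hjet s p (rho h))) = rho h" by (simp add: hjet_vals)
      then have "h = jet_of 2 (hjet s p (rho h))" using inj h mem by (metis inj_onD)
      then show "h \<in> range (\<lambda>v. jet_of 2 (hjet s p v))" by blast
    qed (use mem in blast)
  qed
qed

text \<open>Each element of such a space has a known second jet, and then the isotropy equations determine its
  third derivatives.\<close>

lemma H_theta2_eq:
  assumes S: "local_section N S" "p \<in> N"
  defines "s \<equiv> \<lambda>q. snd (S q)"
  shows "H_theta2 (sjet 2 S p) = range (\<lambda>v. jet_of 3 (hjet s p v))"
proof -
  have fp: "fst (sjet 2 S p) = p" by (simp add: sjet_def)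
  have jp: "jproj 1 (sjet 2 S p) = sjet 1 S p" by (simp add: jproj_sjet)
  have iso: "\<alpha> \<in> isotropy 1 (sjet 2 S p) \<longleftrightarrow> (\<exists>X. \<alpha> = jet 3 X p \<and> (\<exists>\<xi>. has_lift 1 X (sjet 1 S p) \<xi> \<and> \<xi> \<in> jet_plane 1 (sjet 2 S p)))" for \<alpha>
    unfolding isotropy_def jp fp by (auto simp: numeral_3_eq_3 One_nat_def)
  note H1 = H_theta1_eq[OF S, folded s_def]
  show ?thesis unfolding H_theta2_def fp jp H1
  proof (rule the_equality, intro conjI)
    let ?H = "range (\<lambda>v. jet_of 3 (hjet s p v))"
    show "horizontal 3 p ?H" by (rule horizontal_hjet) simp
    show "?H \<subseteq> isotropy 1 (sjet 2 S p)"
    proof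
      fix \<alpha> assume "\<alpha> \<in> ?H"
      then obtain v where v: "\<alpha> = jet_of 3 (hjet s p v)" by blast
      obtain X where X: "has_flow_at X p" "\<And>m n. m + n \<le> 3 \<Longrightarrow> dd m n X p = hjet s p v m n" using flow_with_hjet by blast
      have z: "dd 1 0 X p = 0" "dd 0 1 X p = 0" using X(2) by (simp_all add: hjet_vals)
      have "iso0 s p (\<lambda>m n. dd m n X p)" "iso1 s p (\<lambda>m n. dd m n X p)"
        using iso_cong[of "\<lambda>m n. dd m n X p" "hjet s p v", OF X(2)] iso0_hjet iso1_hjet by simp_all
      moreover have "\<alpha> = jet 3 X p" unfolding v jet_eq_jet_of jet_of_eq_iff using X(2) by simp
      ultimately show "\<alpha> \<in> isotropy 1 (sjet 2 S p)"
        unfolding iso using isotropy_iff(2)[OF S z, folded s_def] X(1) by blast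
    qed
    show "trunc 2 ` ?H = range (\<lambda>v. jet_of 2 (hjet s p v))"
      unfolding image_image by (simp add: trunc_jet_of)
  next
    fix H
    assume H: "horizontal 3 p H \<and> H \<subseteq> isotropy 1 (sjet 2 S p) \<and> trunc 2 ` H = range (\<lambda>v. jet_of 2 (hjet s p v))"
    have surj: "rho ` H = UNIV" using H by (auto simp: horizontal_def)
    have eq: "h = jet_of 3 (hjet s p (rho h))" if h: "h \<in> H" for h
    proof -
      obtain X where X: "h = jet 3 X p" "\<exists>\<xi>. has_lift 1 X (sjet 1 S p) \<xi> \<and> \<xi> \<in> jet_plane 1 (sjet 2 S p)"
        using H h iso by blast
      have "trunc 2 h \<in> range (\<lambda>v. jet_of 2 (hjet s p v))" using H h by blast
      then obtain v where v: "jet_of 2 (\<lambda>m n. dd m n X p) = jet_of 2 (hjet s p v)"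
        unfolding X(1) jet_eq_jet_of by (auto simp: trunc_jet_of)
      then have v2: "\<forall>m n. m + n \<le> 2 \<longrightarrow> dd m n X p = hjet s p v m n" unfolding jet_of_eq_iff .
      have z: "dd 1 0 X p = 0" "dd 0 1 X p = 0" using v2 by (simp_all add: hjet_vals)
      have "iso1 s p (\<lambda>m n. dd m n X p)" using isotropy_iff(2)[OF S z, folded s_def] X(2) by blast
      from iso1_unique[OF this, of v] have "\<forall>m n. m + n \<le> 3 \<longrightarrow> dd m n X p = hjet s p v m n"
        unfolding multiindex_le3 using v2 by (simp add: hjet_vals(1))
      then have "h = jet_of 3 (hjet s p v)" unfolding X(1) jet_eq_jet_of jet_of_eq_iff .
      moreover then have "rho h = v" by (simp add: hjet_vals)
      ultimately show ?thesis by simp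
    qed
    show "H = range (\<lambda>v. jet_of 3 (hjet s p v))"
      using eq surj by (auto simp: image_iff) (metis UNIV_I imageE)
  qed
qed

lemma omega_vanishes_iff:
  assumes S: "local_section N S" "p \<in> N"
  defines "s \<equiv> \<lambda>q. snd (S q)"
  shows "(\<forall>v w. pullback_form (sjet 2 S) omega2 p v w = 0) \<longleftrightarrow> liouville1 s p = 0 \<and> liouville2 s p = 0"
proof -
  have fp: "fst (sjet 2 S p) = p" by (simp add: sjet_def)
  have fd: "fst (frechet_derivative (sjet 2 S) (at p) v) = v" for v
    unfolding frechet_derivative_at[OF has_derivative_sjet[OF S], symmetric] by simp
  have *: "pullback_form (sjet 2 S) omega2 p v w = jet_of 2 (\<lambda>m n. fst v *\<^sub>R hjet s p w (Suc m) n + snd v *\<^sub>R hjet s p w m (Suc n)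
    - (fst w *\<^sub>R hjet s p v (Suc m) n + snd w *\<^sub>R hjet s p v m (Suc n)))" for v w
    unfolding pullback_form_def omega2_def omega_at_def fd fp H_theta2_eq[OF S, folded s_def]
    using bracket_hjet[of 2 p s v w] by simp
  have z: "pullback_form (sjet 2 S) omega2 p v w = 0 \<longleftrightarrow> (fst v * snd w - snd v * fst w) * liouville1 s p = 0 \<and> (fst v * snd w - snd v * fst w) * liouville2 s p = 0" for v w
    unfolding * jet_of_zero[of 2, symmetric] jet_of_eq_iff multiindex_le2 curvature_hjet
    by (auto simp: prod_eq_iff)
  show ?thesis
  proof
    assume "\<forall>v w. pullback_form (sjet 2 S) omega2 p v w = 0"
    then show "liouville1 s p = 0 \<and> liouville2 s p = 0" using z[of "(1, 0)" "(0, 1)"] by simp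
  next
    assume "liouville1 s p = 0 \<and> liouville2 s p = 0"
    then show "\<forall>v w. pullback_form (sjet 2 S) omega2 p v w = 0" using z by simp
  qed
qed


section \<open>Parallel sections of flat connections\<close>

text \<open>Compare a maximum of the norm with the mean value inequality on the unit interval.\<close>

lemma half_gronwall:
  fixes R :: "real \<Rightarrow> 'b::real_normed_vector"
  assumes d: "\<And>t. t \<in> {0..1} \<Longrightarrow> (R has_vector_derivative R' t) (at t within {0..1})"
    and b: "\<And>t. t \<in> {0..1} \<Longrightarrow> norm (R' t) \<le> norm (R t) / 2 + \<epsilon>" and 0: "R 0 = 0" and t: "t \<in> {0..1}"
  shows "norm (R t) \<le> 2 * \<epsilon>"
proof -
  have "continuous_on {0..1} R"
    using d has_vector_derivative_continuous continuous_on_eq_continuous_within by blast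
  then have "continuous_on {0..1} (\<lambda>t. norm (R t))" by (intro continuous_intros)
  then obtain m where m: "m \<in> {0..1}" "\<And>t. t \<in> {0..1} \<Longrightarrow> norm (R t) \<le> norm (R m)"
    using continuous_attains_sup[of "{0..1::real}" "\<lambda>t. norm (R t)"] by auto
  define B where "B = norm (R m) / 2 + \<epsilon>"
  have B: "norm (R' t) \<le> B" if "t \<in> {0..1}" for t
    using b[OF that] m(2)[OF that] by (simp add: B_def)
  have B0: "0 \<le> B" using B[OF m(1)] norm_ge_zero order_trans by blast
  have "norm (R m - R 0) \<le> B * norm (m - 0)"
  proof (rule differentiable_bound[of "{0..1}" R "\<lambda>t h. h *\<^sub>R R' t"])
    show "(R has_derivative (\<lambda>h. h *\<^sub>R R' t)) (at t within {0..1})" if "t \<in> {0..1}" for t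
      using d[OF that] by (simp add: has_vector_derivative_def)
    show "onorm (\<lambda>h. h *\<^sub>R R' t) \<le> B" if "t \<in> {0..1}" for t
      by (rule onorm_le) (use B[OF that] in \<open>simp add: mult.commute[of B] mult_left_mono\<close>)
  qed (use m in auto)
  also have "\<dots> \<le> B * 1" using m B0 by (intro mult_left_mono) auto
  finally have "norm (R m) \<le> norm (R m) / 2 + \<epsilon>" using 0 by (simp add: B_def)
  then show ?thesis using m(2)[OF t] by linarith
qed

text \<open>Parallel transport along the rays from the origin. The transported vectors form the fixed point
  of a contraction on bounded continuous functions. Flatness makes this section parallel in all
  directions: for neighbouring rays through \<open>w\<close> and \<open>w + h\<close>, let \<open>D\<close> be the difference of the values
  at the time \<open>t\<close> and \<open>E\<close> the difference predicted by the connection. By flatness \<open>D - E\<close> satisfies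
  the transport equation of the first ray up to a term of order two in \<open>h\<close>, and it vanishes at the
  origin.\<close>

lemma flat_connection_parallel_section:
  fixes Om :: "'a::euclidean_space \<Rightarrow> 'a \<Rightarrow> ('s::banach \<Rightarrow>\<^sub>L 's)" and Om' :: "'a \<Rightarrow> 'a \<Rightarrow> 'a \<Rightarrow> ('s \<Rightarrow>\<^sub>L 's)"
  assumes r: "0 < r" and M: "0 \<le> M"
    and lin: "\<And>q. q \<in> ball 0 r \<Longrightarrow> linear (Om q)"
    and cont: "continuous_on (ball 0 r \<times> UNIV) (\<lambda>(q, v). Om q v)"
    and bnd: "\<And>q v. q \<in> ball 0 r \<Longrightarrow> norm (Om q v) \<le> M * norm v"
    and lip: "\<And>q q' v. q \<in> ball 0 r \<Longrightarrow> q' \<in> ball 0 r \<Longrightarrow> norm (Om q' v - Om q v) \<le> M * norm (q' - q) * norm v"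
    and quad: "\<And>q q' v. q \<in> ball 0 r \<Longrightarrow> q' \<in> ball 0 r \<Longrightarrow>
      norm (Om q' v - Om q v - Om' q (q' - q) v) \<le> M * (norm (q' - q))\<^sup>2 * norm v"
    and der: "\<And>q v. q \<in> ball 0 r \<Longrightarrow> ((\<lambda>q. Om q v) has_derivative (\<lambda>k. Om' q k v)) (at q)"
    and bnd': "\<And>q k v. q \<in> ball 0 r \<Longrightarrow> norm (Om' q k v) \<le> M * norm k * norm v"
    and flat: "\<And>q h k. q \<in> ball 0 r \<Longrightarrow>
      Om' q k h - Om' q h k + (Om q h o\<^sub>L Om q k) - (Om q k o\<^sub>L Om q h) = 0"
  obtains \<delta> F where "0 < \<delta>" "F 0 = (z0 :: 's)"
    "\<And>w. w \<in> ball 0 \<delta> \<Longrightarrow> (F has_derivative (\<lambda>h. Om w h (F w))) (at w)"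
proof -
  \<comment> \<open>The last bound makes the norm of the connection in directions of the ball at most one half.\<close>
  define \<delta> where "\<delta> = min (r / 2) (min (1 / 2) (1 / (2 * (M + 1))))"
  have \<delta>_half: "\<delta> \<le> 1 / 2" unfolding \<delta>_def by (meson min.cobounded1 min.cobounded2 order_trans)
  have \<delta>: "0 < \<delta>" "\<delta> < r" "\<delta> \<le> 1 / 2"
    using r M \<delta>_half by (auto simp: \<delta>_def min_less_iff_disj)
  have "M * \<delta> \<le> (M + 1) * (1 / (2 * (M + 1)))"
    using M \<delta>(1) by (intro mult_mono) (auto simp: \<delta>_def)
  also have "\<dots> = 1 / 2" using M by (simp add: divide_simps)
  finally have M\<delta>: "M * \<delta> \<le> 1 / 2" .
  have kr: "q \<in> ball 0 r" if "q \<in> cball 0 \<delta>" for q :: 'a using that \<delta> by auto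
  have star: "t *\<^sub>R w \<in> cball 0 \<delta>" if "t \<in> {0..1}" "w \<in> cball 0 \<delta>" for t and w :: 'a
  proof -
    have "\<bar>t\<bar> * norm w \<le> 1 * \<delta>" using that by (intro mult_mono) auto
    then show ?thesis by simp
  qed
  have half: "norm (Om q w) \<le> 1 / 2" if "q \<in> cball 0 \<delta>" "w \<in> cball 0 \<delta>" for q w
  proof -
    have "norm (Om q w) \<le> M * norm w" by (rule bnd[OF kr[OF that(1)]])
    also have "\<dots> \<le> M * \<delta>" using that M by (intro mult_left_mono) auto
    finally show ?thesis using M\<delta> by linarith
  qed
  \<comment> \<open>The retraction onto the small ball lets the operator act on functions on the whole space.\<close>
  define c where "c = closest_point (cball (0::'a) \<delta>)"
  have cc: "continuous_on UNIV c" unfolding c_def using \<delta> by (intro continuous_on_closest_point) auto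
  have cK: "c w \<in> cball 0 \<delta>" for w unfolding c_def using \<delta> by (intro closest_point_in_set) auto
  have cid: "c w = w" if "w \<in> cball 0 \<delta>" for w unfolding c_def by (rule closest_point_self[OF that])
  define g where "g F w t = blinfun_apply (Om (t *\<^sub>R c w) (c w)) (F (t *\<^sub>R c w))" for F :: "'a \<Rightarrow> 's" and w t
  have cg: "continuous_on (UNIV \<times> cbox 0 1) (\<lambda>(w, t). g F w t)" if F: "continuous_on UNIV F" for F
  proof -
    have c1: "continuous_on (UNIV \<times> cbox 0 (1::real)) (\<lambda>x. c (fst x))"
      by (rule continuous_on_compose2[OF cc continuous_on_fst[OF continuous_on_id]]) auto
    have c2: "continuous_on (UNIV \<times> cbox 0 (1::real)) (\<lambda>x. snd x *\<^sub>R c (fst x))" by (intro continuous_intros c1)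
    have "continuous_on (UNIV \<times> cbox 0 (1::real)) (\<lambda>x. case (snd x *\<^sub>R c (fst x), c (fst x)) of (q, v) \<Rightarrow> Om q v)"
    proof (rule continuous_on_compose2[OF cont continuous_on_Pair[OF c2 c1]], rule image_subsetI)
      fix x :: "'a \<times> real" assume "x \<in> UNIV \<times> cbox 0 1"
      then have "snd x *\<^sub>R c (fst x) \<in> cball 0 \<delta>" by (intro star cK) auto
      then show "(snd x *\<^sub>R c (fst x), c (fst x)) \<in> ball 0 r \<times> UNIV" using kr by blast
    qed
    moreover have "continuous_on (UNIV \<times> cbox 0 (1::real)) (\<lambda>x. F (snd x *\<^sub>R c (fst x)))"
      by (rule continuous_on_compose2[OF F c2]) auto
    ultimately show ?thesis
      unfolding g_def case_prod_beta' fst_conv snd_conv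
      by (intro bounded_bilinear.continuous_on[OF bounded_bilinear_blinfun_apply])
  qed
  have cgt: "continuous_on {0..1} (g F w)" if F: "continuous_on UNIV F" for F w
  proof -
    have "continuous_on (cbox 0 1) (\<lambda>t. case (w, t) of (w, t) \<Rightarrow> g F w t)"
      by (rule continuous_on_compose2[OF cg[OF F]]) (auto intro!: continuous_intros)
    then show ?thesis by simp
  qed
  have gb: "norm (g F w t) \<le> B / 2" if "t \<in> {0..1}" "\<And>x. norm (F x) \<le> B" for F w t B
  proof -
    have B: "0 \<le> B" using that(2)[of 0] norm_ge_zero order_trans by blast
    have "norm (g F w t) \<le> norm (Om (t *\<^sub>R c w) (c w)) * norm (F (t *\<^sub>R c w))"
      unfolding g_def by (rule norm_blinfun)
    also have "\<dots> \<le> (1 / 2) * B" using B by (intro mult_mono half star cK that) auto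
    finally show ?thesis by simp
  qed
  have int: "norm (integral {0..1} (g F w)) \<le> B / 2" if "continuous_on UNIV F" "\<And>x. norm (F x) \<le> B" for F w B
    using integral_bound[OF _ cgt[OF that(1)], of w "B / 2"] gb[OF _ that(2)] by simp
  define T where "T F = (\<lambda>w. z0 + integral {0..1} (g (apply_bcontfun F) w))" for F :: "'a \<Rightarrow>\<^sub>C 's"
  have Tb: "T F \<in> bcontfun" for F
  proof (rule bcontfun_normI)
    have "continuous_on UNIV (\<lambda>w. integral (cbox 0 1) (g (apply_bcontfun F) w))"
      by (rule integral_continuous_on_param[OF cg]) simp
    then show "continuous_on UNIV (T F)" unfolding T_def by (intro continuous_intros) simp
    show "norm (T F w) \<le> norm z0 + norm F / 2" for w
      unfolding T_def using int[of "apply_bcontfun F" "norm F" w] norm_bounded[of F]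
      by (intro norm_triangle_le add_left_mono) simp
  qed
  have "\<exists>!F. Bcontfun (T F) = F"
  proof (rule banach_fix_type[of "1 / 2"])
    show "\<forall>x y. dist (Bcontfun (T x)) (Bcontfun (T y)) \<le> 1 / 2 * dist x y"
    proof (intro allI, rule dist_bound)
      fix F G :: "'a \<Rightarrow>\<^sub>C 's" and w
      have "dist (T F w) (T G w) = norm (integral {0..1} (g F w) - integral {0..1} (g G w))"
        by (simp add: T_def dist_norm)
      also have "integral {0..1} (g F w) - integral {0..1} (g G w) = integral {0..1} (\<lambda>t. g F w t - g G w t)"
        by (rule integral_diff[symmetric]; rule integrable_continuous_real; rule cgt; simp)
      also have "(\<lambda>t. g F w t - g G w t) = g (\<lambda>x. F x - G x) w"
        by (rule ext) (simp add: g_def blinfun.diff_right)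
      also have "norm (integral {0..1} (g (\<lambda>x. F x - G x) w)) \<le> dist F G / 2"
        by (rule int) (auto intro!: continuous_intros simp: dist_norm[symmetric] dist_bounded)
      finally show "dist (Bcontfun (T F) w) (Bcontfun (T G) w) \<le> 1 / 2 * dist F G"
        by (simp add: Bcontfun_inverse Tb)
    qed
  qed simp_all
  then obtain F0 where F0: "Bcontfun (T F0) = F0" by blast
  define F where "F = apply_bcontfun F0"
  have cF: "continuous_on UNIV F" by (simp add: F_def)
  have nF: "norm (F x) \<le> norm F0" for x unfolding F_def by (rule norm_bounded)
  have "F = T F0" using Bcontfun_inverse[OF Tb, of F0] F0 by (simp add: F_def)
  then have fixpt: "F w = z0 + integral {0..1} (g F w)" for w
    by (metis F_def T_def)
  have F00: "F 0 = z0"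
  proof -
    have "c 0 = 0" using \<delta> by (intro cid) simp
    then have "g F 0 = (\<lambda>t. 0)" using linear_0[OF lin[OF kr]] \<delta> by (auto simp: g_def)
    then show ?thesis using fixpt[of 0] by simp
  qed
  have ray: "((\<lambda>s. F (s *\<^sub>R w)) has_vector_derivative Om (s *\<^sub>R w) w (F (s *\<^sub>R w))) (at s within {0..1})"
    if w: "w \<in> cball 0 \<delta>" and s: "s \<in> {0..1}" for w s
  proof -
    define k where "k t = blinfun_apply (Om (t *\<^sub>R w) w) (F (t *\<^sub>R w))" for t
    have ck: "continuous_on {0..1} k"
      using cgt[OF cF, of w] unfolding g_def cid[OF w] k_def[abs_def] .
    define G where "G u = integral {0..u} k" for u
    have dG: "(G has_vector_derivative k u) (at u within {0..1})" if "u \<in> {0..1}" for u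
      unfolding G_def by (rule integral_has_vector_derivative[OF ck that])
    have FG: "F (u *\<^sub>R w) = z0 + G u" if u: "u \<in> {0..1}" for u
    proof -
      \<comment> \<open>substitution in the integral, by the fundamental theorem\<close>
      have "((\<lambda>t. u *\<^sub>R k (t * u)) has_integral (G (1 * u) - G (0 * u))) {0..1}"
      proof (rule fundamental_theorem_of_calculus)
        fix t :: real assume t: "t \<in> {0..1}"
        have sub: "(\<lambda>t. t * u) ` {0..1} \<subseteq> {0..1}" using u by (auto intro: mult_le_one)
        have "((\<lambda>t. t * u) has_vector_derivative u) (at t within {0..1})"
          by (auto intro!: derivative_eq_intros simp: has_vector_derivative_def)
        moreover have "(G has_vector_derivative k (t * u)) (at (t * u) within (\<lambda>t. t * u) ` {0..1})"
          using sub t by (intro has_vector_derivative_within_subset[OF dG sub]) blast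
        ultimately show "((\<lambda>t. G (t * u)) has_vector_derivative u *\<^sub>R k (t * u)) (at t within {0..1})"
          using vector_diff_chain_within[of "\<lambda>t. t * u" u t "{0..1}" G "k (t * u)"] by (simp add: o_def)
      qed simp
      moreover have "g F (u *\<^sub>R w) t = u *\<^sub>R k (t * u)" if t: "t \<in> {0..1}" for t
      proof -
        have "t * u \<in> {0..1}" using t u by (auto intro: mult_le_one)
        then show ?thesis
          unfolding g_def cid[OF star[OF u w]] k_def
          using linear_scale[OF lin[OF kr[OF star[OF _ w]]], of "t * u" u w] by (simp add: blinfun.scaleR_left)
      qed
      ultimately have "(g F (u *\<^sub>R w) has_integral (G u - G 0)) {0..1}"
        using has_integral_cong[of "{0..1}" "g F (u *\<^sub>R w)" "\<lambda>t. u *\<^sub>R k (t * u)"] by simp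
      then show ?thesis using fixpt[of "u *\<^sub>R w"] by (simp add: integral_unique G_def)
    qed
    have "((\<lambda>u. z0 + G u) has_vector_derivative k s) (at s within {0..1})"
      using has_vector_derivative_add[OF has_vector_derivative_const dG[OF s]] by simp
    then show ?thesis
      unfolding k_def[symmetric] by (rule has_vector_derivative_transform[OF s, rotated]) (rule FG)
  qed
  define C where "C = 2 * ((2 * M + 16 * M * M) * norm F0)"
  have main: "norm (F (w + h) - F w - Om w h (F w)) \<le> C * (norm h)\<^sup>2"
    if w: "w \<in> cball 0 \<delta>" and wh: "w + h \<in> cball 0 \<delta>" for w h
  proof -
    have nw: "norm w \<le> 1" using w \<delta> by auto
    have nh: "norm h \<le> 1"
      using norm_triangle_ineq4[of "w + h" w] w wh \<delta> by simp
    define q0 q1 where "q0 t = t *\<^sub>R w" and "q1 t = t *\<^sub>R (w + h)" for t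
    have q: "q0 t \<in> ball 0 r" "q1 t \<in> ball 0 r" if "t \<in> {0..1}" for t
      unfolding q0_def q1_def by (rule kr[OF star[OF that w]], rule kr[OF star[OF that wh]])
    define D where "D t = F (q1 t) - F (q0 t)" for t
    have D0: "D 0 = 0" unfolding D_def q0_def q1_def by simp
    define D' where "D' t = Om (q1 t) (w + h) (F (q1 t)) - Om (q0 t) w (F (q0 t))" for t
    have dD: "(D has_vector_derivative D' t) (at t within {0..1})" if "t \<in> {0..1}" for t
      unfolding D_def[abs_def] D'_def q0_def q1_def by (intro has_vector_derivative_diff ray w wh that)
    \<comment> \<open>the remainder of second order in the difference of the connection along the two rays\<close>
    define \<rho> where "\<rho> t = (Om (q1 t) h - Om (q0 t) h) + (Om (q1 t) w - Om (q0 t) w - Om' (q0 t) (t *\<^sub>R h) w)" for t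
    have q10: "q1 t - q0 t = t *\<^sub>R h" for t by (simp add: q0_def q1_def algebra_simps)
    have th: "norm (t *\<^sub>R h) \<le> norm h" if "t \<in> {0..1}" for t using that by (simp add: mult_left_le_one_le)
    have sq: "norm h * norm h \<le> norm h" using nh by (simp add: mult_left_le_one_le)
    have \<rho>: "norm (\<rho> t) \<le> 2 * M * (norm h)\<^sup>2" if t: "t \<in> {0..1}" for t
    proof -
      have "norm (Om (q1 t) h - Om (q0 t) h) \<le> M * norm (t *\<^sub>R h) * norm h"
        using lip[OF q[OF t], of h] by (simp add: q10)
      also have "\<dots> \<le> M * norm h * norm h" using M th[OF t] by (intro mult_right_mono mult_left_mono) auto
      finally have 1: "norm (Om (q1 t) h - Om (q0 t) h) \<le> M * (norm h)\<^sup>2" by (simp add: power2_eq_square mult.assoc)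
      have "norm (Om (q1 t) w - Om (q0 t) w - Om' (q0 t) (t *\<^sub>R h) w) \<le> M * (norm (t *\<^sub>R h))\<^sup>2 * norm w"
        using quad[OF q[OF t], of w] by (simp add: q10)
      also have "\<dots> \<le> M * (norm h)\<^sup>2 * 1" using M th[OF t] nw by (intro mult_mono power_mono) auto
      finally have 2: "norm (Om (q1 t) w - Om (q0 t) w - Om' (q0 t) (t *\<^sub>R h) w) \<le> M * (norm h)\<^sup>2" by simp
      show ?thesis unfolding \<rho>_def by (rule norm_triangle_le) (use 1 2 in linarith)
    qed
    have bigK: "Om (q1 t) (w + h) - Om (q0 t) w = Om (q0 t) h + t *\<^sub>R Om' (q0 t) h w + \<rho> t" if t: "t \<in> {0..1}" for t
    proof -
      have "Om' (q0 t) (t *\<^sub>R h) w = t *\<^sub>R Om' (q0 t) h w"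
        using linear_scale[OF has_derivative_linear[OF der[OF q(1)[OF t], of w]]] .
      then show ?thesis unfolding \<rho>_def linear_add[OF lin[OF q(2)[OF t]]] by simp
    qed
    have nOm: "norm (Om (q0 t) h + t *\<^sub>R Om' (q0 t) h w) \<le> 2 * M * norm h" if t: "t \<in> {0..1}" for t
    proof -
      have "norm (t *\<^sub>R Om' (q0 t) h w) \<le> norm (Om' (q0 t) h w)" using t by (simp add: mult_left_le_one_le)
      also have "\<dots> \<le> M * norm h * norm w" by (rule bnd'[OF q(1)[OF t]])
      also have "\<dots> \<le> M * norm h * 1" using M nw by (intro mult_left_mono) auto
      finally have 1: "norm (t *\<^sub>R Om' (q0 t) h w) \<le> M * norm h" by simp
      show ?thesis by (rule norm_triangle_le) (use 1 bnd[OF q(1)[OF t], of h] in linarith)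
    qed
    have D_lip: "norm (D t) \<le> 2 * (4 * M * norm h * norm F0)" if t: "t \<in> {0..1}" for t
    proof (rule half_gronwall[OF dD _ _ t])
      fix t :: real assume t: "t \<in> {0..1}"
      have e: "D' t = Om (q0 t) w (D t) + (Om (q1 t) (w + h) - Om (q0 t) w) (F (q1 t))"
        by (simp add: D'_def D_def blinfun.diff_left blinfun.diff_right)
      have 1: "norm (Om (q0 t) w (D t)) \<le> norm (D t) / 2"
        using norm_blinfun[of "Om (q0 t) w" "D t"] mult_right_mono[OF half[of "q0 t" w], of "norm (D t)"] star[OF t w] w
        by (simp add: q0_def)
      have "norm (Om (q1 t) (w + h) - Om (q0 t) w) \<le> 2 * M * norm h + 2 * M * (norm h)\<^sup>2"
        unfolding bigK[OF t] by (rule norm_triangle_le) (use nOm[OF t] \<rho>[OF t] in linarith)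
      also have "2 * M * (norm h)\<^sup>2 \<le> 2 * M * norm h"
        using M sq by (intro mult_left_mono) (auto simp: power2_eq_square)
      finally have 2: "norm (Om (q1 t) (w + h) - Om (q0 t) w) \<le> 4 * M * norm h" by simp
      have "norm ((Om (q1 t) (w + h) - Om (q0 t) w) (F (q1 t))) \<le> 4 * M * norm h * norm F0"
        by (rule order_trans[OF norm_blinfun]) (intro mult_mono 2 nF, use M in auto)
      then show "norm (D' t) \<le> norm (D t) / 2 + 4 * M * norm h * norm F0"
        unfolding e using 1 by (intro norm_triangle_le) linarith
    qed (simp_all add: D0)
    define E where "E t = t *\<^sub>R Om (q0 t) h (F (q0 t))" for t
    define E' where "E' t = Om (q0 t) h (F (q0 t)) + t *\<^sub>R (Om' (q0 t) w h (F (q0 t)) + Om (q0 t) h (Om (q0 t) w (F (q0 t))))" for t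
    have dE: "(E has_vector_derivative E' t) (at t within {0..1})" if t: "t \<in> {0..1}" for t
    proof -
      have "((\<lambda>t. q0 t) has_derivative (\<lambda>s. s *\<^sub>R w)) (at t within {0..1})"
        unfolding q0_def by (auto intro!: derivative_eq_intros)
      from has_derivative_compose[OF this der[OF q(1)[OF t], of h]]
      have "((\<lambda>t. Om (q0 t) h) has_vector_derivative Om' (q0 t) w h) (at t within {0..1})"
        using linear_scale[OF has_derivative_linear[OF der[OF q(1)[OF t], of h]]]
        by (simp add: has_vector_derivative_def)
      from bounded_bilinear.has_vector_derivative[OF bounded_bilinear_blinfun_apply this ray[OF w t, folded q0_def]]
      have "((\<lambda>t. Om (q0 t) h (F (q0 t))) has_vector_derivative
          (Om (q0 t) h (Om (q0 t) w (F (q0 t))) + Om' (q0 t) w h (F (q0 t)))) (at t within {0..1})" by simp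
      from has_vector_derivative_scaleR[OF DERIV_ident this]
      show ?thesis unfolding E_def[abs_def] E'_def by (simp add: add.commute)
    qed
    have "norm (D 1 - E 1) \<le> 2 * ((2 * M + 16 * M * M) * norm F0 * (norm h)\<^sup>2)"
    proof (rule half_gronwall[of "\<lambda>t. D t - E t" "\<lambda>t. D' t - E' t"])
      fix t :: real assume t: "t \<in> {0..1}"
      show "((\<lambda>t. D t - E t) has_vector_derivative D' t - E' t) (at t within {0..1})"
        by (intro has_vector_derivative_diff dD dE t)
      define A where "A = Om (q0 t) h + t *\<^sub>R Om' (q0 t) h w"
      have fl: "Om' (q0 t) w h (F (q0 t)) + Om (q0 t) h (Om (q0 t) w (F (q0 t))) =
          Om' (q0 t) h w (F (q0 t)) + Om (q0 t) w (Om (q0 t) h (F (q0 t)))"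
        using arg_cong[OF flat[OF q(1)[OF t], of w h], of "\<lambda>b. blinfun_apply b (F (q0 t))"]
        by (simp add: blinfun.bilinear_simps algebra_simps)
      have e: "D' t - E' t = Om (q0 t) w (D t - E t) + (\<rho> t (F (q1 t)) + A (D t))"
      proof -
        have "D' t = Om (q0 t) w (D t) + (Om (q1 t) (w + h) - Om (q0 t) w) (F (q1 t))"
          by (simp add: D'_def D_def blinfun.diff_left blinfun.diff_right)
        also have "\<dots> = Om (q0 t) w (D t) + (A (F (q1 t)) + \<rho> t (F (q1 t)))"
          unfolding bigK[OF t] A_def by (simp add: blinfun.add_left)
        also have "A (F (q1 t)) = A (D t) + A (F (q0 t))" by (simp add: D_def blinfun.diff_right)
        finally have 1: "D' t = Om (q0 t) w (D t) + (A (D t) + A (F (q0 t)) + \<rho> t (F (q1 t)))" .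
        have "E' t = A (F (q0 t)) + Om (q0 t) w (E t)"
          unfolding E'_def fl E_def A_def by (simp add: blinfun.bilinear_simps algebra_simps)
        then show ?thesis unfolding 1 by (simp add: blinfun.diff_right)
      qed
      have 1: "norm (Om (q0 t) w (D t - E t)) \<le> norm (D t - E t) / 2"
        using norm_blinfun[of "Om (q0 t) w" "D t - E t"] mult_right_mono[OF half[of "q0 t" w], of "norm (D t - E t)"] star[OF t w] w
        by (simp add: q0_def)
      have 2: "norm (\<rho> t (F (q1 t))) \<le> (2 * M * (norm h)\<^sup>2) * norm F0"
        by (rule order_trans[OF norm_blinfun]) (intro mult_mono \<rho> t nF, use M in auto)
      have "norm (A (D t)) \<le> (2 * M * norm h) * (2 * (4 * M * norm h * norm F0))"
        unfolding A_def by (rule order_trans[OF norm_blinfun]) (intro mult_mono nOm D_lip t, use M in auto)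
      also have "\<dots> = (16 * M * M) * norm F0 * (norm h)\<^sup>2" by (simp add: power2_eq_square)
      finally have 3: "norm (A (D t)) \<le> (16 * M * M) * norm F0 * (norm h)\<^sup>2" .
      have "norm (D' t - E' t) \<le> norm (Om (q0 t) w (D t - E t)) + (norm (\<rho> t (F (q1 t))) + norm (A (D t)))"
        unfolding e by (intro norm_triangle_le add_left_mono norm_triangle_ineq)
      then show "norm (D' t - E' t) \<le> norm (D t - E t) / 2 + (2 * M + 16 * M * M) * norm F0 * (norm h)\<^sup>2"
        using 1 2 3 by (simp add: algebra_simps)
    qed (simp_all add: D0 E_def)
    then show ?thesis by (simp add: D_def E_def q0_def q1_def C_def mult.assoc)
  qed
  have "(F has_derivative (\<lambda>h. Om w h (F w))) (at w)" if w: "w \<in> ball 0 \<delta>" for w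
  proof -
    have wK: "w \<in> cball 0 \<delta>" using w by simp
    show ?thesis
    proof (rule has_derivativeI_sandwich[of "\<delta> - norm w"])
      show "0 < \<delta> - norm w" using w by simp
      have "linear (\<lambda>h. Om w h (F w))"
        by (rule linearI) (simp_all add: linear_add[OF lin[OF kr[OF wK]]] linear_scale[OF lin[OF kr[OF wK]]] blinfun.bilinear_simps)
      then show "bounded_linear (\<lambda>h. Om w h (F w))" by (rule linear_conv_bounded_linear[THEN iffD1])
      fix y assume y: "y \<noteq> w" "dist y w < \<delta> - norm w"
      have "norm y \<le> norm (y - w) + norm w" using norm_triangle_ineq[of "y - w" w] by simp
      then have "y \<in> cball 0 \<delta>" using y(2) by (simp add: dist_norm)
      then have "norm (F y - F w - Om w (y - w) (F w)) \<le> C * (norm (y - w))\<^sup>2"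
        using main[OF wK, of "y - w"] by simp
      then show "norm (F y - F w - Om w (y - w) (F w)) / norm (y - w) \<le> C * norm (y - w)"
        using y(1) by (simp add: divide_le_eq power2_eq_square mult.assoc)
    next
      have "((\<lambda>y. C * norm (y - w)) \<longlongrightarrow> C * norm (w - w)) (at w)" by (intro tendsto_intros)
      then show "((\<lambda>y. C * norm (y - w)) \<longlongrightarrow> 0) (at w)" by simp
    qed
  qed
  then show ?thesis using that \<delta>(1) F00 by blast
qed


section \<open>Flat linear systems in the plane\<close>

lemma norm_pd_le:
  assumes "f differentiable (at q)"
  shows "norm (pd k f q) \<le> norm k * (\<Sum>b\<in>Basis. norm (pd b f q))"
proof -
  have "norm (pd k f q) \<le> (\<Sum>b\<in>Basis. norm ((k \<bullet> b) *\<^sub>R pd b f q))"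
    unfolding pd_expand[OF assms, of k] by (rule norm_sum)
  also have "\<dots> \<le> (\<Sum>b\<in>Basis. norm k * norm (pd b f q))"
    by (intro sum_mono) (simp add: mult_right_mono Basis_le_norm)
  finally show ?thesis by (simp add: sum_distrib_left)
qed

text \<open>All constants come from one bound for the first and second derivatives on a small ball; the quadratic
  estimate is Taylor's formula on a segment.\<close>

lemma smooth_local_bounds:
  fixes h :: "'a::euclidean_space \<Rightarrow> 'c::real_normed_vector"
  assumes U: "open U" "p \<in> U" "smooth_on U h"
  obtains r M where "0 < r" "0 \<le> M" "ball p r \<subseteq> U"
    "\<And>q. q \<in> ball p r \<Longrightarrow> norm (h q) \<le> M"
    "\<And>q q'. q \<in> ball p r \<Longrightarrow> q' \<in> ball p r \<Longrightarrow> norm (h q' - h q) \<le> M * norm (q' - q)"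
    "\<And>q q'. q \<in> ball p r \<Longrightarrow> q' \<in> ball p r \<Longrightarrow> norm (h q' - h q - pd (q' - q) h q) \<le> M * (norm (q' - q))\<^sup>2"
    "\<And>q k. q \<in> ball p r \<Longrightarrow> norm (pd k h q) \<le> M * norm k"
proof -
  define \<phi> where "\<phi> q = norm (h q) + (\<Sum>b\<in>Basis. norm (pd b h q)) + (\<Sum>b\<in>Basis. \<Sum>c\<in>Basis. norm (pd c (pd b h) q))" for q
  have "continuous_on U \<phi>" unfolding \<phi>_def[abs_def]
    by (intro continuous_intros smooth_on_continuous[OF U(3)] smooth_on_continuous[OF smooth_on_pd[OF U(1)]] smooth_on_pd U)
  then have "isCont \<phi> p" using U continuous_on_eq_continuous_at by blast
  then obtain r1 where r1: "r1 > 0" "\<And>q. dist q p < r1 \<Longrightarrow> dist (\<phi> q) (\<phi> p) < 1"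
    unfolding continuous_at_eps_delta by (metis zero_less_one)
  obtain r2 where r2: "r2 > 0" "ball p r2 \<subseteq> U" using U openE by blast
  define r where "r = min r1 r2"
  have r: "r > 0" "ball p r \<subseteq> U" using r1 r2 by (auto simp: r_def)
  define M0 where "M0 = \<phi> p + 1"
  have s0: "0 \<le> norm (h q)" "0 \<le> (\<Sum>b\<in>Basis. norm (pd b h q))" "0 \<le> (\<Sum>b\<in>Basis. \<Sum>c\<in>Basis. norm (pd c (pd b h) q))" for q
    by (auto intro!: sum_nonneg)
  have M0: "0 \<le> M0" unfolding M0_def \<phi>_def using s0[of p] by linarith
  have \<phi>: "\<phi> q \<le> M0" if "q \<in> ball p r" for q
    using r1(2)[of q] that by (auto simp: M0_def r_def dist_commute dist_real_def)
  have b0: "norm (h q) \<le> M0" "(\<Sum>b\<in>Basis. norm (pd b h q)) \<le> M0"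
    "(\<Sum>b\<in>Basis. \<Sum>c\<in>Basis. norm (pd c (pd b h) q)) \<le> M0" if "q \<in> ball p r" for q
    using \<phi>[OF that] s0[of q] unfolding \<phi>_def by linarith+
  have dh: "h differentiable (at q)" if "q \<in> ball p r" for q
    by (rule smooth_on_differentiable[OF U(3)]) (use r that in blast)
  have dph: "pd b h differentiable (at q)" if "q \<in> ball p r" for q b
    by (rule smooth_on_differentiable[OF smooth_on_pd[OF U(1,3)]]) (use r that in blast)
  have b1: "norm (pd k h q) \<le> M0 * norm k" if q: "q \<in> ball p r" for q k
    using norm_pd_le[OF dh[OF q], of k] mult_left_mono[OF b0(2)[OF q], of "norm k"] by (simp add: mult.commute)
  have lipg: "norm (f q' - f q) \<le> M0 * norm (q' - q)"
    if "\<And>q. q \<in> ball p r \<Longrightarrow> f differentiable (at q)" "\<And>q k. q \<in> ball p r \<Longrightarrow> norm (pd k f q) \<le> M0 * norm k"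
      "q \<in> ball p r" "q' \<in> ball p r" for f :: "'a \<Rightarrow> 'c" and q q'
    by (rule differentiable_bound[of "ball p r" f "\<lambda>x k. pd k f x"])
      (use that in \<open>auto intro!: onorm_le has_derivative_at_withinI has_pd\<close>)
  have b2: "norm (pd k (pd b h) q) \<le> M0 * norm k" if q: "q \<in> ball p r" and b: "b \<in> Basis" for q k b
  proof -
    have "(\<Sum>c\<in>Basis. norm (pd c (pd b h) q)) \<le> (\<Sum>b\<in>Basis. \<Sum>c\<in>Basis. norm (pd c (pd b h) q))"
      by (rule member_le_sum[OF b, of "\<lambda>b. \<Sum>c\<in>Basis. norm (pd c (pd b h) q)"]) (auto intro!: sum_nonneg)
    then have "(\<Sum>c\<in>Basis. norm (pd c (pd b h) q)) \<le> M0" using b0(3)[OF q] by linarith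
    then show ?thesis
      using norm_pd_le[OF dph[OF q, of b], of k] mult_left_mono[of "\<Sum>c\<in>Basis. norm (pd c (pd b h) q)" M0 "norm k"]
      by (simp add: mult.commute)
  qed
  define M where "M = (real DIM('a) + 1) * M0"
  have MM: "M0 \<le> M" using M0 by (simp add: M_def algebra_simps)
  have quad: "norm (h q' - h q - pd (q' - q) h q) \<le> M * (norm (q' - q))\<^sup>2" if q: "q \<in> ball p r" "q' \<in> ball p r" for q q'
  proof -
    have seg: "closed_segment q q' \<subseteq> ball p r" using q by (simp add: closed_segment_subset)
    have "norm (h q' - h q - pd (q' - q) h q) \<le> norm (q' - q) * (M * norm (q' - q))"
    proof (rule differentiable_bound_linearization[of q q' "closed_segment q q'" h "\<lambda>x k. pd k h x" q])
      show "q + t *\<^sub>R (q' - q) \<in> closed_segment q q'" if "t \<in> {0..1}" for t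
        unfolding in_segment using that by (intro exI[of _ t]) (simp add: algebra_simps)
      show "(h has_derivative (\<lambda>k. pd k h x)) (at x within closed_segment q q')" if "x \<in> closed_segment q q'" for x
        by (rule has_derivative_at_withinI[OF has_pd[OF dh[OF subsetD[OF seg that]]]])
      show "q \<in> closed_segment q q'" by simp
      fix x assume x: "x \<in> closed_segment q q'"
      have xb: "x \<in> ball p r" by (rule subsetD[OF seg x])
      have xq: "norm (x - q) \<le> norm (q' - q)" using segment_bound(1)[OF x] .
      show "onorm ((\<lambda>k. pd k h x) - (\<lambda>k. pd k h q)) \<le> M * norm (q' - q)"
      proof (rule onorm_le)
        fix k
        have "norm (pd k h x - pd k h q) = norm (\<Sum>b\<in>Basis. (k \<bullet> b) *\<^sub>R (pd b h x - pd b h q))"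
          unfolding pd_expand[OF dh[OF xb], of k] pd_expand[OF dh[OF q(1)], of k]
          by (simp add: sum_subtractf scaleR_diff_right)
        also have "\<dots> \<le> (\<Sum>b\<in>(Basis :: 'a set). norm k * (M0 * norm (q' - q)))"
        proof (rule order_trans[OF norm_sum], rule sum_mono)
          fix b :: 'a assume b: "b \<in> Basis"
          have "norm (pd b h x - pd b h q) \<le> M0 * norm (x - q)"
            by (rule lipg[OF dph b2[OF _ b] q(1) xb])
          also have "\<dots> \<le> M0 * norm (q' - q)" using xq M0 by (rule mult_left_mono)
          finally show "norm ((k \<bullet> b) *\<^sub>R (pd b h x - pd b h q)) \<le> norm k * (M0 * norm (q' - q))"
            using Basis_le_norm[OF b, of k] M0 by (simp add: mult_mono)
        qed
        also have "\<dots> = real DIM('a) * M0 * norm (q' - q) * norm k" by simp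
        also have "\<dots> \<le> M * norm (q' - q) * norm k"
          using M0 by (intro mult_right_mono) (simp_all add: M_def mult_right_mono)
        finally show "norm (((\<lambda>k. pd k h x) - (\<lambda>k. pd k h q)) k) \<le> M * norm (q' - q) * norm k" by simp
      qed
    qed
    then show ?thesis by (simp add: power2_eq_square mult_ac)
  qed
  show ?thesis
  proof (rule that[OF r(1) _ r(2)])
    show "0 \<le> M" using M0 MM by simp
    show "norm (h q) \<le> M" if "q \<in> ball p r" for q using b0(1)[OF that] MM by simp
    show "norm (h q' - h q) \<le> M * norm (q' - q)" if "q \<in> ball p r" "q' \<in> ball p r" for q q'
      using lipg[OF dh b1 that] mult_right_mono[OF MM, of "norm (q' - q)"] by simp
    show "norm (pd k h q) \<le> M * norm k" if "q \<in> ball p r" for q k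
      using b1[OF that, of k] mult_right_mono[OF MM, of "norm k"] by simp
  qed (rule quad)
qed

lemma parallel_section:
  fixes A B :: "base \<Rightarrow> ('s::banach \<Rightarrow>\<^sub>L 's)"
  assumes U: "open U" "p \<in> U" and A: "smooth_on U A" and B: "smooth_on U B"
    and flat: "\<And>q. q \<in> U \<Longrightarrow> d2 A q + (A q o\<^sub>L B q) = d1 B q + (B q o\<^sub>L A q)"
  obtains N F where "open N" "p \<in> N" "N \<subseteq> U" "F p = z0"
    "\<And>q. q \<in> N \<Longrightarrow> (F has_derivative (\<lambda>h. fst h *\<^sub>R A q (F q) + snd h *\<^sub>R B q (F q))) (at q)"
proof -
  obtain r1 M1 where 1: "0 < r1" "0 \<le> M1" "ball p r1 \<subseteq> U"
    "\<And>q. q \<in> ball p r1 \<Longrightarrow> norm (A q) \<le> M1"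
    "\<And>q q'. q \<in> ball p r1 \<Longrightarrow> q' \<in> ball p r1 \<Longrightarrow> norm (A q' - A q) \<le> M1 * norm (q' - q)"
    "\<And>q q'. q \<in> ball p r1 \<Longrightarrow> q' \<in> ball p r1 \<Longrightarrow> norm (A q' - A q - pd (q' - q) A q) \<le> M1 * (norm (q' - q))\<^sup>2"
    "\<And>q k. q \<in> ball p r1 \<Longrightarrow> norm (pd k A q) \<le> M1 * norm k"
    using smooth_local_bounds[OF U A] by blast
  obtain r2 M2 where 2: "0 < r2" "0 \<le> M2" "ball p r2 \<subseteq> U"
    "\<And>q. q \<in> ball p r2 \<Longrightarrow> norm (B q) \<le> M2"
    "\<And>q q'. q \<in> ball p r2 \<Longrightarrow> q' \<in> ball p r2 \<Longrightarrow> norm (B q' - B q) \<le> M2 * norm (q' - q)"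
    "\<And>q q'. q \<in> ball p r2 \<Longrightarrow> q' \<in> ball p r2 \<Longrightarrow> norm (B q' - B q - pd (q' - q) B q) \<le> M2 * (norm (q' - q))\<^sup>2"
    "\<And>q k. q \<in> ball p r2 \<Longrightarrow> norm (pd k B q) \<le> M2 * norm k"
    using smooth_local_bounds[OF U B] by blast
  define r where "r = min r1 r2"
  define M where "M = M1 + M2"
  have r: "0 < r" and M: "0 \<le> M" using 1 2 by (auto simp: r_def M_def)
  have b1: "p + w \<in> ball p r1" and b2: "p + w \<in> ball p r2" and bU: "p + w \<in> U" if "w \<in> ball 0 r" for w
    using that 1(3) by (auto simp: r_def dist_norm)
  define Om where "Om w v = fst v *\<^sub>R A (p + w) + snd v *\<^sub>R B (p + w)" for w v :: base
  define Om' where "Om' w k v = fst v *\<^sub>R pd k A (p + w) + snd v *\<^sub>R pd k B (p + w)" for w k v :: base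
  have comb: "norm (fst v *\<^sub>R X + snd v *\<^sub>R Y) \<le> (M1 * c + M2 * c) * norm v"
    if "norm X \<le> M1 * c" "norm Y \<le> M2 * c" for v :: base and X Y :: "'s \<Rightarrow>\<^sub>L 's" and c
  proof -
    have 0: "0 \<le> M1 * c" "0 \<le> M2 * c" using that norm_ge_zero order_trans by blast+
    have n: "\<bar>fst v\<bar> \<le> norm v" "\<bar>snd v\<bar> \<le> norm v"
      using norm_fst_le[of "fst v" "snd v"] norm_snd_le[of "snd v" "fst v"] by simp_all
    have "norm (fst v *\<^sub>R X + snd v *\<^sub>R Y) \<le> \<bar>fst v\<bar> * norm X + \<bar>snd v\<bar> * norm Y"
      by (rule norm_triangle_le) simp
    also have "\<dots> \<le> norm v * (M1 * c) + norm v * (M2 * c)"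
      by (intro add_mono mult_mono n that) simp_all
    finally show ?thesis by (simp add: algebra_simps)
  qed
  obtain \<delta> F where \<delta>: "0 < \<delta>" and F: "F 0 = z0"
    "\<And>w. w \<in> ball 0 \<delta> \<Longrightarrow> (F has_derivative (\<lambda>h. Om w h (F w))) (at w)"
  proof (rule flat_connection_parallel_section[OF r M, of Om Om' z0])
    show "linear (Om q)" for q
      by (rule linearI) (simp_all add: Om_def algebra_simps)
    show "continuous_on (ball 0 r \<times> UNIV) (\<lambda>(q, v). Om q v)"
    proof -
      have "continuous_on (ball 0 r \<times> UNIV) (\<lambda>x. A (p + fst x))" "continuous_on (ball 0 r \<times> UNIV) (\<lambda>x. B (p + fst x))"
        by (rule continuous_on_compose2[OF smooth_on_continuous[OF A]] continuous_on_compose2[OF smooth_on_continuous[OF B]];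
            (intro continuous_intros | use bU in auto))+
      then show ?thesis unfolding Om_def case_prod_beta' by (intro continuous_intros)
    qed
    show "norm (Om q v) \<le> M * norm v" if "q \<in> ball 0 r" for q v
      using comb[of "A (p + q)" 1 "B (p + q)" v] 1(4)[OF b1[OF that]] 2(4)[OF b2[OF that]] by (simp add: Om_def M_def)
    show "norm (Om q' v - Om q v) \<le> M * norm (q' - q) * norm v" if "q \<in> ball 0 r" "q' \<in> ball 0 r" for q q' v
    proof -
      have e: "Om q' v - Om q v = fst v *\<^sub>R (A (p + q') - A (p + q)) + snd v *\<^sub>R (B (p + q') - B (p + q))"
        by (simp add: Om_def algebra_simps)
      show ?thesis unfolding e using comb[of "A (p + q') - A (p + q)" "norm (q' - q)" "B (p + q') - B (p + q)" v]
          1(5)[OF b1[OF that(1)] b1[OF that(2)]] 2(5)[OF b2[OF that(1)] b2[OF that(2)]] by (simp add: M_def algebra_simps)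
    qed
    show "norm (Om q' v - Om q v - Om' q (q' - q) v) \<le> M * (norm (q' - q))\<^sup>2 * norm v" if "q \<in> ball 0 r" "q' \<in> ball 0 r" for q q' v
    proof -
      have e: "Om q' v - Om q v - Om' q (q' - q) v = fst v *\<^sub>R (A (p + q') - A (p + q) - pd (q' - q) A (p + q))
          + snd v *\<^sub>R (B (p + q') - B (p + q) - pd (q' - q) B (p + q))"
        by (simp add: Om_def Om'_def algebra_simps)
      show ?thesis unfolding e
        using comb[of "A (p + q') - A (p + q) - pd (q' - q) A (p + q)" "(norm (q' - q))\<^sup>2" "B (p + q') - B (p + q) - pd (q' - q) B (p + q)" v]
          1(6)[OF b1[OF that(1)] b1[OF that(2)]] 2(6)[OF b2[OF that(1)] b2[OF that(2)]] by (simp add: M_def algebra_simps)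
    qed
    show "((\<lambda>q. Om q v) has_derivative (\<lambda>k. Om' q k v)) (at q)" if "q \<in> ball 0 r" for q v
    proof -
      have t: "((\<lambda>q. p + q) has_derivative (\<lambda>k. k)) (at q)" by (auto intro!: derivative_eq_intros)
      have "((\<lambda>q. A (p + q)) has_derivative (\<lambda>k. pd k A (p + q))) (at q)"
        "((\<lambda>q. B (p + q)) has_derivative (\<lambda>k. pd k B (p + q))) (at q)"
        using has_derivative_compose[OF t has_pd[OF smooth_on_differentiable[OF A bU[OF that]]]]
          has_derivative_compose[OF t has_pd[OF smooth_on_differentiable[OF B bU[OF that]]]] .
      then show ?thesis unfolding Om_def Om'_def by (intro has_derivative_add has_derivative_scaleR_right)
    qed
    show "norm (Om' q k v) \<le> M * norm k * norm v" if "q \<in> ball 0 r" for q k v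
      using comb[of "pd k A (p + q)" "norm k" "pd k B (p + q)" v] 1(7)[OF b1[OF that]] 2(7)[OF b2[OF that]]
      by (simp add: Om'_def M_def algebra_simps)
    show "Om' q k h - Om' q h k + (Om q h o\<^sub>L Om q k) - (Om q k o\<^sub>L Om q h) = 0" if "q \<in> ball 0 r" for q h k
    proof (rule blinfun_eqI)
      fix x
      note d = smooth_on_differentiable[OF A bU[OF that]] smooth_on_differentiable[OF B bU[OF that]]
      have f: "d2 A (p + q) x = d1 B (p + q) x + B (p + q) (A (p + q) x) - A (p + q) (B (p + q) x)"
        using arg_cong[OF flat[OF bU[OF that]], of "\<lambda>b. blinfun_apply b x"]
        by (simp add: blinfun.add_left algebra_simps)
      show "blinfun_apply (Om' q k h - Om' q h k + (Om q h o\<^sub>L Om q k) - (Om q k o\<^sub>L Om q h)) x = blinfun_apply 0 x"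
        unfolding Om'_def Om_def pd_base[OF d(1)] pd_base[OF d(2)]
        by (simp add: blinfun.bilinear_simps f algebra_simps)
    qed
  qed blast
  define N where "N = (ball p \<delta> \<inter> U)"
  define Fp where "Fp q = F (q - p)" for q
  have "(Fp has_derivative (\<lambda>h. fst h *\<^sub>R A q (Fp q) + snd h *\<^sub>R B q (Fp q))) (at q)" if "q \<in> N" for q
  proof -
    have t: "((\<lambda>q. q - p) has_derivative (\<lambda>k. k)) (at q)" by (auto intro!: derivative_eq_intros)
    have "q - p \<in> ball 0 \<delta>" using that by (simp add: N_def dist_norm norm_minus_commute)
    from has_derivative_compose[OF t F(2)[OF this]] show ?thesis
      by (simp add: Fp_def[abs_def] Om_def blinfun.bilinear_simps)
  qed
  then show ?thesis using that[of N Fp] U \<delta> F(1) by (auto simp: N_def Fp_def)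
qed

text \<open>Bootstrapping: the derivatives of \<open>F\<close> are as often differentiable as \<open>F\<close>.\<close>

lemma smooth_on_parallel:
  fixes A B :: "base \<Rightarrow> ('s::banach \<Rightarrow>\<^sub>L 's)"
  assumes N: "open N" "smooth_on N A" "smooth_on N B"
    and F: "\<And>q. q \<in> N \<Longrightarrow> (F has_derivative (\<lambda>h. fst h *\<^sub>R A q (F q) + snd h *\<^sub>R B q (F q))) (at q)"
  shows "smooth_on N F"
  unfolding smooth_on_def
proof
  have df: "F differentiable (at q)" if "q \<in> N" for q using F[OF that] differentiable_def by blast
  fix k show "cdiff_on k N F"
  proof (induction k)
    case 0
    show ?case using df by (auto intro!: continuous_at_imp_continuous_on differentiable_imp_continuous_within)
  next
    case (Suc k)
    have "cdiff_on k N (pd b F)" for b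
    proof -
      have "cdiff_on k N (\<lambda>q. fst b *\<^sub>R A q (F q) + snd b *\<^sub>R B q (F q))"
        using N by (intro cdiff_on_add cdiff_on_bounded_linear[OF bounded_linear_scaleR_right]
            cdiff_on_bilinear[OF bounded_bilinear_blinfun_apply] Suc smooth_on_cdiff)
      then show ?thesis
        using cdiff_on_cong[OF N(1), of "pd b F"] pd_unique[OF F, of _ b] by simp
    qed
    then show ?case using df by (simp add: cdiff_on_Suc_pd)
  qed
qed


section \<open>Cubic forms related by a transformation\<close>

text \<open>The right-hand side of the equation as a homogeneous cubic form.\<close>

definition cub :: "fibre \<Rightarrow> base \<Rightarrow> real" where
  "cub u w = fst u * fst w ^ 3 + fst (snd u) * (fst w ^ 2 * snd w) + fst (snd (snd u)) * (fst w * snd w ^ 2)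
     + snd (snd (snd u)) * snd w ^ 3"

definition hess :: "(base \<Rightarrow> base) \<Rightarrow> base \<Rightarrow> base \<Rightarrow> base" where
  "hess f x w = (fst w * fst w) *\<^sub>R d1 (d1 f) x + (2 * fst w * snd w) *\<^sub>R d1 (d2 f) x + (snd w * snd w) *\<^sub>R d2 (d2 f) x"

definition tang :: "(base \<Rightarrow> base) \<Rightarrow> base \<Rightarrow> base \<Rightarrow> base" where
  "tang f x w = fst w *\<^sub>R d1 f x + snd w *\<^sub>R d2 f x"

definition cross :: "base \<Rightarrow> base \<Rightarrow> real" where
  "cross a b = fst a * snd b - snd a * fst b"

text \<open>The coefficients \<open>u\<close> at \<open>x\<close> are taken to \<open>v\<close> at \<open>f x\<close>. The transformation law says that the cubic form
  of the new equation, pulled back, and the old one times the Jacobian differ by the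
  determinant of the first and second derivative of \<open>f\<close> in the same direction. As an identity for all
  directions, the law can be composed by the chain rule.\<close>

definition relates :: "(base \<Rightarrow> base) \<Rightarrow> base \<Rightarrow> fibre \<Rightarrow> fibre \<Rightarrow> bool" where
  "relates f x u v \<longleftrightarrow> (\<forall>w. jac f x * cub u w = cub v (tang f x w) - cross (tang f x w) (hess f x w))"

lemma cubic_zero:
  assumes "\<And>w1 w2 :: real. c0 * w1 ^ 3 + c1 * (w1 ^ 2 * w2) + c2 * (w1 * w2 ^ 2) + c3 * w2 ^ 3 = 0"
  shows "c0 = 0" "c1 = 0" "c2 = 0" "c3 = 0"
proof -
  show "c0 = 0" using assms[of 1 0] by simp
  show "c3 = 0" using assms[of 0 1] by simp
  show "c1 = 0" "c2 = 0" using assms[of 1 1] assms[of 1 "-1"] assms[of 1 0] assms[of 0 1] by simp_all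
qed

text \<open>Two cubic forms that agree in all directions have the same coefficients.\<close>

lemma relates_coeffs:
  fixes f x u v
  defines "fx \<equiv> fst (d1 f x)" and "gx \<equiv> snd (d1 f x)" and "fy \<equiv> fst (d2 f x)" and "gy \<equiv> snd (d2 f x)"
    and "A11 \<equiv> fst (d1 (d1 f) x)" and "B11 \<equiv> snd (d1 (d1 f) x)" and "A12 \<equiv> fst (d1 (d2 f) x)"
    and "B12 \<equiv> snd (d1 (d2 f) x)" and "A22 \<equiv> fst (d2 (d2 f) x)" and "B22 \<equiv> snd (d2 (d2 f) x)"
    and "u0 \<equiv> fst u" and "u1 \<equiv> fst (snd u)" and "u2 \<equiv> fst (snd (snd u))" and "u3 \<equiv> snd (snd (snd u))"
    and "v0 \<equiv> fst v" and "v1 \<equiv> fst (snd v)" and "v2 \<equiv> fst (snd (snd v))" and "v3 \<equiv> snd (snd (snd v))"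
  shows "relates f x u v \<longleftrightarrow>
    jac f x * u0 = v0*fx^3 + v1*fx^2*gx + v2*fx*gx^2 + v3*gx^3 - (fx*B11 - gx*A11) \<and>
    jac f x * u1 = 3 * v0*fx^2*fy + v1*(fx^2*gy + 2*fx*fy*gx) + v2*(2*fx*gx*gy + fy*gx^2) + 3 * v3*gx^2*gy
      - (2*fx*B12 + fy*B11 - 2*gx*A12 - gy*A11) \<and>
    jac f x * u2 = 3 * v0*fx*fy^2 + v1*(2*fx*fy*gy + fy^2*gx) + v2*(fx*gy^2 + 2*fy*gx*gy) + 3 * v3*gx*gy^2
      - (fx*B22 + 2*fy*B12 - gx*A22 - 2*gy*A12) \<and>
    jac f x * u3 = v0*fy^3 + v1*fy^2*gy + v2*fy*gy^2 + v3*gy^3 - (fy*B22 - gy*A22)" (is "_ \<longleftrightarrow> ?R")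
proof -
  have e: "jac f x * cub u w - (cub v (tang f x w) - cross (tang f x w) (hess f x w)) =
    (jac f x * u0 - (v0*fx^3 + v1*fx^2*gx + v2*fx*gx^2 + v3*gx^3 - (fx*B11 - gx*A11))) * fst w ^ 3 +
    (jac f x * u1 - (3 * v0*fx^2*fy + v1*(fx^2*gy + 2*fx*fy*gx) + v2*(2*fx*gx*gy + fy*gx^2) + 3 * v3*gx^2*gy
      - (2*fx*B12 + fy*B11 - 2*gx*A12 - gy*A11))) * (fst w ^ 2 * snd w) +
    (jac f x * u2 - (3 * v0*fx*fy^2 + v1*(2*fx*fy*gy + fy^2*gx) + v2*(fx*gy^2 + 2*fy*gx*gy) + 3 * v3*gx*gy^2
      - (fx*B22 + 2*fy*B12 - gx*A22 - 2*gy*A12))) * (fst w * snd w ^ 2) +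
    (jac f x * u3 - (v0*fy^3 + v1*fy^2*gy + v2*fy*gy^2 + v3*gy^3 - (fy*B22 - gy*A22))) * snd w ^ 3" for w
    unfolding cub_def cross_def tang_def hess_def fst_add snd_add fst_scaleR snd_scaleR real_scaleR_def
      fx_def[symmetric] gx_def[symmetric] fy_def[symmetric] gy_def[symmetric] A11_def[symmetric] B11_def[symmetric]
      A12_def[symmetric] B12_def[symmetric] A22_def[symmetric] B22_def[symmetric] u0_def[symmetric] u1_def[symmetric]
      u2_def[symmetric] u3_def[symmetric] v0_def[symmetric] v1_def[symmetric] v2_def[symmetric] v3_def[symmetric]
    by algebra
  show ?thesis
  proof
    assume "relates f x u v"
    then have "jac f x * cub u w - (cub v (tang f x w) - cross (tang f x w) (hess f x w)) = 0" for w
      by (simp add: relates_def del: split_paired_All)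
    note z = this[unfolded e]
    show ?R using cubic_zero[OF z[of "(_, _)", unfolded fst_conv snd_conv]] by simp
  next
    assume ?R
    then have "jac f x * cub u w - (cub v (tang f x w) - cross (tang f x w) (hess f x w)) = 0" for w
      unfolding e by simp
    then show "relates f x u v" by (simp add: relates_def del: split_paired_All)
  qed
qed

text \<open>The substitution of a linear map into binary cubic forms is inverted by the substitution of its
  adjugate, up to a power of the determinant.\<close>

lemma lift_fun_algebra:
  fixes J fx fy gx gy A11 A12 A22 B11 B12 B22 u0 u1 u2 u3 v0 v1 v2 v3 :: real
  assumes J: "J = fx * gy - fy * gx" "J \<noteq> 0"
  defines "N0 \<equiv> u0 * gy^3 - u1 * gx * gy^2 + u2 * gy * gx^2 - u3 * gx^3 + (B11 * gy^2 - 2 * B12 * gx * gy + B22 * gx^2)"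
    and "N1 \<equiv> - 3 * u0 * gy^2 * fy + u1 * (fx * gy^2 + 2 * gx * gy * fy) - u2 * (2 * gx * fx * gy + fy * gx^2)
          + 3 * u3 * gx^2 * fx
          + (2 * B12 * (fx * gy + gx * fy) - 2 * B11 * gy * fy - 2 * B22 * gx * fx)
          - (A11 * gy^2 - 2 * A12 * gx * gy + A22 * gx^2)"
    and "N2 \<equiv> 3 * u0 * gy * fy^2 - u1 * (2 * fx * gy * fy + gx * fy^2) + u2 * (gy * fx^2 + 2 * fy * gx * fx)
          - 3 * u3 * gx * fx^2
          + (B11 * fy^2 - 2 * B12 * fx * fy + B22 * fx^2)
          - (2 * A12 * (fx * gy + gx * fy) - 2 * A11 * gy * fy - 2 * A22 * gx * fx)"
    and "N3 \<equiv> - u0 * fy^3 + u1 * fx * fy^2 - u2 * fy * fx^2 + u3 * fx^3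
          - (A11 * fy^2 - 2 * A12 * fx * fy + A22 * fx^2)"
  shows "N0 = J^2 * v0 \<and> N1 = J^2 * v1 \<and> N2 = J^2 * v2 \<and> N3 = J^2 * v3 \<longleftrightarrow>
    J * u0 = v0*fx^3 + v1*fx^2*gx + v2*fx*gx^2 + v3*gx^3 - (fx*B11 - gx*A11) \<and>
    J * u1 = 3 * v0*fx^2*fy + v1*(fx^2*gy + 2*fx*fy*gx) + v2*(2*fx*gx*gy + fy*gx^2) + 3 * v3*gx^2*gy
      - (2*fx*B12 + fy*B11 - 2*gx*A12 - gy*A11) \<and>
    J * u2 = 3 * v0*fx*fy^2 + v1*(2*fx*fy*gy + fy^2*gx) + v2*(fx*gy^2 + 2*fy*gx*gy) + 3 * v3*gx*gy^2
      - (fx*B22 + 2*fy*B12 - gx*A22 - 2*gy*A12) \<and>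
    J * u3 = v0*fy^3 + v1*fy^2*gy + v2*fy*gy^2 + v3*gy^3 - (fy*B22 - gy*A22)" (is "?L \<longleftrightarrow> ?R")
proof
  define E0 where "E0 = v0*fx^3 + v1*fx^2*gx + v2*fx*gx^2 + v3*gx^3 - (fx*B11 - gx*A11)"
  define E1 where "E1 = 3 * v0*fx^2*fy + v1*(fx^2*gy + 2*fx*fy*gx) + v2*(2*fx*gx*gy + fy*gx^2) + 3 * v3*gx^2*gy
      - (2*fx*B12 + fy*B11 - 2*gx*A12 - gy*A11)"
  define E2 where "E2 = 3 * v0*fx*fy^2 + v1*(2*fx*fy*gy + fy^2*gx) + v2*(fx*gy^2 + 2*fy*gx*gy) + 3 * v3*gx*gy^2
      - (fx*B22 + 2*fy*B12 - gx*A22 - 2*gy*A12)"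
  define E3 where "E3 = v0*fy^3 + v1*fy^2*gy + v2*fy*gy^2 + v3*gy^3 - (fy*B22 - gy*A22)"
  note E = E0_def E1_def E2_def E3_def
  assume L: ?L
  have 1: "J^3 * u0 = fx^3 * N0 + fx^2*gx * N1 + fx*gx^2 * N2 + gx^3 * N3 - J^2 * (fx*B11 - gx*A11)"
    "J^3 * u1 = 3*fx^2*fy * N0 + (fx^2*gy + 2*fx*fy*gx) * N1 + (2*fx*gx*gy + fy*gx^2) * N2 + 3*gx^2*gy * N3
       - J^2 * (2*fx*B12 + fy*B11 - 2*gx*A12 - gy*A11)"
    "J^3 * u2 = 3*fx*fy^2 * N0 + (2*fx*fy*gy + fy^2*gx) * N1 + (fx*gy^2 + 2*fy*gx*gy) * N2 + 3*gx*gy^2 * N3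
       - J^2 * (fx*B22 + 2*fy*B12 - gx*A22 - 2*gy*A12)"
    "J^3 * u3 = fy^3 * N0 + fy^2*gy * N1 + fy*gy^2 * N2 + gy^3 * N3 - J^2 * (fy*B22 - gy*A22)"
    unfolding N0_def N1_def N2_def N3_def J(1) by algebra+
  have "J^2 * (J * u0) = J^2 * E0" "J^2 * (J * u1) = J^2 * E1" "J^2 * (J * u2) = J^2 * E2" "J^2 * (J * u3) = J^2 * E3"
    using 1 L unfolding E by algebra+
  then have "J * u0 = E0 \<and> J * u1 = E1 \<and> J * u2 = E2 \<and> J * u3 = E3" using J(2) by simp
  then show ?R unfolding E .
next
  assume R: ?R
  note r = R[THEN conjunct1] R[THEN conjunct2, THEN conjunct1] R[THEN conjunct2, THEN conjunct2, THEN conjunct1]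
      R[THEN conjunct2, THEN conjunct2, THEN conjunct2]
  have 1: "J * N0 = (J*u0) * gy^3 - (J*u1) * gx * gy^2 + (J*u2) * gy * gx^2 - (J*u3) * gx^3 + J * (B11 * gy^2 - 2 * B12 * gx * gy + B22 * gx^2)"
    unfolding N0_def by algebra
  have 2: "J * N1 = - 3 * (J*u0) * gy^2 * fy + (J*u1) * (fx * gy^2 + 2 * gx * gy * fy) - (J*u2) * (2 * gx * fx * gy + fy * gx^2)
          + 3 * (J*u3) * gx^2 * fx
          + J * (2 * B12 * (fx * gy + gx * fy) - 2 * B11 * gy * fy - 2 * B22 * gx * fx)
          - J * (A11 * gy^2 - 2 * A12 * gx * gy + A22 * gx^2)"
    unfolding N1_def by algebra
  have 3: "J * N2 = 3 * (J*u0) * gy * fy^2 - (J*u1) * (2 * fx * gy * fy + gx * fy^2) + (J*u2) * (gy * fx^2 + 2 * fy * gx * fx)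
          - 3 * (J*u3) * gx * fx^2
          + J * (B11 * fy^2 - 2 * B12 * fx * fy + B22 * fx^2)
          - J * (2 * A12 * (fx * gy + gx * fy) - 2 * A11 * gy * fy - 2 * A22 * gx * fx)"
    unfolding N2_def by algebra
  have 4: "J * N3 = - (J*u0) * fy^3 + (J*u1) * fx * fy^2 - (J*u2) * fy * fx^2 + (J*u3) * fx^3
          - J * (A11 * fy^2 - 2 * A12 * fx * fy + A22 * fx^2)"
    unfolding N3_def by algebra
  have "J * N0 = J * (J^2 * v0)" unfolding 1 r unfolding J(1) by algebra
  moreover have "J * N1 = J * (J^2 * v1)" unfolding 2 r unfolding J(1) by algebra
  moreover have "J * N2 = J * (J^2 * v2)" unfolding 3 r unfolding J(1) by algebra
  moreover have "J * N3 = J * (J^2 * v3)" unfolding 4 r unfolding J(1) by algebra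
  ultimately show ?L using J(2) by simp
qed

lemma lift_fun_relates:
  assumes "jac f x \<noteq> 0"
  shows "lift_fun (jet2 f x u) = v \<longleftrightarrow> relates f x u v"
  unfolding relates_coeffs
  using assms by (subst lift_fun_algebra[symmetric])
    (auto simp: lift_fun_def jet2_def Let_def jac_def prod_eq_iff divide_eq_eq mult.commute[of "_ ^ 2"])

text \<open>If the second derivatives of \<open>f\<close> are expressed by its first derivatives, then \<open>f\<close> takes the equation
  to \<open>y'' = 0\<close> exactly if the coefficients are these combinations of the Christoffel symbols.\<close>

lemma relates_christoffel:
  assumes "jac f x \<noteq> 0"
    and "d1 (d1 f) x = a *\<^sub>R d1 f x + d *\<^sub>R d2 f x" "d1 (d2 f) x = b *\<^sub>R d1 f x + e *\<^sub>R d2 f x"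
    and "d2 (d2 f) x = c *\<^sub>R d1 f x + k *\<^sub>R d2 f x"
  shows "relates f x u 0 \<longleftrightarrow> u = (- d, a - 2 * e, 2 * b - k, c)"
proof -
  define fx gx fy gy where "fx = fst (d1 f x)" and "gx = snd (d1 f x)" and "fy = fst (d2 f x)" and "gy = snd (d2 f x)"
  have e: "- (fx * (a * gx + d * gy) - gx * (a * fx + d * fy)) = jac f x * (- d)"
    "- (2 * fx * (b * gx + e * gy) + fy * (a * gx + d * gy) - 2 * gx * (b * fx + e * fy) - gy * (a * fx + d * fy)) = jac f x * (a - 2 * e)"
    "- (fx * (c * gx + k * gy) + 2 * fy * (b * gx + e * gy) - gx * (c * fx + k * fy) - 2 * gy * (b * fx + e * fy)) = jac f x * (2 * b - k)"
    "- (fy * (c * gx + k * gy) - gy * (c * fx + k * fy)) = jac f x * c"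
    unfolding jac_def fx_def[symmetric] gx_def[symmetric] fy_def[symmetric] gy_def[symmetric] by algebra+
  have "relates f x u 0 \<longleftrightarrow> jac f x * fst u = jac f x * (- d) \<and> jac f x * fst (snd u) = jac f x * (a - 2 * e) \<and>
     jac f x * fst (snd (snd u)) = jac f x * (2 * b - k) \<and> jac f x * snd (snd (snd u)) = jac f x * c"
    unfolding relates_coeffs assms(2-4) fst_add snd_add fst_scaleR snd_scaleR real_scaleR_def
      fx_def[symmetric] gx_def[symmetric] fy_def[symmetric] gy_def[symmetric] e[symmetric] by simp
  then show ?thesis unfolding mult_left_cancel[OF assms(1)] by (simp add: prod_eq_iff)
qed


section \<open>Flattening transformations\<close>

type_synonym tractor = "real \<times> real \<times> real"

text \<open>The matrices of the system for \<open>(z, z\<^sub>x, z\<^sub>y)\<close>, without the row that says that the derivative of \<open>z\<close> is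
  \<open>z\<^sub>x\<close> or \<open>z\<^sub>y\<close>. Both matrices have a multiple of the diagonal matrix with entries \<open>1\<close> and \<open>-1\<close> in
  their lower right part, since the connection is normalised to be trace free.\<close>

definition trm :: "real \<Rightarrow> real \<Rightarrow> real \<Rightarrow> real \<Rightarrow> real \<Rightarrow> tractor \<Rightarrow>\<^sub>L tractor" where
  "trm a b c d e = a *\<^sub>R Blinfun (\<lambda>x. (0, fst (snd x), - snd (snd x))) + b *\<^sub>R Blinfun (\<lambda>x. (0, - snd (snd x), 0))
     + c *\<^sub>R Blinfun (\<lambda>x. (0, fst x, 0)) + d *\<^sub>R Blinfun (\<lambda>x. (0, 0, fst (snd x))) + e *\<^sub>R Blinfun (\<lambda>x. (0, 0, fst x))"

lemma bl_tractor: "linear f \<Longrightarrow> blinfun_apply (Blinfun f) x = f x" for f :: "tractor \<Rightarrow> tractor"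
  by (simp add: bounded_linear_Blinfun_apply linear_conv_bounded_linear)

lemma trm_apply: "blinfun_apply (trm a b c d e) x =
    (0, a * fst (snd x) - b * snd (snd x) + c * fst x, d * fst (snd x) - a * snd (snd x) + e * fst x)"
  unfolding trm_def by (simp add: blinfun.bilinear_simps bl_tractor linear_iff)

definition proj1 :: "tractor \<Rightarrow>\<^sub>L tractor" where "proj1 = Blinfun (\<lambda>x. (fst (snd x), 0, 0))"
definition proj2 :: "tractor \<Rightarrow>\<^sub>L tractor" where "proj2 = Blinfun (\<lambda>x. (snd (snd x), 0, 0))"

lemma proj_apply: "blinfun_apply proj1 x = (fst (snd x), 0, 0)" "blinfun_apply proj2 x = (snd (snd x), 0, 0)"
  unfolding proj1_def proj2_def by (simp_all add: bl_tractor linear_iff)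

lemma pd_trm:
  assumes "f1 differentiable (at x)" "f2 differentiable (at x)" "f3 differentiable (at x)" "f4 differentiable (at x)" "f5 differentiable (at x)"
  shows "pd v (\<lambda>x. K + trm (f1 x) (f2 x) (f3 x) (f4 x) (f5 x)) x = trm (pd v f1 x) (pd v f2 x) (pd v f3 x) (pd v f4 x) (pd v f5 x)"
  unfolding trm_def by (simp add: pds dfs assms)

lemma smooth_on_trm:
  "open U \<Longrightarrow> smooth_on U f1 \<Longrightarrow> smooth_on U f2 \<Longrightarrow> smooth_on U f3 \<Longrightarrow> smooth_on U f4 \<Longrightarrow> smooth_on U f5 \<Longrightarrow>
    smooth_on U (\<lambda>x. K + trm (f1 x) (f2 x) (f3 x) (f4 x) (f5 x))"
  unfolding trm_def by (intro smooth_intros)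

locale flat_ode =
  fixes U :: "base set" and s :: "base \<Rightarrow> fibre"
  assumes U: "open U" and s: "smooth_on U s" and L: "\<And>q. q \<in> U \<Longrightarrow> liouville1 s q = 0 \<and> liouville2 s q = 0"
begin

definition "u0 q = fst (s q)"
definition "u1 q = fst (snd (s q))"
definition "u2 q = fst (snd (snd (s q)))"
definition "u3 q = snd (snd (snd (s q)))"
definition "P q = fst (d2 s q) - fst (snd (d1 s q)) / 3 + 2 * u1 q ^ 2 / 9 - 2 * u0 q * u2 q / 3"
definition "Q q = (fst (snd (d2 s q)) - fst (snd (snd (d1 s q)))) / 3 + u1 q * u2 q / 9 - u0 q * u3 q"
definition "R q = fst (snd (snd (d2 s q))) / 3 - snd (snd (snd (d1 s q))) + 2 * u2 q ^ 2 / 9 - 2 * u1 q * u3 q / 3"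
definition "A q = proj1 + trm (u1 q / 3) (u0 q) (P q) (u2 q / 3) (Q q)"
definition "B q = proj2 + trm (u2 q / 3) (u1 q / 3) (Q q) (u3 q) (R q)"

lemma smooth_coeffs: "smooth_on U u0" "smooth_on U u1" "smooth_on U u2" "smooth_on U u3"
    "smooth_on U P" "smooth_on U Q" "smooth_on U R"
proof -
  show u: "smooth_on U u0" "smooth_on U u1" "smooth_on U u2" "smooth_on U u3"
    unfolding u0_def[abs_def] u1_def[abs_def] u2_def[abs_def] u3_def[abs_def] by (intro smooth_intros U s)+
  have c: "(3::real) \<noteq> 0" "(9::real) \<noteq> 0" by simp_all
  show "smooth_on U P" "smooth_on U Q" "smooth_on U R"
    unfolding P_def[abs_def] Q_def[abs_def] R_def[abs_def] by (intro smooth_intros U s u c)+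
qed

lemma smooth_AB: "smooth_on U A" "smooth_on U B"
proof -
  have c: "(3::real) \<noteq> 0" by simp
  show "smooth_on U A" "smooth_on U B"
    unfolding A_def[abs_def] B_def[abs_def] by (intro smooth_on_trm smooth_intros U smooth_coeffs c)+
qed

text \<open>In the coefficients of \<open>z\<^sub>x\<close> and \<open>z\<^sub>y\<close> the equality holds by the choice of \<open>P\<close>, \<open>Q\<close> and \<open>R\<close>; the
  coefficients of \<open>z\<close> differ by a third of the Liouville expressions.\<close>

lemma flat_AB:
  assumes q: "q \<in> U"
  shows "d2 A q + (A q o\<^sub>L B q) = d1 B q + (B q o\<^sub>L A q)"
proof -
  note d = smooth_on_differentiable[OF _ q]
  have ds: "s differentiable (at q)" "d1 s differentiable (at q)" "d2 s differentiable (at q)"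
    by (rule d, intro smooth_intros U s)+
  have du: "u0 differentiable (at q)" "u1 differentiable (at q)" "u2 differentiable (at q)" "u3 differentiable (at q)"
    "P differentiable (at q)" "Q differentiable (at q)" "R differentiable (at q)" by (intro d smooth_coeffs)+
  have pu: "pd b u0 q = fst (pd b s q)" "pd b u1 q = fst (snd (pd b s q))" "pd b u2 q = fst (snd (snd (pd b s q)))"
    "pd b u3 q = snd (snd (snd (pd b s q)))" for b
    unfolding u0_def[abs_def] u1_def[abs_def] u2_def[abs_def] u3_def[abs_def] by (simp_all add: pds dfs ds)
  have com: "d2 (d1 s) q = d1 (d2 s) q" by (rule d_commute[OF U q s])
  have pP: "pd b P q = fst (pd b (d2 s) q) - fst (snd (pd b (d1 s) q)) / 3 + 4 * u1 q * pd b u1 q / 9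
      - 2 * (u0 q * pd b u2 q + pd b u0 q * u2 q) / 3" for b
    unfolding P_def[abs_def] by (simp add: pds dfs ds du) (simp add: field_simps)
  have pQ: "pd b Q q = (fst (snd (pd b (d2 s) q)) - fst (snd (snd (pd b (d1 s) q)))) / 3
      + (u1 q * pd b u2 q + pd b u1 q * u2 q) / 9 - (u0 q * pd b u3 q + pd b u0 q * u3 q)" for b
    unfolding Q_def[abs_def] by (simp add: pds dfs ds du) (simp add: field_simps)
  have pR: "pd b R q = fst (snd (snd (pd b (d2 s) q))) / 3 - snd (snd (snd (pd b (d1 s) q))) + 4 * u2 q * pd b u2 q / 9
      - 2 * (u1 q * pd b u3 q + pd b u1 q * u3 q) / 3" for b
    unfolding R_def[abs_def] by (simp add: pds dfs ds du) (simp add: field_simps)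
  have d3: "(\<lambda>q. u0 q / 3) differentiable (at q)" "(\<lambda>q. u1 q / 3) differentiable (at q)" "(\<lambda>q. u2 q / 3) differentiable (at q)"
    by (intro dfs du; simp)+
  have p3: "pd b (\<lambda>q. u1 q / 3) q = pd b u1 q / 3" "pd b (\<lambda>q. u2 q / 3) q = pd b u2 q / 3" for b
    by (simp_all add: pds dfs du)
  have A2: "d2 A q = trm (d2 u1 q / 3) (d2 u0 q) (d2 P q) (d2 u2 q / 3) (d2 Q q)"
    unfolding A_def[abs_def] d2_eq by (subst pd_trm) (simp_all add: d3 du p3)
  have B1: "d1 B q = trm (d1 u2 q / 3) (d1 u1 q / 3) (d1 Q q) (d1 u3 q) (d1 R q)"
    unfolding B_def[abs_def] d1_eq by (subst pd_trm) (simp_all add: d3 du p3)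
  have dl: "d1 u0 q = fst (d1 s q)" "d1 u1 q = fst (snd (d1 s q))" "d1 u2 q = fst (snd (snd (d1 s q)))" "d1 u3 q = snd (snd (snd (d1 s q)))"
    "d2 u0 q = fst (d2 s q)" "d2 u1 q = fst (snd (d2 s q))" "d2 u2 q = fst (snd (snd (d2 s q)))" "d2 u3 q = snd (snd (snd (d2 s q)))"
    by (simp_all add: d1_eq d2_eq pu)
  have l1: "3 * fst (d2 (d2 s) q) - 2 * fst (snd (d1 (d2 s) q)) + fst (snd (snd (d1 (d1 s) q)))
     - 3 * u0 q * d2 u2 q + 6 * u0 q * d1 u3 q + 2 * u1 q * d2 u1 q - u1 q * d1 u2 q
     - 3 * u2 q * d2 u0 q + 3 * u3 q * d1 u0 q = 0"
    using L[OF q] by (simp add: liouville1_def Let_def dl u0_def u1_def u2_def u3_def)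
  have l2: "fst (snd (d2 (d2 s) q)) - 2 * fst (snd (snd (d1 (d2 s) q))) + 3 * snd (snd (snd (d1 (d1 s) q)))
     + 3 * u1 q * d1 u3 q - 3 * u0 q * d2 u3 q - 6 * u3 q * d2 u0 q + 3 * u3 q * d1 u1 q
     + u2 q * d2 u1 q - 2 * u2 q * d1 u2 q = 0"
    using L[OF q] by (simp add: liouville2_def Let_def dl u0_def u1_def u2_def u3_def)
  have eP: "3 * P q = 3 * d2 u0 q - d1 u1 q + 2 * u1 q ^ 2 / 3 - 2 * u0 q * u2 q"
    and eQ: "3 * Q q = d2 u1 q - d1 u2 q + u1 q * u2 q / 3 - 3 * u0 q * u3 q"
    and eR: "3 * R q = d2 u2 q - 3 * d1 u3 q + 2 * u2 q ^ 2 / 3 - 2 * u1 q * u3 q"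
    by (simp_all add: P_def Q_def R_def dl field_simps)
  have dP2: "d2 P q = fst (d2 (d2 s) q) - fst (snd (d1 (d2 s) q)) / 3 + 4 * u1 q * d2 u1 q / 9
      - 2 * (u0 q * d2 u2 q + d2 u0 q * u2 q) / 3" using pP[of "(0,1)"] by (simp add: d2_eq[symmetric] com)
  have dQ1: "d1 Q q = (fst (snd (d1 (d2 s) q)) - fst (snd (snd (d1 (d1 s) q)))) / 3
      + (u1 q * d1 u2 q + d1 u1 q * u2 q) / 9 - (u0 q * d1 u3 q + d1 u0 q * u3 q)" using pQ[of "(1,0)"] by (simp add: d1_eq[symmetric])
  have dQ2: "d2 Q q = (fst (snd (d2 (d2 s) q)) - fst (snd (snd (d1 (d2 s) q)))) / 3
      + (u1 q * d2 u2 q + d2 u1 q * u2 q) / 9 - (u0 q * d2 u3 q + d2 u0 q * u3 q)" using pQ[of "(0,1)"] by (simp add: d2_eq[symmetric] com)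
  have dR1: "d1 R q = fst (snd (snd (d1 (d2 s) q))) / 3 - snd (snd (snd (d1 (d1 s) q))) + 4 * u2 q * d1 u2 q / 9
      - 2 * (u1 q * d1 u3 q + d1 u1 q * u3 q) / 3" using pR[of "(1,0)"] by (simp add: d1_eq[symmetric])
  have P': "P q = d2 u0 q - d1 u1 q / 3 + 2 * u1 q ^ 2 / 9 - 2 * u0 q * u2 q / 3"
    and Q': "Q q = (d2 u1 q - d1 u2 q) / 3 + u1 q * u2 q / 9 - u0 q * u3 q"
    and R': "R q = d2 u2 q / 3 - d1 u3 q + 2 * u2 q ^ 2 / 9 - 2 * u1 q * u3 q / 3"
    by (simp_all add: P_def Q_def R_def dl)
  have c1: "d2 P q + 2 * u1 q * Q q / 3 - u0 q * R q = d1 Q q + u2 q * P q / 3"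
    using l1 unfolding dP2 dQ1 P' Q' R' by (simp add: field_simps power2_eq_square)
  have c2: "d2 Q q + 2 * u2 q * Q q / 3 - u1 q * R q / 3 = d1 R q + u3 q * P q"
    using l2 unfolding dQ2 dR1 P' Q' R' by (simp add: field_simps power2_eq_square)
  show ?thesis
  proof (rule blinfun_eqI)
    fix x :: tractor
    obtain z p r where x: "x = (z, p, r)" by (cases x)
    have "(d2 u1 q / 3) * p - d2 u0 q * r + d2 P q * z + ((u1 q / 3) * (u2 q / 3 * p - u1 q / 3 * r + Q q * z) - u0 q * (u3 q * p - u2 q / 3 * r + R q * z) + P q * r)
        = (d1 u2 q / 3) * p - (d1 u1 q / 3) * r + d1 Q q * z + ((u2 q / 3) * (u1 q / 3 * p - u0 q * r + P q * z) - (u1 q / 3) * (u2 q / 3 * p - u1 q / 3 * r + Q q * z) + Q q * p)"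
    proof -
      have "d2 P q * z = (d1 Q q + u2 q * P q / 3 - 2 * u1 q * Q q / 3 + u0 q * R q) * z" using c1 by simp
      moreover have "P q * r = (d2 u0 q - d1 u1 q / 3 + 2 * u1 q ^ 2 / 9 - 2 * u0 q * u2 q / 3) * r" by (simp only: P')
      moreover have "Q q * p = ((d2 u1 q - d1 u2 q) / 3 + u1 q * u2 q / 9 - u0 q * u3 q) * p" by (simp only: Q')
      ultimately show ?thesis by (simp add: field_simps power2_eq_square)
    qed
    moreover have "(d2 u2 q / 3) * p - (d2 u1 q / 3) * r + d2 Q q * z + ((u2 q / 3) * (u2 q / 3 * p - u1 q / 3 * r + Q q * z) - (u1 q / 3) * (u3 q * p - u2 q / 3 * r + R q * z) + Q q * r)
        = d1 u3 q * p - (d1 u2 q / 3) * r + d1 R q * z + (u3 q * (u1 q / 3 * p - u0 q * r + P q * z) - (u2 q / 3) * (u2 q / 3 * p - u1 q / 3 * r + Q q * z) + R q * p)"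
    proof -
      have "d2 Q q * z = (d1 R q + u3 q * P q - 2 * u2 q * Q q / 3 + u1 q * R q / 3) * z" using c2 by simp
      moreover have "Q q * r = ((d2 u1 q - d1 u2 q) / 3 + u1 q * u2 q / 9 - u0 q * u3 q) * r" by (simp only: Q')
      moreover have "R q * p = (d2 u2 q / 3 - d1 u3 q + 2 * u2 q ^ 2 / 9 - 2 * u1 q * u3 q / 3) * p" by (simp only: R')
      ultimately show ?thesis by (simp add: field_simps power2_eq_square)
    qed
    ultimately show "blinfun_apply (d2 A q + (A q o\<^sub>L B q)) x = blinfun_apply (d1 B q + (B q o\<^sub>L A q)) x"
      unfolding A2 B1 A_def B_def x
      by (simp add: blinfun.bilinear_simps trm_apply proj_apply algebra_simps)
  qed
qed

text \<open>Let \<open>h\<close> be the quotient of a solution by the solution \<open>z\<^sub>0\<close>. Its second derivatives are expressed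
  by its first derivatives alone: the terms without derivatives cancel, and the Christoffel symbols
  change by multiples of \<open>X = z\<^sub>0\<^sub>x/z\<^sub>0\<close> and \<open>Y = z\<^sub>0\<^sub>y/z\<^sub>0\<close> that do not affect the combinations which give
  the coefficients of the equation.\<close>

lemma flattening:
  assumes p: "p \<in> U"
  obtains N f where "p \<in> N" "N \<subseteq> U" "point_transformation N f" "\<And>q. q \<in> N \<Longrightarrow> relates f q (s q) 0"
proof -
  have ex: "\<exists>N F. open N \<and> p \<in> N \<and> N \<subseteq> U \<and> F p = z0 \<and>
    (\<forall>q\<in>N. (F has_derivative (\<lambda>h. fst h *\<^sub>R A q (F q) + snd h *\<^sub>R B q (F q))) (at q))" for z0
    by (rule parallel_section[OF U p smooth_AB flat_AB, of z0]) (assumption, blast)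
  obtain N0 Z0 where 0: "open N0" "p \<in> N0" "N0 \<subseteq> U" "Z0 p = (1, 0, 0)"
    "\<And>q. q \<in> N0 \<Longrightarrow> (Z0 has_derivative (\<lambda>h. fst h *\<^sub>R A q (Z0 q) + snd h *\<^sub>R B q (Z0 q))) (at q)" using ex[of "(1, 0, 0)"] by blast
  obtain N1 Z1 where 1: "open N1" "p \<in> N1" "N1 \<subseteq> U" "Z1 p = (0, 1, 0)"
    "\<And>q. q \<in> N1 \<Longrightarrow> (Z1 has_derivative (\<lambda>h. fst h *\<^sub>R A q (Z1 q) + snd h *\<^sub>R B q (Z1 q))) (at q)" using ex[of "(0, 1, 0)"] by blast
  obtain N2 Z2 where 2: "open N2" "p \<in> N2" "N2 \<subseteq> U" "Z2 p = (0, 0, 1)"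
    "\<And>q. q \<in> N2 \<Longrightarrow> (Z2 has_derivative (\<lambda>h. fst h *\<^sub>R A q (Z2 q) + snd h *\<^sub>R B q (Z2 q))) (at q)" using ex[of "(0, 0, 1)"] by blast
  have sm: "smooth_on N Z" if "open N" "N \<subseteq> U"
    "\<And>q. q \<in> N \<Longrightarrow> (Z has_derivative (\<lambda>h. fst h *\<^sub>R A q (Z q) + snd h *\<^sub>R B q (Z q))) (at q)" for N Z
    by (rule smooth_on_parallel[OF that(1) smooth_on_subset[OF smooth_AB(1) that(2)] smooth_on_subset[OF smooth_AB(2) that(2)] that(3)])
  have sZ: "smooth_on N0 Z0" "smooth_on N1 Z1" "smooth_on N2 Z2"
    using sm[OF 0(1,3,5)] sm[OF 1(1,3,5)] sm[OF 2(1,3,5)] by blast+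
  define N where "N = {q \<in> N0 \<inter> N1 \<inter> N2. fst (Z0 q) \<noteq> 0}"
  have oN: "open N"
  proof -
    have "continuous_on (N0 \<inter> N1 \<inter> N2) (\<lambda>q. fst (Z0 q))"
      by (rule continuous_on_subset[OF continuous_on_fst[OF smooth_on_continuous[OF sZ(1)]]]) blast
    then have "open ((N0 \<inter> N1 \<inter> N2) \<inter> (\<lambda>q. fst (Z0 q)) -` (- {0}))"
      by (rule continuous_open_preimage) (use 0 1 2 in auto)
    moreover have "N = (N0 \<inter> N1 \<inter> N2) \<inter> (\<lambda>q. fst (Z0 q)) -` (- {0})" by (auto simp: N_def)
    ultimately show ?thesis by simp
  qed
  have pN: "p \<in> N" using 0 1 2 by (simp add: N_def)
  have NU: "N \<subseteq> U" using 0 by (auto simp: N_def)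
  have sN: "smooth_on N Z0" "smooth_on N Z1" "smooth_on N Z2"
    by (rule smooth_on_subset[OF sZ(1)] smooth_on_subset[OF sZ(2)] smooth_on_subset[OF sZ(3)]; auto simp: N_def)+
  have nz: "fst (Z0 q) \<noteq> 0" if "q \<in> N" for q using that by (simp add: N_def)
  define par where "par Z \<longleftrightarrow> smooth_on N Z \<and> (\<forall>q\<in>N. d1 Z q = A q (Z q) \<and> d2 Z q = B q (Z q))" for Z
  have par: "par Z0" "par Z1" "par Z2"
    unfolding par_def d1_eq d2_eq using sN pd_unique[OF 0(5)] pd_unique[OF 1(5)] pd_unique[OF 2(5)] by (auto simp: N_def)
  define f where "f q = (fst (Z1 q) / fst (Z0 q), fst (Z2 q) / fst (Z0 q))" for q
  have sf: "smooth_on N f" unfolding f_def[abs_def] by (intro smooth_intros oN sN nz)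
  have AB1: "fst (A q Z) = fst (snd Z)" "fst (snd (A q Z)) = u1 q / 3 * fst (snd Z) - u0 q * snd (snd Z) + P q * fst Z"
    "snd (snd (A q Z)) = u2 q / 3 * fst (snd Z) - u1 q / 3 * snd (snd Z) + Q q * fst Z"
    "fst (B q Z) = snd (snd Z)" "fst (snd (B q Z)) = u2 q / 3 * fst (snd Z) - u1 q / 3 * snd (snd Z) + Q q * fst Z"
    "snd (snd (B q Z)) = u3 q * fst (snd Z) - u2 q / 3 * snd (snd Z) + R q * fst Z" for q Z
    by (simp_all add: A_def B_def blinfun.bilinear_simps trm_apply proj_apply)
  \<comment> \<open>the logarithmic derivatives of the denominator\<close>
  define X Y where "X q = fst (snd (Z0 q)) / fst (Z0 q)" and "Y q = snd (snd (Z0 q)) / fst (Z0 q)" for q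
  have quot: "d1 (d1 h) q = (u1 q / 3 - 2 * X q) * d1 h q - u0 q * d2 h q \<and>
     d1 (d2 h) q = (u2 q / 3 - Y q) * d1 h q + (- u1 q / 3 - X q) * d2 h q \<and>
     d2 (d2 h) q = u3 q * d1 h q - (u2 q / 3 + 2 * Y q) * d2 h q"
    if Z: "par Z" and h: "h = (\<lambda>q. fst (Z q) / fst (Z0 q))" and q: "q \<in> N" for Z h q
  proof -
    have sZ: "smooth_on N Z" and dZ: "\<And>q. q \<in> N \<Longrightarrow> d1 Z q = A q (Z q)" "\<And>q. q \<in> N \<Longrightarrow> d2 Z q = B q (Z q)"
      using Z by (auto simp: par_def)
    have dZ0: "\<And>q. q \<in> N \<Longrightarrow> d1 Z0 q = A q (Z0 q)" "\<And>q. q \<in> N \<Longrightarrow> d2 Z0 q = B q (Z0 q)"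
      using par(1) by (auto simp: par_def)
    have sh: "smooth_on N h" unfolding h by (intro smooth_intros oN sZ sN nz)
    note df = smooth_on_differentiable[of N]
    have prod: "fst (Z q) = h q * fst (Z0 q)" if "q \<in> N" for q using nz[OF that] by (simp add: h)
    have f1: "fst (pd b Z q) = h q * fst (pd b Z0 q) + pd b h q * fst (Z0 q)" if q: "q \<in> N" for b q
    proof -
      have "pd b (\<lambda>q. fst (Z q)) q = pd b (\<lambda>q. h q * fst (Z0 q)) q" by (rule pd_cong[OF oN q prod])
      then show ?thesis using df[OF sZ q] df[OF sN(1) q] df[OF sh q] by (simp add: pds dfs)
    qed
    have f2: "fst (pd c (pd b Z) q) = h q * fst (pd c (pd b Z0) q) + pd c h q * fst (pd b Z0 q)
        + pd b h q * fst (pd c Z0 q) + pd c (pd b h) q * fst (Z0 q)" for b c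
    proof -
      have "pd c (\<lambda>q. fst (pd b Z q)) q = pd c (\<lambda>q. h q * fst (pd b Z0 q) + pd b h q * fst (Z0 q)) q"
        by (rule pd_cong[OF oN q f1])
      then show ?thesis
        using df[OF sZ q] df[OF sN(1) q] df[OF sh q] df[OF smooth_on_pd[OF oN sZ] q] df[OF smooth_on_pd[OF oN sN(1)] q] df[OF smooth_on_pd[OF oN sh] q]
        by (simp add: pds dfs)
    qed
    have g: "fst (d1 (d1 Z) q) = fst (snd (d1 Z q))" "fst (d1 (d2 Z) q) = snd (snd (d1 Z q))" "fst (d2 (d2 Z) q) = snd (snd (d2 Z q))"
      if "par Z" for Z
    proof -
      have sZ: "smooth_on N Z" and dZ: "\<And>q. q \<in> N \<Longrightarrow> d1 Z q = A q (Z q)" "\<And>q. q \<in> N \<Longrightarrow> d2 Z q = B q (Z q)"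
        using that by (auto simp: par_def)
      have c: "pd b (\<lambda>q. fst (d1 Z q)) q = pd b (\<lambda>q. fst (snd (Z q))) q" "pd b (\<lambda>q. fst (d2 Z q)) q = pd b (\<lambda>q. snd (snd (Z q))) q" for b
        by (rule pd_cong[OF oN q], simp add: dZ AB1)+
      have e: "fst (pd b (d1 Z) q) = fst (snd (pd b Z q))" "fst (pd b (d2 Z) q) = snd (snd (pd b Z q))" for b
        using c[of b] df[OF sZ q] df[OF smooth_on_d1[OF oN sZ] q] df[OF smooth_on_d2[OF oN sZ] q]
        by (simp_all add: pds dfs)
      show "fst (d1 (d1 Z) q) = fst (snd (d1 Z q))" "fst (d1 (d2 Z) q) = snd (snd (d1 Z q))" "fst (d2 (d2 Z) q) = snd (snd (d2 Z q))"
        using e[of "(1,0)"] e(2)[of "(0,1)"] by (simp_all flip: d1_eq d2_eq)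
    qed
    define z where "z = fst (Z0 q)"
    have z: "z \<noteq> 0" using nz[OF q] by (simp add: z_def)
    have X: "fst (snd (Z0 q)) = z * X q" and Y: "snd (snd (Z0 q)) = z * Y q" using z by (simp_all add: X_def Y_def z_def)
    have e1: "fst (snd (Z q)) = h q * (z * X q) + d1 h q * z" "snd (snd (Z q)) = h q * (z * Y q) + d2 h q * z"
      using f1[OF q, of "(1,0)"] f1[OF q, of "(0,1)"] q by (simp_all add: dZ dZ0 AB1 X Y z_def flip: d1_eq d2_eq)
    have e0: "fst (Z q) = h q * z" using prod[OF q] by (simp add: z_def)
    have "z * d1 (d1 h) q = z * ((u1 q / 3 - 2 * X q) * d1 h q - u0 q * d2 h q)"
      using f2[of "(1,0)" "(1,0)"] unfolding d1_eq[symmetric] d2_eq[symmetric] g[OF Z] g[OF par(1)] dZ[OF q] dZ0[OF q] AB1 e1 e0 X Y z_def[symmetric]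
      by (simp add: algebra_simps)
    moreover have "z * d1 (d2 h) q = z * ((u2 q / 3 - Y q) * d1 h q + (- u1 q / 3 - X q) * d2 h q)"
      using f2[of "(1,0)" "(0,1)"] unfolding d1_eq[symmetric] d2_eq[symmetric] g[OF Z] g[OF par(1)] dZ[OF q] dZ0[OF q] AB1 e1 e0 X Y z_def[symmetric]
      by (simp add: algebra_simps)
    moreover have "z * d2 (d2 h) q = z * (u3 q * d1 h q - (u2 q / 3 + 2 * Y q) * d2 h q)"
      using f2[of "(0,1)" "(0,1)"] unfolding d1_eq[symmetric] d2_eq[symmetric] g[OF Z] g[OF par(1)] dZ[OF q] dZ0[OF q] AB1 e1 e0 X Y z_def[symmetric]
      by (simp add: algebra_simps)
    ultimately show ?thesis using z by simp
  qed
  define h1 h2 where "h1 = (\<lambda>q. fst (Z1 q) / fst (Z0 q))" and "h2 = (\<lambda>q. fst (Z2 q) / fst (Z0 q))"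
  have "smooth_on N h1" unfolding h1_def by (intro smooth_intros oN sN nz)
  moreover have "smooth_on N h2" unfolding h2_def by (intro smooth_intros oN sN nz)
  ultimately have sh: "smooth_on N h1" "smooth_on N h2" by blast+
  have fh: "f = (\<lambda>q. (h1 q, h2 q))" by (simp add: f_def[abs_def] h1_def h2_def)
  have pdf: "pd b f q = (pd b h1 q, pd b h2 q)" if "q \<in> N" for b q
    unfolding fh by (rule pd_Pair) (rule smooth_on_differentiable[OF _ that], rule sh)+
  have pdf2: "pd c (pd b f) q = (pd c (pd b h1) q, pd c (pd b h2) q)" if q: "q \<in> N" for b c q
  proof -
    have "pd c (pd b f) q = pd c (\<lambda>q. (pd b h1 q, pd b h2 q)) q" by (rule pd_cong[OF oN q pdf])
    also have "\<dots> = (pd c (pd b h1) q, pd c (pd b h2) q)"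
      by (rule pd_Pair) (rule smooth_on_differentiable[OF _ q], rule smooth_on_pd[OF oN], rule sh)+
    finally show ?thesis .
  qed
  have rel: "relates f q (s q) 0" if q: "q \<in> N" and j: "jac f q \<noteq> 0" for q
  proof -
    have F: "d1 f q = (d1 h1 q, d1 h2 q)" "d2 f q = (d2 h1 q, d2 h2 q)" "d1 (d1 f) q = (d1 (d1 h1) q, d1 (d1 h2) q)"
      "d1 (d2 f) q = (d1 (d2 h1) q, d1 (d2 h2) q)" "d2 (d2 f) q = (d2 (d2 h1) q, d2 (d2 h2) q)"
      using pdf[OF q] pdf2[OF q] by (simp_all add: d1_eq d2_eq)
    have "relates f q (s q) 0 \<longleftrightarrow> s q = (- (- u0 q), (u1 q / 3 - 2 * X q) - 2 * (- u1 q / 3 - X q),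
        2 * (u2 q / 3 - Y q) - (- (u2 q / 3 + 2 * Y q)), u3 q)"
      by (rule relates_christoffel[OF j])
        (simp_all add: F quot[OF par(2) h1_def q] quot[OF par(3) h2_def q] algebra_simps)
    then show ?thesis by (simp add: prod_eq_iff u0_def u1_def u2_def u3_def)
  qed
  have "jac f p \<noteq> 0"
  proof -
    have "pd b f p = (fst (pd b Z1 p), fst (pd b Z2 p))" for b
    proof -
      have "pd b h1 p = fst (pd b Z1 p)" "pd b h2 p = fst (pd b Z2 p)"
        unfolding h1_def h2_def
        using smooth_on_differentiable[OF sN(1) pN] smooth_on_differentiable[OF sN(2) pN] smooth_on_differentiable[OF sN(3) pN] 0(4) 1(4) 2(4)
        by (simp_all add: pds dfs)
      then show ?thesis using pdf[OF pN] by simp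
    qed
    from this[of "(1, 0)"] this[of "(0, 1)"] have "d1 f p = (1, 0)" "d2 f p = (0, 1)"
      using par pN 0(4) 1(4) 2(4) by (simp_all add: par_def AB1 flip: d1_eq d2_eq)
    then show ?thesis by (simp add: jac_def)
  qed
  then obtain M where M: "p \<in> M" "M \<subseteq> N" "point_transformation M f"
    using local_diffeo[OF oN pN sf] by metis
  then show ?thesis using that[of M f] rel NU point_transformation_jac by blast
qed

end


section \<open>Flat equations have vanishing invariants\<close>

lemma compose_second_derivative:
  fixes f g :: "base \<Rightarrow> base"
  assumes M: "open M" "q \<in> M" "smooth_on M f" and V: "open V" "smooth_on V g" "f ` M \<subseteq> V"
  defines "F \<equiv> \<lambda>q. g (f q)"
  shows "pd b F q = tang g (f q) (pd b f q)"
    and "pd c (pd b F) q = tang g (f q) (pd c (pd b f) q)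
     + fst (pd b f q) *\<^sub>R (fst (pd c f q) *\<^sub>R d1 (d1 g) (f q) + snd (pd c f q) *\<^sub>R d1 (d2 g) (f q))
     + snd (pd b f q) *\<^sub>R (fst (pd c f q) *\<^sub>R d1 (d2 g) (f q) + snd (pd c f q) *\<^sub>R d2 (d2 g) (f q))"
proof -
  have fV: "f x \<in> V" if "x \<in> M" for x using V(3) that by blast
  have df: "f differentiable (at x)" if "x \<in> M" for x by (rule smooth_on_differentiable[OF M(3) that])
  have dg: "h differentiable (at (f x))" if "x \<in> M" "smooth_on V h" for x and h :: "base \<Rightarrow> base"
    by (rule smooth_on_differentiable[OF that(2) fV[OF that(1)]])
  have 1: "pd b F x = fst (pd b f x) *\<^sub>R d1 g (f x) + snd (pd b f x) *\<^sub>R d2 g (f x)" if "x \<in> M" for x b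
    unfolding F_def pd_compose[OF df[OF that] dg[OF that V(2)]] pd_base[OF dg[OF that V(2)]] ..
  show "pd b F q = tang g (f q) (pd b f q)" unfolding tang_def by (rule 1[OF M(2)])
  have sg: "smooth_on V (d1 g)" "smooth_on V (d2 g)" by (intro smooth_intros V)+
  have cg: "pd c (\<lambda>x. h (f x)) q = fst (pd c f q) *\<^sub>R d1 h (f q) + snd (pd c f q) *\<^sub>R d2 h (f q)"
    "(\<lambda>x. h (f x)) differentiable (at q)" if "smooth_on V h" for h :: "base \<Rightarrow> base"
    using pd_compose[OF df[OF M(2)] dg[OF M(2) that], of c] pd_base[OF dg[OF M(2) that], of "pd c f q"]
      differentiable_compose_at[OF df[OF M(2)] dg[OF M(2) that]] by simp_all
  have "pd c (pd b F) q = pd c (\<lambda>x. fst (pd b f x) *\<^sub>R d1 g (f x) + snd (pd b f x) *\<^sub>R d2 g (f x)) q"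
    by (rule pd_cong[OF M(1,2) 1])
  also have "\<dots> = fst (pd b f q) *\<^sub>R pd c (\<lambda>x. d1 g (f x)) q + fst (pd c (pd b f) q) *\<^sub>R d1 g (f q)
     + (snd (pd b f q) *\<^sub>R pd c (\<lambda>x. d2 g (f x)) q + snd (pd c (pd b f) q) *\<^sub>R d2 g (f q))"
  proof -
    have d: "pd b f differentiable (at q)" by (rule smooth_on_differentiable[OF smooth_on_pd[OF M(1,3)] M(2)])
    have d': "(\<lambda>x. fst (pd b f x)) differentiable (at q)" "(\<lambda>x. snd (pd b f x)) differentiable (at q)" by (intro dfs d)+
    show ?thesis
      unfolding pd_add[OF differentiable_scaleR[OF d'(1) cg(2)[OF sg(1)]] differentiable_scaleR[OF d'(2) cg(2)[OF sg(2)]]]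
        pd_scaleR[OF d'(1) cg(2)[OF sg(1)]] pd_scaleR[OF d'(2) cg(2)[OF sg(2)]] pd_fst[OF d] pd_snd[OF d] ..
  qed
  finally show "pd c (pd b F) q = tang g (f q) (pd c (pd b f) q)
     + fst (pd b f q) *\<^sub>R (fst (pd c f q) *\<^sub>R d1 (d1 g) (f q) + snd (pd c f q) *\<^sub>R d1 (d2 g) (f q))
     + snd (pd b f q) *\<^sub>R (fst (pd c f q) *\<^sub>R d1 (d2 g) (f q) + snd (pd c f q) *\<^sub>R d2 (d2 g) (f q))"
    unfolding cg(1)[OF sg(1)] cg(1)[OF sg(2)] tang_def d_commute[OF V(1) fV[OF M(2)] V(2)] by (simp add: algebra_simps)
qed

text \<open>The Hessian of the composition is the image under \<open>Dg\<close> of the Hessian of \<open>f\<close> plus the Hessian of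
  \<open>g\<close> in the transformed direction. The determinant with the first summand is the Jacobian of \<open>g\<close> times
  the determinant in the law for \<open>f\<close>, and the second one gives the determinant in the law for \<open>g\<close>.\<close>

lemma relates_compose:
  fixes f g :: "base \<Rightarrow> base"
  assumes M: "open M" "q \<in> M" "smooth_on M f" and V: "open V" "smooth_on V g" "f ` M \<subseteq> V"
    and r: "relates f q u v" "relates g (f q) v w"
  shows "jac (\<lambda>q. g (f q)) q = jac g (f q) * jac f q" "relates (\<lambda>q. g (f q)) q u w"
proof -
  let ?F = "\<lambda>q. g (f q)"
  note c = compose_second_derivative[OF M V]
  have dF: "d1 ?F q = tang g (f q) (d1 f q)" "d2 ?F q = tang g (f q) (d2 f q)"
    using c(1)[of "(1,0)"] c(1)[of "(0,1)"] by (simp_all add: d1_eq d2_eq)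
  show j: "jac ?F q = jac g (f q) * jac f q"
    unfolding jac_def dF tang_def fst_add snd_add fst_scaleR snd_scaleR real_scaleR_def by algebra
  have t: "tang ?F q x = tang g (f q) (tang f q x)" for x
    unfolding tang_def[of ?F] dF by (simp add: tang_def algebra_simps)
  have h: "hess ?F q x = tang g (f q) (hess f q x) + hess g (f q) (tang f q x)" for x
  proof -
    define a1 a2 b1 b2 where "a1 = fst (d1 f q)" and "a2 = snd (d1 f q)" and "b1 = fst (d2 f q)" and "b2 = snd (d2 f q)"
    have F2: "d1 (d1 ?F) q = tang g (f q) (d1 (d1 f) q) + (a1 * a1) *\<^sub>R d1 (d1 g) (f q) + (2 * a1 * a2) *\<^sub>R d1 (d2 g) (f q) + (a2 * a2) *\<^sub>R d2 (d2 g) (f q)"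
      "d1 (d2 ?F) q = tang g (f q) (d1 (d2 f) q) + (b1 * a1) *\<^sub>R d1 (d1 g) (f q) + (b1 * a2 + b2 * a1) *\<^sub>R d1 (d2 g) (f q) + (b2 * a2) *\<^sub>R d2 (d2 g) (f q)"
      "d2 (d2 ?F) q = tang g (f q) (d2 (d2 f) q) + (b1 * b1) *\<^sub>R d1 (d1 g) (f q) + (2 * b1 * b2) *\<^sub>R d1 (d2 g) (f q) + (b2 * b2) *\<^sub>R d2 (d2 g) (f q)"
      using c(2)[of "(1,0)" "(1,0)"] c(2)[of "(1,0)" "(0,1)"] c(2)[of "(0,1)" "(0,1)"]
      by (simp_all add: d1_eq[symmetric] d2_eq[symmetric] a1_def a2_def b1_def b2_def algebra_simps flip: scaleR_2)
    show ?thesis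
      unfolding hess_def[of ?F] F2
      by (simp add: hess_def tang_def prod_eq_iff flip: a1_def a2_def b1_def b2_def) (simp add: algebra_simps)
  qed
  have cr: "cross (tang g (f q) a) (tang g (f q) b) = jac g (f q) * cross a b" for a b
    unfolding cross_def tang_def jac_def fst_add snd_add fst_scaleR snd_scaleR real_scaleR_def by algebra
  have cadd: "cross a (b + c) = cross a b + cross a c" for a b c by (simp add: cross_def algebra_simps)
  show "relates ?F q u w" unfolding relates_def
  proof
    fix x
    have "jac ?F q * cub u x = jac g (f q) * (jac f q * cub u x)" by (simp add: j)
    also have "\<dots> = jac g (f q) * cub v (tang f q x) - jac g (f q) * cross (tang f q x) (hess f q x)"
      by (simp only: r(1)[unfolded relates_def, rule_format, of x] right_diff_distrib)
    also have "jac g (f q) * cub v (tang f q x) = cub w (tang g (f q) (tang f q x)) - cross (tang g (f q) (tang f q x)) (hess g (f q) (tang f q x))"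
      using r(2)[unfolded relates_def, rule_format, of "tang f q x"] .
    finally show "jac ?F q * cub u x = cub w (tang ?F q x) - cross (tang ?F q x) (hess ?F q x)"
      unfolding t h cadd cr by simp
  qed
qed

text \<open>Let \<open>a\<close>, \<open>b\<close>, \<open>c\<close> be the first and \<open>d\<close>, \<open>e\<close>, \<open>f\<close> the second components of the Christoffel symbols
  \<open>g11\<close>, \<open>g12\<close>, \<open>g22\<close> of the connection with flat coordinates \<open>F\<close>. Comparing the third derivatives of
  \<open>F\<close> shows that the components \<open>K\<^sub>1, \<dots>, K\<^sub>4\<close> of its curvature vanish. With the values of the
  coefficients given by the Christoffel symbols, the two Liouville expressions are
  \<open>- 2 K\<^sub>1\<^sub>x - 3 K\<^sub>2\<^sub>y + K\<^sub>4\<^sub>x + (2 a - e) K\<^sub>1 + 3 b K\<^sub>2 + 3 d K\<^sub>3 + (2 e - a) K\<^sub>4\<close> and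
  \<open>K\<^sub>1\<^sub>y - 3 K\<^sub>3\<^sub>x - 2 K\<^sub>4\<^sub>y + (2 b - f) K\<^sub>1 + 3 c K\<^sub>2 + 3 e K\<^sub>3 + (2 f - b) K\<^sub>4\<close>.\<close>

lemma relates_zero_imp_liouville:
  assumes M: "open M" "x \<in> M" and F: "smooth_on M F" and s: "smooth_on M s"
    and j: "\<And>q. q \<in> M \<Longrightarrow> jac F q \<noteq> 0" and rel: "\<And>q. q \<in> M \<Longrightarrow> relates F q (s q) 0"
  shows "liouville1 s x = 0" "liouville2 s x = 0"
proof -
  define G where "G h q = fst (h q) *\<^sub>R dinv F (1, 0) q + snd (h q) *\<^sub>R dinv F (0, 1) q" for h :: "base \<Rightarrow> base" and q
  have Gs: "smooth_on M (G h)" if "smooth_on M h" for h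
    unfolding G_def[abs_def] by (intro smooth_intros smooth_on_dinv M F that j)
  have Ge: "h q = fst (G h q) *\<^sub>R d1 F q + snd (G h q) *\<^sub>R d2 F q" if "q \<in> M" for h q
  proof -
    have "G h q = dinv F (h q) q" by (simp add: G_def dinv_def prod_eq_iff diff_divide_distrib mult.commute)
    then show ?thesis using dinv_right[OF j[OF that], of "h q"] by simp
  qed
  define g11 g12 g22 where "g11 = G (d1 (d1 F))" and "g12 = G (d1 (d2 F))" and "g22 = G (d2 (d2 F))"
  have sg: "smooth_on M g11" "smooth_on M g12" "smooth_on M g22"
    unfolding g11_def g12_def g22_def by (intro Gs smooth_intros M F)+
  have sF: "smooth_on M (d1 F)" "smooth_on M (d2 F)" "smooth_on M (d1 (d1 F))" "smooth_on M (d1 (d2 F))" "smooth_on M (d2 (d2 F))"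
    by (intro smooth_intros M F)+
  note df = smooth_on_differentiable[of M]
  have E: "d1 (d1 F) q = fst (g11 q) *\<^sub>R d1 F q + snd (g11 q) *\<^sub>R d2 F q"
    "d1 (d2 F) q = fst (g12 q) *\<^sub>R d1 F q + snd (g12 q) *\<^sub>R d2 F q"
    "d2 (d1 F) q = fst (g12 q) *\<^sub>R d1 F q + snd (g12 q) *\<^sub>R d2 F q"
    "d2 (d2 F) q = fst (g22 q) *\<^sub>R d1 F q + snd (g22 q) *\<^sub>R d2 F q" if "q \<in> M" for q
    using Ge[OF that] d_commute[OF M(1) that F] unfolding g11_def g12_def g22_def by simp_all
  have pE: "pd v (\<lambda>q. fst (g q) *\<^sub>R d1 F q + snd (g q) *\<^sub>R d2 F q) q =
      (fst (g q) *\<^sub>R pd v (d1 F) q + fst (pd v g q) *\<^sub>R d1 F q) + (snd (g q) *\<^sub>R pd v (d2 F) q + snd (pd v g q) *\<^sub>R d2 F q)"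
    if "smooth_on M g" "q \<in> M" for v g q
  proof -
    have "(\<lambda>q. fst (g q)) differentiable (at q)" "(\<lambda>q. snd (g q)) differentiable (at q)" by (intro dfs df that)+
    note d = this df[OF sF(1) that(2)] df[OF sF(2) that(2)]
    show ?thesis
      unfolding pd_add[OF differentiable_scaleR[OF d(1,3)] differentiable_scaleR[OF d(2,4)]] pd_scaleR[OF d(1,3)] pd_scaleR[OF d(2,4)]
        pd_fst[OF df[OF that]] pd_snd[OF df[OF that]] ..
  qed
  have indep: "a = 0 \<and> b = 0" if "a *\<^sub>R d1 F q + b *\<^sub>R d2 F q = 0" "q \<in> M" for a b q
    using dinv_solve[OF j[OF that(2)], of "(a, b)" 0] that(1) by (simp add: dinv_def zero_prod_def)
  have K: "fst (d2 g11 q) - fst (d1 g12 q) + fst (g22 q) * snd (g11 q) - fst (g12 q) * snd (g12 q) = 0 \<and>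
      snd (d2 g11 q) - snd (d1 g12 q) + fst (g11 q) * snd (g12 q) + snd (g11 q) * snd (g22 q) - fst (g12 q) * snd (g11 q) - snd (g12 q) * snd (g12 q) = 0"
    "fst (d2 g12 q) - fst (d1 g22 q) + fst (g12 q) * fst (g12 q) + snd (g12 q) * fst (g22 q) - fst (g22 q) * fst (g11 q) - snd (g22 q) * fst (g12 q) = 0 \<and>
      snd (d2 g12 q) - snd (d1 g22 q) + fst (g12 q) * snd (g12 q) - fst (g22 q) * snd (g11 q) = 0" if q: "q \<in> M" for q
  proof -
    have 1: "d2 (d1 (d1 F)) q = d1 (d1 (d2 F)) q"
    proof -
      have "d2 (d1 (d1 F)) q = d1 (d2 (d1 F)) q" by (rule d_commute[OF M(1) q sF(1)])
      also have "\<dots> = d1 (d1 (d2 F)) q" by (rule d1_cong[OF M(1) q]) (rule d_commute[OF M(1) _ F])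
      finally show ?thesis .
    qed
    have 2: "d2 (d1 (d2 F)) q = d1 (d2 (d2 F)) q" by (rule d_commute[OF M(1) q sF(2)])
    have p: "d2 (d1 (d1 F)) q = (fst (g11 q) *\<^sub>R d2 (d1 F) q + fst (d2 g11 q) *\<^sub>R d1 F q) + (snd (g11 q) *\<^sub>R d2 (d2 F) q + snd (d2 g11 q) *\<^sub>R d2 F q)"
      "d1 (d1 (d2 F)) q = (fst (g12 q) *\<^sub>R d1 (d1 F) q + fst (d1 g12 q) *\<^sub>R d1 F q) + (snd (g12 q) *\<^sub>R d1 (d2 F) q + snd (d1 g12 q) *\<^sub>R d2 F q)"
      "d2 (d1 (d2 F)) q = (fst (g12 q) *\<^sub>R d2 (d1 F) q + fst (d2 g12 q) *\<^sub>R d1 F q) + (snd (g12 q) *\<^sub>R d2 (d2 F) q + snd (d2 g12 q) *\<^sub>R d2 F q)"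
      "d1 (d2 (d2 F)) q = (fst (g22 q) *\<^sub>R d1 (d1 F) q + fst (d1 g22 q) *\<^sub>R d1 F q) + (snd (g22 q) *\<^sub>R d1 (d2 F) q + snd (d1 g22 q) *\<^sub>R d2 F q)"
      using d2_cong[OF M(1) q E(1)] d1_cong[OF M(1) q E(2)] d2_cong[OF M(1) q E(2)] d1_cong[OF M(1) q E(4)]
        pE[OF sg(1) q, of "(0,1)"] pE[OF sg(2) q, of "(1,0)"] pE[OF sg(2) q, of "(0,1)"] pE[OF sg(3) q, of "(1,0)"]
      by (simp_all flip: d1_eq d2_eq)
    have "(fst (d2 g11 q) - fst (d1 g12 q) + fst (g22 q) * snd (g11 q) - fst (g12 q) * snd (g12 q)) *\<^sub>R d1 F q +
      (snd (d2 g11 q) - snd (d1 g12 q) + fst (g11 q) * snd (g12 q) + snd (g11 q) * snd (g22 q) - fst (g12 q) * snd (g11 q) - snd (g12 q) * snd (g12 q)) *\<^sub>R d2 F q = 0"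
      using 1 unfolding p(1,2) E[OF q] by (simp add: prod_eq_iff) (simp add: algebra_simps)
    from indep[OF this q] show "fst (d2 g11 q) - fst (d1 g12 q) + fst (g22 q) * snd (g11 q) - fst (g12 q) * snd (g12 q) = 0 \<and>
      snd (d2 g11 q) - snd (d1 g12 q) + fst (g11 q) * snd (g12 q) + snd (g11 q) * snd (g22 q) - fst (g12 q) * snd (g11 q) - snd (g12 q) * snd (g12 q) = 0" .
    have "(fst (d2 g12 q) - fst (d1 g22 q) + fst (g12 q) * fst (g12 q) + snd (g12 q) * fst (g22 q) - fst (g22 q) * fst (g11 q) - snd (g22 q) * fst (g12 q)) *\<^sub>R d1 F q +
      (snd (d2 g12 q) - snd (d1 g22 q) + fst (g12 q) * snd (g12 q) - fst (g22 q) * snd (g11 q)) *\<^sub>R d2 F q = 0"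
      using 2 unfolding p(3,4) E[OF q] by (simp add: prod_eq_iff) (simp add: algebra_simps)
    from indep[OF this q] show "fst (d2 g12 q) - fst (d1 g22 q) + fst (g12 q) * fst (g12 q) + snd (g12 q) * fst (g22 q) - fst (g22 q) * fst (g11 q) - snd (g22 q) * fst (g12 q) = 0 \<and>
      snd (d2 g12 q) - snd (d1 g22 q) + fst (g12 q) * snd (g12 q) - fst (g22 q) * snd (g11 q) = 0" .
  qed
  have sv: "s q = (- snd (g11 q), fst (g11 q) - 2 * snd (g12 q), 2 * fst (g12 q) - snd (g22 q), fst (g22 q))" if q: "q \<in> M" for q
    using relates_christoffel[OF j[OF q] E(1)[OF q] E(2)[OF q] E(4)[OF q]] rel[OF q] by blast
  have dg: "g11 differentiable (at q)" "g12 differentiable (at q)" "g22 differentiable (at q)" if "q \<in> M" for q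
    using df sg that by blast+
  have dpg: "pd v g11 differentiable (at q)" "pd v g12 differentiable (at q)" "pd v g22 differentiable (at q)" if "q \<in> M" for q v
    using df smooth_on_pd[OF M(1)] sg that by blast+
  have s1: "pd v s q = (- snd (pd v g11 q), fst (pd v g11 q) - 2 * snd (pd v g12 q), 2 * fst (pd v g12 q) - snd (pd v g22 q), fst (pd v g22 q))"
    if q: "q \<in> M" for q v
  proof -
    have "pd v s q = pd v (\<lambda>q. (- snd (g11 q), fst (g11 q) - 2 * snd (g12 q), 2 * fst (g12 q) - snd (g22 q), fst (g22 q))) q"
      by (rule pd_cong[OF M(1) q sv])
    then show ?thesis by (simp add: pds dfs dg q)
  qed
  have s2: "pd w (pd v s) x = (- snd (pd w (pd v g11) x), fst (pd w (pd v g11) x) - 2 * snd (pd w (pd v g12) x),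
      2 * fst (pd w (pd v g12) x) - snd (pd w (pd v g22) x), fst (pd w (pd v g22) x))" for v w
  proof -
    have "pd w (pd v s) x = pd w (\<lambda>q. (- snd (pd v g11 q), fst (pd v g11 q) - 2 * snd (pd v g12 q), 2 * fst (pd v g12 q) - snd (pd v g22 q), fst (pd v g22 q))) x"
      by (rule pd_cong[OF M s1])
    then show ?thesis by (simp add: pds dfs dpg M(2))
  qed
  note D = dg[OF M(2)] dpg[OF M(2)]
  have dK: "pd v h x = 0" if "\<And>q. q \<in> M \<Longrightarrow> h q = 0" for v and h :: "base \<Rightarrow> real"
    using pd_cong[OF M, of h "\<lambda>_. 0" v] that by simp
  have k1: "fst (pd v (d2 g11) x) - fst (pd v (d1 g12) x) + (fst (g22 x) * snd (pd v g11 x) + fst (pd v g22 x) * snd (g11 x)) - (fst (g12 x) * snd (pd v g12 x) + fst (pd v g12 x) * snd (g12 x)) = 0" (is ?ka)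
    and k2: "snd (pd v (d2 g11) x) - snd (pd v (d1 g12) x) + (fst (g11 x) * snd (pd v g12 x) + fst (pd v g11 x) * snd (g12 x)) + (snd (g11 x) * snd (pd v g22 x) + snd (pd v g11 x) * snd (g22 x))
      - (fst (g12 x) * snd (pd v g11 x) + fst (pd v g12 x) * snd (g11 x)) - (snd (g12 x) * snd (pd v g12 x) + snd (pd v g12 x) * snd (g12 x)) = 0" (is ?kb)
    and k3: "fst (pd v (d2 g12) x) - fst (pd v (d1 g22) x) + (fst (g12 x) * fst (pd v g12 x) + fst (pd v g12 x) * fst (g12 x)) + (snd (g12 x) * fst (pd v g22 x) + snd (pd v g12 x) * fst (g22 x))
      - (fst (g22 x) * fst (pd v g11 x) + fst (pd v g22 x) * fst (g11 x)) - (snd (g22 x) * fst (pd v g12 x) + snd (pd v g22 x) * fst (g12 x)) = 0" (is ?kc)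
    and k4: "snd (pd v (d2 g12) x) - snd (pd v (d1 g22) x) + (fst (g12 x) * snd (pd v g12 x) + fst (pd v g12 x) * snd (g12 x)) - (fst (g22 x) * snd (pd v g11 x) + fst (pd v g22 x) * snd (g11 x)) = 0" (is ?kd) for v
  proof -
    have "pd v (\<lambda>q. fst (d2 g11 q) - fst (d1 g12 q) + fst (g22 q) * snd (g11 q) - fst (g12 q) * snd (g12 q)) x = 0"
      "pd v (\<lambda>q. snd (d2 g11 q) - snd (d1 g12 q) + fst (g11 q) * snd (g12 q) + snd (g11 q) * snd (g22 q) - fst (g12 q) * snd (g11 q) - snd (g12 q) * snd (g12 q)) x = 0"
      "pd v (\<lambda>q. fst (d2 g12 q) - fst (d1 g22 q) + fst (g12 q) * fst (g12 q) + snd (g12 q) * fst (g22 q) - fst (g22 q) * fst (g11 q) - snd (g22 q) * fst (g12 q)) x = 0"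
      "pd v (\<lambda>q. snd (d2 g12 q) - snd (d1 g22 q) + fst (g12 q) * snd (g12 q) - fst (g22 q) * snd (g11 q)) x = 0"
      by (rule dK, use K in simp)+
    then show ?ka ?kb ?kc ?kd
      unfolding d1_eq d2_eq by (simp_all add: pds dfs D)
  qed
  note com = d_commute[OF M sg(1)] d_commute[OF M sg(2)] d_commute[OF M sg(3)]
  note kx = k1[of "(1,0)", folded d1_eq] k2[of "(1,0)", folded d1_eq] k3[of "(1,0)", folded d1_eq] k4[of "(1,0)", folded d1_eq]
  note ky = k1[of "(0,1)", folded d2_eq, unfolded com] k2[of "(0,1)", folded d2_eq, unfolded com]
    k3[of "(0,1)", folded d2_eq, unfolded com] k4[of "(0,1)", folded d2_eq, unfolded com]
  note S1 = s1[OF M(2), of "(1,0)", folded d1_eq] s1[OF M(2), of "(0,1)", folded d2_eq]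
  note S2 = s2[of "(0,1)" "(0,1)", folded d2_eq] s2[of "(1,0)" "(0,1)", folded d1_eq d2_eq] s2[of "(1,0)" "(1,0)", folded d1_eq]
  show "liouville1 s x = 0"
    using kx(1) ky(2) kx(4) K(1)[OF M(2), THEN conjunct1] K(1)[OF M(2), THEN conjunct2] K(2)[OF M(2), THEN conjunct1] K(2)[OF M(2), THEN conjunct2]
    unfolding liouville1_def Let_def sv[OF M(2)] S1 S2 fst_conv snd_conv by algebra
  show "liouville2 s x = 0"
    using ky(1) kx(3) ky(4) K(1)[OF M(2), THEN conjunct1] K(1)[OF M(2), THEN conjunct2] K(2)[OF M(2), THEN conjunct1] K(2)[OF M(2), THEN conjunct2]
    unfolding liouville2_def Let_def sv[OF M(2)] S1 S2 fst_conv snd_conv by algebra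
qed


section \<open>Linear equations and the theorem\<close>

text \<open>Each term contains \<open>u\<^sup>2\<close>, \<open>u\<^sup>3\<close>, a derivative of \<open>u\<^sup>1\<close> in \<open>y\<close> or the second
  derivative in \<open>y\<close> of \<open>u\<^sup>0\<close>, which is affine in \<open>y\<close>.\<close>

lemma linear_ode_liouville:
  fixes a b c :: "real \<Rightarrow> real"
  assumes V: "open V" and sm: "smooth_on (fst ` V) a" "smooth_on (fst ` V) b" "smooth_on (fst ` V) c"
  defines "s \<equiv> \<lambda>q. snd (linear_ode_section a b c q)"
  shows "smooth_on V s" "q \<in> V \<Longrightarrow> liouville1 s q = 0" "q \<in> V \<Longrightarrow> liouville2 s q = 0"
proof -
  have s: "s = (\<lambda>q. (b (fst q) * snd q + c (fst q), a (fst q), 0, 0))"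
    by (auto simp: s_def linear_ode_section_def ode_section_def)
  have oV: "open (fst ` V)" by (rule open_image_fst[OF V])
  have sf: "smooth_on V (\<lambda>q. h (fst q))" if "smooth_on (fst ` V) h" for h :: "real \<Rightarrow> real"
    by (rule smooth_on_compose[OF V oV smooth_on_fst[OF V smooth_on_id] that]) simp
  show ss: "smooth_on V s" unfolding s by (intro smooth_intros V sf sm)
  assume q: "q \<in> V"
  have fst_y: "pd (0, 1) (\<lambda>q. h (fst q)) x = 0" if "smooth_on (fst ` V) h" "x \<in> V" for h :: "real \<Rightarrow> real" and x
  proof -
    have d: "h differentiable (at (fst x))" by (rule smooth_on_differentiable[OF that(1)]) (use that in simp)
    have "((\<lambda>q. h (fst q)) has_derivative (\<lambda>v. pd (fst v) h (fst x))) (at x)"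
      by (rule has_derivative_compose[OF bounded_linear_imp_has_derivative[OF bounded_linear_fst] has_pd[OF d]])
    from pd_unique[OF this, of "(0, 1)"] show ?thesis using linear_0[OF linear_pd[OF d]] by simp
  qed
  have df: "h differentiable (at x)" if "smooth_on V h" "x \<in> V" for h :: "base \<Rightarrow> fibre" and x
    by (rule smooth_on_differentiable[OF that])
  have dh: "(\<lambda>q. h (fst q)) differentiable (at x)" if "smooth_on (fst ` V) h" "x \<in> V" for h :: "real \<Rightarrow> real" and x
    by (rule smooth_on_differentiable[OF sf[OF that(1)] that(2)])
  have psnd: "pd (0, 1) (\<lambda>q::base. snd q) x = 1" "(\<lambda>q::base. snd q) differentiable (at x)" for x
    using pd_unique[OF bounded_linear_imp_has_derivative[OF bounded_linear_snd], of "(0, 1)" x]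
    by (auto intro: bounded_linear_imp_differentiable bounded_linear_snd)
  have z2: "fst (snd (snd (s x))) = 0" "snd (snd (snd (s x))) = 0" for x by (simp_all add: s)
  have z: "fst (snd (snd (pd v s x))) = 0" "snd (snd (snd (pd v s x))) = 0" if "x \<in> V" for v x
  proof -
    have "pd v (\<lambda>q. fst (snd (snd (s q)))) x = 0" "pd v (\<lambda>q. snd (snd (snd (s q)))) x = 0" by (simp_all add: z2)
    then show "fst (snd (snd (pd v s x))) = 0" "snd (snd (snd (pd v s x))) = 0"
      using df[OF ss that] by (simp_all add: pds dfs)
  qed
  have y1: "fst (snd (d2 s x)) = 0" if "x \<in> V" for x
  proof -
    have "pd (0, 1) (\<lambda>q. fst (snd (s q))) x = 0" unfolding s using fst_y[OF sm(1) that] by simp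
    then show ?thesis unfolding d2_eq[of s] using df[OF ss that] by (simp add: pds dfs)
  qed
  have y0: "fst (d2 s x) = b (fst x)" if "x \<in> V" for x
  proof -
    have "pd (0, 1) (\<lambda>q. fst (s q)) x = b (fst x)"
      unfolding s fst_conv using that
      by (simp add: pds dfs dh[OF sm(2)] dh[OF sm(3)] psnd fst_y[OF sm(2)] fst_y[OF sm(3)])
    then show ?thesis unfolding d2_eq[of s] using df[OF ss that] by (simp add: pds dfs)
  qed
  have s1: "smooth_on V (d1 s)" "smooth_on V (d2 s)" by (intro smooth_intros V ss)+
  have zz: "fst (snd (snd (d1 (d1 s) q))) = 0" "snd (snd (snd (d1 (d1 s) q))) = 0"
    "fst (snd (snd (d1 (d2 s) q))) = 0"
  proof -
    have "pd (1, 0) (\<lambda>q. fst (snd (snd (d1 s q)))) q = pd (1, 0) (\<lambda>_. 0) q"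
      "pd (1, 0) (\<lambda>q. snd (snd (snd (d1 s q)))) q = pd (1, 0) (\<lambda>_. 0) q"
      "pd (1, 0) (\<lambda>q. fst (snd (snd (d2 s q)))) q = pd (1, 0) (\<lambda>_. 0) q"
      by (rule pd_cong[OF V q], simp add: z d1_eq[of s] d2_eq[of s])+
    then show "fst (snd (snd (d1 (d1 s) q))) = 0" "snd (snd (snd (d1 (d1 s) q))) = 0" "fst (snd (snd (d1 (d2 s) q))) = 0"
      unfolding d1_eq[of "d1 s"] d1_eq[of "d2 s"] using df[OF s1(1) q] df[OF s1(2) q] by (simp_all add: pds dfs)
  qed
  have yy1: "fst (snd (d1 (d2 s) q)) = 0" "fst (snd (d2 (d2 s) q)) = 0"
  proof -
    have "pd v (\<lambda>q. fst (snd (d2 s q))) q = pd v (\<lambda>_. 0) q" for v by (rule pd_cong[OF V q y1])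
    from this[of "(1,0)"] this[of "(0,1)"] show "fst (snd (d1 (d2 s) q)) = 0" "fst (snd (d2 (d2 s) q)) = 0"
      unfolding d1_eq[of "d2 s"] d2_eq[of "d2 s"] using df[OF s1(2) q] by (simp_all add: pds dfs)
  qed
  have yy0: "fst (d2 (d2 s) q) = 0"
  proof -
    have "pd (0, 1) (\<lambda>q. fst (d2 s q)) q = pd (0, 1) (\<lambda>q. b (fst q)) q" by (rule pd_cong[OF V q y0])
    then show ?thesis unfolding d2_eq[of "d2 s"] using df[OF s1(2) q] fst_y[OF sm(2) q] by (simp add: pds dfs)
  qed
  have z1: "fst (snd (snd (d1 s q))) = 0" "snd (snd (snd (d1 s q))) = 0" "fst (snd (snd (d2 s q))) = 0" "snd (snd (snd (d2 s q))) = 0"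
    using z[OF q] by (simp_all add: d1_eq d2_eq)
  show "liouville1 s q = 0" "liouville2 s q = 0"
    unfolding liouville1_def liouville2_def Let_def by (simp_all add: z2 z1 zz yy0 yy1 y1[OF q])
qed

text \<open>The transformation to a linear equation is composed with one that takes this linear equation to
  \<open>y'' = 0\<close>.\<close>

lemma linearizable_imp_liouville:
  assumes S: "local_section U S" and lin: "linearizable_near U S p"
  defines "s \<equiv> \<lambda>q. snd (S q)"
  shows "liouville1 s p = 0" "liouville2 s p = 0"
proof -
  have ss: "smooth_on U s" using S unfolding s_def by (auto simp: local_section_def intro: smooth_on_snd)
  obtain N f a b c where p: "p \<in> N" and N: "N \<subseteq> U" and pt: "point_transformation N f"
    and sm: "smooth_on (fst ` f ` N) a" "smooth_on (fst ` f ` N) b" "smooth_on (fst ` f ` N) c"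
    and eq: "\<And>q. q \<in> f ` N \<Longrightarrow> linear_ode_section a b c q = push_section N f S q"
    using lin unfolding linearizable_near_def by blast
  have f: "open N" "open (f ` N)" "smooth_on N f" using pt by (auto simp: point_transformation_def)
  define t where "t q = snd (linear_ode_section a b c q)" for q
  note L = linear_ode_liouville[OF f(2) sm, folded t_def]
  have rel: "relates f q (s q) (t (f q))" if q: "q \<in> N" for q
  proof -
    have "push_section N f S (f q) = (f q, lift_fun (jet2 f q (s q)))"
      using push_section_at[OF pt S q] N q by (auto simp: s_def)
    then have "lift_fun (jet2 f q (s q)) = t (f q)" using eq[of "f q"] q by (simp add: t_def)
    then show ?thesis using lift_fun_relates[OF point_transformation_jac[OF pt q]] by simp
  qed
  interpret flat_ode "f ` N" t
    by unfold_locales (use f(2) L in auto)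
  obtain N' g where g: "f p \<in> N'" "N' \<subseteq> f ` N" "point_transformation N' g" "\<And>y. y \<in> N' \<Longrightarrow> relates g y (t y) 0"
    using flattening[of "f p"] p by blast
  have N': "open N'" "smooth_on N' g" using g(3) by (auto simp: point_transformation_def)
  define M where "M = N \<inter> f -` N'"
  have M: "open M" unfolding M_def by (rule continuous_open_preimage[OF smooth_on_continuous[OF f(3)] f(1) N'(1)])
  have MN: "M \<subseteq> N" "f ` M \<subseteq> N'" "p \<in> M" using g p by (auto simp: M_def)
  have sM: "smooth_on M f" "smooth_on M s"
    by (rule smooth_on_subset[OF f(3) MN(1)], rule smooth_on_subset[OF ss order_trans[OF MN(1) N]])
  have fM: "f q \<in> N'" "q \<in> N" if "q \<in> M" for q using that by (auto simp: M_def)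
  have c: "jac (\<lambda>q. g (f q)) q = jac g (f q) * jac f q" "relates (\<lambda>q. g (f q)) q (s q) 0" if q: "q \<in> M" for q
    using relates_compose[OF M q sM(1) N' MN(2) rel[OF fM(2)[OF q]] g(4)[OF fM(1)[OF q]]] by auto
  have j: "jac (\<lambda>q. g (f q)) q \<noteq> 0" if q: "q \<in> M" for q
    using c(1)[OF q] point_transformation_jac[OF g(3) fM(1)[OF q]] point_transformation_jac[OF pt fM(2)[OF q]] by simp
  have sF: "smooth_on M (\<lambda>q. g (f q))" by (rule smooth_on_compose[OF M N'(1) sM(1) N'(2) MN(2)])
  show "liouville1 s p = 0" "liouville2 s p = 0"
    using relates_zero_imp_liouville[OF M MN(3) sF sM(2) j c(2)] by blast+
qed

lemma liouville_imp_linearizable: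
  assumes S: "local_section U S" and p: "p \<in> U"
    and L: "\<And>q. q \<in> U \<Longrightarrow> liouville1 (\<lambda>q. snd (S q)) q = 0 \<and> liouville2 (\<lambda>q. snd (S q)) q = 0"
  shows "linearizable_near U S p"
proof -
  have U': "open U" "smooth_on U (\<lambda>q. snd (S q))" using S by (auto simp: local_section_def intro: smooth_on_snd)
  interpret flat_ode U "\<lambda>q. snd (S q)" by unfold_locales (use U' L in auto)
  obtain N f where N: "p \<in> N" "N \<subseteq> U" "point_transformation N f" "\<And>q. q \<in> N \<Longrightarrow> relates f q (snd (S q)) 0"
    using flattening[OF p] by blast
  have "linear_ode_section (\<lambda>_. 0) (\<lambda>_. 0) (\<lambda>_. 0) y = push_section N f S y" if y: "y \<in> f ` N" for y
  proof -
    obtain q where q: "q \<in> N" "y = f q" using y by blast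
    have "lift_fun (jet2 f q (snd (S q))) = 0"
      using lift_fun_relates[OF point_transformation_jac[OF N(3) q(1)]] N(4)[OF q(1)] by blast
    then have "push_section N f S y = (y, 0)"
      using push_section_at[OF N(3) S q(1)] N(2) q by auto
    then show ?thesis by (auto simp: linear_ode_section_def ode_section_def zero_prod_def)
  qed
  then show ?thesis unfolding linearizable_near_def
    by (intro exI[of _ N] exI[of _ f] exI[of _ "\<lambda>_. 0"] conjI N smooth_on_const ballI)
qed

theorem corollary4p7:
  fixes U :: "base set" and u0 u1 u2 u3 :: "base \<Rightarrow> real"
  assumes "open U"
    and "smooth_on U u0" and "smooth_on U u1" and "smooth_on U u2" and "smooth_on U u3"
  defines "S \<equiv> ode_section u0 u1 u2 u3"
  shows "(\<forall>p\<in>U. linearizable_near U S p) \<longleftrightarrow>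
    (\<forall>p\<in>U. \<forall>v w. pullback_form (sjet 2 S) omega2 p v w = 0)"
proof -
  have S: "local_section U S"
    unfolding local_section_def S_def ode_section_def[abs_def]
    using assms(1-5) by (auto intro!: smooth_on_Pair smooth_on_id)
  have "(\<forall>p\<in>U. linearizable_near U S p) \<longleftrightarrow> (\<forall>p\<in>U. liouville1 (\<lambda>q. snd (S q)) p = 0 \<and> liouville2 (\<lambda>q. snd (S q)) p = 0)"
    using linearizable_imp_liouville[OF S] liouville_imp_linearizable[OF S] by blast
  then show ?thesis using omega_vanishes_iff[OF S] by blast
qed

end
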